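(* Let $\zeta(j)$ and $\theta(j)$, $j\in\mathbb Z$, be mutually uncorrelated $T$-PC stochastic sequences whose $T$-blocked $T$-variate stationary sequences $\vec\zeta(\tilde j)$ and $\vec\theta(\tilde j)$ have spectral density matrices $f(\lambda)$ and $g(\lambda)$, respectively. Assume the minimality condition $$\int_{-\pi}^{\pi}\mathrm{Tr}\left[(f(\lambda)+g(\lambda))^{-1}\right]d\lambda<\infty .$$ Let the coefficients $a(j)$, $j\ge 1$, satisfy $\sum_{j=1}^\infty|a(j)|<\infty$ and have the form $a(\nu+\tilde jT)=\hat a(\tilde j)e^{2\pi i\tilde j\nu/T}$, $\nu=1,\dots,T$, $\tilde j\ge 0$, and assume that the operator $\mathbf B$ is invertible. Let $A\vec\zeta=\sum_{\tilde j=0}^\infty\vec a^{\top}(\tilde j)\vec\zeta(\tilde j)$, $A(e^{i\lambda})=\sum_{\tilde j=0}^\infty \vec a(\tilde j)e^{i\tilde j\lambda}$, and put $\vec{\mathbf c}=(\vec c(k))_{k\in\Gamma}=\mathbf B^{-1}\mathbf R\vec{\mathbf a}$ and $C(e^{i\lambda})=\sum_{n\in\Gamma}\vec c(n)e^{in\lambda}$. Then the spectral characteristic $\vec h(f,g)$ of the optimal (minimum mean square error) linear estimate of $A\vec\zeta$ based on observations of $\vec\zeta(\tilde j)+\vec\theta(\tilde j)$ at the points $\tilde j\in\{\dots,-2,-1\}\setminus\widetilde S$ is $$\vec h^{\top}(f,g)=\left(A^{\top}(e^{i\lambda})f(\lambda)-C^{\top}(e^{i\lambda})\right)\left[f(\lambda)+g(\lambda)\right]^{-1}=A^{\top}(e^{i\lambda})-\left(A^{\top}(e^{i\lambda})g(\lambda)+C^{\top}(e^{i\lambda})\right)\left[f(\lambda)+g(\lambda)\right]^{-1},$$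 and the mean square error of this optimal estimate is $$\Delta(f,g)=\langle\mathbf D\vec{\mathbf a},\vec{\mathbf a}\rangle+\langle\mathbf B\vec{\mathbf c},\vec{\mathbf c}\rangle .$$
   Context: Periodically correlated sequences. A complex zero-mean, finite-variance stochastic sequence $\zeta(n)$, $n\in\mathbb Z$, is $T$-PC (periodically correlated with period $T$) if $E\zeta(n+T)\overline{\zeta(m+T)}=E\zeta(n)\overline{\zeta(m)}$ for all $n,m\in\mathbb Z$ and no smaller positive $T$ has this property. Its $T$-blocked sequence $\vec\zeta(n)=(\zeta_1(n),\dots,\zeta_T(n))^\top$, $\zeta_p(n)=\zeta(nT+p)$, $p=1,\dots,T$, is a $T$-variate stationary sequence. A spectral density matrix is an integrable, Hermitian positive semidefinite $T\times T$ matrix function on $[-\pi,\pi]$; $\vec\zeta$ has spectral density $f$ if $E\,\vec\zeta(n+k)\vec\zeta(n)^*=\frac1{2\pi}\int_{-\pi}^\pi e^{ik\lambda}f(\lambda)d\lambda$. Missing observations. Let $s\ge1$, let $N_1,\dots,N_s,K_1,\dots,K_s$ be nonnegative integers, $N_0=K_0=0$, $M_l=\sum_{k=0}^l(N_k+K_k)$, $\widetilde S=\bigcup_{l=1}^s\{-M_l,\dots,-M_{l-1}-N_l-1\}$ and $\Gamma=\widetilde S\cup\{0,1,2,\dots\}$. Functional. With $a(\nu+\tilde jT)=\hat a(\tilde j)e^{2\pi i\tilde j\nu/T}$ put $\vec a(\tilde j)=(a_1(\tilde j),\dots,a_T(\tilde j))^\top$, $a_\nu(\tilde j)=\hat a(\tilde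 j)e^{2\pi i\tilde j\nu/T}$. Then $\sum_{j=1}^\infty a(j)\zeta(j)=\sum_{\tilde j=0}^\infty\vec a^\top(\tilde j)\vec\zeta(\tilde j)=A\vec\zeta$. Let $\vec{\mathbf a}=(\vec{\mathbf a}(k))_{k\in\Gamma}$ with $\vec{\mathbf a}(k)=\vec 0$ for $k\in\widetilde S$ and $\vec{\mathbf a}(k)=\vec a(k)$ for $k\ge0$. Operators. $\mathbf B,\mathbf R,\mathbf D$ are the linear operators defined by the (infinite) block matrices indexed by $\Gamma\times\Gamma$ whose $(k,j)$ blocks are $B(k-j)$, $R(k-j)$, $D(k-j)$, where $$B(k-j)=\frac1{2\pi}\int_{-\pi}^\pi\left[(f+g)^{-1}\right]^\top e^{i(j-k)\lambda}d\lambda,\quad R(k-j)=\frac1{2\pi}\int_{-\pi}^\pi\left[f(f+g)^{-1}\right]^\top e^{i(j-k)\lambda}d\lambda,$$ $$D(k-j)=\frac1{2\pi}\int_{-\pi}^\pi\left[f(f+g)^{-1}g\right]^\top e^{i(j-k)\lambda}d\lambda .$$ Invertibility of $\mathbf B$ means that $\mathbf B$ has an inverse matrix $\mathbf B^{-1}$; $\langle x,y\rangle=\sum_{k\in\Gamma}x(k)^\top\overline{y(k)}$. Estimates. $L_2(f+g)$ is the Hilbert space of $\mathbb C^T$-valued functions $\vec b$ with $\int_{-\pi}^{\pi}\vec b^\top(f+g)\overline{\vec b}\,d\lambda<\infty$; $L_2^s(f+g)$ is its closed subspace generated by $e^{i\tilde j\lambda}\delta_\nu$, $\nu=1,\dots,T$,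 $\tilde j\in\{\dots,-2,-1\}\setminus\widetilde S$, where $\delta_\nu$ is the $\nu$-th standard basis vector. Linear estimates of $A\vec\zeta$ based on the observations are $\widehat{A\vec\zeta}=\int_{-\pi}^\pi\vec h^\top(e^{i\lambda})(Z^{\vec\zeta}(d\lambda)+Z^{\vec\theta}(d\lambda))$ with $\vec h\in L_2^s(f+g)$ (the spectral characteristic), where $Z^{\vec\zeta},Z^{\vec\theta}$ are the orthogonal random spectral measures, $\vec\zeta(n)=\int e^{in\lambda}Z^{\vec\zeta}(d\lambda)$ and similarly for $\vec\theta$. The mean square error is $$\Delta(\vec h;f,g)=E|A\vec\zeta-\widehat{A\vec\zeta}|^2=\frac1{2\pi}\int_{-\pi}^\pi(A-\vec h)^\top f\,\overline{(A-\vec h)}\,d\lambda+\frac1{2\pi}\int_{-\pi}^\pi\vec h^\top g\,\overline{\vec h}\,d\lambda,$$ the optimal estimate minimizes it over $\vec h\in L_2^s(f+g)$, and $\Delta(f,g)$ is the minimum.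
   Formalization: Invertibility of B is taken to mean that the inverse matrix also acts as the inverse map on a set of sequences containing Ra (so B c = R a), and the series C = Σ c(n)e^{inλ} is assumed to converge in L_2((f+g)^{-1}); the English leaves B^{-1}Ra and C undefined in general. *)

theory Defs
  imports "HOL-Probability.Probability"
begin

text \<open>Vectors and matrices over the complex numbers: \<open>vdot x y\<close> is $x^\top y$ (no conjugation)
  and \<open>qform F b c\<close> is $b^\top F\,\overline{c}$.\<close>

definition vdot :: "complex^'t \<Rightarrow> complex^'t \<Rightarrow> complex" where
  "vdot x y = (\<Sum>i\<in>UNIV. x $ i * y $ i)"

definition vcnj :: "complex^'t \<Rightarrow> complex^'t" where
  "vcnj x = (\<chi> i. cnj (x $ i))"

definition qform :: "complex^'t^'t \<Rightarrow> complex^'t \<Rightarrow> complex^'t \<Rightarrow> complex" where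
  "qform F b c = vdot (b v* F) (vcnj c)"

definition hermitian_psd :: "complex^'t^'t \<Rightarrow> bool" where
  "hermitian_psd F \<longleftrightarrow> (\<forall>i j. F $ i $ j = cnj (F $ j $ i)) \<and> (\<forall>v. 0 \<le> Re (qform F v v))"


section \<open>Periodically correlated sequences and their blocked sequences\<close>

definition zero_mean_finite_variance :: "'a measure \<Rightarrow> (int \<Rightarrow> 'a \<Rightarrow> complex) \<Rightarrow> bool" where
  "zero_mean_finite_variance M \<zeta> \<longleftrightarrow>
     (\<forall>n. \<zeta> n \<in> borel_measurable M \<and> integrable M (\<lambda>\<omega>. (cmod (\<zeta> n \<omega>))\<^sup>2)
        \<and> (\<integral>\<omega>. \<zeta> n \<omega> \<partial>M) = 0)"

definition covariance_period :: "'a measure \<Rightarrow> nat \<Rightarrow> (int \<Rightarrow> 'a \<Rightarrow> complex) \<Rightarrow> bool" where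
  "covariance_period M T \<zeta> \<longleftrightarrow>
     (\<forall>n m. (\<integral>\<omega>. \<zeta> (n + int T) \<omega> * cnj (\<zeta> (m + int T) \<omega>) \<partial>M)
          = (\<integral>\<omega>. \<zeta> n \<omega> * cnj (\<zeta> m \<omega>) \<partial>M))"

definition periodically_correlated :: "'a measure \<Rightarrow> nat \<Rightarrow> (int \<Rightarrow> 'a \<Rightarrow> complex) \<Rightarrow> bool" where
  "periodically_correlated M T \<zeta> \<longleftrightarrow>
     zero_mean_finite_variance M \<zeta> \<and> 0 < T \<and> covariance_period M T \<zeta>
     \<and> (\<forall>T'. 0 < T' \<and> T' < T \<longrightarrow> \<not> covariance_period M T' \<zeta>)"

definition mutually_uncorrelated ::
    "'a measure \<Rightarrow> (int \<Rightarrow> 'a \<Rightarrow> complex) \<Rightarrow> (int \<Rightarrow> 'a \<Rightarrow> complex) \<Rightarrow> bool" where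
  "mutually_uncorrelated M \<zeta> \<theta> \<longleftrightarrow> (\<forall>n m. (\<integral>\<omega>. \<zeta> n \<omega> * cnj (\<theta> m \<omega>) \<partial>M) = 0)"

text \<open>The index type \<open>'t\<close> has \<open>T\<close> elements; \<open>idx\<close> is a bijection from it onto \<open>{1..T}\<close> that
  gives each coordinate its number.\<close>

definition blocked :: "nat \<Rightarrow> ('t \<Rightarrow> nat) \<Rightarrow> (int \<Rightarrow> 'a \<Rightarrow> complex) \<Rightarrow> int \<Rightarrow> 'a \<Rightarrow> complex^'t" where
  "blocked T idx \<zeta> n \<omega> = (\<chi> p. \<zeta> (n * int T + int (idx p)) \<omega>)"


section \<open>Spectral densities and orthogonal random spectral measures\<close>

definition spectral_density_matrix :: "(real \<Rightarrow> complex^'t^'t) \<Rightarrow> bool" where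
  "spectral_density_matrix f \<longleftrightarrow>
     set_integrable lborel {-pi..pi} f \<and> (\<forall>l\<in>{-pi..pi}. hermitian_psd (f l))"

definition has_spectral_density ::
    "'a measure \<Rightarrow> (int \<Rightarrow> 'a \<Rightarrow> complex^'t) \<Rightarrow> (real \<Rightarrow> complex^'t^'t) \<Rightarrow> bool" where
  "has_spectral_density M X f \<longleftrightarrow> spectral_density_matrix f \<and>
     (\<forall>n k p q. (\<integral>\<omega>. X (n + k) \<omega> $ p * cnj (X n \<omega> $ q) \<partial>M)
        = (LINT l:{-pi..pi}|lborel. cis (of_int k * l) * f l $ p $ q) / (2 * pi))"

definition L2 :: "(real \<Rightarrow> complex^'t^'t) \<Rightarrow> (real \<Rightarrow> complex^'t) set" where
  "L2 F = {b. set_borel_measurable lborel {-pi..pi} b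
            \<and> set_integrable lborel {-pi..pi} (\<lambda>l. qform (F l) (b l) (b l))}"

definition L2_normsq :: "(real \<Rightarrow> complex^'t^'t) \<Rightarrow> (real \<Rightarrow> complex^'t) \<Rightarrow> real" where
  "L2_normsq F b = (LINT l:{-pi..pi}|lborel. Re (qform (F l) (b l) (b l)))"

definition trig_poly :: "int set \<Rightarrow> (int \<Rightarrow> complex^'t) \<Rightarrow> real \<Rightarrow> complex^'t" where
  "trig_poly J \<beta> l = (\<Sum>j\<in>J. cis (of_int j * l) *s \<beta> j)"

text \<open>Closed subspace of \<open>L2 F\<close> generated by $e^{ij\lambda}\delta_\nu$ with \<open>j \<in> S\<close>.\<close>

definition L2_span :: "(real \<Rightarrow> complex^'t^'t) \<Rightarrow> int set \<Rightarrow> (real \<Rightarrow> complex^'t) set" where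
  "L2_span F S = {h \<in> L2 F. \<forall>\<epsilon>>0. \<exists>J \<beta>. finite J \<and> J \<subseteq> S
                     \<and> L2_normsq F (\<lambda>l. h l - trig_poly J \<beta> l) < \<epsilon>}"

text \<open>Additivity (in mean square, hence almost surely) of an orthogonal random measure follows from
  the covariance formula.\<close>

definition random_spectral_measure ::
    "'a measure \<Rightarrow> (real set \<Rightarrow> 'a \<Rightarrow> complex^'t) \<Rightarrow> (real \<Rightarrow> complex^'t^'t) \<Rightarrow> bool" where
  "random_spectral_measure M Z f \<longleftrightarrow>
     (\<forall>A\<in>sets borel. A \<subseteq> {-pi..pi} \<longrightarrow>
        Z A \<in> borel_measurable M \<and> integrable M (\<lambda>\<omega>. (norm (Z A \<omega>))\<^sup>2) \<and> (\<integral>\<omega>. Z A \<omega> \<partial>M) = 0) \<and>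
     (\<forall>A\<in>sets borel. \<forall>B\<in>sets borel. A \<subseteq> {-pi..pi} \<longrightarrow> B \<subseteq> {-pi..pi} \<longrightarrow>
        (\<forall>p q. (\<integral>\<omega>. Z A \<omega> $ p * cnj (Z B \<omega> $ q) \<partial>M)
                 = (LINT l:A \<inter> B|lborel. f l $ p $ q) / (2 * pi)))"

text \<open>\<open>has_stoch_integral M Z F h \<eta>\<close> says $\eta=\int_{-\pi}^{\pi}h^\top(\lambda)\,Z(d\lambda)$, where
  \<open>F\<close> is the spectral density of \<open>Z\<close>: \<open>\<eta>\<close> is a mean-square limit of integrals of step
  functions approximating \<open>h\<close> in \<open>L2 F\<close>. It determines \<open>\<eta>\<close> up to a null set.\<close>

definition has_stoch_integral ::
    "'a measure \<Rightarrow> (real set \<Rightarrow> 'a \<Rightarrow> complex^'t) \<Rightarrow> (real \<Rightarrow> complex^'t^'t)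
       \<Rightarrow> (real \<Rightarrow> complex^'t) \<Rightarrow> ('a \<Rightarrow> complex) \<Rightarrow> bool" where
  "has_stoch_integral M Z F h \<eta> \<longleftrightarrow>
     h \<in> L2 F \<and> \<eta> \<in> borel_measurable M \<and> integrable M (\<lambda>\<omega>. (cmod (\<eta> \<omega>))\<^sup>2) \<and>
     (\<forall>\<epsilon>>0. \<exists>(m::nat) A b. (\<forall>i<m. A i \<in> sets borel \<and> A i \<subseteq> {-pi..pi})
        \<and> L2_normsq F (\<lambda>l. h l - (\<Sum>i<m. indicat_real (A i) l *\<^sub>R b i)) < \<epsilon>
        \<and> (\<integral>\<omega>. (cmod (\<eta> \<omega> - (\<Sum>i<m. vdot (b i) (Z (A i) \<omega>))))\<^sup>2 \<partial>M) < \<epsilon>)"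

definition spectral_representation ::
    "'a measure \<Rightarrow> (real set \<Rightarrow> 'a \<Rightarrow> complex^'t) \<Rightarrow> (real \<Rightarrow> complex^'t^'t)
       \<Rightarrow> (int \<Rightarrow> 'a \<Rightarrow> complex^'t) \<Rightarrow> bool" where
  "spectral_representation M Z f X \<longleftrightarrow> random_spectral_measure M Z f \<and>
     (\<forall>n p. has_stoch_integral M Z f (\<lambda>l. axis p (cis (of_int n * l))) (\<lambda>\<omega>. X n \<omega> $ p))"


section \<open>Missing observations\<close>

definition gap_end :: "(nat \<Rightarrow> nat) \<Rightarrow> (nat \<Rightarrow> nat) \<Rightarrow> nat \<Rightarrow> int" where
  "gap_end N K l = int (\<Sum>k\<le>l. N k + K k)"

definition missing :: "nat \<Rightarrow> (nat \<Rightarrow> nat) \<Rightarrow> (nat \<Rightarrow> nat) \<Rightarrow> int set" where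
  "missing s N K = (\<Union>l\<in>{1..s}. {- gap_end N K l .. - gap_end N K (l - 1) - int (N l) - 1})"

definition Gamma_set :: "nat \<Rightarrow> (nat \<Rightarrow> nat) \<Rightarrow> (nat \<Rightarrow> nat) \<Rightarrow> int set" where
  "Gamma_set s N K = missing s N K \<union> {0..}"

definition observed :: "nat \<Rightarrow> (nat \<Rightarrow> nat) \<Rightarrow> (nat \<Rightarrow> nat) \<Rightarrow> int set" where
  "observed s N K = {..-1} - missing s N K"


section \<open>Infinite block matrices indexed by \<open>\<Gamma>\<close>\<close>

text \<open>\<open>\<Gamma>\<close> is bounded below, so the partial sums are finite; the order of summation on the
  finite negative part is immaterial.\<close>

definition series_sums :: "int set \<Rightarrow> (int \<Rightarrow> 'v::real_normed_vector) \<Rightarrow> 'v \<Rightarrow> bool" where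
  "series_sums \<Gamma> u v \<longleftrightarrow> (\<lambda>N. \<Sum>n\<in>{n\<in>\<Gamma>. n \<le> int N}. u n) \<longlonglongrightarrow> v"

definition series_summable :: "int set \<Rightarrow> (int \<Rightarrow> 'v::real_normed_vector) \<Rightarrow> bool" where
  "series_summable \<Gamma> u \<longleftrightarrow> (\<exists>v. series_sums \<Gamma> u v)"

definition series :: "int set \<Rightarrow> (int \<Rightarrow> 'v::real_normed_vector) \<Rightarrow> 'v" where
  "series \<Gamma> u = (THE v. series_sums \<Gamma> u v)"

text \<open>\<open>toeplitz \<Phi>\<close> has the $(k,j)$ block
  $\frac1{2\pi}\int_{-\pi}^{\pi}\Phi(\lambda)^\top e^{i(j-k)\lambda}\,d\lambda$.\<close>

definition toeplitz :: "(real \<Rightarrow> complex^'t^'t) \<Rightarrow> int \<Rightarrow> int \<Rightarrow> complex^'t^'t" where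
  "toeplitz \<Phi> k j = (\<chi> p q.
     (LINT l:{-pi..pi}|lborel. transpose (\<Phi> l) $ p $ q * cis (of_int (j - k) * l)) / (2 * pi))"

definition applicable ::
    "int set \<Rightarrow> (int \<Rightarrow> int \<Rightarrow> complex^'t^'t) \<Rightarrow> (int \<Rightarrow> complex^'t) \<Rightarrow> bool" where
  "applicable \<Gamma> m x \<longleftrightarrow> (\<forall>k\<in>\<Gamma>. series_summable \<Gamma> (\<lambda>j. m k j *v x j))"

definition op_apply ::
    "int set \<Rightarrow> (int \<Rightarrow> int \<Rightarrow> complex^'t^'t) \<Rightarrow> (int \<Rightarrow> complex^'t) \<Rightarrow> int \<Rightarrow> complex^'t" where
  "op_apply \<Gamma> m x k = (if k \<in> \<Gamma> then series \<Gamma> (\<lambda>j. m k j *v x j) else 0)"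

text \<open>The pairing $\langle x,y\rangle=\sum_{k\in\Gamma}x(k)^\top\overline{y(k)}$ and its convergence.\<close>

definition pairing_converges :: "int set \<Rightarrow> (int \<Rightarrow> complex^'t) \<Rightarrow> (int \<Rightarrow> complex^'t) \<Rightarrow> bool" where
  "pairing_converges \<Gamma> x y \<longleftrightarrow> series_summable \<Gamma> (\<lambda>k. vdot (x k) (vcnj (y k)))"

definition pairing :: "int set \<Rightarrow> (int \<Rightarrow> complex^'t) \<Rightarrow> (int \<Rightarrow> complex^'t) \<Rightarrow> complex" where
  "pairing \<Gamma> x y = series \<Gamma> (\<lambda>k. vdot (x k) (vcnj (y k)))"

definition inverse_matrix ::
    "int set \<Rightarrow> (int \<Rightarrow> int \<Rightarrow> complex^'t^'t) \<Rightarrow> (int \<Rightarrow> int \<Rightarrow> complex^'t^'t) \<Rightarrow> bool" where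
  "inverse_matrix \<Gamma> m V \<longleftrightarrow>
     (\<forall>k\<in>\<Gamma>. \<forall>l\<in>\<Gamma>. series_sums \<Gamma> (\<lambda>j. m k j ** V j l) (if k = l then mat 1 else 0)
                  \<and> series_sums \<Gamma> (\<lambda>j. V k j ** m j l) (if k = l then mat 1 else 0))"

text \<open>Products of infinite matrices are not associative: \<open>inverse_matrix \<Gamma> m V\<close> neither determines
  \<open>V\<close> nor implies $V(mx)=x$. (On the nonnegative integers, take \<open>m\<close> to be the Toeplitz matrix of
  $|1-z|^{2\alpha}$ with $0<\alpha<1/2$. The coefficients \<open>x\<close> of $(1-z)^{-1-\alpha}$ satisfy
  $mx=0$, so $V+xx^*$ is an inverse matrix whenever \<open>V\<close> is.) Invertibility of the operator \<open>m\<close>,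
  acting from a set \<open>X\<close> of sequences on \<open>\<Gamma>\<close> to a set \<open>Y\<close>, means that the inverse matrix also
  represents the inverse map from \<open>Y\<close> to \<open>X\<close>. Sequences on \<open>\<Gamma>\<close> are extended by 0.\<close>

definition invertible_operator ::
    "int set \<Rightarrow> (int \<Rightarrow> complex^'t) set \<Rightarrow> (int \<Rightarrow> complex^'t) set
       \<Rightarrow> (int \<Rightarrow> int \<Rightarrow> complex^'t^'t) \<Rightarrow> (int \<Rightarrow> int \<Rightarrow> complex^'t^'t) \<Rightarrow> bool" where
  "invertible_operator \<Gamma> X Y m V \<longleftrightarrow> inverse_matrix \<Gamma> m V \<and>
     (\<forall>x\<in>X. applicable \<Gamma> m x \<and> op_apply \<Gamma> m x \<in> Y \<and> op_apply \<Gamma> V (op_apply \<Gamma> m x) = x) \<and>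
     (\<forall>y\<in>Y. applicable \<Gamma> V y \<and> op_apply \<Gamma> V y \<in> X \<and> op_apply \<Gamma> m (op_apply \<Gamma> V y) = y)"

text \<open>The series $C=\sum_{n\in\Gamma}c(n)e^{in\lambda}$ converges in \<open>L2 W\<close>. With $W=(f+g)^{-1}$
  this is the space for which $C^\top(f+g)^{-1}$ lies in \<open>L2 (f+g)\<close>.\<close>

definition fourier_sums_in_L2 ::
    "(real \<Rightarrow> complex^'t^'t) \<Rightarrow> int set \<Rightarrow> (int \<Rightarrow> complex^'t) \<Rightarrow> (real \<Rightarrow> complex^'t) \<Rightarrow> bool" where
  "fourier_sums_in_L2 W \<Gamma> c C \<longleftrightarrow> C \<in> L2 W \<and>
     (\<lambda>N. L2_normsq W (\<lambda>l. C l - trig_poly {n\<in>\<Gamma>. n \<le> int N} c l)) \<longlonglongrightarrow> 0"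


section \<open>The functional and its optimal linear estimate\<close>

definition coeff_vec :: "nat \<Rightarrow> ('t \<Rightarrow> nat) \<Rightarrow> (nat \<Rightarrow> complex) \<Rightarrow> nat \<Rightarrow> complex^'t" where
  "coeff_vec T idx ahat j =
     (\<chi> p. ahat j * exp (2 * of_real pi * \<i> * of_nat j * of_nat (idx p) / of_nat T))"

definition extended_coeff :: "nat \<Rightarrow> ('t \<Rightarrow> nat) \<Rightarrow> (nat \<Rightarrow> complex) \<Rightarrow> int \<Rightarrow> complex^'t" where
  "extended_coeff T idx ahat k = (if 0 \<le> k then coeff_vec T idx ahat (nat k) else 0)"

text \<open>For absolutely summable coefficients and uniformly bounded second moments the series converges
  absolutely almost surely, and in mean square.\<close>

definition functional_A ::
    "(nat \<Rightarrow> complex^'t) \<Rightarrow> (int \<Rightarrow> 'a \<Rightarrow> complex^'t) \<Rightarrow> 'a \<Rightarrow> complex" where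
  "functional_A av X \<omega> = (\<Sum>j. vdot (av j) (X (int j) \<omega>))"

definition symbol_A :: "(nat \<Rightarrow> complex^'t) \<Rightarrow> real \<Rightarrow> complex^'t" where
  "symbol_A av l = (\<Sum>j. cis (of_nat j * l) *s av j)"

definition mean_square_error :: "'a measure \<Rightarrow> ('a \<Rightarrow> complex) \<Rightarrow> ('a \<Rightarrow> complex) \<Rightarrow> real" where
  "mean_square_error M \<xi> \<eta> = (\<integral>\<omega>. (cmod (\<xi> \<omega> - \<eta> \<omega>))\<^sup>2 \<partial>M)"

text \<open>\<open>h\<close> is the spectral characteristic, and \<open>\<eta>\<close> the value, of an optimal linear estimate of \<open>\<xi>\<close>
  from the observations, at the times in \<open>S\<close>, of the sequence with random spectral measure \<open>Z\<close>
  and spectral density \<open>F\<close>.\<close>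

definition optimal_estimate ::
    "'a measure \<Rightarrow> ('a \<Rightarrow> complex) \<Rightarrow> (real set \<Rightarrow> 'a \<Rightarrow> complex^'t) \<Rightarrow> (real \<Rightarrow> complex^'t^'t)
       \<Rightarrow> int set \<Rightarrow> (real \<Rightarrow> complex^'t) \<Rightarrow> ('a \<Rightarrow> complex) \<Rightarrow> bool" where
  "optimal_estimate M \<xi> Z F S h \<eta> \<longleftrightarrow>
     h \<in> L2_span F S \<and> has_stoch_integral M Z F h \<eta> \<and>
     (\<forall>h' \<eta>'. h' \<in> L2_span F S \<and> has_stoch_integral M Z F h' \<eta>' \<longrightarrow>
        mean_square_error M \<xi> \<eta> \<le> mean_square_error M \<xi> \<eta>')"

end

theory Submission
  imports Defs
begin

text \<open>Write \<open>F = f + g\<close>. Multiplication by \<open>F\<close> gives \<open>(A - h)\<^sup>T f - h\<^sup>T g = C\<^sup>T\<close>, and the Fourier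
  coefficients of \<open>C\<close> live on \<open>\<Gamma>\<close>, so this function is orthogonal to \<open>e\<^sup>i\<^sup>j\<^sup>\<lambda> \<delta>\<^sub>\<nu>\<close> for every observed \<open>j\<close>;
  by Pythagoras \<open>h\<close> is the unique minimizer once \<open>h\<close> is known to be admissible. The equation
  \<open>B c = R a\<close> says that the Fourier coefficients of \<open>h\<close> on \<open>\<Gamma>\<close> vanish. That this puts \<open>h\<close> into the
  closed span in \<open>L\<^sub>2(F)\<close> of the observed exponentials is not automatic, since \<open>h\<close> need not be square
  integrable and Fejer means need not converge in \<open>L\<^sub>2(F)\<close>. Instead \<open>h\<close> is multiplied by \<open>\<psi>\<^sup>2\<close> for an
  antianalytic \<open>\<psi>\<close> with \<open>w \<bar>\<psi>\<bar>\<^sup>2\<close> constant, where \<open>w = 1 + \<bar>h\<bar> / m\<close>: the product is bounded, its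
  coefficients still vanish on the nonnegative integers, and it tends to \<open>h\<close> as \<open>m\<close> grows; bounded
  functions are approximated by Fejer means. The finitely many missing times are removed
  afterwards, their coefficients being continuous on \<open>L\<^sub>2(F)\<close>. The isometry of the stochastic
  integral turns the mean square error into the spectral integrals.\<close>

text \<open>The obstacle is that \<open>f + g\<close> and its inverse are merely integrable. Neither
  need be bounded, so truncating a Fourier series need not be a bounded operation on
  \<open>L2 (f + g)\<close>. Minimality still makes \<open>L2 (f + g)\<close> and
  \<open>L2 W\<close> dual under the unweighted pairing, and both consist of functions with
  integrable components; so coefficients exist and depend continuously on the function, and
  \<open>1 + |h| / m\<close> is an integrable weight to which Szegoe's construction applies. The
  square of psi is forced: its modulus c / w cancels |h| up to a factor of order c m, whereas a
  single factor would leave growth like the root of |h|. The normalization (integral of psi equal to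
  2 pi, and 2 pi c at most the integral of w) drives psi to 1 in mean square. The error involves two
  random measures, that of zeta for the functional and the sum for the estimate; since only the
  sequences are assumed uncorrelated, this has to be carried over to their measures first. In the
  error formula the mixed terms cancel because g W f and f W g both equal f - f W f.\<close>

lemma integral_Cauchy_Schwarz:
  fixes x y z :: "'a \<Rightarrow> real"
  assumes x: "integrable M x" and y: "integrable M y" and z: "integrable M z"
    and y0: "AE t in M. 0 \<le> y t" and z0: "AE t in M. 0 \<le> z t"
    and le: "AE t in M. (x t)\<^sup>2 \<le> y t * z t"
  shows "(\<integral>t. x t \<partial>M)\<^sup>2 \<le> (\<integral>t. y t \<partial>M) * (\<integral>t. z t \<partial>M)"
proof -
  define X Y Z' where "X = (\<integral>t. \<bar>x t\<bar> \<partial>M)" and "Y = (\<integral>t. y t \<partial>M)" and "Z' = (\<integral>t. z t \<partial>M)"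
  have Y: "0 \<le> Y" and Z: "0 \<le> Z'" and X: "0 \<le> X"
    unfolding X_def Y_def Z'_def using y0 z0 by (auto intro!: integral_nonneg_AE)
  \<comment> \<open>The weighted arithmetic-geometric mean inequality holds pointwise with free
    weights \<open>a\<close>, \<open>b\<close>. Integrating first and choosing the weights
    afterwards avoids normalizing by quantities that may vanish; \<open>a = X\<close>,
    \<open>b = Y\<close> gives the claim when \<open>Y\<close> is positive.\<close>
  have scaled: "2 * a * b * X \<le> a\<^sup>2 * Y + b\<^sup>2 * Z'" if ab: "0 \<le> a" "0 \<le> b" for a b
  proof -
    have "(\<integral>t. 2 * a * b * \<bar>x t\<bar> \<partial>M) \<le> (\<integral>t. a\<^sup>2 * y t + b\<^sup>2 * z t \<partial>M)"
    proof (rule integral_mono_AE)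
      show "AE t in M. 2 * a * b * \<bar>x t\<bar> \<le> a\<^sup>2 * y t + b\<^sup>2 * z t"
        using y0 z0 le
      proof eventually_elim
        case (elim t)
        have "(\<bar>x t\<bar>)\<^sup>2 \<le> (sqrt (y t) * sqrt (z t))\<^sup>2"
          using elim by (simp add: power_mult_distrib)
        then have "\<bar>x t\<bar> \<le> sqrt (y t) * sqrt (z t)"
          using elim by (meson mult_nonneg_nonneg power2_le_imp_le real_sqrt_ge_zero)
        then have "2 * a * b * \<bar>x t\<bar> \<le> 2 * a * b * (sqrt (y t) * sqrt (z t))"
          using ab by (intro mult_left_mono) auto
        also have "\<dots> \<le> a\<^sup>2 * y t + b\<^sup>2 * z t"
          using sum_squares_bound[of "a * sqrt (y t)" "b * sqrt (z t)"] elim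
          by (simp add: power_mult_distrib algebra_simps)
        finally show ?case .
      qed
    qed (use x y z in auto)
    also have "\<dots> = a\<^sup>2 * Y + b\<^sup>2 * Z'"
      using y z by (simp add: Y_def Z'_def)
    finally show ?thesis
      by (simp add: X_def)
  qed
  have XX: "X\<^sup>2 \<le> Y * Z'"
  proof (cases "Y = 0")
    case True
    have "X \<le> 0"
    proof (rule field_le_epsilon)
      fix e :: real assume e: "0 < e"
      \<comment> \<open>With \<open>Y = 0\<close> the first weight is free and can be made large;
        adding 1 keeps it positive when \<open>Z'\<close> vanishes too.\<close>
      from scaled[of "(Z' + 1) / e" 1] True have "2 * ((Z' + 1) / e) * X \<le> Z'"
        using e Z by simp
      then have "2 * (Z' + 1) * X \<le> Z' * e"
        using e by (simp add: field_simps)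
      also have "\<dots> \<le> 2 * (Z' + 1) * e"
        using e Z by (intro mult_right_mono) auto
      finally show "X \<le> 0 + e"
        using Z by simp
    qed
    then show ?thesis using X True by simp
  next
    case False
    have "2 * X * Y * X \<le> X\<^sup>2 * Y + Y\<^sup>2 * Z'"
      using scaled[OF X Y] by (simp add: mult_ac)
    then have "Y * X\<^sup>2 \<le> Y * (Y * Z')"
      by (simp add: power2_eq_square algebra_simps)
    then show ?thesis
      using False Y by simp
  qed
  have "\<bar>\<integral>t. x t \<partial>M\<bar> \<le> X"
    unfolding X_def by (rule integral_abs_bound)
  then have "(\<integral>t. x t \<partial>M)\<^sup>2 \<le> X\<^sup>2"
    using power_mono[of "\<bar>\<integral>t. x t \<partial>M\<bar>" X 2] by simp
  with XX show ?thesis by (simp add: Y_def Z'_def)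
qed

lemma AE_subseq_tendsto_of_integral:
  fixes u :: "nat \<Rightarrow> 'a \<Rightarrow> complex"
  assumes u: "\<And>n. u n \<in> borel_measurable M" and i: "\<And>n. integrable M (\<lambda>x. (cmod (u n x - v x))\<^sup>2)"
    and lim: "(\<lambda>n. \<integral>x. (cmod (u n x - v x))\<^sup>2 \<partial>M) \<longlonglongrightarrow> 0"
  obtains r where "strict_mono r" "AE x in M. (\<lambda>n. u (r n) x) \<longlonglongrightarrow> v x"
proof -
  obtain r where r: "strict_mono r"
    "AE x in M. (\<lambda>n. (cmod (u (r n) x - v x))\<^sup>2) \<longlonglongrightarrow> 0"
    using tendsto_L1_AE_subseq[of M "\<lambda>n x. (cmod (u n x - v x))\<^sup>2"] i lim by auto
  have "AE x in M. (\<lambda>n. u (r n) x) \<longlonglongrightarrow> v x"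
    using r(2)
  proof eventually_elim
    case (elim x)
    then have "(\<lambda>n. sqrt ((cmod (u (r n) x - v x))\<^sup>2)) \<longlonglongrightarrow> sqrt 0"
      by (intro tendsto_intros)
    then have "(\<lambda>n. u (r n) x - v x) \<longlonglongrightarrow> 0"
      by (simp add: tendsto_norm_zero_iff)
    then show ?case using LIM_zero_iff by blast
  qed
  with r(1) that show thesis by blast
qed

section \<open>Square-integrable functions and completeness\<close>

definition square_integrable :: "'a measure \<Rightarrow> ('a \<Rightarrow> complex) \<Rightarrow> bool" where
  "square_integrable M u \<longleftrightarrow> u \<in> borel_measurable M \<and> integrable M (\<lambda>x. (cmod (u x))\<^sup>2)"

lemma borel_measurable_cnj [measurable]: "cnj \<in> borel_measurable borel"
  by (intro borel_measurable_continuous_onI continuous_intros)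

lemma square_integrableD:
  assumes "square_integrable M u"
  shows "u \<in> borel_measurable M" "integrable M (\<lambda>x. (cmod (u x))\<^sup>2)"
  using assms by (auto simp: square_integrable_def)

lemma cmod_add_square_le: "(cmod (a + b))\<^sup>2 \<le> 2 * (cmod a)\<^sup>2 + 2 * (cmod b)\<^sup>2"
proof -
  have "(cmod (a + b))\<^sup>2 \<le> (cmod a + cmod b)\<^sup>2"
    by (intro power_mono norm_triangle_ineq) auto
  also have "\<dots> \<le> 2 * (cmod a)\<^sup>2 + 2 * (cmod b)\<^sup>2"
    using sum_squares_bound[of "cmod a" "cmod b"] by (simp add: power2_sum)
  finally show ?thesis .
qed

lemma square_integrable_add:
  assumes "square_integrable M u" "square_integrable M v"
  shows "square_integrable M (\<lambda>x. u x + v x)"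
proof -
  note [measurable] = assms[THEN square_integrableD(1)]
  have "integrable M (\<lambda>x. 2 * (cmod (u x))\<^sup>2 + 2 * (cmod (v x))\<^sup>2)"
    using assms by (simp add: square_integrable_def)
  then have "integrable M (\<lambda>x. (cmod (u x + v x))\<^sup>2)"
    by (rule Bochner_Integration.integrable_bound) (use cmod_add_square_le in auto)
  then show ?thesis by (simp add: square_integrable_def)
qed

lemma square_integrable_cmult:
  assumes "square_integrable M u"
  shows "square_integrable M (\<lambda>x. c * u x)"
  using assms by (auto simp: square_integrable_def norm_mult power_mult_distrib)

lemma square_integrable_diff:
  assumes "square_integrable M u" "square_integrable M v"
  shows "square_integrable M (\<lambda>x. u x - v x)"
  using square_integrable_add[OF assms(1) square_integrable_cmult[OF assms(2), of "-1"]] by simp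

lemma square_integrable_zero: "square_integrable M (\<lambda>x. 0)"
  by (simp add: square_integrable_def)

lemma square_integrable_sum:
  assumes "\<And>i. i \<in> I \<Longrightarrow> square_integrable M (u i)"
  shows "square_integrable M (\<lambda>x. \<Sum>i\<in>I. u i x)"
  using assms
  by (induction I rule: infinite_finite_induct)
    (auto intro: square_integrable_add square_integrable_zero)

lemma square_integrable_mult_cnj:
  assumes "square_integrable M u" "square_integrable M v"
  shows "integrable M (\<lambda>x. u x * cnj (v x))"
proof -
  note [measurable] = assms[THEN square_integrableD(1)]
  have "integrable M (\<lambda>x. (cmod (u x))\<^sup>2 + (cmod (v x))\<^sup>2)"
    using assms by (simp add: square_integrable_def)
  then show ?thesis
  proof (rule Bochner_Integration.integrable_bound)
    show "AE x in M. norm (u x * cnj (v x)) \<le> norm ((cmod (u x))\<^sup>2 + (cmod (v x))\<^sup>2)"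
    proof (rule AE_I2)
      fix x
      have "2 * (cmod (u x) * cmod (v x)) \<le> (cmod (u x))\<^sup>2 + (cmod (v x))\<^sup>2"
        using sum_squares_bound[of "cmod (u x)" "cmod (v x)"] by simp
      moreover have "0 \<le> cmod (u x) * cmod (v x)" by simp
      ultimately show "norm (u x * cnj (v x)) \<le> norm ((cmod (u x))\<^sup>2 + (cmod (v x))\<^sup>2)"
        by (simp add: norm_mult del: mult_nonneg_nonneg zero_le_mult_iff)
    qed
  qed measurable
qed

lemma square_integrable_Cauchy_Schwarz:
  assumes "square_integrable M u" "square_integrable M v"
  shows "(cmod (\<integral>x. u x * cnj (v x) \<partial>M))\<^sup>2
    \<le> (\<integral>x. (cmod (u x))\<^sup>2 \<partial>M) * (\<integral>x. (cmod (v x))\<^sup>2 \<partial>M)"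
proof -
  have i: "integrable M (\<lambda>x. u x * cnj (v x))"
    using assms by (rule square_integrable_mult_cnj)
  have "(cmod (\<integral>x. u x * cnj (v x) \<partial>M))\<^sup>2 \<le> (\<integral>x. cmod (u x * cnj (v x)) \<partial>M)\<^sup>2"
    by (intro power_mono integral_norm_bound) auto
  also have "\<dots> \<le> (\<integral>x. (cmod (u x))\<^sup>2 \<partial>M) * (\<integral>x. (cmod (v x))\<^sup>2 \<partial>M)"
    by (rule integral_Cauchy_Schwarz) (use assms integrable_norm[OF i] in \<open>auto simp: norm_mult power_mult_distrib square_integrable_def\<close>)
  finally show ?thesis .
qed

lemma square_integrable_integrable:
  assumes "finite_measure M" "square_integrable M u"
  shows "integrable M u"
proof -
  interpret finite_measure M by fact
  have "square_integrable M (\<lambda>x. 1)" by (auto simp: square_integrable_def)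
  from square_integrable_mult_cnj[OF assms(2) this] show ?thesis by simp
qed

text \<open>The increments of a fast subsequence are absolutely summable almost everywhere because
  \<open>2 t \<le> 2\<^sup>-\<^sup>n + 2\<^sup>n t\<^sup>2\<close>.\<close>

lemma square_integrable_complete:
  fixes X :: "nat \<Rightarrow> 'a \<Rightarrow> complex"
  assumes X: "\<And>n. square_integrable M (X n)"
    and Cauchy: "\<And>e. 0 < e \<Longrightarrow> \<exists>N. \<forall>m\<ge>N. \<forall>n\<ge>N. (\<integral>x. (cmod (X m x - X n x))\<^sup>2 \<partial>M) < e"
  obtains Y where "square_integrable M Y" "(\<lambda>n. \<integral>x. (cmod (X n x - Y x))\<^sup>2 \<partial>M) \<longlonglongrightarrow> 0"
proof -
  note [measurable] = X[THEN square_integrableD(1)]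
  define d where "d m n = (\<integral>x. (cmod (X m x - X n x))\<^sup>2 \<partial>M)" for m n
  have di: "integrable M (\<lambda>x. (cmod (X m x - X n x))\<^sup>2)" for m n
    using square_integrable_diff[OF X X] by (auto simp: square_integrable_def)
  \<comment> \<open>The rate \<open>(1/4)^k\<close> outruns the factor \<open>2^k\<close> of the
    pointwise estimate: the integrals of \<open>2^k\<close> times the squared increments are bounded
    by a geometric series of ratio 1/2.\<close>
  have "\<exists>N. \<forall>m\<ge>N. \<forall>n\<ge>N. d m n < (1/4)^k" for k
    unfolding d_def by (rule Cauchy) simp
  then obtain N0 where N0: "\<And>k m n. m \<ge> N0 k \<Longrightarrow> n \<ge> N0 k \<Longrightarrow> d m n < (1/4)^k"
    by metis
  \<comment> \<open>Adding up all thresholds so far puts \<open>r k\<close> beyond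
    \<open>N0 k\<close>, and the extra \<open>k\<close> makes the sequence strictly increasing even
    where thresholds are 0.\<close>
  define r where "r k = (\<Sum>i\<le>k. N0 i) + k" for k
  have rN: "r k \<ge> N0 k" for k
    unfolding r_def by (simp add: trans_le_add1 member_le_sum)
  have "r k < r (Suc k)" for k by (simp add: r_def)
  then have rm: "strict_mono r" by (rule strict_mono_Suc_iff[THEN iffD2, rule_format])
  have rk: "d (r (Suc k)) (r k) < (1/4)^k" for k
    using N0[OF order_trans[OF rN] rN] rm by (simp add: strict_mono_less_eq)
  define D where "D k x = X (r (Suc k)) x - X (r k) x" for k x
  have [measurable]: "D k \<in> borel_measurable M" for k unfolding D_def by measurable
  have "(\<integral>\<^sup>+x. (\<Sum>k. ennreal (2^k * (cmod (D k x))\<^sup>2)) \<partial>M)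
    = (\<Sum>k. \<integral>\<^sup>+x. ennreal (2^k * (cmod (D k x))\<^sup>2) \<partial>M)"
    by (rule nn_integral_suminf) measurable
  also have "\<dots> = (\<Sum>k. ennreal (2^k * d (r (Suc k)) (r k)))"
    unfolding D_def d_def
    by (subst nn_integral_eq_integral) (auto intro: di)
  also have "\<dots> \<le> (\<Sum>k. ennreal ((1/2)^k))"
  proof (rule suminf_le)
    fix k
    have "2^k * d (r (Suc k)) (r k) \<le> 2^k * (1/4)^k"
      using rk[of k] by (intro mult_left_mono) auto
    also have "\<dots> = (1/2)^k" by (simp add: power_mult_distrib[symmetric])
    finally show "ennreal (2^k * d (r (Suc k)) (r k)) \<le> ennreal ((1/2)^k)"
      by (rule ennreal_leI)
  qed auto
  also have "\<dots> < \<infinity>"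
    by (subst suminf_ennreal2) (auto intro!: summable_geometric)
  finally have "AE x in M. (\<Sum>k. ennreal (2^k * (cmod (D k x))\<^sup>2)) \<noteq> \<infinity>"
    by (intro nn_integral_PInf_AE) auto
  then have conv: "AE x in M. convergent (\<lambda>k. X (r k) x)"
  proof eventually_elim
    case (elim x)
    have s: "summable (\<lambda>k. 2^k * (cmod (D k x))\<^sup>2)"
      by (rule summable_suminf_not_top) (use elim in auto)
    have "summable (\<lambda>k. (1/2::real)^k + 2^k * (cmod (D k x))\<^sup>2)"
      by (intro summable_add s summable_geometric) auto
    then have "summable (\<lambda>k. cmod (D k x))"
    proof (rule summable_comparison_test_ev[rotated], intro always_eventually allI)
      fix k
      define q where "q = sqrt (2^k)"
      have q: "0 < q" "q\<^sup>2 = 2^k" by (auto simp: q_def)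
      have "2 * (1/q) * (q * cmod (D k x)) \<le> (1/q)\<^sup>2 + (q * cmod (D k x))\<^sup>2"
        by (rule sum_squares_bound)
      then have "2 * cmod (D k x) \<le> (1/2)^k + 2^k * (cmod (D k x))\<^sup>2"
        using q(1) by (simp add: power_mult_distrib q(2) power_divide)
      then show "norm (cmod (D k x)) \<le> (1/2)^k + 2^k * (cmod (D k x))\<^sup>2" 
        using norm_ge_zero[of "D k x"] by (simp del: norm_ge_zero)
    qed
    then have "summable (\<lambda>k. D k x)" by (rule summable_norm_cancel)
    moreover have "(\<Sum>k<n. D k x) = X (r n) x - X (r 0) x" for n
      unfolding D_def by (rule sum_lessThan_telescope)
    ultimately have "convergent (\<lambda>n. X (r n) x - X (r 0) x)"
      by (simp add: summable_iff_convergent)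
    from convergent_add[OF this convergent_const[of "X (r 0) x"]] show ?case by simp
  qed
  define Y where "Y x = lim (\<lambda>k. X (r k) x)" for x
  have [measurable]: "Y \<in> borel_measurable M" unfolding Y_def by measurable
  have lim: "AE x in M. (\<lambda>k. X (r k) x) \<longlonglongrightarrow> Y x"
    using conv by eventually_elim (simp add: Y_def convergent_LIMSEQ_iff)
  \<comment> \<open>Fatou's lemma along the subsequence bounds the distance of every late
    \<open>X n\<close> from \<open>Y\<close>, so the whole sequence converges. The same bound at one
    index shows that \<open>Y\<close> is square integrable.\<close>
  have Fatou: "(\<integral>\<^sup>+x. ennreal ((cmod (X n x - Y x))\<^sup>2) \<partial>M) \<le> ennreal e"
    if e: "\<And>m n. m \<ge> N \<Longrightarrow> n \<ge> N \<Longrightarrow> d m n < e" and n: "n \<ge> N" for N n e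
  proof -
    have "(\<integral>\<^sup>+x. ennreal ((cmod (X n x - Y x))\<^sup>2) \<partial>M)
      = (\<integral>\<^sup>+x. liminf (\<lambda>k. ennreal ((cmod (X n x - X (r k) x))\<^sup>2)) \<partial>M)"
    proof (rule nn_integral_cong_AE)
      show "AE x in M. ennreal ((cmod (X n x - Y x))\<^sup>2) = liminf (\<lambda>k. ennreal ((cmod (X n x - X (r k) x))\<^sup>2))"
        using lim
      proof eventually_elim
        case (elim x)
        then have "(\<lambda>k. ennreal ((cmod (X n x - X (r k) x))\<^sup>2)) \<longlonglongrightarrow> ennreal ((cmod (X n x - Y x))\<^sup>2)"
          by (intro tendsto_intros)
        then show ?case using lim_imp_Liminf[OF sequentially_bot] by metis
      qed
    qed
    also have "\<dots> \<le> liminf (\<lambda>k. \<integral>\<^sup>+x. ennreal ((cmod (X n x - X (r k) x))\<^sup>2) \<partial>M)"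
      by (rule nn_integral_liminf) measurable
    also have "\<dots> = liminf (\<lambda>k. ennreal (d n (r k)))"
      unfolding d_def by (subst nn_integral_eq_integral) (auto intro: di)
    also have "\<dots> \<le> ennreal e"
    proof (rule Liminf_le)
      show "\<forall>\<^sub>F k in sequentially. ennreal (d n (r k)) \<le> ennreal e"
        using eventually_ge_at_top[of N]
      proof eventually_elim
        case (elim k)
        with rm have "r k \<ge> N" using seq_suble order_trans by blast
        from e[OF n this] show ?case by (intro ennreal_leI) simp
      qed
    qed simp
    finally show ?thesis .
  qed
  have si: "square_integrable M (\<lambda>x. X (N0 0) x - Y x)"
  proof -
    have "(\<integral>\<^sup>+x. ennreal ((cmod (X (N0 0) x - Y x))\<^sup>2) \<partial>M) \<le> ennreal 1"
      by (rule Fatou[of "N0 0"]) (use N0[of 0] in auto)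
    also have "\<dots> < \<infinity>" by simp
    finally have "integrable M (\<lambda>x. (cmod (X (N0 0) x - Y x))\<^sup>2)"
      by (intro integrableI_nonneg) auto
    then show ?thesis by (simp add: square_integrable_def)
  qed
  have Y: "square_integrable M Y"
    using square_integrable_diff[OF X[of "N0 0"] si] by simp
  have "(\<lambda>n. \<integral>x. (cmod (X n x - Y x))\<^sup>2 \<partial>M) \<longlonglongrightarrow> 0"
  proof (rule LIMSEQ_I)
    fix e :: real assume e: "0 < e"
    then obtain N where N: "\<And>m n. m \<ge> N \<Longrightarrow> n \<ge> N \<Longrightarrow> d m n < e / 2"
      using Cauchy[of "e/2"] unfolding d_def by auto
    show "\<exists>no. \<forall>n\<ge>no. norm ((\<integral>x. (cmod (X n x - Y x))\<^sup>2 \<partial>M) - 0) < e"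
    proof (intro exI allI impI)
      fix n assume "n \<ge> N"
      then have "(\<integral>\<^sup>+x. ennreal ((cmod (X n x - Y x))\<^sup>2) \<partial>M) \<le> ennreal (e / 2)"
        using Fatou N by blast
      moreover have "(\<integral>\<^sup>+x. ennreal ((cmod (X n x - Y x))\<^sup>2) \<partial>M) = ennreal (\<integral>x. (cmod (X n x - Y x))\<^sup>2 \<partial>M)"
        using square_integrable_diff[OF X Y] by (intro nn_integral_eq_integral) (auto simp: square_integrable_def)
      ultimately have "(\<integral>x. (cmod (X n x - Y x))\<^sup>2 \<partial>M) \<le> e / 2"
        using e by simp
      then show "norm ((\<integral>x. (cmod (X n x - Y x))\<^sup>2 \<partial>M) - 0) < e"
        using e by simp
    qed
  qed
  with Y that show thesis by blast
qed

section \<open>Square-integrable functions: inner products and projections\<close>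

lemma square_integrable_norm_diff:
  assumes u: "square_integrable M u" and s: "square_integrable M s"
  shows "(\<integral>x. (cmod (u x - c * s x))\<^sup>2 \<partial>M)
    = (\<integral>x. (cmod (u x))\<^sup>2 \<partial>M) - 2 * Re (cnj c * (\<integral>x. u x * cnj (s x) \<partial>M))
      + (cmod c)\<^sup>2 * (\<integral>x. (cmod (s x))\<^sup>2 \<partial>M)"
proof -
  have eq: "(cmod (u x - c * s x))\<^sup>2
      = (cmod (u x))\<^sup>2 - 2 * Re (cnj c * (u x * cnj (s x))) + (cmod c)\<^sup>2 * (cmod (s x))\<^sup>2" for x
    unfolding cmod_power2 by (simp add: power2_eq_square algebra_simps)
  have i: "integrable M (\<lambda>x. cnj c * (u x * cnj (s x)))"
    using square_integrable_mult_cnj[OF u s] by simp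
  have "(\<integral>x. Re (cnj c * (u x * cnj (s x))) \<partial>M) = Re (cnj c * (\<integral>x. u x * cnj (s x) \<partial>M))"
    using i by (subst integral_Re) (simp_all add: integral_mult_right_zero)
  moreover define r where "r x = Re (cnj c * (u x * cnj (s x)))" for x
  moreover have "integrable M r"
    unfolding r_def using i by (rule integrable_Re)
  ultimately show ?thesis
    unfolding eq r_def[symmetric] using u s by (simp add: square_integrable_def)
qed

lemma square_integrable_inner_tendsto:
  assumes X: "\<And>n. square_integrable M (X n)" and Y: "square_integrable M Y"
    and s: "square_integrable M s"
    and lim: "(\<lambda>n. \<integral>x. (cmod (X n x - Y x))\<^sup>2 \<partial>M) \<longlonglongrightarrow> 0"
  shows "(\<lambda>n. \<integral>x. X n x * cnj (s x) \<partial>M) \<longlonglongrightarrow> (\<integral>x. Y x * cnj (s x) \<partial>M)"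
proof (rule LIM_zero_cancel, rule tendsto_norm_zero_cancel)
  have eq: "(\<integral>x. X n x * cnj (s x) \<partial>M) - (\<integral>x. Y x * cnj (s x) \<partial>M) = (\<integral>x. (X n x - Y x) * cnj (s x) \<partial>M)" for n
    using square_integrable_mult_cnj[OF X s] square_integrable_mult_cnj[OF Y s]
    by (simp add: left_diff_distrib)
  show "(\<lambda>n. cmod ((\<integral>x. X n x * cnj (s x) \<partial>M) - (\<integral>x. Y x * cnj (s x) \<partial>M))) \<longlonglongrightarrow> 0"
    unfolding eq
  proof (rule tendsto_sandwich[OF _ _ tendsto_const])
    show "\<forall>\<^sub>F n in sequentially. cmod (\<integral>x. (X n x - Y x) * cnj (s x) \<partial>M)
      \<le> sqrt ((\<integral>x. (cmod (X n x - Y x))\<^sup>2 \<partial>M) * (\<integral>x. (cmod (s x))\<^sup>2 \<partial>M))"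
      using square_integrable_Cauchy_Schwarz[OF square_integrable_diff[OF X Y] s]
      by (intro always_eventually allI real_le_rsqrt)
    show "(\<lambda>n. sqrt ((\<integral>x. (cmod (X n x - Y x))\<^sup>2 \<partial>M) * (\<integral>x. (cmod (s x))\<^sup>2 \<partial>M))) \<longlonglongrightarrow> 0"
      using tendsto_real_sqrt[OF tendsto_mult_left_zero[OF lim]] by simp
  qed auto
qed

text \<open>\<open>S\<close> need not be closed, so what exists is a minimizing sequence in
  \<open>S\<close> and the limit \<open>\<psi>\<close> of its residuals. Both are returned: Szegoe's
  construction needs the approximants themselves, because their frequencies are known.\<close>

lemma square_integrable_projection:
  fixes S :: "('a \<Rightarrow> complex) set"
  assumes S: "\<And>s. s \<in> S \<Longrightarrow> square_integrable M s" and zero: "(\<lambda>x. 0) \<in> S"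
    and add: "\<And>s t. s \<in> S \<Longrightarrow> t \<in> S \<Longrightarrow> (\<lambda>x. s x + t x) \<in> S"
    and scale: "\<And>c s. s \<in> S \<Longrightarrow> (\<lambda>x. c * s x) \<in> S"
    and v: "square_integrable M v"
  obtains P \<psi> where "\<And>k::nat. P k \<in> S" "square_integrable M \<psi>"
    "(\<lambda>k. \<integral>x. (cmod (v x - P k x - \<psi> x))\<^sup>2 \<partial>M) \<longlonglongrightarrow> 0"
    "\<And>s. s \<in> S \<Longrightarrow> (\<integral>x. \<psi> x * cnj (s x) \<partial>M) = 0"
proof -
  define E where "E s = (\<integral>x. (cmod (v x - s x))\<^sup>2 \<partial>M)" for s
  define d where "d = (INF s\<in>S. E s)"
  have bdd: "bdd_below (E ` S)"
    by (rule bdd_belowI[of _ 0]) (auto simp: E_def)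
  have d: "d \<le> E s" if "s \<in> S" for s
    unfolding d_def by (rule cINF_lower[OF bdd that])
  have "\<exists>s\<in>S. E s < d + 1 / real (Suc k)" for k
    using cINF_less_iff[of S E "d + 1 / real (Suc k)"] bdd zero by (auto simp: d_def)
  then obtain P where P: "\<And>k. P k \<in> S" "\<And>k. E (P k) < d + 1 / real (Suc k)"
    by metis
  define X where "X k x = v x - P k x" for k x
  have X: "square_integrable M (X k)" for k
    unfolding X_def by (intro square_integrable_diff v S P)
  have par: "(\<integral>x. (cmod (X m x - X n x))\<^sup>2 \<partial>M) \<le> 2 / real (Suc m) + 2 / real (Suc n)" for m n
  proof -
    \<comment> \<open>The midpoint lies in \<open>S\<close>, so its squared distance from
      \<open>v\<close> is at least \<open>d\<close>; the parallelogram identity then makes the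
      residuals of the minimizing sequence Cauchy.\<close>
    define s where "s x = (1/2) * (P m x + P n x)" for x
    have s: "s \<in> S" unfolding s_def by (intro scale add P)
    have "(cmod (X m x - X n x))\<^sup>2 = 2 * (cmod (X m x))\<^sup>2 + 2 * (cmod (X n x))\<^sup>2 - 4 * (cmod (v x - s x))\<^sup>2" for x
      unfolding cmod_power2 X_def s_def by (simp add: power2_eq_square field_simps)
    then have "(\<integral>x. (cmod (X m x - X n x))\<^sup>2 \<partial>M) = 2 * E (P m) + 2 * E (P n) - 4 * E s"
      using X[of m] X[of n] square_integrable_diff[OF v S[OF s]]
      by (simp add: E_def square_integrable_def flip: X_def)
    also have "\<dots> \<le> 2 * (d + 1 / real (Suc m)) + 2 * (d + 1 / real (Suc n)) - 4 * d"
      using P(2)[of m] P(2)[of n] d[OF s] by argo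
    finally show ?thesis by simp
  qed
  obtain \<psi> where \<psi>: "square_integrable M \<psi>"
    and lim: "(\<lambda>n. \<integral>x. (cmod (X n x - \<psi> x))\<^sup>2 \<partial>M) \<longlonglongrightarrow> 0"
  proof (rule square_integrable_complete[OF X])
    fix e :: real assume e: "0 < e"
    then obtain N where N: "1 / real (Suc N) < e / 4"
      using reals_Archimedean[of "e/4"] by (auto simp: inverse_eq_divide)
    show "\<exists>N. \<forall>m\<ge>N. \<forall>n\<ge>N. (\<integral>x. (cmod (X m x - X n x))\<^sup>2 \<partial>M) < e"
    proof (intro exI allI impI)
      fix m n assume "N \<le> m" "N \<le> n"
      then have "1 / real (Suc m) \<le> 1 / real (Suc N)" "1 / real (Suc n) \<le> 1 / real (Suc N)"
        by (auto intro!: divide_left_mono)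
      with par[of m n] N show "(\<integral>x. (cmod (X m x - X n x))\<^sup>2 \<partial>M) < e" by simp
    qed
  qed auto
  have orth: "(\<integral>x. \<psi> x * cnj (s x) \<partial>M) = 0" if s: "s \<in> S" for s
  proof -
    define Q where "Q = (\<integral>x. (cmod (s x))\<^sup>2 \<partial>M)"
    have Q: "0 \<le> Q" by (simp add: Q_def)
    have small: "(cmod (\<integral>x. X k x * cnj (s x) \<partial>M))\<^sup>2 \<le> Q / real (Suc k)" for k
    proof (cases "Q = 0")
      case True
      with square_integrable_Cauchy_Schwarz[OF X[of k] S[OF s]] show ?thesis
        by (simp add: Q_def)
    next
      case False
      define b where "b = (\<integral>x. X k x * cnj (s x) \<partial>M)"
      \<comment> \<open>The optimal multiple of \<open>s\<close>: subtracting it lowers the squared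
        distance by \<open>(cmod b)\<^sup>2 / Q\<close>, while \<open>P k\<close> is already within
        \<open>1 / real (Suc k)\<close> of the infimum.\<close>
      define c where "c = b / of_real Q"
      have "(\<lambda>x. P k x + c * s x) \<in> S" by (intro add scale P s)
      then have "d \<le> (\<integral>x. (cmod (X k x - c * s x))\<^sup>2 \<partial>M)"
        using d unfolding E_def X_def by (fastforce simp: algebra_simps)
      also have "\<dots> = E (P k) - 2 * Re (cnj c * b) + (cmod c)\<^sup>2 * Q"
        using square_integrable_norm_diff[OF X S[OF s], of k c]
        by (simp add: E_def X_def b_def Q_def)
      also have "\<dots> = E (P k) - (cmod b)\<^sup>2 / Q"
      proof -
        have "cnj c * b = of_real ((cmod b)\<^sup>2 / Q)"
          by (simp add: c_def complex_norm_square mult.commute del: of_real_power)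
        moreover have "(cmod c)\<^sup>2 * Q = (cmod b)\<^sup>2 / Q"
          using False Q by (simp add: c_def norm_divide power_divide power2_eq_square)
        ultimately show ?thesis by simp
      qed
      finally have "(cmod b)\<^sup>2 / Q \<le> 1 / real (Suc k)"
        using P(2)[of k] by linarith
      then show ?thesis
        using False Q by (simp add: b_def field_simps)
    qed
    have "(\<lambda>k. (cmod (\<integral>x. X k x * cnj (s x) \<partial>M))\<^sup>2) \<longlonglongrightarrow> (cmod (\<integral>x. \<psi> x * cnj (s x) \<partial>M))\<^sup>2"
      by (intro tendsto_intros square_integrable_inner_tendsto X \<psi> S s lim)
    moreover have "(\<lambda>k. (cmod (\<integral>x. X k x * cnj (s x) \<partial>M))\<^sup>2) \<longlonglongrightarrow> 0"
    proof (rule tendsto_sandwich[OF _ _ tendsto_const])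
      show "(\<lambda>k. Q / real (Suc k)) \<longlonglongrightarrow> 0"
        using LIMSEQ_Suc[OF lim_const_over_n[of Q]] by simp
    qed (use small in auto)
    ultimately have "(cmod (\<integral>x. \<psi> x * cnj (s x) \<partial>M))\<^sup>2 = 0"
      using LIMSEQ_unique by blast
    then show ?thesis by simp
  qed
  show thesis
    by (rule that[of P \<psi>]) (use P \<psi> lim orth in \<open>auto simp: X_def\<close>)
qed

section \<open>Fourier series on the circle\<close>

text \<open>Restricting the measure turns set integrals into plain integrals. The end points have
  the same image under \<open>cis\<close>; they form a null set and are discarded when the interval
  is compared with the unit circle.\<close>

abbreviation circle :: "real measure" where
  "circle \<equiv> restrict_space lborel {-pi..pi}"

lemma space_circle [simp]: "space circle = {-pi..pi}"
  by (simp add: space_restrict_space)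

lemma finite_measure_circle: "finite_measure circle"
  by (rule finite_measureI) (simp add: emeasure_restrict_space)

lemma sigma_finite_measure_circle: "sigma_finite_measure circle"
proof -
  interpret finite_measure circle by (rule finite_measure_circle)
  show ?thesis by unfold_locales
qed

lemma integrable_circle_const [simp]: "integrable circle (\<lambda>_. c)"
  for c :: "'b::{banach, second_countable_topology}"
  by (rule finite_measure.integrable_const[OF finite_measure_circle])

lemma measure_circle [simp]: "measure circle {-pi..pi} = 2 * pi"
  by (simp add: measure_restrict_space)

lemma set_integrable_circle: "set_integrable lborel {-pi..pi} u \<longleftrightarrow> integrable circle u"
  for u :: "real \<Rightarrow> 'b::{banach, second_countable_topology}"
  by (simp add: set_integrable_def integrable_restrict_space)

lemma set_integral_circle: "(LINT l:{-pi..pi}|lborel. u l) = (\<integral>l. u l \<partial>circle)"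
  for u :: "real \<Rightarrow> 'b::{banach, second_countable_topology}"
  by (simp add: set_lebesgue_integral_def integral_restrict_space)

lemma set_borel_measurable_circle:
  "set_borel_measurable lborel {-pi..pi} u \<longleftrightarrow> u \<in> borel_measurable circle"
  for u :: "real \<Rightarrow> 'b::{real_normed_vector, second_countable_topology}"
  by (simp add: set_borel_measurable_def borel_measurable_restrict_space_iff)

lemma AE_circle_iff: "(AE l in circle. P l) \<longleftrightarrow> (AE l in lborel. l \<in> {-pi..pi} \<longrightarrow> P l)"
  by (rule AE_restrict_space_iff) simp

lemma borel_measurable_circle: "u \<in> borel_measurable borel \<Longrightarrow> u \<in> borel_measurable circle"
  by (simp add: measurable_restrict_space1)

definition unit_char :: "int \<Rightarrow> real \<Rightarrow> complex" where
  "unit_char j l = cis (of_int j * l)"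

lemma unit_char_measurable [measurable]: "unit_char j \<in> borel_measurable borel"
  unfolding unit_char_def by (intro borel_measurable_continuous_onI continuous_intros)

lemma unit_char_measurable_circle [measurable]: "unit_char j \<in> borel_measurable circle"
  by (rule borel_measurable_circle) measurable

lemma norm_unit_char [simp]: "cmod (unit_char j l) = 1"
  by (simp add: unit_char_def)

lemma unit_char_mult: "unit_char j l * unit_char k l = unit_char (j + k) l"
  by (simp add: unit_char_def cis_mult distrib_right)

lemma unit_char_mult_left: "unit_char j l * (unit_char k l * z) = unit_char (j + k) l * z"
  by (simp flip: unit_char_mult mult.assoc)

lemma cnj_unit_char [simp]: "cnj (unit_char j l) = unit_char (- j) l"
  by (simp add: unit_char_def cis_cnj)

lemma unit_char_0 [simp]: "unit_char 0 l = 1"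
  by (simp add: unit_char_def)

lemma integrable_unit_char_mult:
  assumes "integrable circle u"
  shows "integrable circle (\<lambda>l. unit_char j l * u l)"
  using assms by (rule Bochner_Integration.integrable_bound)
    (use borel_measurable_integrable[OF assms] in \<open>auto simp: norm_mult\<close>)

lemma integrable_unit_char: "integrable circle (unit_char j)"
  using integrable_unit_char_mult[OF integrable_circle_const[of 1], of j]
  by simp

lemma integral_unit_char: "(\<integral>l. unit_char j l \<partial>circle) = (if j = 0 then of_real (2 * pi) else 0)"
proof (cases "j = 0")
  case True
  then show ?thesis by (simp add: scaleR_conv_of_real)
next
  case False
  define G where "G l = cis (of_int j * l) / (\<i> * of_int j)" for l :: real
  have "(\<integral>l. indicator {-pi..pi} l *\<^sub>R unit_char j l \<partial>lborel) = G pi - G (- pi)"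
  proof (rule integral_FTC_Icc)
    fix l :: real
    have "((\<lambda>l. cis (of_int j * l)) has_vector_derivative of_int j *\<^sub>R (\<i> * cis (of_int j * l)))
      (at l within {-pi..pi})"
    proof -
      have "((\<lambda>z. exp (\<i> * of_int j * z)) has_field_derivative (\<i> * of_int j * exp (\<i> * of_int j * of_real l)))
        (at (of_real l))"
        by (auto intro!: derivative_eq_intros)
      from has_vector_derivative_real_field[OF this]
      show ?thesis by (simp add: cis_conv_exp scaleR_conv_of_real mult_ac)
    qed
    then show "(G has_vector_derivative unit_char j l) (at l within {-pi..pi})"
      unfolding G_def unit_char_def using False
      by (auto intro!: derivative_eq_intros simp: scaleR_conv_of_real field_simps)
  qed (auto simp: unit_char_def intro!: continuous_intros)
  moreover have "G pi = G (- pi)"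
  proof -
    have "cis (of_int j * pi) = cis (of_int j * (- pi)) * cis (2 * pi * of_int j)"
      by (simp add: cis_mult algebra_simps)
    then show ?thesis by (simp add: G_def)
  qed
  ultimately show ?thesis
    using False by (simp add: integral_restrict_space)
qed

section \<open>Uniqueness of Fourier coefficients\<close>

definition vanishing_coeffs :: "(real \<Rightarrow> complex) \<Rightarrow> bool" where
  "vanishing_coeffs u \<longleftrightarrow> integrable circle u \<and> (\<forall>j. (\<integral>l. unit_char j l * u l \<partial>circle) = 0)"

lemma vanishing_coeffs_unit_char:
  assumes "vanishing_coeffs u"
  shows "vanishing_coeffs (\<lambda>l. unit_char k l * u l)"
  using assms unfolding vanishing_coeffs_def
  by (simp add: integrable_unit_char_mult unit_char_mult_left)

lemma vanishing_coeffs_add: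
  assumes "vanishing_coeffs u" "vanishing_coeffs v"
  shows "vanishing_coeffs (\<lambda>l. u l + v l)"
  using assms unfolding vanishing_coeffs_def
  by (auto simp: distrib_left integrable_unit_char_mult)

lemma vanishing_coeffs_cmult:
  assumes "vanishing_coeffs u"
  shows "vanishing_coeffs (\<lambda>l. c * u l)"
proof -
  have "(\<integral>l. unit_char j l * (c * u l) \<partial>circle) = c * (\<integral>l. unit_char j l * u l \<partial>circle)" for j
    by (subst integral_mult_right_zero[symmetric]) (simp add: mult_ac)
  then show ?thesis
    using assms unfolding vanishing_coeffs_def by auto
qed

text \<open>A real-linear functional of \<open>cis l\<close> is a combination of
  \<open>unit_char 1\<close> and \<open>unit_char (-1)\<close>, so a real polynomial in the
  coordinates of \<open>cis l\<close> is a trigonometric polynomial. Real polynomials are the class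
  to which Stone-Weierstrass on the circle refers.\<close>

lemma vanishing_coeffs_polynomial:
  assumes "real_polynomial_function p" "vanishing_coeffs u"
  shows "vanishing_coeffs (\<lambda>l. of_real (p (cis l)) * u l)"
  using assms
proof (induction p arbitrary: u rule: real_polynomial_function.induct)
  case (linear L)
  interpret bounded_linear L by fact
  have "of_real (L (cis l)) * u l
      = ((of_real (L 1) - \<i> * of_real (L \<i>)) / 2) * (unit_char 1 l * u l)
        + ((of_real (L 1) + \<i> * of_real (L \<i>)) / 2) * (unit_char (-1) l * u l)" for l
  proof -
    have "cis l = cos l *\<^sub>R 1 + sin l *\<^sub>R \<i>"
      by (simp add: complex_eq_iff)
    then have "L (cis l) = cos l * L 1 + sin l * L \<i>"
      by (simp only: add scaleR real_scaleR_def)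
    then show ?thesis
      by (simp add: unit_char_def complex_eq_iff algebra_simps add_divide_distrib diff_divide_distrib)
  qed
  then show ?case
    by (simp only:) (intro vanishing_coeffs_add vanishing_coeffs_cmult vanishing_coeffs_unit_char linear.prems)
next
  case (const c)
  then show ?case by (rule vanishing_coeffs_cmult)
next
  case (add f g)
  then show ?case using vanishing_coeffs_add[OF add.IH] by (simp add: distrib_right)
next
  case (mult f g)
  then show ?case by (simp add: mult.assoc)
qed

lemma vanishing_coeffs_continuous:
  assumes u: "vanishing_coeffs u" and k: "continuous_on (sphere 0 1) k"
  shows "(\<integral>l. of_real (k (cis l)) * u l \<partial>circle) = 0"
proof -
  have ui: "integrable circle u" using u by (simp add: vanishing_coeffs_def)
  define U where "U = (\<integral>l. cmod (u l) \<partial>circle)"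
  have U: "0 \<le> U" by (simp add: U_def)
  have kc: "continuous_on UNIV (\<lambda>l. k (cis l))"
    by (intro continuous_on_compose2[OF k]) (auto intro!: continuous_intros)
  then have km: "(\<lambda>l. k (cis l)) \<in> borel_measurable borel"
    by (rule borel_measurable_continuous_onI)
  obtain C where C: "\<And>l. \<bar>k (cis l)\<bar> \<le> C"
  proof -
    have "bounded (k ` sphere 0 1)"
      by (intro compact_imp_bounded compact_continuous_image k compact_sphere)
    then obtain C where "\<And>z. z \<in> sphere 0 1 \<Longrightarrow> \<bar>k z\<bar> \<le> C"
      unfolding bounded_iff by fastforce
    then show thesis by (intro that[of C]) simp
  qed
  have ki: "integrable circle (\<lambda>l. of_real (k (cis l)) * u l)"
  proof (rule Bochner_Integration.integrable_bound)
    show "integrable circle (\<lambda>l. C * cmod (u l))" using ui by simp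
    show "(\<lambda>l. of_real (k (cis l)) * u l) \<in> borel_measurable circle"
      using borel_measurable_circle[OF km] ui by measurable
    have "0 \<le> C" using C[of 0] by linarith
    then show "AE l in circle. norm (of_real (k (cis l)) * u l) \<le> norm (C * cmod (u l))"
      using C by (intro AE_I2) (simp add: norm_mult mult_right_mono)
  qed
  have "cmod (\<integral>l. of_real (k (cis l)) * u l \<partial>circle) \<le> 0 + e" if e: "0 < e" for e
  proof -
    \<comment> \<open>The uniform error of the polynomial enters multiplied by the integral
      \<open>U\<close> of the modulus of \<open>u\<close>; the added 1 avoids a division by
      zero.\<close>
    have "0 < e / (U + 1)" using e U by simp
    then obtain p where p: "real_polynomial_function p"
      "\<And>z. z \<in> sphere 0 1 \<Longrightarrow> \<bar>k z - p z\<bar> < e / (U + 1)"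
      using Stone_Weierstrass_real_polynomial_function[OF compact_sphere k] by blast
    have pv: "vanishing_coeffs (\<lambda>l. of_real (p (cis l)) * u l)"
      by (rule vanishing_coeffs_polynomial[OF p(1) u])
    then have pi: "integrable circle (\<lambda>l. of_real (p (cis l)) * u l)"
      "(\<integral>l. of_real (p (cis l)) * u l \<partial>circle) = 0"
      unfolding vanishing_coeffs_def by (auto dest: spec[of _ 0])
    have "(\<integral>l. of_real (k (cis l)) * u l \<partial>circle)
        = (\<integral>l. of_real (k (cis l)) * u l - of_real (p (cis l)) * u l \<partial>circle)"
      using ki pi by simp
    also have "cmod \<dots> \<le> (\<integral>l. e / (U + 1) * cmod (u l) \<partial>circle)"
    proof (rule order_trans[OF integral_norm_bound integral_mono])
      fix l
      have "cmod (of_real (k (cis l)) * u l - of_real (p (cis l)) * u l) = \<bar>k (cis l) - p (cis l)\<bar> * cmod (u l)"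
        by (simp add: norm_mult flip: left_diff_distrib of_real_diff)
      also have "\<dots> \<le> e / (U + 1) * cmod (u l)"
        using p(2)[of "cis l"] by (intro mult_right_mono) auto
      finally show "cmod (of_real (k (cis l)) * u l - of_real (p (cis l)) * u l) \<le> e / (U + 1) * cmod (u l)" .
    qed (use ki pi ui in auto)
    also have "\<dots> = e / (U + 1) * U" by (simp add: U_def)
    also have "\<dots> \<le> e" using e U by (simp add: field_simps)
    finally show ?thesis by simp
  qed
  then have "cmod (\<integral>l. of_real (k (cis l)) * u l \<partial>circle) \<le> 0"
    by (rule field_le_epsilon)
  then show ?thesis by simp
qed

lemma vanishing_coeffs_open:
  assumes u: "vanishing_coeffs u" and V: "open V" and V2: "V \<noteq> UNIV"
  shows "(\<integral>l. indicator V (cis l) *\<^sub>R u l \<partial>circle) = 0"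
proof -
  have ui: "integrable circle u" using u by (simp add: vanishing_coeffs_def)
  \<comment> \<open>These continuous functions increase to the indicator of \<open>V\<close>. The
    complement of \<open>V\<close> must be nonempty, since \<open>infdist\<close> to the empty set
    is 0 by convention.\<close>
  define k where "k n z = min 1 (real n * infdist z (- V))" for n z
  have kc: "continuous_on A (k n)" for n A
    unfolding k_def by (intro continuous_intros)
  have lim: "(\<lambda>n. k n z) \<longlonglongrightarrow> indicator V z" for z
  proof (cases "z \<in> V")
    case True
    have "0 < infdist z (- V)"
      using V V2 True by (intro infdist_pos_not_in_closed) auto
    then obtain N where N: "1 \<le> real N * infdist z (- V)"
      using reals_Archimedean3 by (meson less_imp_le)
    have "\<forall>\<^sub>F n in sequentially. k n z = 1"
      using eventually_ge_at_top[of N]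
    proof eventually_elim
      case (elim n)
      have "real N * infdist z (- V) \<le> real n * infdist z (- V)"
        using elim by (intro mult_right_mono infdist_nonneg) auto
      with N show ?case unfolding k_def by linarith
    qed
    then show ?thesis using True by (simp add: tendsto_eventually)
  next
    case False
    then show ?thesis by (simp add: k_def)
  qed
  have [measurable]: "V \<in> sets borel" using V by simp
  have cm [measurable]: "cis \<in> borel_measurable circle"
    by (intro borel_measurable_circle borel_measurable_continuous_onI continuous_intros)
  have um [measurable]: "u \<in> borel_measurable circle" using ui by simp
  have "(\<lambda>n. \<integral>l. k n (cis l) *\<^sub>R u l \<partial>circle) \<longlonglongrightarrow> (\<integral>l. indicator V (cis l) *\<^sub>R u l \<partial>circle)"
  proof (rule integral_dominated_convergence)
    show "(\<lambda>l. k n (cis l) *\<^sub>R u l) \<in> borel_measurable circle" for n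
      using measurable_compose[OF cm borel_measurable_continuous_onI[OF kc]] um by measurable
    show "integrable circle (\<lambda>l. cmod (u l))" using ui by simp
    show "AE l in circle. norm (k n (cis l) *\<^sub>R u l) \<le> cmod (u l)" for n
    proof (rule AE_I2)
      fix l
      have "\<bar>k n (cis l)\<bar> \<le> 1" unfolding k_def by (simp add: infdist_nonneg)
      then show "norm (k n (cis l) *\<^sub>R u l) \<le> cmod (u l)"
        by (simp add: mult_left_le_one_le)
    qed
  qed (auto intro!: tendsto_intros lim)
  moreover have "(\<integral>l. k n (cis l) *\<^sub>R u l \<partial>circle) = 0" for n
    using vanishing_coeffs_continuous[OF u kc] by (simp add: scaleR_conv_of_real)
  ultimately show ?thesis
    using LIMSEQ_unique tendsto_const by (metis (lifting) ext)
qed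

text \<open>Integrals that vanish over open sets vanish over all Borel sets by the pi-lambda
  theorem, and a function with vanishing integrals is null. The link between open sets of the
  interval and open sets of the plane is \<open>Arg\<close>.\<close>

lemma fourier_uniqueness:
  assumes ui: "integrable circle u" and zero: "\<And>j. (\<integral>l. unit_char j l * u l \<partial>circle) = 0"
  shows "AE l in circle. u l = 0"
proof -
  have u: "vanishing_coeffs u" using assms by (simp add: vanishing_coeffs_def)
  have um [measurable]: "u \<in> borel_measurable circle" using ui by simp
  have ae: "AE l in circle. l \<noteq> pi \<and> l \<noteq> -pi"
    unfolding AE_circle_iff using AE_lborel_singleton[of pi] AE_lborel_singleton[of "-pi"]
    by eventually_elim auto
  have int_ind: "integrable circle (\<lambda>l. indicator A l *\<^sub>R u l)" if "A \<in> sets borel" for A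
  proof (rule Bochner_Integration.integrable_bound[OF ui])
    have "(\<lambda>l. indicator A l :: real) \<in> borel_measurable circle"
      using that by (intro borel_measurable_circle) auto
    then show "(\<lambda>l. indicator A l *\<^sub>R u l) \<in> borel_measurable circle" by measurable
  qed (auto simp: indicator_def)
  have opens: "(\<integral>l. indicator (V \<inter> {-pi<..<pi}) l *\<^sub>R u l \<partial>circle) = 0" if V: "open V" for V
  proof -
    \<comment> \<open>\<open>Arg\<close> is continuous only off the nonpositive real axis. The
      preimage of \<open>V\<close> in this slit plane is open, and it omits 0, which supplies the
      nonempty complement. Both end points of the interval map to the slit, hence the cut to the
      open interval.\<close>
    define U where "U = {z \<in> - \<real>\<^sub>\<le>\<^sub>0. Arg z \<in> V}"
    have "open (- \<real>\<^sub>\<le>\<^sub>0 \<inter> Arg -` V)"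
      using continuous_on_open_vimage[of "- \<real>\<^sub>\<le>\<^sub>0" Arg] continuous_on_Arg V
      by (auto simp: open_Compl Int_commute)
    then have U: "open U" unfolding U_def by (simp add: Int_def vimage_def)
    have iff: "cis l \<in> U \<longleftrightarrow> l \<in> V \<inter> {-pi<..<pi}" if l: "l \<in> {-pi<..<pi}" for l
    proof -
      have "Arg (cis l) = l" using l by (intro Arg_cis) auto
      moreover have "cis l \<notin> \<real>\<^sub>\<le>\<^sub>0"
        using l \<open>Arg (cis l) = l\<close> Arg_eq_pi[of "cis l"] cis_neq_zero[of l]
        by (auto simp: complex_nonpos_Reals_iff complex_eq_iff)
      ultimately show ?thesis using l by (auto simp: U_def)
    qed
    have "(\<integral>l. indicator (V \<inter> {-pi<..<pi}) l *\<^sub>R u l \<partial>circle) = (\<integral>l. indicator U (cis l) *\<^sub>R u l \<partial>circle)"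
    proof (rule integral_cong_AE)
      have [measurable]: "cis \<in> borel_measurable circle" "U \<in> sets borel"
        using U by (auto intro!: borel_measurable_circle borel_measurable_continuous_onI continuous_intros)
      show "(\<lambda>l. indicator U (cis l) *\<^sub>R u l) \<in> borel_measurable circle"
        by measurable
      show "(\<lambda>l. indicator (V \<inter> {-pi<..<pi}) l *\<^sub>R u l) \<in> borel_measurable circle"
        using V by (intro borel_measurable_integrable int_ind) auto
      show "AE l in circle. indicator (V \<inter> {-pi<..<pi}) l *\<^sub>R u l = indicator U (cis l) *\<^sub>R u l"
        using ae AE_space
      proof eventually_elim
        case (elim l)
        with iff[of l] show ?case by (auto simp: indicator_def)
      qed
    qed
    also have "\<dots> = 0"
    proof (rule vanishing_coeffs_open[OF u U])
      have "0 \<notin> U" by (simp add: U_def)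
      then show "U \<noteq> UNIV" by blast
    qed
    finally show ?thesis .
  qed
  have borels: "(\<integral>l. indicator (A \<inter> {-pi<..<pi}) l *\<^sub>R u l \<partial>circle) = 0" if A: "A \<in> sets borel" for A
  proof -
    have "Int_stable {V::real set. open V}" by (auto simp: Int_stable_def)
    moreover have "{V::real set. open V} \<subseteq> Pow UNIV" by simp
    moreover have "A \<in> sigma_sets UNIV {V. open V}"
      using A by (simp add: borel_def)
    ultimately show ?thesis
    proof (induction rule: sigma_sets_induct_disjoint)
      case (basic V)
      then show ?case using opens by simp
    next
      case empty
      then show ?case by simp
    next
      case (compl A)
      then have A: "A \<in> sets borel" by (simp add: borel_def)
      have "(\<integral>l. indicator ((UNIV - A) \<inter> {-pi<..<pi}) l *\<^sub>R u l \<partial>circle)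
        = (\<integral>l. indicator (UNIV \<inter> {-pi<..<pi}) l *\<^sub>R u l - indicator (A \<inter> {-pi<..<pi}) l *\<^sub>R u l \<partial>circle)"
        by (intro Bochner_Integration.integral_cong) (auto simp: indicator_def)
      also have "\<dots> = 0"
        using A compl.IH opens[OF open_UNIV] by (subst Bochner_Integration.integral_diff) (simp_all add: int_ind)
      finally show ?case .
    next
      case (union A)
      then have A: "A i \<in> sets borel" for i by (auto simp: borel_def)
      have eq: "(\<Union>i. A i) \<inter> {-pi<..<pi} = (\<Union>i. A i \<inter> {-pi<..<pi})" by auto
      have "(LINT l:(\<Union>i. A i \<inter> {-pi<..<pi})|circle. u l) = (\<Sum>i. LINT l:(A i \<inter> {-pi<..<pi})|circle. u l)"
      proof (rule lebesgue_integral_countable_add)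
        show "A i \<inter> {-pi<..<pi} \<in> sets circle" for i
          using A[of i] by (auto simp: sets_restrict_space_iff)
        show "A i \<inter> {-pi<..<pi} \<inter> (A j \<inter> {-pi<..<pi}) = {}" if "i \<noteq> j" for i j
          using union(1) that by (auto simp: disjoint_family_on_def)
        show "set_integrable circle (\<Union>i. A i \<inter> {-pi<..<pi}) u"
          unfolding set_integrable_def using A by (intro int_ind) auto
      qed
      then show ?case
        unfolding eq set_lebesgue_integral_def using union.IH by simp
    qed
  qed
  show ?thesis
  proof (rule sigma_finite_measure.density_zero[OF sigma_finite_measure_circle ui])
    fix A assume "A \<in> sets circle"
    then have A: "A \<in> sets borel" "A \<subseteq> {-pi..pi}"
      by (auto simp: sets_restrict_space_iff)
    have "(LINT l:A|circle. u l) = (\<integral>l. indicator (A \<inter> {-pi<..<pi}) l *\<^sub>R u l \<partial>circle)"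
      unfolding set_lebesgue_integral_def
    proof (rule integral_cong_AE)
      show "AE l in circle. indicator A l *\<^sub>R u l = indicator (A \<inter> {-pi<..<pi}) l *\<^sub>R u l"
        using ae AE_space by eventually_elim (auto simp: indicator_def)
    qed (use A in \<open>auto intro!: borel_measurable_integrable int_ind\<close>)
    with borels[OF A(1)] show "set_lebesgue_integral circle A u = 0" by simp
  qed
qed

section \<open>Trigonometric sums and Fejer means\<close>

definition fourier_coeff :: "(real \<Rightarrow> complex) \<Rightarrow> int \<Rightarrow> complex" where
  "fourier_coeff u k = (\<integral>l. unit_char (- k) l * u l \<partial>circle) / (2 * pi)"

lemma square_integrable_unit_char: "square_integrable circle (unit_char j)"
  by (simp add: square_integrable_def)

lemma integral_cnj_unit_char: "(\<integral>l. u l * cnj (unit_char j l) \<partial>circle) = 2 * pi * fourier_coeff u j"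
  by (simp add: fourier_coeff_def mult.commute)

text \<open>Arbitrary coefficients \<open>q\<close> let one identity serve Bessel's inequality,
  density and the Fejer means. In the induction the residual after the frequencies in
  \<open>J\<close> still has the coefficient of \<open>v\<close> at the fresh frequency.\<close>

lemma trig_sum_norm_diff:
  assumes v: "square_integrable circle v" and J: "finite J"
  shows "(\<integral>l. (cmod (v l - (\<Sum>j\<in>J. q j * unit_char j l)))\<^sup>2 \<partial>circle)
    = (\<integral>l. (cmod (v l))\<^sup>2 \<partial>circle) - 2 * pi * (\<Sum>j\<in>J. (cmod (fourier_coeff v j))\<^sup>2)
      + 2 * pi * (\<Sum>j\<in>J. (cmod (q j - fourier_coeff v j))\<^sup>2)"
  using J
proof (induction J rule: finite_induct)
  case empty
  then show ?case by simp
next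
  case (insert i J)
  define r where "r l = v l - (\<Sum>j\<in>J. q j * unit_char j l)" for l
  have r: "square_integrable circle r"
    unfolding r_def
    by (intro square_integrable_diff v square_integrable_sum square_integrable_cmult square_integrable_unit_char)
  have "(\<integral>l. r l * cnj (unit_char i l) \<partial>circle)
      = (\<integral>l. v l * cnj (unit_char i l) - (\<Sum>j\<in>J. q j * unit_char (j - i) l) \<partial>circle)"
    unfolding r_def
    by (simp add: left_diff_distrib sum_distrib_right mult.assoc unit_char_mult)
  also have "\<dots> = (\<integral>l. v l * cnj (unit_char i l) \<partial>circle) - (\<Sum>j\<in>J. q j * (\<integral>l. unit_char (j - i) l \<partial>circle))"
    using square_integrable_mult_cnj[OF v square_integrable_unit_char] integrable_unit_char
    by (simp del: cnj_unit_char)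
  also have "(\<Sum>j\<in>J. q j * (\<integral>l. unit_char (j - i) l \<partial>circle)) = 0"
    using insert.hyps by (intro sum.neutral) (auto simp: integral_unit_char)
  finally have ri: "(\<integral>l. r l * cnj (unit_char i l) \<partial>circle) = 2 * pi * fourier_coeff v i"
    unfolding integral_cnj_unit_char by simp
  have "(\<integral>l. (cmod (v l - (\<Sum>j\<in>insert i J. q j * unit_char j l)))\<^sup>2 \<partial>circle)
      = (\<integral>l. (cmod (r l - q i * unit_char i l))\<^sup>2 \<partial>circle)"
    using insert.hyps by (simp add: r_def algebra_simps)
  also have "\<dots> = (\<integral>l. (cmod (r l))\<^sup>2 \<partial>circle) - 2 * Re (cnj (q i) * (2 * pi * fourier_coeff v i)) + (cmod (q i))\<^sup>2 * (2 * pi)"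
    using square_integrable_norm_diff[OF r square_integrable_unit_char] ri by simp
  also have "\<dots> = (\<integral>l. (cmod (r l))\<^sup>2 \<partial>circle) - 2 * pi * (cmod (fourier_coeff v i))\<^sup>2
      + 2 * pi * (cmod (q i - fourier_coeff v i))\<^sup>2"
    unfolding cmod_power2 by (simp add: power2_eq_square algebra_simps)
  finally show ?case
    using insert.hyps insert.IH by (simp add: r_def algebra_simps)
qed

lemma bessel:
  assumes v: "square_integrable circle v" and J: "finite J"
  shows "2 * pi * (\<Sum>j\<in>J. (cmod (fourier_coeff v j))\<^sup>2) \<le> (\<integral>l. (cmod (v l))\<^sup>2 \<partial>circle)"
proof -
  have "0 \<le> (\<integral>l. (cmod (v l - (\<Sum>j\<in>J. fourier_coeff v j * unit_char j l)))\<^sup>2 \<partial>circle)"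
    by simp
  then show ?thesis
    unfolding trig_sum_norm_diff[OF assms] by simp
qed

text \<open>A set of functions closed under addition and scaling, in the form required by
  \<open>square_integrable_projection\<close>. The index sets \<open>{..0}\<close> and
  \<open>{..-1}\<close> are the antianalytic cases.\<close>

definition trig_sums :: "int set \<Rightarrow> (real \<Rightarrow> complex) set" where
  "trig_sums S = {u. \<exists>J q. finite J \<and> J \<subseteq> S \<and> u = (\<lambda>l. \<Sum>j\<in>J. q j * unit_char j l)}"

lemma trig_sumsI:
  "finite J \<Longrightarrow> J \<subseteq> S \<Longrightarrow> (\<lambda>l. \<Sum>j\<in>J. q j * unit_char j l) \<in> trig_sums S"
  unfolding trig_sums_def by blast

lemma trig_sums_cases:
  assumes "u \<in> trig_sums S"
  obtains J q where "finite J" "J \<subseteq> S" "u = (\<lambda>l. \<Sum>j\<in>J. q j * unit_char j l)"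
  using assms unfolding trig_sums_def by blast

lemma trig_sums_zero: "(\<lambda>l. 0) \<in> trig_sums S"
  using trig_sumsI[of "{}" S] by simp

lemma trig_sums_unit_char: "j \<in> S \<Longrightarrow> unit_char j \<in> trig_sums S"
  using trig_sumsI[of "{j}" S "\<lambda>_. 1"] by (simp add: eta_contract_eq)

lemma trig_sums_cmult:
  assumes "u \<in> trig_sums S"
  shows "(\<lambda>l. c * u l) \<in> trig_sums S"
proof -
  obtain J q where J: "finite J" "J \<subseteq> S" "u = (\<lambda>l. \<Sum>j\<in>J. q j * unit_char j l)"
    using assms by (rule trig_sums_cases)
  then have "(\<lambda>l. c * u l) = (\<lambda>l. \<Sum>j\<in>J. (c * q j) * unit_char j l)"
    by (simp add: sum_distrib_left mult.assoc)
  with trig_sumsI[OF J(1,2)] show ?thesis by simp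
qed

lemma trig_sums_add:
  assumes "u \<in> trig_sums S" "v \<in> trig_sums S"
  shows "(\<lambda>l. u l + v l) \<in> trig_sums S"
proof -
  obtain J q where J: "finite J" "J \<subseteq> S" "u = (\<lambda>l. \<Sum>j\<in>J. q j * unit_char j l)"
    using assms(1) by (rule trig_sums_cases)
  obtain I p where I: "finite I" "I \<subseteq> S" "v = (\<lambda>l. \<Sum>j\<in>I. p j * unit_char j l)"
    using assms(2) by (rule trig_sums_cases)
  have "u = (\<lambda>l. \<Sum>j\<in>J \<union> I. (if j \<in> J then q j else 0) * unit_char j l)"
    unfolding J(3) by (intro ext sum.mono_neutral_cong_left) (use J I in auto)
  moreover have "v = (\<lambda>l. \<Sum>j\<in>J \<union> I. (if j \<in> I then p j else 0) * unit_char j l)"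
    unfolding I(3) by (intro ext sum.mono_neutral_cong_left) (use J I in auto)
  ultimately have "(\<lambda>l. u l + v l)
      = (\<lambda>l. \<Sum>j\<in>J \<union> I. ((if j \<in> J then q j else 0) + (if j \<in> I then p j else 0)) * unit_char j l)"
    by (simp add: distrib_right sum.distrib)
  with trig_sumsI[of "J \<union> I" S] J I show ?thesis by simp
qed

lemma trig_sums_sum:
  assumes "\<And>i. i \<in> I \<Longrightarrow> u i \<in> trig_sums S"
  shows "(\<lambda>l. \<Sum>i\<in>I. u i l) \<in> trig_sums S"
  using assms by (induction I rule: infinite_finite_induct) (auto intro: trig_sums_add trig_sums_zero)

lemma trig_sums_shift:
  assumes "u \<in> trig_sums S" "\<And>j. j \<in> S \<Longrightarrow> n + j \<in> S'"
  shows "(\<lambda>l. unit_char n l * u l) \<in> trig_sums S'"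
proof -
  obtain J q where J: "finite J" "J \<subseteq> S" "u = (\<lambda>l. \<Sum>j\<in>J. q j * unit_char j l)"
    using assms(1) by (rule trig_sums_cases)
  have "(\<lambda>l. \<Sum>j\<in>J. q j * unit_char (n + j) l) \<in> trig_sums S'"
    by (intro trig_sums_sum trig_sums_cmult trig_sums_unit_char assms) (use J in auto)
  then show ?thesis
    unfolding J(3) by (simp add: sum_distrib_left mult.left_commute unit_char_mult)
qed

lemma trig_sums_measurable:
  assumes "u \<in> trig_sums S" shows "u \<in> borel_measurable borel"
  using assms by (rule trig_sums_cases) auto

lemma trig_sums_bounded:
  assumes "u \<in> trig_sums S" obtains K where "\<And>l. cmod (u l) \<le> K"
proof -
  obtain J q where J: "finite J" "J \<subseteq> S" "u = (\<lambda>l. \<Sum>j\<in>J. q j * unit_char j l)"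
    using assms by (rule trig_sums_cases)
  show thesis
  proof (rule that)
    show "cmod (u l) \<le> (\<Sum>j\<in>J. cmod (q j))" for l
      unfolding J(3) by (rule order_trans[OF norm_sum]) (simp add: norm_mult)
  qed
qed

text \<open>A difference \<open>j\<close> arises from \<open>N + 1 - |j|\<close> pairs, the origin
  of the triangular Fejer weights. Passing to \<open>Suc N\<close> adds a row, a column and a
  corner, in which every difference of modulus at most \<open>Suc N\<close> occurs exactly
  once.\<close>

lemma sum_of_differences:
  fixes G :: "int \<Rightarrow> complex"
  shows "(\<Sum>k\<le>N. \<Sum>m\<le>N. G (int k - int m))
    = (\<Sum>j\<in>{- int N..int N}. of_real (real N + 1 - \<bar>of_int j\<bar>) * G j)"
proof (induction N)
  case 0
  then show ?case by simp
next
  case (Suc N)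
  have ends: "{- int (Suc N)..int (Suc N)} = insert (- int (Suc N)) (insert (int (Suc N)) {- int N..int N})" for N
    by auto
  have symm: "(\<Sum>j\<in>{- int n..int n}. G j) = G 0 + (\<Sum>k<n. G (int k + 1)) + (\<Sum>k<n. G (- 1 - int k))" for n
  proof (induction n)
    case (Suc n)
    have "(\<Sum>j\<in>{- int (Suc n)..int (Suc n)}. G j)
        = G (- int (Suc n)) + (G (int (Suc n)) + (\<Sum>j\<in>{- int n..int n}. G j))"
      unfolding ends by (subst sum.insert, simp, simp)+ simp
    moreover have "- int (Suc n) = - int n - 1" "int (Suc n) = int n + 1" by simp_all
    ultimately show ?case using Suc.IH by (simp add: algebra_simps)
  qed simp
  have rev1: "(\<Sum>m\<le>N. G (int (Suc N) - int m)) = (\<Sum>k<Suc N. G (int k + 1))"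
    by (subst lessThan_Suc_atMost[symmetric], subst sum.nat_diff_reindex[symmetric])
      (auto intro!: sum.cong arg_cong[where f = G])
  have rev2: "(\<Sum>k\<le>N. G (int k - int (Suc N))) = (\<Sum>k<Suc N. G (- 1 - int k))"
    by (subst lessThan_Suc_atMost[symmetric], subst sum.nat_diff_reindex[symmetric])
      (auto intro!: sum.cong arg_cong[where f = G])
  have "(\<Sum>k\<le>Suc N. \<Sum>m\<le>Suc N. G (int k - int m))
      = (\<Sum>k\<le>N. \<Sum>m\<le>N. G (int k - int m)) + (\<Sum>k\<le>N. G (int k - int (Suc N)))
        + (\<Sum>m\<le>N. G (int (Suc N) - int m)) + G 0"
    by (simp add: sum.distrib)
  also have "\<dots> = (\<Sum>j\<in>{- int N..int N}. of_real (real N + 1 - \<bar>of_int j\<bar>) * G j) + (\<Sum>j\<in>{- int (Suc N)..int (Suc N)}. G j)"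
    unfolding Suc.IH rev1 rev2 symm[of "Suc N"] by simp
  also have "\<dots> = (\<Sum>j\<in>{- int (Suc N)..int (Suc N)}. of_real (real (Suc N) + 1 - \<bar>of_int j\<bar>) * G j)"
    unfolding ends by (simp add: sum.distrib[symmetric] algebra_simps)
  finally show ?case .
qed

definition fejer_mean :: "nat \<Rightarrow> (real \<Rightarrow> complex) \<Rightarrow> real \<Rightarrow> complex" where
  "fejer_mean N v l = (\<Sum>j\<in>{- int N..int N}.
     (of_real (1 - \<bar>of_int j\<bar> / (real N + 1)) * fourier_coeff v j) * unit_char j l)"

lemma fejer_mean_double_sum:
  "of_nat (Suc N) * fejer_mean N v l
    = (\<Sum>k\<le>N. \<Sum>m\<le>N. fourier_coeff v (int k - int m) * unit_char (int k - int m) l)"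
proof -
  have real: "real (Suc N) * (1 - x / (real N + 1)) = real N + 1 - x" for x :: real
    by (simp add: field_simps)
  have "of_nat (Suc N) * (of_real (1 - \<bar>of_int j\<bar> / (real N + 1)) * c * e)
      = of_real (real N + 1 - \<bar>of_int j\<bar>) * (c * e)" for j :: int and c e :: complex
    unfolding real[symmetric] of_real_mult of_real_of_nat_eq by (simp only: mult.assoc)
  then show ?thesis
    unfolding sum_of_differences[of "\<lambda>j. fourier_coeff v j * unit_char j l" N] fejer_mean_def sum_distrib_left
    by (intro sum.cong) auto
qed

text \<open>The right side exhibits the positivity of Fejer's kernel, here still multiplied by
  \<open>N + 1\<close>.\<close>

lemma fejer_kernel:
  "(\<Sum>k\<le>N. \<Sum>m\<le>N. unit_char (int m - int k) t * unit_char (int k - int m) l)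
    = of_real ((cmod (\<Sum>k\<le>N. unit_char (int k) l * unit_char (- int k) t))\<^sup>2)"
proof -
  have "unit_char (int m - int k) t * unit_char (int k - int m) l
      = (unit_char (int k) l * unit_char (- int k) t) * cnj (unit_char (int m) l * unit_char (- int m) t)" for k m
  proof -
    have "unit_char (int m - int k) t = unit_char (int m) t * unit_char (- int k) t"
      "unit_char (int k - int m) l = unit_char (int k) l * unit_char (- int m) l"
      by (simp_all add: unit_char_mult)
    then show ?thesis by (simp add: mult_ac)
  qed
  then show ?thesis
    unfolding complex_norm_square cnj_sum sum_product by simp
qed

text \<open>Averaging against a positive kernel of total mass 1 cannot exceed an essential bound.
  The conclusion holds at every point although the bound on \<open>v\<close> holds almost
  everywhere.\<close>

lemma fejer_mean_bound:
  assumes v: "integrable circle v" and K: "AE l in circle. cmod (v l) \<le> K"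
  shows "cmod (fejer_mean N v l) \<le> K"
proof -
  define D where "D t = (cmod (\<Sum>k\<le>N. unit_char (int k) l * unit_char (- int k) t))\<^sup>2" for t
  have rep: "of_nat (Suc N) * fejer_mean N u l = (\<integral>t. of_real (D t) * u t \<partial>circle) / (2 * pi)"
    if u: "integrable circle u" for u
  proof -
    define E where "E k m t = unit_char (int m - int k) t * unit_char (int k - int m) l" for k m t
    have E: "E k m t * u t = unit_char (int k - int m) l * (unit_char (int m - int k) t * u t)" for k m t
      by (simp add: E_def mult_ac)
    have Ei: "integrable circle (\<lambda>t. E k m t * u t)" for k m
      unfolding E by (intro integrable_mult_right integrable_unit_char_mult u)
    have EI: "(\<integral>t. E k m t * u t \<partial>circle) / (2 * pi)
        = fourier_coeff u (int k - int m) * unit_char (int k - int m) l" for k m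
      unfolding E fourier_coeff_def integral_mult_right_zero by simp
    have "of_nat (Suc N) * fejer_mean N u l = (\<Sum>k\<le>N. \<Sum>m\<le>N. \<integral>t. E k m t * u t \<partial>circle) / (2 * pi)"
      unfolding fejer_mean_double_sum sum_divide_distrib EI ..
    also have "(\<Sum>k\<le>N. \<Sum>m\<le>N. \<integral>t. E k m t * u t \<partial>circle) = (\<integral>t. (\<Sum>k\<le>N. \<Sum>m\<le>N. E k m t) * u t \<partial>circle)"
      using Ei by (simp add: sum_distrib_right)
    also have "(\<lambda>t. (\<Sum>k\<le>N. \<Sum>m\<le>N. E k m t)) = (\<lambda>t. of_real (D t))"
      unfolding E_def fejer_kernel D_def ..
    finally show ?thesis .
  qed
  have Dm: "D \<in> borel_measurable circle" unfolding D_def by measurable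
  have Dint: "integrable circle D"
  proof -
    have "square_integrable circle (\<lambda>t. \<Sum>k\<le>N. unit_char (int k) l * unit_char (- int k) t)"
      by (intro square_integrable_sum square_integrable_cmult square_integrable_unit_char)
    then show ?thesis by (simp add: square_integrable_def D_def[abs_def])
  qed
  \<comment> \<open>The mass is read off from the representation \<open>rep\<close> itself, applied
    to the constant 1, whose Fejer means are all 1.\<close>
  have mass: "(\<integral>t. D t \<partial>circle) = 2 * pi * real (Suc N)"
  proof -
    have fc1: "fourier_coeff (\<lambda>_. 1) j = (if j = 0 then 1 else 0)" for j
      by (simp add: fourier_coeff_def integral_unit_char)
    have "fejer_mean N (\<lambda>_. 1) l = (\<Sum>j\<in>{- int N..int N}. if j = 0 then 1 else 0)"
      unfolding fejer_mean_def fc1 by (intro sum.cong) auto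
    then have "fejer_mean N (\<lambda>_. 1) l = 1" by simp
    with rep[OF integrable_circle_const[of 1]]
    have "complex_of_real (\<integral>t. D t \<partial>circle) = of_real (2 * pi * real (Suc N))"
      by (simp add: field_simps)
    then show ?thesis by (simp only: of_real_eq_iff)
  qed
  have "real (Suc N) * cmod (fejer_mean N v l) = cmod (of_nat (Suc N) * fejer_mean N v l)"
    by (simp only: norm_mult norm_of_nat)
  also have "\<dots> = cmod (\<integral>t. of_real (D t) * v t \<partial>circle) / (2 * pi)"
    unfolding rep[OF v] by (simp add: norm_divide)
  also have "\<dots> \<le> (\<integral>t. D t * K \<partial>circle) / (2 * pi)"
  proof (intro divide_right_mono order_trans[OF integral_norm_bound integral_mono_AE'])
    show "integrable circle (\<lambda>t. D t * K)" using Dint by simp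
    show "AE t in circle. cmod (of_real (D t) * v t) \<le> D t * K"
      using K
    proof eventually_elim
      case (elim t)
      have "0 \<le> D t" by (simp add: D_def)
      with elim show ?case by (simp only: norm_mult norm_of_real abs_of_nonneg mult_left_mono)
    qed
    show "AE t in circle. 0 \<le> D t * K"
      using K
    proof eventually_elim
      case (elim t)
      have "0 \<le> D t" "0 \<le> K" using order_trans[OF norm_ge_zero elim] by (auto simp: D_def)
      then show ?case by simp
    qed
  qed (auto)
  also have "\<dots> = real (Suc N) * K"
    by (simp add: mass del: of_nat_Suc)
  finally show ?thesis
    by (simp del: of_nat_Suc)
qed

text \<open>The residual of projecting \<open>v\<close> onto all trigonometric sums is orthogonal to
  every character, hence null by uniqueness of Fourier coefficients.\<close>

lemma trig_sums_dense:
  assumes v: "square_integrable circle v" and e: "0 < e"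
  obtains J q where "finite J" "(\<integral>l. (cmod (v l - (\<Sum>j\<in>J. q j * unit_char j l)))\<^sup>2 \<partial>circle) < e"
proof -
  have sq: "square_integrable circle s" if "s \<in> trig_sums UNIV" for s
    using that by (rule trig_sums_cases)
      (auto intro!: square_integrable_sum square_integrable_cmult square_integrable_unit_char)
  obtain P \<psi> where P: "\<And>k::nat. P k \<in> trig_sums UNIV" and \<psi>: "square_integrable circle \<psi>"
    and lim: "(\<lambda>k. \<integral>l. (cmod (v l - P k l - \<psi> l))\<^sup>2 \<partial>circle) \<longlonglongrightarrow> 0"
    and orth: "\<And>s. s \<in> trig_sums UNIV \<Longrightarrow> (\<integral>l. \<psi> l * cnj (s l) \<partial>circle) = 0"
    using square_integrable_projection[OF sq trig_sums_zero trig_sums_add trig_sums_cmult v] by blast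
  have "AE l in circle. \<psi> l = 0"
  proof (rule fourier_uniqueness)
    show "integrable circle \<psi>"
      by (rule square_integrable_integrable[OF finite_measure_circle \<psi>])
    fix j
    show "(\<integral>l. unit_char j l * \<psi> l \<partial>circle) = 0"
      using orth[OF trig_sums_unit_char, of "- j"] by (simp add: mult.commute)
  qed
  then have "(\<integral>l. (cmod (v l - P k l - \<psi> l))\<^sup>2 \<partial>circle) = (\<integral>l. (cmod (v l - P k l))\<^sup>2 \<partial>circle)" for k
    using square_integrable_diff[OF v sq[OF P, of k]] \<psi>
    by (intro integral_cong_AE) (auto simp: square_integrable_def elim!: eventually_mono)
  with lim have "\<forall>\<^sub>F k in sequentially. (\<integral>l. (cmod (v l - P k l))\<^sup>2 \<partial>circle) < e"
    using e by (auto dest: order_tendstoD)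
  then obtain k where k: "(\<integral>l. (cmod (v l - P k l))\<^sup>2 \<partial>circle) < e"
    by (auto simp: eventually_sequentially)
  obtain J q where "finite J" "P k = (\<lambda>l. \<Sum>j\<in>J. q j * unit_char j l)"
    using P[of k] by (rule trig_sums_cases)
  with k that show thesis by simp
qed

text \<open>The exact error formula reduces this to coefficients. Up to a fixed cutoff
  \<open>m\<close> the Fejer factors miss 1 by at most \<open>m / (N + 1)\<close>; beyond it the
  coefficient mass is already small by density. Frequencies between \<open>m\<close> and
  \<open>N\<close> enter with the favourable sign and are dropped.\<close>

lemma fejer_mean_tendsto:
  assumes v: "square_integrable circle v"
  shows "(\<lambda>N. \<integral>l. (cmod (v l - fejer_mean N v l))\<^sup>2 \<partial>circle) \<longlonglongrightarrow> 0"
proof (rule LIMSEQ_I)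
  fix e :: real assume e: "0 < e"
  define V where "V = (\<integral>l. (cmod (v l))\<^sup>2 \<partial>circle)"
  define c where "c j = (cmod (fourier_coeff v j))\<^sup>2" for j
  have c0: "0 \<le> c j" for j by (simp add: c_def)
  have V: "0 \<le> V" by (simp add: V_def)
  obtain J q where J: "finite J"
    and Je: "(\<integral>l. (cmod (v l - (\<Sum>j\<in>J. q j * unit_char j l)))\<^sup>2 \<partial>circle) < e / 2"
    using trig_sums_dense[OF v, of "e / 2"] e by auto
  obtain m where m: "J \<subseteq> {- int m..int m}"
  proof -
    have "bdd_above ((\<lambda>j. \<bar>j\<bar>) ` J)" using J by simp
    then obtain b where "\<And>j. j \<in> J \<Longrightarrow> \<bar>j\<bar> \<le> b" by (auto simp: bdd_above_def)
    then have "J \<subseteq> {- int (nat b)..int (nat b)}" by fastforce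
    then show thesis by (rule that)
  qed
  have "V - 2 * pi * (\<Sum>j\<in>J. c j) < e / 2"
  proof -
    have "0 \<le> 2 * pi * (\<Sum>j\<in>J. (cmod (q j - fourier_coeff v j))\<^sup>2)"
      by (intro mult_nonneg_nonneg sum_nonneg) auto
    then show ?thesis
      using Je unfolding trig_sum_norm_diff[OF v J] V_def c_def by linarith
  qed
  moreover have "2 * pi * (\<Sum>j\<in>J. c j) \<le> 2 * pi * (\<Sum>j\<in>{- int m..int m}. c j)"
    using m c0 by (intro mult_left_mono sum_mono2) auto
  ultimately have tail: "V - 2 * pi * (\<Sum>j\<in>{- int m..int m}. c j) < e / 2"
    by linarith
  have "(\<lambda>N. (real m / (real N + 1))\<^sup>2 * V) \<longlonglongrightarrow> 0\<^sup>2 * V"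
    using LIMSEQ_Suc[OF lim_const_over_n[of "real m"]]
    by (intro tendsto_intros) (simp add: add.commute)
  then have "\<forall>\<^sub>F N in sequentially. (real m / (real N + 1))\<^sup>2 * V < e / 2"
    using e by (auto dest!: order_tendstoD(2)[where a = "e / 2"])
  moreover have "\<forall>\<^sub>F N in sequentially. m \<le> N" by (rule eventually_ge_at_top)
  ultimately have "\<forall>\<^sub>F N in sequentially. (\<integral>l. (cmod (v l - fejer_mean N v l))\<^sup>2 \<partial>circle) < e"
  proof eventually_elim
    case (elim N)
    have "(cmod (of_real (1 - \<bar>of_int j\<bar> / (real N + 1)) * fourier_coeff v j - fourier_coeff v j))\<^sup>2
        = (\<bar>of_int j\<bar> / (real N + 1))\<^sup>2 * c j" for j
    proof -
      have "of_real (1 - \<bar>of_int j\<bar> / (real N + 1)) * fourier_coeff v j - fourier_coeff v j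
        = of_real (- (\<bar>of_int j\<bar> / (real N + 1))) * fourier_coeff v j"
        by (simp only: of_real_diff of_real_minus) (simp add: algebra_simps)
      then show ?thesis
        by (simp only: norm_mult norm_of_real power_mult_distrib) (simp add: c_def)
    qed
    then have "(\<integral>l. (cmod (v l - fejer_mean N v l))\<^sup>2 \<partial>circle)
        = V - 2 * pi * (\<Sum>j\<in>{- int N..int N}. c j)
          + 2 * pi * (\<Sum>j\<in>{- int N..int N}. (\<bar>of_int j\<bar> / (real N + 1))\<^sup>2 * c j)"
      unfolding fejer_mean_def trig_sum_norm_diff[OF v finite_atLeastAtMost_int] V_def c_def by simp
    also have "\<dots> = V - 2 * pi * (\<Sum>j\<in>{- int N..int N}. (1 - (\<bar>of_int j\<bar> / (real N + 1))\<^sup>2) * c j)"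
      by (simp add: left_diff_distrib sum_subtractf right_diff_distrib)
    also have "\<dots> \<le> V - 2 * pi * (\<Sum>j\<in>{- int m..int m}. (1 - (real m / (real N + 1))\<^sup>2) * c j)"
    proof -
      have "(\<Sum>j\<in>{- int m..int m}. (1 - (real m / (real N + 1))\<^sup>2) * c j)
          \<le> (\<Sum>j\<in>{- int m..int m}. (1 - (\<bar>of_int j\<bar> / (real N + 1))\<^sup>2) * c j)"
        by (intro sum_mono mult_right_mono c0 diff_left_mono power_mono divide_right_mono) auto
      also have "\<dots> \<le> (\<Sum>j\<in>{- int N..int N}. (1 - (\<bar>of_int j\<bar> / (real N + 1))\<^sup>2) * c j)"
      proof (intro sum_mono2 mult_nonneg_nonneg c0)
        fix j assume "j \<in> {- int N..int N} - {- int m..int m}"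
        then have "\<bar>of_int j\<bar> / (real N + 1) \<le> 1" by (auto simp: field_simps)
        then show "0 \<le> 1 - (\<bar>of_int j\<bar> / (real N + 1))\<^sup>2"
          by (simp add: power_le_one)
      qed (use elim in auto)
      finally show ?thesis by simp
    qed
    also have "\<dots> = (V - 2 * pi * (\<Sum>j\<in>{- int m..int m}. c j))
        + (real m / (real N + 1))\<^sup>2 * (2 * pi * (\<Sum>j\<in>{- int m..int m}. c j))"
      unfolding sum_distrib_left[symmetric] by (simp add: algebra_simps)
    also have "\<dots> \<le> (V - 2 * pi * (\<Sum>j\<in>{- int m..int m}. c j)) + (real m / (real N + 1))\<^sup>2 * V"
      using bessel[OF v, of "{- int m..int m}"]
      by (intro add_left_mono mult_left_mono) (auto simp: V_def c_def)
    finally show ?case using tail elim by linarith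
  qed
  then show "\<exists>no. \<forall>N\<ge>no. norm ((\<integral>l. (cmod (v l - fejer_mean N v l))\<^sup>2 \<partial>circle) - 0) < e"
    by (simp add: eventually_sequentially)
qed

section \<open>Szegoe's extremal problem\<close>

lemma integral_trig_sum_negative:
  assumes "s \<in> trig_sums {..-1}"
  shows "(\<integral>l. s l \<partial>circle) = 0"
proof -
  obtain J q where J: "finite J" "J \<subseteq> {..-1}" "s = (\<lambda>l. \<Sum>j\<in>J. q j * unit_char j l)"
    using assms by (rule trig_sums_cases)
  then have "(\<integral>l. s l \<partial>circle) = (\<Sum>j\<in>J. q j * (\<integral>l. unit_char j l \<partial>circle))"
    using integrable_unit_char by simp
  also have "\<dots> = 0"
    using J(2) by (intro sum.neutral) (auto simp: integral_unit_char)
  finally show ?thesis .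
qed

text \<open>Szegoe's argument: the residual \<open>\<psi>\<close> of projecting \<open>1\<close> onto the span of \<open>e\<^sup>i\<^sup>j\<^sup>\<lambda>\<close>, \<open>j < 0\<close>,
  in \<open>L\<^sup>2(w)\<close> is orthogonal to \<open>e\<^sup>i\<^sup>n\<^sup>\<lambda> \<psi>\<close> for \<open>n < 0\<close>, so all nonzero Fourier coefficients of
  \<open>w \<bar>\<psi>\<bar>\<^sup>2\<close> vanish.\<close>

lemma szego_outer_function:
  fixes w :: "real \<Rightarrow> real"
  assumes w: "integrable circle w" and w1: "\<And>l. 1 \<le> w l"
  obtains \<psi> P c where "\<And>k::nat. P k \<in> trig_sums {..0}" "\<psi> \<in> borel_measurable circle"
    "\<And>k. integrable circle (\<lambda>l. w l * (cmod (P k l - \<psi> l))\<^sup>2)"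
    "(\<lambda>k. \<integral>l. w l * (cmod (P k l - \<psi> l))\<^sup>2 \<partial>circle) \<longlonglongrightarrow> 0"
    "AE l in circle. w l * (cmod (\<psi> l))\<^sup>2 = c" "0 \<le> c" "2 * pi * c \<le> (\<integral>l. w l \<partial>circle)"
    "(\<integral>l. \<psi> l \<partial>circle) = 2 * pi"
proof -
  \<comment> \<open>With \<open>w\<close> absorbed into the measure, the weighted space is an
    ordinary space of square-integrable functions, so the projection lemma applies to it.\<close>
  define \<mu> where "\<mu> = density circle w"
  have wm [measurable]: "w \<in> borel_measurable circle" using w by simp
  have w0: "0 \<le> w l" for l using w1[of l] by simp
  have sets_\<mu>: "borel_measurable \<mu> = borel_measurable circle"
    by (rule measurable_cong_sets) (simp_all add: \<mu>_def)
  have sq: "square_integrable \<mu> u \<longleftrightarrow> u \<in> borel_measurable circle \<and> integrable circle (\<lambda>l. w l * (cmod (u l))\<^sup>2)" for u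
  proof (cases "u \<in> borel_measurable circle")
    case True
    then have [measurable]: "u \<in> borel_measurable circle" .
    have "(\<lambda>l. (cmod (u l))\<^sup>2) \<in> borel_measurable circle" by measurable
    then show ?thesis
      unfolding square_integrable_def sets_\<mu> using True w0
      unfolding \<mu>_def by (subst integrable_density) auto
  next
    case False
    then show ?thesis by (simp add: square_integrable_def sets_\<mu>)
  qed
  have nrm: "(\<integral>l. (cmod (u l))\<^sup>2 \<partial>\<mu>) = (\<integral>l. w l * (cmod (u l))\<^sup>2 \<partial>circle)" if "u \<in> borel_measurable circle" for u
    using that w0 unfolding \<mu>_def by (subst integral_density) auto
  have inner: "(\<integral>l. u l * cnj (v l) \<partial>\<mu>) = (\<integral>l. of_real (w l) * (u l * cnj (v l)) \<partial>circle)"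
    if [measurable]: "u \<in> borel_measurable circle" "v \<in> borel_measurable circle" for u v
  proof -
    have "(\<lambda>l. u l * cnj (v l)) \<in> borel_measurable circle" by measurable
    then show ?thesis
      using w0 unfolding \<mu>_def by (subst integral_density) (auto simp: scaleR_conv_of_real)
  qed
  have sq_bounded: "square_integrable \<mu> u" if [measurable]: "u \<in> borel_measurable circle" and K: "\<And>l. cmod (u l) \<le> K" for u K
  proof -
    have "integrable circle (\<lambda>l. w l * (cmod (u l))\<^sup>2)"
    proof (rule Bochner_Integration.integrable_bound)
      show "integrable circle (\<lambda>l. w l * K\<^sup>2)" using w by simp
      show "AE l in circle. norm (w l * (cmod (u l))\<^sup>2) \<le> norm (w l * K\<^sup>2)"
        using w0 K by (auto simp: abs_mult intro!: mult_left_mono power_mono)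
    qed measurable
    then show ?thesis by (simp add: sq)
  qed
  have trig: "square_integrable \<mu> s" if "s \<in> trig_sums A" for s A
    using trig_sums_bounded[OF that] borel_measurable_circle[OF trig_sums_measurable[OF that]] sq_bounded
    by metis
  have one: "square_integrable \<mu> (\<lambda>l. 1)"
    by (rule sq_bounded[of _ 1]) auto
  obtain Q \<psi> where Q: "\<And>k::nat. Q k \<in> trig_sums {..-1}" and \<psi>: "square_integrable \<mu> \<psi>"
    and lim0: "(\<lambda>k. \<integral>l. (cmod (1 - Q k l - \<psi> l))\<^sup>2 \<partial>\<mu>) \<longlonglongrightarrow> 0"
    and orth: "\<And>s. s \<in> trig_sums {..-1} \<Longrightarrow> (\<integral>l. \<psi> l * cnj (s l) \<partial>\<mu>) = 0"
    by (rule square_integrable_projection[of "trig_sums {..-1}" \<mu> "\<lambda>l. 1"])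
      (auto intro: trig trig_sums_zero trig_sums_add trig_sums_cmult one)
  \<comment> \<open>The residuals are antianalytic sums with constant term 1, so
    \<open>\<psi>\<close> is a limit of such sums; this gives both its antianalyticity and its
    mean.\<close>
  define P where "P k l = 1 - Q k l" for k l
  have \<psi>m [measurable]: "\<psi> \<in> borel_measurable circle" using \<psi> by (simp add: sq)
  have P: "P k \<in> trig_sums {..0}" for k
  proof -
    have "Q k \<in> trig_sums {..0}"
      using trig_sums_shift[OF Q, of 0 "{..0}"] by (simp add: eta_contract_eq)
    moreover have "(\<lambda>l. 1) \<in> trig_sums {..0}"
      using trig_sums_unit_char[of 0 "{..0}"] by (simp add: unit_char_def[abs_def])
    ultimately have "(\<lambda>l. 1 + (-1) * Q k l) \<in> trig_sums {..0}"
      by (intro trig_sums_add trig_sums_cmult)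
    then show ?thesis by (simp add: P_def[abs_def])
  qed
  have Pm [measurable]: "P k \<in> borel_measurable circle" for k
    using borel_measurable_circle[OF trig_sums_measurable[OF P]] .
  have P\<psi>: "square_integrable \<mu> (\<lambda>l. P k l - \<psi> l)" for k
    by (intro square_integrable_diff trig[OF P] \<psi>)
  have lim: "(\<lambda>k. \<integral>l. (cmod (P k l - \<psi> l))\<^sup>2 \<partial>\<mu>) \<longlonglongrightarrow> 0"
    using lim0 by (simp add: P_def)
  have lim_c: "(\<lambda>k. \<integral>l. w l * (cmod (P k l - \<psi> l))\<^sup>2 \<partial>circle) \<longlonglongrightarrow> 0"
    using lim by (simp add: nrm)
  have int_c: "integrable circle (\<lambda>l. w l * (cmod (P k l - \<psi> l))\<^sup>2)" for k
    using P\<psi>[of k] by (simp add: sq)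
  define u where "u l = complex_of_real (w l * (cmod (\<psi> l))\<^sup>2)" for l
  have u_eq: "u l = of_real (w l) * (\<psi> l * cnj (\<psi> l))" for l
    by (simp only: u_def of_real_mult complex_norm_square)
  have ui: "integrable circle u"
    using \<psi> unfolding u_def by (simp add: sq del: of_real_mult of_real_power)
  \<comment> \<open>Multiplication by \<open>unit_char n\<close> with negative \<open>n\<close>
    moves all frequencies of \<open>P k\<close> into the negative ones, to which
    \<open>\<psi>\<close> is orthogonal. The limit in \<open>k\<close> turns this into a coefficient
    of \<open>u\<close>.\<close>
  have neg: "(\<integral>l. unit_char n l * u l \<partial>circle) = 0" if n: "n \<le> -1" for n
  proof -
    have eP: "(\<lambda>l. unit_char n l * P k l) \<in> trig_sums {..-1}" for k
      by (rule trig_sums_shift[OF P]) (use n in auto)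
    have e\<psi>: "square_integrable \<mu> (\<lambda>l. unit_char n l * \<psi> l)"
      using \<psi> unfolding sq by (auto simp: norm_mult)
    have "(\<lambda>k. \<integral>l. (unit_char n l * P k l) * cnj (\<psi> l) \<partial>\<mu>) \<longlonglongrightarrow> (\<integral>l. (unit_char n l * \<psi> l) * cnj (\<psi> l) \<partial>\<mu>)"
    proof (rule square_integrable_inner_tendsto[OF trig[OF eP] e\<psi> \<psi>])
      show "(\<lambda>k. \<integral>l. (cmod (unit_char n l * P k l - unit_char n l * \<psi> l))\<^sup>2 \<partial>\<mu>) \<longlonglongrightarrow> 0"
        using lim by (simp add: norm_mult flip: right_diff_distrib)
    qed
    moreover have "(\<integral>l. (unit_char n l * P k l) * cnj (\<psi> l) \<partial>\<mu>) = 0" for k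
    proof -
      have "(\<integral>l. (unit_char n l * P k l) * cnj (\<psi> l) \<partial>\<mu>) = cnj (\<integral>l. \<psi> l * cnj (unit_char n l * P k l) \<partial>\<mu>)"
        by (subst Bochner_Integration.integral_cnj[symmetric]) (simp add: mult_ac)
      then show ?thesis using orth[OF eP] by simp
    qed
    ultimately have "(\<integral>l. (unit_char n l * \<psi> l) * cnj (\<psi> l) \<partial>\<mu>) = 0"
      by (simp add: LIMSEQ_const_iff)
    then show ?thesis
      by (subst (asm) inner) (auto simp: u_eq mult_ac)
  qed
  \<comment> \<open>\<open>u\<close> is real-valued, so its coefficients at opposite indices are
    conjugate.\<close>
  have nonzero: "(\<integral>l. unit_char n l * u l \<partial>circle) = 0" if "n \<noteq> 0" for n
  proof (cases "n \<le> -1")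
    case False
    with that have "- n \<le> -1" by simp
    from neg[OF this] have "(\<integral>l. cnj (unit_char n l * u l) \<partial>circle) = 0"
      by (simp add: u_def)
    then show ?thesis by (subst (asm) Bochner_Integration.integral_cnj) simp
  qed (rule neg)
  define c where "c = (\<integral>l. w l * (cmod (\<psi> l))\<^sup>2 \<partial>circle) / (2 * pi)"
  have u_int: "(\<integral>l. u l \<partial>circle) = of_real (2 * pi * c)"
    unfolding u_def integral_complex_of_real c_def by simp
  have "AE l in circle. u l - of_real c = 0"
  proof (rule fourier_uniqueness)
    show "integrable circle (\<lambda>l. u l - of_real c)"
      using ui by simp
    fix n
    have "(\<integral>l. unit_char n l * (u l - of_real c) \<partial>circle)
        = (\<integral>l. unit_char n l * u l \<partial>circle) - of_real c * (\<integral>l. unit_char n l \<partial>circle)"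
      using integrable_unit_char_mult[OF ui] integrable_unit_char
      by (simp add: right_diff_distrib mult.commute[of _ "complex_of_real c"])
    also have "\<dots> = 0"
      using nonzero[of n] u_int by (cases "n = 0") (auto simp: integral_unit_char scaleR_conv_of_real)
    finally show "(\<integral>l. unit_char n l * (u l - of_real c) \<partial>circle) = 0" .
  qed
  then have const: "AE l in circle. w l * (cmod (\<psi> l))\<^sup>2 = c"
    by eventually_elim (simp add: u_def del: of_real_mult of_real_power)
  have c0: "0 \<le> c" unfolding c_def using w0 by (intro divide_nonneg_nonneg) (auto intro!: Bochner_Integration.integral_nonneg)
  \<comment> \<open>Every \<open>Q k\<close> is orthogonal to \<open>\<psi>\<close>, so pairing
    \<open>\<psi>\<close> with 1 and with itself gives the same number. Cauchy-Schwarz between 1 and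
    \<open>\<psi>\<close> then bounds \<open>2 * pi * c\<close> by the mass of
    \<open>w\<close>.\<close>
  have "(\<integral>l. 1 * cnj (\<psi> l) \<partial>\<mu>) = of_real (2 * pi * c)"
  proof -
    have "(\<lambda>k. \<integral>l. P k l * cnj (\<psi> l) \<partial>\<mu>) \<longlonglongrightarrow> (\<integral>l. \<psi> l * cnj (\<psi> l) \<partial>\<mu>)"
      by (rule square_integrable_inner_tendsto[OF trig[OF P] \<psi> \<psi> lim])
    moreover have "(\<integral>l. P k l * cnj (\<psi> l) \<partial>\<mu>) = (\<integral>l. 1 * cnj (\<psi> l) \<partial>\<mu>)" for k
    proof -
      have "(\<integral>l. Q k l * cnj (\<psi> l) \<partial>\<mu>) = cnj (\<integral>l. \<psi> l * cnj (Q k l) \<partial>\<mu>)"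
        by (subst Bochner_Integration.integral_cnj[symmetric]) (simp add: mult_ac)
      then have "(\<integral>l. Q k l * cnj (\<psi> l) \<partial>\<mu>) = 0" using orth[OF Q] by simp
      then show ?thesis
        unfolding P_def left_diff_distrib
        using square_integrable_mult_cnj[OF one \<psi>] square_integrable_mult_cnj[OF trig[OF Q] \<psi>]
        by simp
    qed
    moreover have "(\<integral>l. \<psi> l * cnj (\<psi> l) \<partial>\<mu>) = of_real (2 * pi * c)"
      unfolding u_int[symmetric] by (subst inner) (auto simp: u_eq[abs_def])
    ultimately show ?thesis by (simp add: LIMSEQ_const_iff)
  qed
  moreover have "(\<integral>l. (cmod (\<psi> l))\<^sup>2 \<partial>\<mu>) = 2 * pi * c"
    by (simp add: nrm c_def)
  moreover have "(\<integral>l. (cmod 1)\<^sup>2 \<partial>\<mu>) = (\<integral>l. w l \<partial>circle)"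
    using nrm[of "\<lambda>_. 1"] by simp
  ultimately have "(cmod (of_real (2 * pi * c)))\<^sup>2 \<le> (\<integral>l. w l \<partial>circle) * (2 * pi * c)"
    using square_integrable_Cauchy_Schwarz[OF one \<psi>] by metis
  then have "(2 * pi * c)\<^sup>2 \<le> (\<integral>l. w l \<partial>circle) * (2 * pi * c)"
    by (simp only: norm_of_real power2_abs)
  then have c1: "2 * pi * c \<le> (\<integral>l. w l \<partial>circle)"
  proof (cases "c = 0")
    case True
    then show ?thesis using w0 by simp
  next
    case False
    with c0 have "0 < 2 * pi * c" by simp
    with \<open>(2 * pi * c)\<^sup>2 \<le> _\<close> show ?thesis
      unfolding power2_eq_square by (rule mult_right_le_imp_le)
  qed
  \<comment> \<open>The lower bound on \<open>w\<close> makes weighted convergence stronger than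
    plain mean-square convergence, which is what the unweighted integral of \<open>\<psi>\<close>
    requires.\<close>
  have le: "(cmod z)\<^sup>2 \<le> w l * (cmod z)\<^sup>2" for z l
    using mult_right_mono[OF w1[of l], of "(cmod z)\<^sup>2"] by simp
  have to_circle: "square_integrable circle u" if "square_integrable \<mu> u" for u
  proof -
    from that have [measurable]: "u \<in> borel_measurable circle" by (simp add: sq)
    have "integrable circle (\<lambda>l. (cmod (u l))\<^sup>2)"
      by (rule Bochner_Integration.integrable_bound[of _ "\<lambda>l. w l * (cmod (u l))\<^sup>2"])
        (use that le w0 in \<open>auto simp: sq abs_mult\<close>)
    then show ?thesis by (simp add: square_integrable_def)
  qed
  have "(\<integral>l. \<psi> l \<partial>circle) = 2 * pi"
  proof -
    have "(\<lambda>k. \<integral>l. (cmod (P k l - \<psi> l))\<^sup>2 \<partial>circle) \<longlonglongrightarrow> 0"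
    proof (rule tendsto_sandwich[OF _ _ tendsto_const lim_c])
      show "\<forall>\<^sub>F k in sequentially. (\<integral>l. (cmod (P k l - \<psi> l))\<^sup>2 \<partial>circle) \<le> (\<integral>l. w l * (cmod (P k l - \<psi> l))\<^sup>2 \<partial>circle)"
        using to_circle[OF P\<psi>] int_c le
        by (intro always_eventually allI integral_mono) (auto simp: square_integrable_def)
    qed auto
    from square_integrable_inner_tendsto[OF to_circle[OF trig[OF P]] to_circle[OF \<psi>] to_circle[OF one] this]
    have "(\<lambda>k. \<integral>l. P k l \<partial>circle) \<longlonglongrightarrow> (\<integral>l. \<psi> l \<partial>circle)" by simp
    moreover have "(\<integral>l. P k l \<partial>circle) = 2 * pi" for k
    proof -
      have "integrable circle (Q k)"
        by (rule square_integrable_integrable[OF finite_measure_circle to_circle[OF trig[OF Q]]])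
      then show ?thesis
        unfolding P_def using integral_trig_sum_negative[OF Q[of k]]
        by (simp add: scaleR_conv_of_real)
    qed
    ultimately show ?thesis by (simp add: LIMSEQ_const_iff)
  qed
  with that[OF P \<psi>m int_c lim_c const c0 c1] show thesis .
qed

section \<open>Positive semidefinite forms\<close>

lemma vdot_add_left: "vdot (x + y) z = vdot x z + vdot y z"
  by (simp add: vdot_def distrib_right sum.distrib)

lemma vdot_add_right: "vdot x (y + z) = vdot x y + vdot x z"
  by (simp add: vdot_def distrib_left sum.distrib)

lemma vdot_diff_left: "vdot (x - y) z = vdot x z - vdot y z"
  by (simp add: vdot_def left_diff_distrib sum_subtractf)

lemma vdot_diff_right: "vdot x (y - z) = vdot x y - vdot x z"
  by (simp add: vdot_def right_diff_distrib sum_subtractf)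

lemma vdot_smult_left: "vdot (c *s x) z = c * vdot x z"
  by (simp add: vdot_def sum_distrib_left mult.assoc)

lemma vdot_smult_right: "vdot x (c *s z) = c * vdot x z"
  by (simp add: vdot_def sum_distrib_left mult.left_commute)

lemma vdot_zero_left [simp]: "vdot 0 z = 0"
  by (simp add: vdot_def)

lemma vdot_zero_right [simp]: "vdot z 0 = 0"
  by (simp add: vdot_def)

lemma vdot_commute: "vdot x y = vdot y x"
  by (simp add: vdot_def mult.commute)

lemma cnj_vdot: "cnj (vdot x y) = vdot (vcnj x) (vcnj y)"
  by (simp add: vdot_def vcnj_def)

lemma vcnj_add: "vcnj (x + y) = vcnj x + vcnj y"
  by (simp add: vcnj_def vec_eq_iff)

lemma vcnj_diff: "vcnj (x - y) = vcnj x - vcnj y"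
  by (simp add: vcnj_def vec_eq_iff)

lemma vcnj_smult: "vcnj (c *s x) = cnj c *s vcnj x"
  by (simp add: vcnj_def vec_eq_iff)

lemma vcnj_zero [simp]: "vcnj 0 = 0"
  by (simp add: vcnj_def vec_eq_iff)

lemma vcnj_vcnj [simp]: "vcnj (vcnj x) = x"
  by (simp add: vcnj_def vec_eq_iff)

lemma vcnj_nth [simp]: "vcnj x $ i = cnj (x $ i)"
  by (simp add: vcnj_def)

lemma vec_mat_nth: "(x v* F) $ j = (\<Sum>i\<in>UNIV. x $ i * F $ i $ j)"
  for F :: "complex^'n^'m"
  by (simp add: vector_matrix_mult_def mult.commute)

lemma vec_mat_add_left: "(x + y) v* F = x v* F + y v* F" for F :: "complex^'n^'m"
  by (simp add: vec_eq_iff vec_mat_nth distrib_right sum.distrib)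

lemma vec_mat_add_right: "x v* (F + G) = x v* F + x v* G" for F :: "complex^'n^'m"
  by (simp add: vec_eq_iff vec_mat_nth distrib_left sum.distrib)

lemma vec_mat_diff_left: "(x - y) v* F = x v* F - y v* F" for F :: "complex^'n^'m"
  by (simp add: vec_eq_iff vec_mat_nth left_diff_distrib sum_subtractf)

lemma vec_mat_smult: "(c *s x) v* F = c *s (x v* F)" for F :: "complex^'n^'m"
  by (simp add: vec_eq_iff vec_mat_nth sum_distrib_left mult.assoc)

lemma vec_mat_assoc: "(x v* F) v* G = x v* (F ** G)" for F :: "complex^'n^'m" and G :: "complex^'k^'n"
proof -
  have "(\<Sum>j\<in>UNIV. (\<Sum>i\<in>UNIV. x $ i * F $ i $ j) * G $ j $ k)
      = (\<Sum>i\<in>UNIV. x $ i * (\<Sum>j\<in>UNIV. F $ i $ j * G $ j $ k))" for k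
    unfolding sum_distrib_left sum_distrib_right mult.assoc by (rule sum.swap)
  then show ?thesis by (simp add: vec_eq_iff vec_mat_nth matrix_matrix_mult_def)
qed

lemma vec_mat_one [simp]: "x v* mat 1 = x" for x :: "complex^'n"
  by (simp add: vec_eq_iff vec_mat_nth mat_def if_distrib cong: if_cong)

lemma vec_mat_axis: "(axis i c v* F) $ j = c * F $ i $ j" for F :: "complex^'n^'m"
  by (simp add: vec_mat_nth axis_def if_distrib[of "\<lambda>x. x * _"] cong: if_cong)

lemma mat_vec_axis: "(F *v axis j c) $ i = F $ i $ j * c" for F :: "complex^'n^'m"
  by (simp add: matrix_vector_mult_def axis_def if_distrib cong: if_cong)

lemma vdot_axis: "vdot x (axis j c) = c * x $ j"
  by (simp add: vdot_def axis_def if_distrib mult.commute cong: if_cong)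

lemma vcnj_axis: "vcnj (axis j c) = axis j (cnj c)"
  by (simp add: vec_eq_iff axis_def)

lemma qform_expand: "qform F b c = (\<Sum>j\<in>UNIV. \<Sum>i\<in>UNIV. b $ i * F $ i $ j * cnj (c $ j))"
  by (simp add: qform_def vdot_def vec_mat_nth sum_distrib_right)

lemma qform_axis: "qform F (axis i 1) (axis j 1) = F $ i $ j"
  by (simp add: qform_def vcnj_axis vdot_axis vec_mat_axis)

lemma qform_axis_right: "qform F b (axis j 1) = (b v* F) $ j"
  by (simp add: qform_def vcnj_axis vdot_axis)

lemma qform_add_left: "qform F (x + y) z = qform F x z + qform F y z"
  by (simp add: qform_def vec_mat_add_left vdot_add_left)

lemma qform_diff_left: "qform F (x - y) z = qform F x z - qform F y z"
  by (simp add: qform_def vec_mat_diff_left vdot_diff_left)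

lemma qform_diff_right: "qform F x (y - z) = qform F x y - qform F x z"
  by (simp add: qform_def vcnj_diff vdot_diff_right)

lemma qform_add_right: "qform F x (y + z) = qform F x y + qform F x z"
  by (simp add: qform_def vcnj_add vdot_add_right)

lemma qform_smult_left: "qform F (c *s x) y = c * qform F x y"
  by (simp add: qform_def vec_mat_smult vdot_smult_left)

lemma qform_smult_right: "qform F x (c *s y) = cnj c * qform F x y"
  by (simp add: qform_def vcnj_smult vdot_smult_right)

lemma qform_zero_left [simp]: "qform F 0 x = 0"
  by (simp add: qform_def)

lemma qform_zero_right [simp]: "qform F x 0 = 0"
  by (simp add: qform_def)

lemma qform_add_mat: "qform (F + G) x y = qform F x y + qform G x y"
  by (simp add: qform_def vec_mat_add_right vdot_add_left)

abbreviation qnorm :: "complex^'t^'t \<Rightarrow> complex^'t \<Rightarrow> real" where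
  "qnorm F b \<equiv> Re (qform F b b)"

lemma qform_cnj:
  assumes "hermitian_psd F"
  shows "qform F c b = cnj (qform F b c)"
proof -
  have F: "cnj (F $ i $ j) = F $ j $ i" for i j
    using assms unfolding hermitian_psd_def by (metis complex_cnj_cnj)
  have "cnj (qform F b c) = (\<Sum>j\<in>UNIV. \<Sum>i\<in>UNIV. c $ j * F $ j $ i * cnj (b $ i))"
    by (simp add: qform_expand F mult_ac)
  also have "\<dots> = qform F c b"
    unfolding qform_expand by (rule sum.swap)
  finally show ?thesis ..
qed

lemma qnorm_nonneg: "hermitian_psd F \<Longrightarrow> 0 \<le> qnorm F b"
  by (simp add: hermitian_psd_def)

lemma qform_eq_qnorm:
  assumes "hermitian_psd F" shows "qform F b b = of_real (qnorm F b)"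
proof -
  have "Im (qform F b b) = Im (cnj (qform F b b))"
    using qform_cnj[OF assms, of b b] by (rule arg_cong)
  then show ?thesis by (simp add: complex_eq_iff)
qed

lemma qnorm_diff:
  assumes "hermitian_psd F"
  shows "qnorm F (b - c) = qnorm F b - 2 * Re (qform F b c) + qnorm F c"
  using qform_cnj[OF assms, of b c] by (simp add: qform_diff_left qform_diff_right)

lemma qnorm_smult: "qnorm F (t *s c) = (cmod t)\<^sup>2 * qnorm F c"
proof -
  have "qform F (t *s c) (t *s c) = of_real ((cmod t)\<^sup>2) * qform F c c"
    unfolding complex_norm_square by (simp add: qform_smult_left qform_smult_right)
  then show ?thesis by (simp del: of_real_power)
qed

lemma qform_Cauchy_Schwarz:
  assumes F: "hermitian_psd F"
  shows "(cmod (qform F b c))\<^sup>2 \<le> qnorm F b * qnorm F c"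
proof -
  define B C H where "B = qnorm F b" and "C = qnorm F c" and "H = qform F b c"
  have C: "0 \<le> C" unfolding C_def by (rule qnorm_nonneg[OF F])
  \<comment> \<open>Subtracting real multiples of \<open>H *s c\<close> leaves a real quadratic
    polynomial in \<open>r\<close>. Its minimum is at \<open>1 / C\<close>; for \<open>C = 0\<close>
    it is linear, and a large \<open>r\<close> makes it negative unless
    \<open>H = 0\<close>.\<close>
  have pos: "0 \<le> B - 2 * r * (cmod H)\<^sup>2 + r\<^sup>2 * (cmod H)\<^sup>2 * C" for r :: real
  proof -
    have "0 \<le> qnorm F (b - (of_real r * H) *s c)" by (rule qnorm_nonneg[OF F])
    also have "\<dots> = B - 2 * Re (cnj (of_real r * H) * H) + (cmod (of_real r * H))\<^sup>2 * C"
      by (simp only: qnorm_diff[OF F] qnorm_smult) (simp add: qform_smult_right B_def C_def H_def)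
    also have "cnj (of_real r * H) * H = of_real (r * (cmod H)\<^sup>2)"
      by (simp only: of_real_mult complex_norm_square) simp
    finally show ?thesis by (simp add: norm_mult power_mult_distrib del: of_real_mult)
  qed
  have "(cmod H)\<^sup>2 \<le> B * C"
  proof (cases "C = 0")
    case True
    have "(cmod H)\<^sup>2 = 0"
    proof (rule ccontr)
      assume "(cmod H)\<^sup>2 \<noteq> 0"
      with pos[of "(B + 1) / (2 * (cmod H)\<^sup>2)"] True show False by (simp add: field_simps)
    qed
    then show ?thesis using True by simp
  next
    case False
    with pos[of "1 / C"] C have "(cmod H)\<^sup>2 / C \<le> B"
      by (simp add: power2_eq_square field_simps)
    with C False show ?thesis by (simp add: field_simps)
  qed
  then show ?thesis by (simp add: B_def C_def H_def)
qed

lemma hermitian_psd_add: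
  assumes "hermitian_psd F" "hermitian_psd G"
  shows "hermitian_psd (F + G)"
proof -
  have "(F + G) $ i $ j = cnj ((F + G) $ j $ i)" for i j
  proof -
    have "F $ i $ j = cnj (F $ j $ i)" "G $ i $ j = cnj (G $ j $ i)"
      using assms unfolding hermitian_psd_def by blast+
    then show ?thesis by (simp only: vector_add_component complex_cnj_add)
  qed
  moreover have "0 \<le> qnorm (F + G) v" for v
    using qnorm_nonneg[OF assms(1), of v] qnorm_nonneg[OF assms(2), of v] by (simp add: qform_add_mat)
  ultimately show ?thesis unfolding hermitian_psd_def by blast
qed

lemma qnorm_add_le:
  assumes F: "hermitian_psd F"
  shows "qnorm F (b + c) \<le> 2 * qnorm F b + 2 * qnorm F c"
proof -
  have "qnorm F (b + c) + qnorm F (b - c) = 2 * qnorm F b + 2 * qnorm F c"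
    by (simp add: qform_add_left qform_add_right qform_diff_left qform_diff_right)
  with qnorm_nonneg[OF F, of "b - c"] show ?thesis by linarith
qed

section \<open>Inverse forms and order relations between forms\<close>

context
  fixes F W :: "complex^'t^'t"
  assumes F: "hermitian_psd F" and FW: "F ** W = mat 1" and WF: "W ** F = mat 1"
begin

text \<open>Right multiplication by \<open>W\<close> carries the form of \<open>W\<close>
  isometrically to the form of \<open>F\<close>. Facts about the inverse form, its positivity among
  them, are pulled back along this map.\<close>

lemma qform_inverse: "qform W v c = qform F (v v* W) (c v* W)"
proof -
  have "qform F (c v* W) (v v* W) = vdot c (vcnj (v v* W))"
    by (simp add: qform_def vec_mat_assoc WF)
  then have "qform F (v v* W) (c v* W) = cnj (vdot c (vcnj (v v* W)))"
    by (simp only: qform_cnj[OF F, of "v v* W" "c v* W"])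
  then show ?thesis
    by (simp add: cnj_vdot qform_def vdot_commute[of "vcnj c"])
qed

lemma hermitian_psd_inverse: "hermitian_psd W"
proof -
  have "W $ i $ j = cnj (W $ j $ i)" for i j
    unfolding qform_axis[of W, symmetric] qform_inverse by (rule qform_cnj[OF F])
  moreover have "0 \<le> qnorm W v" for v
    unfolding qform_inverse by (rule qnorm_nonneg[OF F])
  ultimately show ?thesis unfolding hermitian_psd_def by blast
qed

lemma vdot_qform: "vdot v (vcnj c) = qform F v (c v* W)"
proof -
  have "qform F (c v* W) v = vdot c (vcnj v)"
    by (simp add: qform_def vec_mat_assoc WF)
  then have "qform F v (c v* W) = cnj (vdot c (vcnj v))"
    by (simp only: qform_cnj[OF F, of v "c v* W"])
  then show ?thesis by (simp add: cnj_vdot vdot_commute[of "vcnj c"])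
qed

text \<open>The unweighted product is the \<open>F\<close>-form against \<open>c v* W\<close>, so it
  splits between the two dual norms. Applied pointwise, this makes \<open>L2 F\<close> and
  \<open>L2 W\<close> dual.\<close>

lemma vdot_Cauchy_Schwarz: "(cmod (vdot v (vcnj c)))\<^sup>2 \<le> qnorm F v * qnorm W c"
  unfolding vdot_qform qform_inverse[of c] by (rule qform_Cauchy_Schwarz[OF F])

lemma component_le_qnorm: "(cmod (v $ i))\<^sup>2 \<le> qnorm F v * Re (W $ i $ i)"
  using vdot_Cauchy_Schwarz[of v "axis i 1"]
  by (simp add: vcnj_axis vdot_axis qform_axis)

lemma qnorm_eq_0_imp: "qnorm F v = 0 \<Longrightarrow> v = 0"
  using component_le_qnorm[of v] by (simp add: vec_eq_iff)

context
  fixes f g :: "complex^'t^'t"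
  assumes f: "hermitian_psd f" and g: "hermitian_psd g" and sum: "F = f + g"
begin

text \<open>The left side collapses to the \<open>f\<close>-form of \<open>x\<close> against
  \<open>y v* W\<close>; there \<open>f\<close> is dominated by \<open>F\<close>, and the isometry
  returns the second factor to \<open>W\<close>. The bounds on the entries of \<open>f ** W\<close>
  and \<open>f ** W ** f\<close> rest on this inequality.\<close>

lemma qform_ratio_le: "(cmod (qform W (x v* f) y))\<^sup>2 \<le> qnorm f x * qnorm W y"
proof -
  have "qform W (x v* f) y = qform f x (y v* W)"
    unfolding qform_inverse[of "x v* f"] by (simp only: qform_def vec_mat_assoc[of "x v* f"] WF vec_mat_one)
  then have "(cmod (qform W (x v* f) y))\<^sup>2 \<le> qnorm f x * qnorm f (y v* W)"
    using qform_Cauchy_Schwarz[OF f, of x "y v* W"] by simp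
  also have "\<dots> \<le> qnorm f x * qnorm F (y v* W)"
    using qnorm_nonneg[OF f, of x] qnorm_nonneg[OF g]
    by (intro mult_left_mono) (simp_all add: sum qform_add_mat)
  also have "\<dots> = qnorm f x * qnorm W y"
    by (simp add: qform_inverse)
  finally show ?thesis .
qed

text \<open>Taking \<open>y = x v* f\<close> in \<open>qform_ratio_le\<close> and cancelling one
  factor gives the matrix inequality \<open>f W f \<le> f\<close>.\<close>

lemma qnorm_inverse_le: "qnorm W (x v* f) \<le> qnorm f x"
proof -
  define Q where "Q = qnorm W (x v* f)"
  have Q: "0 \<le> Q" unfolding Q_def by (rule qnorm_nonneg[OF hermitian_psd_inverse])
  have "cmod (qform W (x v* f) (x v* f)) = \<bar>Q\<bar>"
    unfolding Q_def by (subst qform_eq_qnorm[OF hermitian_psd_inverse]) (rule norm_of_real)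
  then have "Q\<^sup>2 \<le> qnorm f x * Q"
    using qform_ratio_le[of x "x v* f"] by (simp add: Q_def)
  then show ?thesis
    unfolding Q_def[symmetric] power2_eq_square using Q qnorm_nonneg[OF f, of x]
    by (cases "Q = 0") (auto intro: mult_right_le_imp_le)
qed

text \<open>Products of integrable functions need not be integrable; this bound by a geometric mean
  of integrable diagonal entries is what makes \<open>f ** W\<close> integrable.\<close>

lemma ratio_component_le: "(cmod ((f ** W) $ i $ j))\<^sup>2 \<le> Re (f $ i $ i) * Re (W $ j $ j)"
proof -
  have "qform W (axis i 1 v* f) (axis j 1) = (f ** W) $ i $ j"
    unfolding qform_axis_right vec_mat_assoc by (simp add: vec_mat_axis)
  with qform_ratio_le[of "axis i 1" "axis j 1"] show ?thesis by (simp add: qform_axis)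
qed

text \<open>This matrix is the parallel sum of \<open>f\<close> and \<open>g\<close>. The right side
  is visibly Hermitian and, by \<open>f W f \<le> f\<close>, dominated by \<open>f\<close>.\<close>

lemma parallel_sum_eq: "f ** W ** g = f - f ** W ** f"
proof -
  have diff: "P ** (Q - R) = P ** Q - P ** R" for P Q R :: "complex^'t^'t"
    by (simp add: vec_eq_iff matrix_matrix_mult_def right_diff_distrib sum_subtractf)
  have "f ** W ** g = f ** (W ** (F - f))"
    by (simp add: sum matrix_mul_assoc)
  also have "\<dots> = f - f ** W ** f"
    unfolding diff WF by (simp add: diff matrix_mul_assoc)
  finally show ?thesis .
qed

text \<open>\<open>f W f\<close> is the Gram matrix of the rows of \<open>f\<close> in the form
  \<open>W\<close>, and \<open>qnorm_inverse_le\<close> bounds its diagonal by that of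
  \<open>f\<close>.\<close>

lemma sandwich_component_le: "(cmod ((f ** W ** f) $ i $ j))\<^sup>2 \<le> Re (f $ i $ i) * Re (f $ j $ j)"
proof -
  have "(f ** W ** f) $ i $ j = qform W (axis i 1 v* f) (axis j 1 v* f)"
  proof -
    have "vcnj (axis j 1 v* f) = f *v axis j 1"
    proof -
      have "cnj (f $ j $ k) = f $ k $ j" for k
        using f unfolding hermitian_psd_def by (metis complex_cnj_cnj)
      then show ?thesis
        by (simp add: vec_eq_iff vec_mat_axis mat_vec_axis)
    qed
    moreover have "vdot x (f *v axis j 1) = (x v* f) $ j" for x
      by (simp add: vdot_def vec_mat_nth mat_vec_axis)
    ultimately show ?thesis
      unfolding qform_def vec_mat_assoc by (simp add: vec_mat_axis vec_mat_assoc)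
  qed
  then have "(cmod ((f ** W ** f) $ i $ j))\<^sup>2 \<le> qnorm W (axis i 1 v* f) * qnorm W (axis j 1 v* f)"
    using qform_Cauchy_Schwarz[OF hermitian_psd_inverse, of "axis i 1 v* f" "axis j 1 v* f"] by simp
  also have "\<dots> \<le> qnorm f (axis i 1) * qnorm f (axis j 1)"
    by (intro mult_mono qnorm_inverse_le qnorm_nonneg f hermitian_psd_inverse)
  finally show ?thesis by (simp add: qform_axis)
qed

end

end

section \<open>Weighted spaces of vector functions\<close>

lemma borel_measurable_vec_iff:
  fixes b :: "'a \<Rightarrow> 'b::euclidean_space ^ 't"
  shows "b \<in> borel_measurable M \<longleftrightarrow> (\<forall>i. (\<lambda>x. b x $ i) \<in> borel_measurable M)"
proof
  assume b: "b \<in> borel_measurable M"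
  have "(\<lambda>v::'b^'t. v $ i) \<in> borel_measurable borel" for i
    by (intro borel_measurable_continuous_onI continuous_intros)
  from measurable_compose[OF b this] show "\<forall>i. (\<lambda>x. b x $ i) \<in> borel_measurable M" by simp
next
  assume b: "\<forall>i. (\<lambda>x. b x $ i) \<in> borel_measurable M"
  have "linear (axis i :: 'b \<Rightarrow> 'b^'t)" for i
    by (rule linearI) (auto simp: axis_def vec_eq_iff)
  then have "(axis i :: 'b \<Rightarrow> 'b^'t) \<in> borel_measurable borel" for i
    by (intro borel_measurable_continuous_onI linear_continuous_on) (simp add: linear_conv_bounded_linear)
  then have "(\<lambda>x. axis i (b x $ i)) \<in> borel_measurable M" for i
    using measurable_compose b by blast
  then have "(\<lambda>x. \<Sum>i\<in>UNIV. axis i (b x $ i)) \<in> borel_measurable M"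
    by measurable
  moreover have "(\<Sum>i\<in>UNIV. axis i (v $ i)) = v" for v :: "'b^'t"
    by (simp add: vec_eq_iff axis_def)
  ultimately show "b \<in> borel_measurable M" by simp
qed

lemma borel_measurable_vec_nth [measurable]:
  fixes b :: "'a \<Rightarrow> 'b::euclidean_space ^ 't"
  shows "b \<in> borel_measurable M \<Longrightarrow> (\<lambda>x. b x $ i) \<in> borel_measurable M"
  using borel_measurable_vec_iff by blast

lemma borel_measurable_vec_mat:
  fixes F :: "'a \<Rightarrow> complex^'n^'m"
  assumes "\<And>i j. (\<lambda>x. F x $ i $ j) \<in> borel_measurable M" "b \<in> borel_measurable M"
  shows "(\<lambda>x. b x v* F x) \<in> borel_measurable M"
  unfolding borel_measurable_vec_iff vec_mat_nth
  using assms(1) borel_measurable_vec_nth[OF assms(2)]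
  by (intro allI borel_measurable_sum borel_measurable_times)

lemma borel_measurable_vcnj:
  fixes b :: "'a \<Rightarrow> complex^'n"
  assumes "b \<in> borel_measurable M"
  shows "(\<lambda>x. vcnj (b x)) \<in> borel_measurable M"
  unfolding borel_measurable_vec_iff vcnj_nth
  using assms by (intro allI measurable_compose[OF _ borel_measurable_cnj] borel_measurable_vec_nth)

lemma borel_measurable_vdot:
  fixes b :: "'a \<Rightarrow> complex^'n"
  assumes "b \<in> borel_measurable M" "c \<in> borel_measurable M"
  shows "(\<lambda>x. vdot (b x) (c x)) \<in> borel_measurable M"
  unfolding vdot_def
  using assms by (intro borel_measurable_sum borel_measurable_times borel_measurable_vec_nth)

lemma borel_measurable_smult:
  fixes b :: "'a \<Rightarrow> complex^'n"
  assumes "u \<in> borel_measurable M" "b \<in> borel_measurable M"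
  shows "(\<lambda>x. u x *s b x) \<in> borel_measurable M"
  unfolding borel_measurable_vec_iff vector_smult_component
  using assms by (intro allI borel_measurable_times borel_measurable_vec_nth)

lemma borel_measurable_qform:
  fixes F :: "'a \<Rightarrow> complex^'n^'n"
  assumes "\<And>i j. (\<lambda>x. F x $ i $ j) \<in> borel_measurable M"
    "b \<in> borel_measurable M" "c \<in> borel_measurable M"
  shows "(\<lambda>x. qform (F x) (b x) (c x)) \<in> borel_measurable M"
  unfolding qform_def
  by (intro borel_measurable_vdot borel_measurable_vec_mat borel_measurable_vcnj assms)

definition entry_sum :: "complex^'t^'t \<Rightarrow> real" where
  "entry_sum F = (\<Sum>j\<in>UNIV. \<Sum>i\<in>UNIV. cmod (F $ i $ j))"

lemma entry_sum_nonneg: "0 \<le> entry_sum F"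
  by (simp add: entry_sum_def sum_nonneg)

lemma qform_le_entry_sum:
  assumes b: "\<And>i. cmod (b $ i) \<le> B" and c: "\<And>i. cmod (c $ i) \<le> C"
  shows "cmod (qform F b c) \<le> entry_sum F * (B * C)"
  unfolding qform_expand entry_sum_def sum_distrib_right
proof (intro order_trans[OF norm_sum] sum_mono)
  fix i j
  have "0 \<le> B" "0 \<le> C" using order_trans[OF norm_ge_zero b] order_trans[OF norm_ge_zero c] by auto
  then have "cmod (b $ i) * cmod (F $ i $ j) * cmod (c $ j) \<le> B * cmod (F $ i $ j) * C"
    by (intro mult_mono b c) auto
  then show "cmod (b $ i * F $ i $ j * cnj (c $ j)) \<le> cmod (F $ i $ j) * (B * C)"
    by (simp add: norm_mult mult_ac)
qed

text \<open>Positivity is asked almost everywhere, so that the inverse of \<open>f + g\<close>,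
  controlled only off a null set, is again a weight. Integrable entries put all bounded measurable
  functions into \<open>L2 F\<close>.\<close>

definition weight :: "(real \<Rightarrow> complex^'t^'t) \<Rightarrow> bool" where
  "weight F \<longleftrightarrow> (\<forall>i j. integrable circle (\<lambda>l. F l $ i $ j)) \<and> (AE l in circle. hermitian_psd (F l))"

lemma weight_integrable: "weight F \<Longrightarrow> integrable circle (\<lambda>l. F l $ i $ j)"
  by (simp add: weight_def)

lemma weight_measurable: "weight F \<Longrightarrow> (\<lambda>l. F l $ i $ j) \<in> borel_measurable circle"
  using borel_measurable_integrable weight_integrable by blast

lemma weight_hermitian: "weight F \<Longrightarrow> AE l in circle. hermitian_psd (F l)"
  by (simp add: weight_def)

lemma weight_entry_sum: "weight F \<Longrightarrow> integrable circle (\<lambda>l. entry_sum (F l))"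
  unfolding entry_sum_def by (intro Bochner_Integration.integrable_sum integrable_norm weight_integrable)

lemma weight_add:
  assumes "weight F" "weight G" shows "weight (\<lambda>l. F l + G l)"
  unfolding weight_def
proof (intro conjI allI)
  show "AE l in circle. hermitian_psd (F l + G l)"
    using weight_hermitian[OF assms(1)] weight_hermitian[OF assms(2)]
    by eventually_elim (rule hermitian_psd_add)
qed (use assms in \<open>simp add: weight_integrable\<close>)

lemma L2_normsq_circle: "L2_normsq F b = (\<integral>l. qnorm (F l) (b l) \<partial>circle)"
  by (simp add: L2_normsq_def set_integral_circle)

lemma L2_iff: "b \<in> L2 F \<longleftrightarrow> b \<in> borel_measurable circle \<and> integrable circle (\<lambda>l. qform (F l) (b l) (b l))"
  by (simp add: L2_def set_borel_measurable_circle set_integrable_circle)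

lemma L2_measurable: "b \<in> L2 F \<Longrightarrow> b \<in> borel_measurable circle"
  by (simp add: L2_iff)

lemma L2_integrable: "b \<in> L2 F \<Longrightarrow> integrable circle (\<lambda>l. qnorm (F l) (b l))"
  by (simp add: L2_iff)

lemma L2_normsq_zero [simp]: "L2_normsq F (\<lambda>l. 0) = 0"
  by (simp add: L2_normsq_circle)

context
  fixes F :: "real \<Rightarrow> complex^'t^'t"
  assumes F: "weight F"
begin

lemma qform_measurable:
  "b \<in> borel_measurable circle \<Longrightarrow> c \<in> borel_measurable circle
    \<Longrightarrow> (\<lambda>l. qform (F l) (b l) (c l)) \<in> borel_measurable circle"
  by (intro borel_measurable_qform weight_measurable F)

lemma L2I:
  assumes b: "b \<in> borel_measurable circle" and u: "integrable circle u"
    and le: "AE l in circle. qnorm (F l) (b l) \<le> u l"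
  shows "b \<in> L2 F"
proof -
  have "integrable circle (\<lambda>l. qform (F l) (b l) (b l))"
  proof (rule Bochner_Integration.integrable_bound[OF u qform_measurable[OF b b]])
    show "AE l in circle. norm (qform (F l) (b l) (b l)) \<le> norm (u l)"
      using le weight_hermitian[OF F]
    proof eventually_elim
      case (elim l)
      have "norm (qform (F l) (b l) (b l)) = qnorm (F l) (b l)"
        using qnorm_nonneg[OF elim(2), of "b l"]
        by (subst qform_eq_qnorm[OF elim(2)]) (simp only: norm_of_real abs_of_nonneg)
      with elim(1) show ?case by simp
    qed
  qed
  with b show ?thesis by (simp add: L2_iff)
qed

lemma L2_normsq_nonneg: "0 \<le> L2_normsq F b"
  unfolding L2_normsq_circle
  using weight_hermitian[OF F] by (intro integral_nonneg_AE) (auto elim!: eventually_mono intro: qnorm_nonneg)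

lemma L2_bounded:
  assumes b: "b \<in> borel_measurable circle" and K: "AE l in circle. \<forall>i. cmod (b l $ i) \<le> K"
  shows "b \<in> L2 F"
proof (rule L2I[OF b])
  show "integrable circle (\<lambda>l. entry_sum (F l) * (K * K))"
    using weight_entry_sum[OF F] by simp
  show "AE l in circle. qnorm (F l) (b l) \<le> entry_sum (F l) * (K * K)"
    using K by eventually_elim (use qform_le_entry_sum complex_Re_le_cmod order_trans in blast)
qed

lemma L2_add:
  assumes "b \<in> L2 F" "c \<in> L2 F" shows "(\<lambda>l. b l + c l) \<in> L2 F"
proof (rule L2I)
  show "(\<lambda>l. b l + c l) \<in> borel_measurable circle"
    using assms[THEN L2_measurable] by measurable
  show "integrable circle (\<lambda>l. 2 * qnorm (F l) (b l) + 2 * qnorm (F l) (c l))"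
    using assms[THEN L2_integrable] by simp
  show "AE l in circle. qnorm (F l) (b l + c l) \<le> 2 * qnorm (F l) (b l) + 2 * qnorm (F l) (c l)"
    using weight_hermitian[OF F] by eventually_elim (rule qnorm_add_le)
qed

lemma L2_smult:
  assumes "b \<in> L2 F" shows "(\<lambda>l. t *s b l) \<in> L2 F"
  using assms by (auto simp: L2_iff qform_smult_left qform_smult_right borel_measurable_smult)

lemma L2_diff:
  assumes "b \<in> L2 F" "c \<in> L2 F" shows "(\<lambda>l. b l - c l) \<in> L2 F"
  using L2_add[OF assms(1) L2_smult[OF assms(2), of "-1"]] by (simp add: vector_sneg_minus1[symmetric])

lemma L2_zero: "(\<lambda>l. 0) \<in> L2 F"
  by (simp add: L2_iff)

lemma L2_normsq_add_le:
  assumes "b \<in> L2 F" "c \<in> L2 F"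
  shows "L2_normsq F (\<lambda>l. b l + c l) \<le> 2 * L2_normsq F b + 2 * L2_normsq F c"
proof -
  have "L2_normsq F (\<lambda>l. b l + c l) \<le> (\<integral>l. 2 * qnorm (F l) (b l) + 2 * qnorm (F l) (c l) \<partial>circle)"
    unfolding L2_normsq_circle
  proof (rule integral_mono_AE)
    show "AE l in circle. qnorm (F l) (b l + c l) \<le> 2 * qnorm (F l) (b l) + 2 * qnorm (F l) (c l)"
      using weight_hermitian[OF F] by eventually_elim (rule qnorm_add_le)
  qed (use L2_integrable[OF L2_add[OF assms]] assms[THEN L2_integrable] in auto)
  then show ?thesis
    using assms[THEN L2_integrable] by (simp add: L2_normsq_circle)
qed

lemma L2_normsq_minus: "L2_normsq F (\<lambda>l. - b l) = L2_normsq F b"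
proof -
  have "qnorm (F l) (- b l) = qnorm (F l) (b l)" for l
    using qnorm_smult[of "F l" "-1" "b l"] by (simp flip: vector_sneg_minus1)
  then show ?thesis by (simp add: L2_normsq_circle)
qed

lemma L2_normsq_minus_commute: "L2_normsq F (\<lambda>l. b l - c l) = L2_normsq F (\<lambda>l. c l - b l)"
  using L2_normsq_minus[of "\<lambda>l. b l - c l"] by simp

lemma L2_normsq_triangle:
  assumes "b \<in> L2 F" "c \<in> L2 F" "d \<in> L2 F"
  shows "L2_normsq F (\<lambda>l. b l - d l) \<le> 2 * L2_normsq F (\<lambda>l. b l - c l) + 2 * L2_normsq F (\<lambda>l. c l - d l)"
  using L2_normsq_add_le[OF L2_diff[OF assms(1,2)] L2_diff[OF assms(2,3)]] by simp

lemma L2_inner_integrable: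
  assumes "b \<in> L2 F" "c \<in> L2 F"
  shows "integrable circle (\<lambda>l. qform (F l) (b l) (c l))"
proof (rule Bochner_Integration.integrable_bound)
  show "integrable circle (\<lambda>l. qnorm (F l) (b l) + qnorm (F l) (c l))"
    using assms[THEN L2_integrable] by simp
  show "(\<lambda>l. qform (F l) (b l) (c l)) \<in> borel_measurable circle"
    using assms[THEN L2_measurable] by (rule qform_measurable)
  show "AE l in circle. norm (qform (F l) (b l) (c l)) \<le> norm (qnorm (F l) (b l) + qnorm (F l) (c l))"
    using weight_hermitian[OF F]
  proof eventually_elim
    case (elim l)
    have b: "0 \<le> qnorm (F l) (b l)" and c: "0 \<le> qnorm (F l) (c l)"
      by (rule qnorm_nonneg[OF elim])+
    have "(cmod (qform (F l) (b l) (c l)))\<^sup>2 \<le> qnorm (F l) (b l) * qnorm (F l) (c l)"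
      by (rule qform_Cauchy_Schwarz[OF elim])
    also have "\<dots> \<le> (qnorm (F l) (b l) + qnorm (F l) (c l))\<^sup>2"
      using b c by (simp add: power2_eq_square algebra_simps)
    finally have "cmod (qform (F l) (b l) (c l)) \<le> qnorm (F l) (b l) + qnorm (F l) (c l)"
      by (rule power2_le_imp_le) (use b c in simp)
    then show ?case using b c by simp
  qed
qed

lemma L2_Cauchy_Schwarz:
  assumes "b \<in> L2 F" "c \<in> L2 F"
  shows "(cmod (\<integral>l. qform (F l) (b l) (c l) \<partial>circle))\<^sup>2 \<le> L2_normsq F b * L2_normsq F c"
proof -
  have "(cmod (\<integral>l. qform (F l) (b l) (c l) \<partial>circle))\<^sup>2 \<le> (\<integral>l. cmod (qform (F l) (b l) (c l)) \<partial>circle)\<^sup>2"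
    by (intro power_mono integral_norm_bound) auto
  also have "\<dots> \<le> L2_normsq F b * L2_normsq F c"
    unfolding L2_normsq_circle
  proof (rule integral_Cauchy_Schwarz)
    show "AE l in circle. (cmod (qform (F l) (b l) (c l)))\<^sup>2 \<le> qnorm (F l) (b l) * qnorm (F l) (c l)"
      "AE l in circle. 0 \<le> qnorm (F l) (b l)" "AE l in circle. 0 \<le> qnorm (F l) (c l)"
      using weight_hermitian[OF F]
      by (auto elim!: eventually_mono intro: qform_Cauchy_Schwarz qnorm_nonneg)
  qed (use assms[THEN L2_integrable] L2_inner_integrable[OF assms] in auto)
  finally show ?thesis .
qed

lemma L2_normsq_diff:
  assumes "b \<in> L2 F" "c \<in> L2 F"
  shows "L2_normsq F (\<lambda>l. b l - c l)
    = L2_normsq F b - 2 * Re (\<integral>l. qform (F l) (b l) (c l) \<partial>circle) + L2_normsq F c"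
proof -
  have "L2_normsq F (\<lambda>l. b l - c l)
      = (\<integral>l. qnorm (F l) (b l) - 2 * Re (qform (F l) (b l) (c l)) + qnorm (F l) (c l) \<partial>circle)"
    unfolding L2_normsq_circle
  proof (rule integral_cong_AE)
    show "AE l in circle. qnorm (F l) (b l - c l)
        = qnorm (F l) (b l) - 2 * Re (qform (F l) (b l) (c l)) + qnorm (F l) (c l)"
      using weight_hermitian[OF F] by eventually_elim (rule qnorm_diff)
  qed (use L2_integrable[OF L2_diff[OF assms]] assms[THEN L2_integrable] L2_inner_integrable[OF assms] in auto)
  then show ?thesis
    using assms[THEN L2_integrable] L2_inner_integrable[OF assms] by (simp add: L2_normsq_circle)
qed

lemma L2_inner_tendsto:
  assumes b: "\<And>n. b n \<in> L2 F" and a: "a \<in> L2 F" and c: "c \<in> L2 F"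
    and lim: "(\<lambda>n. L2_normsq F (\<lambda>l. a l - b n l)) \<longlonglongrightarrow> 0"
  shows "(\<lambda>n. \<integral>l. qform (F l) (b n l) (c l) \<partial>circle) \<longlonglongrightarrow> (\<integral>l. qform (F l) (a l) (c l) \<partial>circle)"
proof (rule LIM_zero_cancel, rule tendsto_norm_zero_cancel)
  have eq: "cmod ((\<integral>l. qform (F l) (b n l) (c l) \<partial>circle) - (\<integral>l. qform (F l) (a l) (c l) \<partial>circle))
      = cmod (\<integral>l. qform (F l) (a l - b n l) (c l) \<partial>circle)" for n
    unfolding qform_diff_left
    using L2_inner_integrable[OF b c] L2_inner_integrable[OF a c] by (simp add: norm_minus_commute)
  show "(\<lambda>n. cmod ((\<integral>l. qform (F l) (b n l) (c l) \<partial>circle) - (\<integral>l. qform (F l) (a l) (c l) \<partial>circle))) \<longlonglongrightarrow> 0"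
    unfolding eq
  proof (rule tendsto_sandwich[OF _ _ tendsto_const])
    show "\<forall>\<^sub>F n in sequentially. cmod (\<integral>l. qform (F l) (a l - b n l) (c l) \<partial>circle)
        \<le> sqrt (L2_normsq F (\<lambda>l. a l - b n l) * L2_normsq F c)"
      using L2_Cauchy_Schwarz[OF L2_diff[OF a b] c]
      by (intro always_eventually allI real_le_rsqrt)
    show "(\<lambda>n. sqrt (L2_normsq F (\<lambda>l. a l - b n l) * L2_normsq F c)) \<longlonglongrightarrow> 0"
      using tendsto_real_sqrt[OF tendsto_mult_left_zero[OF lim]] by simp
  qed auto
qed

lemma L2_normsq_tendsto:
  assumes b: "\<And>n. b n \<in> L2 F" and a: "a \<in> L2 F"
    and lim: "(\<lambda>n. L2_normsq F (\<lambda>l. a l - b n l)) \<longlonglongrightarrow> 0"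
  shows "(\<lambda>n. L2_normsq F (b n)) \<longlonglongrightarrow> L2_normsq F a"
proof -
  have "L2_normsq F (b n) = L2_normsq F (\<lambda>l. a l - b n l) - L2_normsq F a
      + 2 * Re (cnj (\<integral>l. qform (F l) (b n l) (a l) \<partial>circle))" for n
  proof -
    have "(\<integral>l. qform (F l) (a l) (b n l) \<partial>circle) = (\<integral>l. cnj (qform (F l) (b n l) (a l)) \<partial>circle)"
    proof (rule integral_cong_AE)
      show "AE l in circle. qform (F l) (a l) (b n l) = cnj (qform (F l) (b n l) (a l))"
        using weight_hermitian[OF F] by eventually_elim (rule qform_cnj)
    qed (use borel_measurable_integrable[OF L2_inner_integrable[OF a b]]
          borel_measurable_integrable[OF L2_inner_integrable[OF b a]] in measurable)
    then show ?thesis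
      using L2_normsq_diff[OF a b, of n] by (simp add: Bochner_Integration.integral_cnj)
  qed
  moreover have "(\<lambda>n. L2_normsq F (\<lambda>l. a l - b n l) - L2_normsq F a
      + 2 * Re (cnj (\<integral>l. qform (F l) (b n l) (a l) \<partial>circle)))
    \<longlonglongrightarrow> 0 - L2_normsq F a + 2 * Re (cnj (\<integral>l. qform (F l) (a l) (a l) \<partial>circle))"
    by (intro tendsto_intros lim L2_inner_tendsto b a)
  moreover have "Re (cnj (\<integral>l. qform (F l) (a l) (a l) \<partial>circle)) = L2_normsq F a"
    using L2_inner_integrable[OF a a] by (simp add: L2_normsq_circle)
  ultimately show ?thesis by simp
qed

end

section \<open>Trigonometric polynomials and closed spans\<close>

lemma trig_poly_unit_char: "trig_poly J \<beta> l = (\<Sum>j\<in>J. unit_char j l *s \<beta> j)"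
  by (simp add: trig_poly_def unit_char_def)

lemma trig_poly_component: "trig_poly J \<beta> l $ i = (\<Sum>j\<in>J. \<beta> j $ i * unit_char j l)"
  by (simp add: trig_poly_unit_char mult.commute)

lemma trig_poly_measurable: "trig_poly J \<beta> \<in> borel_measurable circle"
  unfolding borel_measurable_vec_iff trig_poly_component by measurable

lemma trig_poly_bound: "cmod (trig_poly J \<beta> l $ i) \<le> (\<Sum>i\<in>UNIV. \<Sum>j\<in>J. cmod (\<beta> j $ i))"
proof -
  have "cmod (trig_poly J \<beta> l $ i) \<le> (\<Sum>j\<in>J. cmod (\<beta> j $ i))"
    unfolding trig_poly_component by (rule order_trans[OF norm_sum]) (simp add: norm_mult)
  also have "\<dots> \<le> (\<Sum>i\<in>UNIV. \<Sum>j\<in>J. cmod (\<beta> j $ i))"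
    by (rule member_le_sum) (auto intro: sum_nonneg)
  finally show ?thesis .
qed

lemma trig_poly_L2: "weight F \<Longrightarrow> trig_poly J \<beta> \<in> L2 F"
  by (rule L2_bounded[OF _ trig_poly_measurable]) (auto intro: trig_poly_bound)

lemma L2_span_L2: "h \<in> L2_span F S \<Longrightarrow> h \<in> L2 F"
  by (simp add: L2_span_def)

lemma L2_span_approx:
  assumes "h \<in> L2_span F S" "0 < e"
  obtains J \<beta> where "finite J" "J \<subseteq> S" "L2_normsq F (\<lambda>l. h l - trig_poly J \<beta> l) < e"
  using assms unfolding L2_span_def by blast

lemma L2_span_sequence:
  assumes h: "h \<in> L2_span F S" and F: "weight F"
  obtains J \<beta> where "\<And>n::nat. finite (J n)" "\<And>n. J n \<subseteq> S"
    "(\<lambda>n. L2_normsq F (\<lambda>l. h l - trig_poly (J n) (\<beta> n) l)) \<longlonglongrightarrow> 0"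
proof -
  have "\<exists>J \<beta>. finite J \<and> J \<subseteq> S \<and> L2_normsq F (\<lambda>l. h l - trig_poly J \<beta> l) < 1 / real (Suc n)" for n
  proof -
    have "0 < 1 / real (Suc n)" by simp
    then show ?thesis by (rule L2_span_approx[OF h]) blast
  qed
  then obtain J \<beta> where J: "\<And>n. finite (J n)" "\<And>n. J n \<subseteq> S"
      "\<And>n. L2_normsq F (\<lambda>l. h l - trig_poly (J n) (\<beta> n) l) < 1 / real (Suc n)"
    by metis
  have "(\<lambda>n. L2_normsq F (\<lambda>l. h l - trig_poly (J n) (\<beta> n) l)) \<longlonglongrightarrow> 0"
  proof (rule tendsto_sandwich[OF _ _ tendsto_const])
    show "(\<lambda>n. 1 / real (Suc n)) \<longlonglongrightarrow> 0" using LIMSEQ_Suc[OF lim_1_over_n] by simp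
    show "\<forall>\<^sub>F n in sequentially. L2_normsq F (\<lambda>l. h l - trig_poly (J n) (\<beta> n) l) \<le> 1 / real (Suc n)"
      by (intro always_eventually allI less_imp_le J(3))
    show "\<forall>\<^sub>F n in sequentially. 0 \<le> L2_normsq F (\<lambda>l. h l - trig_poly (J n) (\<beta> n) l)"
      by (intro always_eventually allI L2_normsq_nonneg F)
  qed
  then show thesis by (rule that[OF J(1,2)])
qed

section \<open>Dual weights and Fourier coefficients\<close>

text \<open>The minimality condition in the form in which it is applied. The notion is symmetric, so
  each statement serves \<open>h\<close> in \<open>L2 F\<close> and, with the weights exchanged,
  \<open>C\<close> in \<open>L2 W\<close>.\<close>

definition inverse_weights :: "(real \<Rightarrow> complex^'t^'t) \<Rightarrow> (real \<Rightarrow> complex^'t^'t) \<Rightarrow> bool" where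
  "inverse_weights F W \<longleftrightarrow> weight F \<and> weight W
     \<and> (AE l in circle. F l ** W l = mat 1 \<and> W l ** F l = mat 1)"

lemma inverse_weights_sym: "inverse_weights F W \<Longrightarrow> inverse_weights W F"
  by (auto simp: inverse_weights_def elim!: eventually_mono)

lemma vdot_integrable:
  assumes FW: "inverse_weights F W" and b: "b \<in> L2 F" and c: "c \<in> L2 W"
  shows "integrable circle (\<lambda>l. vdot (b l) (vcnj (c l)))"
    and "(cmod (\<integral>l. vdot (b l) (vcnj (c l)) \<partial>circle))\<^sup>2 \<le> L2_normsq F b * L2_normsq W c"
proof -
  have F: "weight F" and W: "weight W"
    and inv: "AE l in circle. F l ** W l = mat 1 \<and> W l ** F l = mat 1"
    using FW by (auto simp: inverse_weights_def)
  have le: "AE l in circle. (cmod (vdot (b l) (vcnj (c l))))\<^sup>2 \<le> qnorm (F l) (b l) * qnorm (W l) (c l)"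
    using weight_hermitian[OF F] inv by eventually_elim (rule vdot_Cauchy_Schwarz, auto)
  have bp: "AE l in circle. 0 \<le> qnorm (F l) (b l)"
    using weight_hermitian[OF F] by eventually_elim (rule qnorm_nonneg)
  have cp: "AE l in circle. 0 \<le> qnorm (W l) (c l)"
    using weight_hermitian[OF W] by eventually_elim (rule qnorm_nonneg)
  have m: "(\<lambda>l. vdot (b l) (vcnj (c l))) \<in> borel_measurable circle"
    by (intro borel_measurable_vdot borel_measurable_vcnj L2_measurable[OF b] L2_measurable[OF c])
  show i: "integrable circle (\<lambda>l. vdot (b l) (vcnj (c l)))"
  proof (rule Bochner_Integration.integrable_bound[OF _ m])
    show "integrable circle (\<lambda>l. qnorm (F l) (b l) + qnorm (W l) (c l))"
      using L2_integrable[OF b] L2_integrable[OF c] by simp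
    show "AE l in circle. norm (vdot (b l) (vcnj (c l))) \<le> norm (qnorm (F l) (b l) + qnorm (W l) (c l))"
      using le bp cp
    proof eventually_elim
      case (elim l)
      have "qnorm (F l) (b l) * qnorm (W l) (c l) \<le> (qnorm (F l) (b l) + qnorm (W l) (c l))\<^sup>2"
        using elim(2,3) by (simp add: power2_eq_square algebra_simps)
      with elim(1) have "(cmod (vdot (b l) (vcnj (c l))))\<^sup>2 \<le> (qnorm (F l) (b l) + qnorm (W l) (c l))\<^sup>2"
        by (rule order_trans)
      then have "cmod (vdot (b l) (vcnj (c l))) \<le> qnorm (F l) (b l) + qnorm (W l) (c l)"
        by (rule power2_le_imp_le) (use elim in simp)
      then show ?case by simp
    qed
  qed
  have "(cmod (\<integral>l. vdot (b l) (vcnj (c l)) \<partial>circle))\<^sup>2 \<le> (\<integral>l. cmod (vdot (b l) (vcnj (c l))) \<partial>circle)\<^sup>2"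
    by (intro power_mono integral_norm_bound) auto
  also have "\<dots> \<le> L2_normsq F b * L2_normsq W c"
    unfolding L2_normsq_circle
    by (rule integral_Cauchy_Schwarz[OF integrable_norm[OF i] L2_integrable[OF b] L2_integrable[OF c] bp cp])
      (use le in simp)
  finally show "(cmod (\<integral>l. vdot (b l) (vcnj (c l)) \<partial>circle))\<^sup>2 \<le> L2_normsq F b * L2_normsq W c" .
qed

lemma unit_char_axis_L2:
  fixes W :: "real \<Rightarrow> complex^'t^'t"
  shows "weight W \<Longrightarrow> (\<lambda>l. axis i (unit_char n l)) \<in> L2 W"
proof (rule L2_bounded)
  show "(\<lambda>l. axis i (unit_char n l) :: complex^'t) \<in> borel_measurable circle"
    unfolding borel_measurable_vec_iff axis_def by simp measurable
qed (auto simp: axis_def)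

text \<open>Constant vectors lie in \<open>L2 W\<close> because \<open>W\<close> is integrable, and
  pairing with them extracts components. This is where minimality gives the elements of
  \<open>L2 F\<close> Fourier coefficients.\<close>

lemma L2_component_integrable:
  assumes FW: "inverse_weights F W" and b: "b \<in> L2 F"
  shows "integrable circle (\<lambda>l. b l $ i)"
proof -
  have "weight W" using FW by (simp add: inverse_weights_def)
  from vdot_integrable(1)[OF FW b unit_char_axis_L2[OF this, of i 0]]
  show ?thesis by (simp add: vcnj_axis vdot_axis)
qed

lemma fourier_coeff_bound:
  assumes FW: "inverse_weights F W" and b: "b \<in> L2 F"
  shows "(cmod (fourier_coeff (\<lambda>l. b l $ i) n))\<^sup>2 \<le> L2_normsq F b * L2_normsq W (\<lambda>l. axis i (unit_char n l))"
proof -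
  have W: "weight W" and F: "weight F" using FW by (auto simp: inverse_weights_def)
  have "(cmod (\<integral>l. unit_char (- n) l * b l $ i \<partial>circle))\<^sup>2 \<le> L2_normsq F b * L2_normsq W (\<lambda>l. axis i (unit_char n l))"
    using vdot_integrable(2)[OF FW b unit_char_axis_L2[OF W, of i n]] by (simp add: vcnj_axis vdot_axis)
  moreover have "(cmod (fourier_coeff (\<lambda>l. b l $ i) n))\<^sup>2 \<le> (cmod (\<integral>l. unit_char (- n) l * b l $ i \<partial>circle))\<^sup>2"
  proof (intro power_mono)
    have "1 \<le> 2 * pi" using pi_gt3 by simp
    then have "x / (2 * pi) \<le> x / 1" if "0 \<le> x" for x
      using that by (intro divide_left_mono) auto
    then show "cmod (fourier_coeff (\<lambda>l. b l $ i) n) \<le> cmod (\<integral>l. unit_char (- n) l * b l $ i \<partial>circle)"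
      unfolding fourier_coeff_def norm_divide by simp
  qed simp
  ultimately show ?thesis by linarith
qed

lemma fourier_coeff_diff:
  assumes "integrable circle u" "integrable circle v"
  shows "fourier_coeff (\<lambda>l. u l - v l) n = fourier_coeff u n - fourier_coeff v n"
  using assms[THEN integrable_unit_char_mult] by (simp add: fourier_coeff_def right_diff_distrib diff_divide_distrib)

text \<open>Each coefficient is a pairing with a bounded element of \<open>L2 W\<close>, hence
  continuous on \<open>L2 F\<close>.\<close>

lemma fourier_coeff_tendsto:
  assumes FW: "inverse_weights F W" and b: "\<And>k. b k \<in> L2 F" and a: "a \<in> L2 F"
    and lim: "(\<lambda>k. L2_normsq F (\<lambda>l. a l - b k l)) \<longlonglongrightarrow> 0"
  shows "(\<lambda>k. fourier_coeff (\<lambda>l. b k l $ i) n) \<longlonglongrightarrow> fourier_coeff (\<lambda>l. a l $ i) n"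
proof (rule LIM_zero_cancel, rule tendsto_norm_zero_cancel)
  have F: "weight F" using FW by (simp add: inverse_weights_def)
  define K where "K = L2_normsq W (\<lambda>l. axis i (unit_char n l))"
  have eq: "cmod (fourier_coeff (\<lambda>l. b k l $ i) n - fourier_coeff (\<lambda>l. a l $ i) n)
      = cmod (fourier_coeff (\<lambda>l. (a l - b k l) $ i) n)" for k
    using fourier_coeff_diff[OF L2_component_integrable[OF FW a] L2_component_integrable[OF FW b]]
    by (simp add: norm_minus_commute)
  show "(\<lambda>k. cmod (fourier_coeff (\<lambda>l. b k l $ i) n - fourier_coeff (\<lambda>l. a l $ i) n)) \<longlonglongrightarrow> 0"
    unfolding eq
  proof (rule tendsto_sandwich[OF _ _ tendsto_const])
    show "\<forall>\<^sub>F k in sequentially. cmod (fourier_coeff (\<lambda>l. (a l - b k l) $ i) n)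
        \<le> sqrt (L2_normsq F (\<lambda>l. a l - b k l) * K)"
      using fourier_coeff_bound[OF FW L2_diff[OF F a b], of _ i n] unfolding K_def
      by (intro always_eventually allI real_le_rsqrt)
    show "(\<lambda>k. sqrt (L2_normsq F (\<lambda>l. a l - b k l) * K)) \<longlonglongrightarrow> 0"
      using tendsto_real_sqrt[OF tendsto_mult_left_zero[OF lim]] by simp
  qed auto
qed

lemma fourier_coeff_trig_poly:
  assumes "finite J"
  shows "fourier_coeff (\<lambda>l. trig_poly J \<beta> l $ i) n = (if n \<in> J then \<beta> n $ i else 0)"
proof -
  have "(\<integral>l. unit_char (- n) l * trig_poly J \<beta> l $ i \<partial>circle)
      = (\<integral>l. (\<Sum>j\<in>J. \<beta> j $ i * unit_char (j - n) l) \<partial>circle)"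
    unfolding trig_poly_component
    by (intro Bochner_Integration.integral_cong refl)
      (simp add: sum_distrib_left mult.left_commute unit_char_mult)
  also have "\<dots> = (\<Sum>j\<in>J. \<beta> j $ i * (\<integral>l. unit_char (j - n) l \<partial>circle))"
    using integrable_unit_char by simp
  also have "\<dots> = (\<Sum>j\<in>J. if j = n then \<beta> n $ i * (2 * pi) else 0)"
    by (intro sum.cong) (auto simp: integral_unit_char)
  also have "\<dots> = (if n \<in> J then \<beta> n $ i * (2 * pi) else 0)"
    using assms by simp
  finally show ?thesis by (simp add: fourier_coeff_def)
qed

section \<open>Approximation with prescribed frequencies\<close>

text \<open>Fejer means create no new frequencies, keep the bound \<open>K\<close> and converge in
  unweighted mean square. Since \<open>F\<close> may be unbounded, this passes to
  \<open>L2 F\<close> along an almost everywhere convergent subsequence, by dominated convergence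
  with a multiple of \<open>entry_sum\<close>.\<close>

lemma bounded_trig_approx:
  fixes r :: "real \<Rightarrow> complex^'t"
  assumes F: "weight F" and r: "r \<in> borel_measurable circle"
    and K: "AE l in circle. \<forall>i. cmod (r l $ i) \<le> K" and e: "0 < e"
  obtains J \<beta> where "finite J" "\<And>j. j \<in> J \<Longrightarrow> \<exists>i. fourier_coeff (\<lambda>l. r l $ i) j \<noteq> 0"
    "L2_normsq F (\<lambda>l. r l - trig_poly J \<beta> l) < e"
proof -
  have ri: "integrable circle (\<lambda>l. r l $ i)" for i
  proof (rule Bochner_Integration.integrable_bound[OF integrable_circle_const[of K]])
    show "(\<lambda>l. r l $ i) \<in> borel_measurable circle" using r by measurable
    show "AE l in circle. norm (r l $ i) \<le> norm K"
      using K by eventually_elim (metis abs_ge_self order_trans real_norm_def)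
  qed
  have rs: "square_integrable circle (\<lambda>l. r l $ i)" for i
    unfolding square_integrable_def
  proof
    show m: "(\<lambda>l. r l $ i) \<in> borel_measurable circle" using r by measurable
    show "integrable circle (\<lambda>l. (cmod (r l $ i))\<^sup>2)"
    proof (rule Bochner_Integration.integrable_bound[OF integrable_circle_const[of "K\<^sup>2"]])
      show "AE l in circle. norm ((cmod (r l $ i))\<^sup>2) \<le> norm (K\<^sup>2)"
        using K by eventually_elim (auto intro: power_mono)
    qed (use m in measurable)
  qed
  \<comment> \<open>Only frequencies with a nonzero coefficient are kept, so the approximant
    inherits the spectral gaps of \<open>r\<close>; the omitted terms of the Fejer mean are
    0.\<close>
  define J where "J N = {j \<in> {- int N..int N}. \<exists>i. fourier_coeff (\<lambda>l. r l $ i) j \<noteq> 0}" for N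
  define \<beta> where "\<beta> N j = (\<chi> i. of_real (1 - \<bar>of_int j\<bar> / (real N + 1)) * fourier_coeff (\<lambda>l. r l $ i) j)" for N j
  have tp: "trig_poly (J N) (\<beta> N) l $ i = fejer_mean N (\<lambda>l. r l $ i) l" for N l i
    unfolding trig_poly_component fejer_mean_def
    by (intro sum.mono_neutral_cong_left) (auto simp: J_def \<beta>_def)
  define d where "d N l = r l - trig_poly (J N) (\<beta> N) l" for N l
  have dm: "d N \<in> borel_measurable circle" for N
    unfolding d_def using r trig_poly_measurable by measurable
  have db: "AE l in circle. \<forall>i. cmod (d N l $ i) \<le> 2 * K" for N
    using K
  proof (eventually_elim, intro allI)
    fix l i assume l: "\<forall>i. cmod (r l $ i) \<le> K"
    have "cmod (fejer_mean N (\<lambda>l. r l $ i) l) \<le> K"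
      by (rule fejer_mean_bound[OF ri]) (use K in \<open>auto elim!: eventually_mono\<close>)
    moreover have "cmod (r l $ i) \<le> K" using l by blast
    ultimately show "cmod (d N l $ i) \<le> 2 * K"
      unfolding d_def vector_minus_component tp by (intro norm_triangle_le_diff) simp
  qed
  have "(\<lambda>N. \<Sum>i\<in>UNIV. \<integral>l. (cmod (d N l $ i))\<^sup>2 \<partial>circle) \<longlonglongrightarrow> (\<Sum>i\<in>(UNIV::'t set). 0)"
    unfolding d_def vector_minus_component tp by (intro tendsto_sum fejer_mean_tendsto rs)
  moreover have dint: "integrable circle (\<lambda>l. (cmod (d N l $ i))\<^sup>2)" for N i
  proof -
    have "square_integrable circle (\<lambda>l. d N l $ i)"
      unfolding d_def vector_minus_component trig_poly_component
      by (intro square_integrable_diff rs square_integrable_sum square_integrable_cmult square_integrable_unit_char)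
    then show ?thesis by (simp add: square_integrable_def)
  qed
  ultimately have "(\<lambda>N. \<integral>l. norm (\<Sum>i\<in>UNIV. (cmod (d N l $ i))\<^sup>2) \<partial>circle) \<longlonglongrightarrow> 0"
    by (simp add: sum_nonneg)
  from tendsto_L1_AE_subseq[OF _ this] obtain s where s: "strict_mono s"
      "AE l in circle. (\<lambda>n. \<Sum>i\<in>UNIV. (cmod (d (s n) l $ i))\<^sup>2) \<longlonglongrightarrow> 0"
    using dint by auto
  have to0: "AE l in circle. (\<lambda>n. qnorm (F l) (d (s n) l)) \<longlonglongrightarrow> 0"
    using s(2)
  proof eventually_elim
    case (elim l)
    show ?case
    proof (rule tendsto_norm_zero_cancel, rule tendsto_sandwich[OF _ _ tendsto_const])
      define q where "q n = sqrt (\<Sum>i\<in>UNIV. (cmod (d (s n) l $ i))\<^sup>2)" for n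
      have "cmod (d (s n) l $ i) \<le> q n" for n i
        unfolding q_def by (intro real_le_rsqrt member_le_sum[of i UNIV "\<lambda>i. (cmod (d (s n) l $ i))\<^sup>2"]) auto
      then have "\<bar>qnorm (F l) (d (s n) l)\<bar> \<le> entry_sum (F l) * (q n * q n)" for n
        using qform_le_entry_sum abs_Re_le_cmod order_trans by blast
      moreover have "q n * q n = (\<Sum>i\<in>UNIV. (cmod (d (s n) l $ i))\<^sup>2)" for n
        unfolding q_def by (simp add: sum_nonneg)
      ultimately show "\<forall>\<^sub>F n in sequentially. norm (qnorm (F l) (d (s n) l))
          \<le> entry_sum (F l) * (\<Sum>i\<in>UNIV. (cmod (d (s n) l $ i))\<^sup>2)"
        by simp
      show "(\<lambda>n. entry_sum (F l) * (\<Sum>i\<in>UNIV. (cmod (d (s n) l $ i))\<^sup>2)) \<longlonglongrightarrow> 0"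
        using elim by (rule tendsto_mult_right_zero)
    qed auto
  qed
  have "(\<lambda>n. L2_normsq F (d (s n))) \<longlonglongrightarrow> (\<integral>l. 0 \<partial>circle)"
    unfolding L2_normsq_circle
  proof (rule integral_dominated_convergence)
    show "integrable circle (\<lambda>l. entry_sum (F l) * (2 * K * (2 * K)))"
      using weight_entry_sum[OF F] by simp
    show "(\<lambda>l. qnorm (F l) (d (s n) l)) \<in> borel_measurable circle" for n
      using qform_measurable[OF F dm dm] by measurable
    show "AE l in circle. norm (qnorm (F l) (d (s n) l)) \<le> entry_sum (F l) * (2 * K * (2 * K))" for n
      using db[of "s n"]
    proof eventually_elim
      case (elim l)
      have "norm (qnorm (F l) (d (s n) l)) \<le> cmod (qform (F l) (d (s n) l) (d (s n) l))"
        by (simp add: abs_Re_le_cmod)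
      also have "\<dots> \<le> entry_sum (F l) * (2 * K * (2 * K))"
        by (rule qform_le_entry_sum) (use elim in auto)
      finally show ?case .
    qed
  qed (use to0 in auto)
  then have "\<forall>\<^sub>F n in sequentially. L2_normsq F (d (s n)) < e"
    using e by (auto dest: order_tendstoD)
  then obtain n where "L2_normsq F (d (s n)) < e"
    by (auto simp: eventually_sequentially)
  moreover have "finite (J N)" for N
    unfolding J_def by (rule finite_subset[of _ "{- int N..int N}"]) auto
  moreover have "\<exists>i. fourier_coeff (\<lambda>l. r l $ i) j \<noteq> 0" if "j \<in> J N" for j N
    using that by (simp add: J_def)
  ultimately show thesis
    unfolding d_def[abs_def] by (intro that[of "J (s n)" "\<beta> (s n)"])
qed

text \<open>Coefficient \<open>n\<close> of the product with \<open>P k\<close> combines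
  coefficients \<open>n - j\<close> of \<open>v\<close> with \<open>j \<le> 0\<close>, so the
  vanishing persists for \<open>P k\<close>. For the limit, |P - psi| |v| is split into |P - psi|
  times the root of \<open>w\<close> and |v| over that root; the square of the latter is at most
  \<open>K\<close> times |v|, so integrability of \<open>v\<close> suffices.\<close>

lemma antianalytic_mult:
  assumes P: "\<And>k::nat. P k \<in> trig_sums {..0}" and \<psi>m: "\<psi> \<in> borel_measurable circle"
    and w1: "\<And>l. 1 \<le> w l"
    and wi: "\<And>k. integrable circle (\<lambda>l. w l * (cmod (P k l - \<psi> l))\<^sup>2)"
    and lim: "(\<lambda>k. \<integral>l. w l * (cmod (P k l - \<psi> l))\<^sup>2 \<partial>circle) \<longlonglongrightarrow> 0"
    and \<psi>b: "AE l in circle. cmod (\<psi> l) \<le> b"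
    and v: "integrable circle v" and vw: "AE l in circle. cmod (v l) \<le> K * w l"
    and zero: "\<And>n. 0 \<le> n \<Longrightarrow> (\<integral>l. unit_char (- n) l * v l \<partial>circle) = 0" and n: "0 \<le> n"
  shows "(\<integral>l. unit_char (- n) l * (\<psi> l * v l) \<partial>circle) = 0"
proof -
  have vm [measurable]: "v \<in> borel_measurable circle" using v by simp
  note [measurable] = \<psi>m
  have Pm [measurable]: "P k \<in> borel_measurable circle" for k
    using borel_measurable_circle[OF trig_sums_measurable[OF P]] .
  have Pv: "integrable circle (\<lambda>l. P k l * v l)" for k
  proof -
    obtain B where B: "\<And>l. cmod (P k l) \<le> B" by (rule trig_sums_bounded[OF P]) blast
    show ?thesis
    proof (rule Bochner_Integration.integrable_bound)
      show "integrable circle (\<lambda>l. B * cmod (v l))" using v by simp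
      have "0 \<le> B" using order_trans[OF norm_ge_zero B] .
      then show "AE l in circle. norm (P k l * v l) \<le> norm (B * cmod (v l))"
        using B by (intro AE_I2) (simp add: norm_mult mult_right_mono)
    qed measurable
  qed
  have \<psi>v: "integrable circle (\<lambda>l. \<psi> l * v l)"
  proof (rule Bochner_Integration.integrable_bound)
    show "integrable circle (\<lambda>l. b * cmod (v l))" using v by simp
    show "AE l in circle. norm (\<psi> l * v l) \<le> norm (b * cmod (v l))"
      using \<psi>b
    proof eventually_elim
      case (elim l)
      then have "0 \<le> b" using order_trans[OF norm_ge_zero] by blast
      with elim show ?case by (simp add: norm_mult mult_right_mono)
    qed
  qed measurable
  have Pzero: "(\<integral>l. unit_char (- n) l * (P k l * v l) \<partial>circle) = 0" for k
  proof -
    obtain J q where J: "finite J" "J \<subseteq> {..0}" "P k = (\<lambda>l. \<Sum>j\<in>J. q j * unit_char j l)"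
      using P[of k] by (rule trig_sums_cases)
    have "unit_char (- n) l * (P k l * v l) = (\<Sum>j\<in>J. q j * (unit_char (- (n - j)) l * v l))" for l
      unfolding J(3) sum_distrib_right sum_distrib_left
      by (intro sum.cong refl) (simp add: mult.left_commute mult.assoc unit_char_mult_left)
    then have "(\<integral>l. unit_char (- n) l * (P k l * v l) \<partial>circle)
        = (\<Sum>j\<in>J. q j * (\<integral>l. unit_char (- (n - j)) l * v l \<partial>circle))"
      using integrable_unit_char_mult[OF v] by simp
    also have "\<dots> = 0"
      using J(2) n by (intro sum.neutral ballI) (subst zero, auto)
    finally show ?thesis .
  qed
  define V where "V = (\<integral>l. cmod (v l) \<partial>circle)"
  have bound: "(cmod (\<integral>l. unit_char (- n) l * (\<psi> l * v l) \<partial>circle))\<^sup>2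
      \<le> (\<integral>l. w l * (cmod (P k l - \<psi> l))\<^sup>2 \<partial>circle) * (\<bar>K\<bar> * V)" for k
  proof -
    have "(\<integral>l. unit_char (- n) l * (\<psi> l * v l) \<partial>circle)
        = - (\<integral>l. unit_char (- n) l * ((P k l - \<psi> l) * v l) \<partial>circle)"
      using integrable_unit_char_mult[OF Pv] integrable_unit_char_mult[OF \<psi>v] Pzero
      by (simp add: left_diff_distrib right_diff_distrib)
    then have "cmod (\<integral>l. unit_char (- n) l * (\<psi> l * v l) \<partial>circle)
        \<le> (\<integral>l. cmod (unit_char (- n) l * ((P k l - \<psi> l) * v l)) \<partial>circle)"
      by (simp only: norm_minus_cancel integral_norm_bound)
    then have "(cmod (\<integral>l. unit_char (- n) l * (\<psi> l * v l) \<partial>circle))\<^sup>2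
        \<le> (\<integral>l. cmod ((P k l - \<psi> l) * v l) \<partial>circle)\<^sup>2"
      by (intro power_mono) (simp_all add: norm_mult)
    also have "\<dots> \<le> (\<integral>l. w l * (cmod (P k l - \<psi> l))\<^sup>2 \<partial>circle) * (\<integral>l. \<bar>K\<bar> * cmod (v l) \<partial>circle)"
    proof (rule integral_Cauchy_Schwarz)
      show "integrable circle (\<lambda>l. cmod ((P k l - \<psi> l) * v l))"
        using Bochner_Integration.integrable_diff[OF Pv \<psi>v] by (simp add: left_diff_distrib integrable_norm)
      have w0: "0 \<le> w l" for l using w1[of l] by simp
      show "AE l in circle. 0 \<le> w l * (cmod (P k l - \<psi> l))\<^sup>2" "AE l in circle. 0 \<le> \<bar>K\<bar> * cmod (v l)"
        using w0 by auto
      show "AE l in circle. (cmod ((P k l - \<psi> l) * v l))\<^sup>2 \<le> w l * (cmod (P k l - \<psi> l))\<^sup>2 * (\<bar>K\<bar> * cmod (v l))"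
        using vw
      proof eventually_elim
        case (elim l)
        also have "K * w l \<le> \<bar>K\<bar> * w l" using w0 by (intro mult_right_mono) auto
        finally have "cmod (v l) * cmod (v l) \<le> (\<bar>K\<bar> * w l) * cmod (v l)"
          by (intro mult_right_mono) auto
        then have "(cmod (P k l - \<psi> l))\<^sup>2 * (cmod (v l) * cmod (v l))
            \<le> (cmod (P k l - \<psi> l))\<^sup>2 * ((\<bar>K\<bar> * w l) * cmod (v l))"
          by (intro mult_left_mono) auto
        then show ?case by (simp add: norm_mult power2_eq_square mult_ac)
      qed
    qed (use wi v in auto)
    finally show ?thesis by (simp add: V_def)
  qed
  have "(\<lambda>k. (\<integral>l. w l * (cmod (P k l - \<psi> l))\<^sup>2 \<partial>circle) * (\<bar>K\<bar> * V)) \<longlonglongrightarrow> 0"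
    using tendsto_mult_left_zero[OF lim] .
  then have "(cmod (\<integral>l. unit_char (- n) l * (\<psi> l * v l) \<partial>circle))\<^sup>2 \<le> 0"
    using bound by (intro LIMSEQ_le_const) auto
  then show ?thesis by simp
qed

lemma L2_span_negative:
  fixes h :: "real \<Rightarrow> complex^'t"
  assumes FW: "inverse_weights F W" and h: "h \<in> L2 F"
    and zero: "\<And>n i. 0 \<le> n \<Longrightarrow> fourier_coeff (\<lambda>l. h l $ i) n = 0"
  shows "h \<in> L2_span F {..-1}"
proof -
  have F: "weight F" using FW by (simp add: inverse_weights_def)
  note [measurable] = L2_measurable[OF h]
  have hi: "integrable circle (\<lambda>l. h l $ i)" for i
    by (rule L2_component_integrable[OF FW h])
  have hz: "(\<integral>l. unit_char (- n) l * h l $ i \<partial>circle) = 0" if "0 \<le> n" for n i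
    using zero[OF that, of i] by (simp add: fourier_coeff_def)
  define H where "H l = (\<Sum>i\<in>UNIV. cmod (h l $ i))" for l
  have H0: "0 \<le> H l" for l by (simp add: H_def sum_nonneg)
  have hH: "cmod (h l $ i) \<le> H l" for l i
    unfolding H_def by (rule member_le_sum) auto
  have Hi: "integrable circle H" unfolding H_def using hi by simp
  define I where "I = (\<integral>l. H l \<partial>circle)"
  have I0: "0 \<le> I" unfolding I_def using H0 by simp
  \<comment> \<open>\<open>H\<close> is integrable since minimality embeds \<open>L2 F\<close> into
    the integrable functions. Thus \<open>w m\<close> is an admissible Szegoe weight; it exceeds 1
    by the total mass \<open>I / real (Suc m)\<close> and dominates \<open>h\<close> up to the
    factor \<open>Suc m\<close>.\<close>
  define w where "w m l = 1 + H l / real (Suc m)" for m l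
  have w1: "1 \<le> w m l" for m l unfolding w_def using H0 by simp
  have wi: "integrable circle (w m)" for m unfolding w_def using Hi by simp
  have wI: "(\<integral>l. w m l \<partial>circle) = 2 * pi + I / real (Suc m)" for m
    unfolding w_def I_def using Hi by simp
  have Hw: "H l \<le> real (Suc m) * w m l" for m l
    unfolding w_def by (simp add: field_simps)
  define good where "good m \<psi> c \<longleftrightarrow> \<psi> \<in> borel_measurable circle \<and> (AE l in circle. w m l * (cmod (\<psi> l))\<^sup>2 = c) \<and> 0 \<le> c
      \<and> 2 * pi * c \<le> 2 * pi + I / real (Suc m) \<and> (\<integral>l. \<psi> l \<partial>circle) = 2 * pi
      \<and> (\<forall>i n. 0 \<le> n \<longrightarrow> (\<integral>l. unit_char (- n) l * (\<psi> l * (\<psi> l * h l $ i)) \<partial>circle) = 0)" for m \<psi> c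
  have "\<exists>\<psi> c. good m \<psi> c" for m
  proof -
    obtain \<psi> P c where P: "\<And>k::nat. P k \<in> trig_sums {..0}" and \<psi>m [measurable]: "\<psi> \<in> borel_measurable circle"
      and Pi: "\<And>k. integrable circle (\<lambda>l. w m l * (cmod (P k l - \<psi> l))\<^sup>2)"
      and lim: "(\<lambda>k. \<integral>l. w m l * (cmod (P k l - \<psi> l))\<^sup>2 \<partial>circle) \<longlonglongrightarrow> 0"
      and c: "AE l in circle. w m l * (cmod (\<psi> l))\<^sup>2 = c" and c0: "0 \<le> c"
      and cI: "2 * pi * c \<le> (\<integral>l. w m l \<partial>circle)" and mean: "(\<integral>l. \<psi> l \<partial>circle) = 2 * pi"
      by (rule szego_outer_function[OF wi w1]) blast
    have \<psi>b: "AE l in circle. cmod (\<psi> l) \<le> sqrt c"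
      using c
    proof eventually_elim
      case (elim l)
      have "1 * (cmod (\<psi> l))\<^sup>2 \<le> w m l * (cmod (\<psi> l))\<^sup>2"
        using w1[of m l] by (intro mult_right_mono) auto
      with elim show ?case by (intro real_le_rsqrt) simp
    qed
    \<comment> \<open>The two factors are applied one at a time, because
      \<open>antianalytic_mult\<close> wants its argument dominated by a multiple of
      \<open>w m\<close>. The product of \<open>\<psi>\<close> and \<open>h\<close> satisfies this
      again, \<open>\<psi>\<close> being bounded.\<close>
    have z1: "(\<integral>l. unit_char (- n) l * (\<psi> l * h l $ i) \<partial>circle) = 0" if "0 \<le> n" for n i
    proof (rule antianalytic_mult[OF P \<psi>m w1 Pi lim \<psi>b hi _ hz that])
      show "AE l in circle. cmod (h l $ i) \<le> real (Suc m) * w m l"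
        using order_trans[OF hH Hw] by blast
    qed
    have \<psi>h: "AE l in circle. cmod (\<psi> l * h l $ i) \<le> sqrt c * H l" for i
      using \<psi>b
    proof eventually_elim
      case (elim l)
      then show ?case unfolding norm_mult using hH c0 by (intro mult_mono) auto
    qed
    have \<psi>hi: "integrable circle (\<lambda>l. \<psi> l * h l $ i)" for i
    proof (rule Bochner_Integration.integrable_bound)
      show "integrable circle (\<lambda>l. sqrt c * H l)" using Hi by simp
      show "AE l in circle. norm (\<psi> l * h l $ i) \<le> norm (sqrt c * H l)"
        using \<psi>h[of i] by eventually_elim (metis abs_ge_self order_trans real_norm_def)
    qed measurable
    have z2: "(\<integral>l. unit_char (- n) l * (\<psi> l * (\<psi> l * h l $ i)) \<partial>circle) = 0" if "0 \<le> n" for n i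
    proof (rule antianalytic_mult[OF P \<psi>m w1 Pi lim \<psi>b \<psi>hi _ z1 that])
      show "AE l in circle. cmod (\<psi> l * h l $ i) \<le> (sqrt c * real (Suc m)) * w m l"
        using \<psi>h[of i]
      proof eventually_elim
        case (elim l)
        also have "sqrt c * H l \<le> sqrt c * (real (Suc m) * w m l)"
          using c0 Hw by (intro mult_left_mono) auto
        finally show ?case by (simp only: mult.assoc)
      qed
    qed
    show ?thesis
      using \<psi>m c c0 cI mean z2 unfolding wI good_def by blast
  qed
  then obtain \<psi> c where good: "\<And>m. good m (\<psi> m) (c m)" by metis
  have \<psi>m [measurable]: "\<psi> m \<in> borel_measurable circle"
    and c: "AE l in circle. w m l * (cmod (\<psi> m l))\<^sup>2 = c m" and c0: "0 \<le> c m"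
    and cI: "2 * pi * c m \<le> 2 * pi + I / real (Suc m)" and mean: "(\<integral>l. \<psi> m l \<partial>circle) = 2 * pi" for m
    using good[of m] unfolding good_def by blast+
  have z: "(\<integral>l. unit_char (- n) l * (\<psi> m l * (\<psi> m l * h l $ i)) \<partial>circle) = 0" if "0 \<le> n" for m i n
    using good[of m] that unfolding good_def by blast
  \<comment> \<open>A bound uniform in \<open>m\<close>, which supplies the dominating constant
    \<open>(2 + I)\<^sup>2\<close> of the limit passage.\<close>
  have c_le: "c m \<le> 1 + I" for m
  proof -
    have "I / real (Suc m) \<le> I / 1" using I0 by (intro divide_left_mono) auto
    with cI[of m] have "2 * pi * c m \<le> 2 * pi + I" by simp
    also have "\<dots> \<le> 2 * pi * (1 + I)"
      using I0 pi_gt3 mult_right_mono[of 1 "2 * pi" I] by (simp add: distrib_left)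
    finally show ?thesis by simp
  qed
  have \<psi>sq: "AE l in circle. (cmod (\<psi> m l))\<^sup>2 \<le> c m" for m
    using c[of m]
  proof eventually_elim
    case (elim l)
    have "1 * (cmod (\<psi> m l))\<^sup>2 \<le> w m l * (cmod (\<psi> m l))\<^sup>2"
      using w1[of m l] by (intro mult_right_mono) auto
    with elim show ?case by simp
  qed
  have \<psi>si: "square_integrable circle (\<psi> m)" for m
    unfolding square_integrable_def
  proof
    show "integrable circle (\<lambda>l. (cmod (\<psi> m l))\<^sup>2)"
    proof (rule Bochner_Integration.integrable_bound[OF integrable_circle_const[of "c m"]])
      show "AE l in circle. norm ((cmod (\<psi> m l))\<^sup>2) \<le> norm (c m)"
        using \<psi>sq[of m] by eventually_elim (use c0[of m] in simp)
    qed measurable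
  qed measurable
  have one: "square_integrable circle (\<lambda>l. 1)" by (simp add: square_integrable_def)
  \<comment> \<open>As \<open>\<psi> m\<close> has mean 1, its squared distance from 1 is the excess
    of its squared norm over \<open>2 * pi\<close>, and this is at most the excess mass of the
    weight.\<close>
  have dist1: "(\<integral>l. (cmod (\<psi> m l - 1))\<^sup>2 \<partial>circle) \<le> I / real (Suc m)" for m
  proof -
    have "(\<integral>l. (cmod (\<psi> m l - 1))\<^sup>2 \<partial>circle) = (\<integral>l. (cmod (\<psi> m l))\<^sup>2 \<partial>circle) - 2 * pi"
      using square_integrable_norm_diff[OF \<psi>si one, of m 1] mean[of m] by simp
    also have "(\<integral>l. (cmod (\<psi> m l))\<^sup>2 \<partial>circle) \<le> (\<integral>l. c m \<partial>circle)"
      using \<psi>sq[of m] \<psi>si[of m] by (intro integral_mono_AE) (auto simp: square_integrable_def)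
    also have "\<dots> = 2 * pi * c m" by simp
    finally show ?thesis using cI[of m] by linarith
  qed
  have lim1: "(\<lambda>m. \<integral>l. (cmod (\<psi> m l - 1))\<^sup>2 \<partial>circle) \<longlonglongrightarrow> 0"
  proof (rule tendsto_sandwich[OF _ _ tendsto_const])
    show "(\<lambda>m. I / real (Suc m)) \<longlonglongrightarrow> 0" by (rule LIMSEQ_Suc[OF lim_const_over_n])
  qed (use dist1 in \<open>auto intro!: always_eventually\<close>)
  have int1: "integrable circle (\<lambda>l. (cmod (\<psi> m l - 1))\<^sup>2)" for m
    using square_integrable_diff[OF \<psi>si one] by (simp add: square_integrable_def)
  obtain s where s: "strict_mono s" "AE l in circle. (\<lambda>n. \<psi> (s n) l) \<longlonglongrightarrow> 1"
    by (rule AE_subseq_tendsto_of_integral[of \<psi> circle "\<lambda>_. 1", OF \<psi>m int1 lim1]) blast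
  define r where "r m l = (\<psi> m l * \<psi> m l) *s h l" for m l
  have rm: "r m \<in> borel_measurable circle" for m
    unfolding r_def by (intro borel_measurable_smult) measurable
  have diff: "qnorm (F l) (h l - r m l) = (cmod (1 - \<psi> m l * \<psi> m l))\<^sup>2 * qnorm (F l) (h l)" for m l
  proof -
    have "h l - r m l = (1 - \<psi> m l * \<psi> m l) *s h l"
      by (simp add: r_def vec_eq_iff left_diff_distrib)
    then show ?thesis by (simp only: qnorm_smult)
  qed
  have diff_le: "AE l in circle. (cmod (1 - \<psi> m l * \<psi> m l))\<^sup>2 \<le> (2 + I)\<^sup>2" for m
    using \<psi>sq[of m]
  proof eventually_elim
    case (elim l)
    have "cmod (1 - \<psi> m l * \<psi> m l) \<le> cmod 1 + cmod (\<psi> m l * \<psi> m l)" by (rule norm_triangle_ineq4)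
    also have "\<dots> \<le> 2 + I" using elim c_le[of m] by (simp add: norm_mult power2_eq_square)
    finally show ?case by (intro power_mono) auto
  qed
  have "(\<lambda>n. L2_normsq F (\<lambda>l. h l - r (s n) l)) \<longlonglongrightarrow> (\<integral>l. 0 \<partial>circle)"
    unfolding L2_normsq_circle diff
  proof (rule integral_dominated_convergence)
    show "integrable circle (\<lambda>l. (2 + I)\<^sup>2 * qnorm (F l) (h l))"
      using L2_integrable[OF h] by simp
    show "(\<lambda>l. (cmod (1 - \<psi> (s n) l * \<psi> (s n) l))\<^sup>2 * qnorm (F l) (h l)) \<in> borel_measurable circle" for n
      using borel_measurable_integrable[OF L2_integrable[OF h]] by measurable
    show "AE l in circle. norm ((cmod (1 - \<psi> (s n) l * \<psi> (s n) l))\<^sup>2 * qnorm (F l) (h l))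
        \<le> (2 + I)\<^sup>2 * qnorm (F l) (h l)" for n
      using diff_le[of "s n"] weight_hermitian[OF F]
    proof eventually_elim
      case (elim l)
      then show ?case
        using qnorm_nonneg[OF elim(2), of "h l"] by (simp add: abs_mult mult_right_mono)
    qed
    show "AE l in circle. (\<lambda>n. (cmod (1 - \<psi> (s n) l * \<psi> (s n) l))\<^sup>2 * qnorm (F l) (h l)) \<longlonglongrightarrow> 0"
      using s(2)
    proof eventually_elim
      case (elim l)
      have "(\<lambda>n. (cmod (1 - \<psi> (s n) l * \<psi> (s n) l))\<^sup>2 * qnorm (F l) (h l))
          \<longlonglongrightarrow> (cmod (1 - 1 * 1))\<^sup>2 * qnorm (F l) (h l)"
        by (intro tendsto_intros elim)
      then show ?case by simp
    qed
  qed simp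
  then have lim: "(\<lambda>n. L2_normsq F (\<lambda>l. h l - r (s n) l)) \<longlonglongrightarrow> 0" by simp
  \<comment> \<open>Both factors of \<open>\<psi>\<close> are spent here: together they turn
    \<open>w\<close> into the constant \<open>c m\<close>, and \<open>h\<close> is at most
    \<open>Suc m\<close> times \<open>w\<close>.\<close>
  have rb: "AE l in circle. \<forall>i. cmod (r m l $ i) \<le> real (Suc m) * c m" for m
    using c[of m]
  proof (eventually_elim, intro allI)
    fix l i assume l: "w m l * (cmod (\<psi> m l))\<^sup>2 = c m"
    have "cmod (r m l $ i) = (cmod (\<psi> m l))\<^sup>2 * cmod (h l $ i)"
      by (simp add: r_def norm_mult power2_eq_square)
    also have "\<dots> \<le> (cmod (\<psi> m l))\<^sup>2 * (real (Suc m) * w m l)"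
      using order_trans[OF hH Hw] by (intro mult_left_mono) auto
    also have "\<dots> = real (Suc m) * (w m l * (cmod (\<psi> m l))\<^sup>2)" by (simp only: mult_ac)
    finally show "cmod (r m l $ i) \<le> real (Suc m) * c m" unfolding l .
  qed
  have rL2: "r m \<in> L2 F" for m
    by (rule L2_bounded[OF F rm rb])
  have rz: "fourier_coeff (\<lambda>l. r m l $ i) n = 0" if "0 \<le> n" for m i n
    using z[OF that, of m i] by (simp add: fourier_coeff_def r_def mult.assoc)
  show ?thesis
    unfolding L2_span_def
  proof (intro CollectI conjI h allI impI)
    fix e :: real assume e: "0 < e"
    then have "\<forall>\<^sub>F n in sequentially. L2_normsq F (\<lambda>l. h l - r (s n) l) < e / 4"
      using lim by (auto dest: order_tendstoD(2)[where a = "e / 4"])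
    then obtain n where n: "L2_normsq F (\<lambda>l. h l - r (s n) l) < e / 4"
      by (auto simp: eventually_sequentially)
    obtain J \<beta> where J: "finite J" "\<And>j. j \<in> J \<Longrightarrow> \<exists>i. fourier_coeff (\<lambda>l. r (s n) l $ i) j \<noteq> 0"
        "L2_normsq F (\<lambda>l. r (s n) l - trig_poly J \<beta> l) < e / 4"
      using bounded_trig_approx[OF F rm rb, of "e / 4" "s n"] e by auto
    have "J \<subseteq> {..-1}"
    proof
      fix j assume "j \<in> J"
      with J(2) rz have "\<not> 0 \<le> j" by blast
      then show "j \<in> {..-1}" by simp
    qed
    moreover have "L2_normsq F (\<lambda>l. h l - trig_poly J \<beta> l) < e"
      using L2_normsq_triangle[OF F h rL2[of "s n"] trig_poly_L2[OF F, of J \<beta>]] n J(3) by linarith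
    ultimately show "\<exists>J \<beta>. finite J \<and> J \<subseteq> {..-1} \<and> L2_normsq F (\<lambda>l. h l - trig_poly J \<beta> l) < e"
      using J(1) by blast
  qed
qed

text \<open>The coefficients of the approximants at the points of \<open>G\<close> converge to those
  of \<open>h\<close>, which are 0. As \<open>G\<close> is finite, deleting these terms changes the
  approximants by something that tends to 0 in \<open>L2 F\<close>.\<close>

lemma L2_span_delete:
  assumes FW: "inverse_weights F W" and h: "h \<in> L2_span F S" and G: "finite G"
    and zero: "\<And>n i. n \<in> G \<Longrightarrow> fourier_coeff (\<lambda>l. h l $ i) n = 0"
  shows "h \<in> L2_span F (S - G)"
proof -
  have F: "weight F" using FW by (simp add: inverse_weights_def)
  note hL2 = L2_span_L2[OF h]
  obtain J \<beta> where J: "\<And>n::nat. finite (J n)" "\<And>n. J n \<subseteq> S"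
    and lim: "(\<lambda>n. L2_normsq F (\<lambda>l. h l - trig_poly (J n) (\<beta> n) l)) \<longlonglongrightarrow> 0"
    by (rule L2_span_sequence[OF h F]) blast
  \<comment> \<open>Padding with 0 collects the deleted terms in a polynomial over the fixed index
    set \<open>G\<close>, whatever \<open>J n\<close> is.\<close>
  define \<gamma> where "\<gamma> n j = (if j \<in> J n then \<beta> n j else 0)" for n j
  have \<gamma>0: "(\<lambda>n. \<gamma> n j $ i) \<longlonglongrightarrow> 0" if "j \<in> G" for j i
  proof -
    have "fourier_coeff (\<lambda>l. trig_poly (J n) (\<beta> n) l $ i) j = \<gamma> n j $ i" for n
      by (simp add: fourier_coeff_trig_poly[OF J(1)] \<gamma>_def)
    then show ?thesis
      using fourier_coeff_tendsto[OF FW trig_poly_L2[OF F] hL2 lim, of i j] zero[OF that] by simp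
  qed
  define t where "t n = (\<Sum>i\<in>UNIV. \<Sum>j\<in>G. cmod (\<gamma> n j $ i))" for n
  have t0: "t \<longlonglongrightarrow> 0"
  proof -
    have "(\<lambda>n. \<Sum>i\<in>UNIV. \<Sum>j\<in>G. cmod (\<gamma> n j $ i)) \<longlonglongrightarrow> (\<Sum>i\<in>(UNIV::'a set). \<Sum>j\<in>G. cmod 0)"
      by (intro tendsto_intros \<gamma>0)
    then show ?thesis by (simp add: t_def[abs_def])
  qed
  define E where "E = (\<integral>l. entry_sum (F l) \<partial>circle)"
  have gap: "L2_normsq F (trig_poly G (\<gamma> n)) \<le> E * (t n * t n)" for n
  proof -
    have "L2_normsq F (trig_poly G (\<gamma> n)) \<le> (\<integral>l. entry_sum (F l) * (t n * t n) \<partial>circle)"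
      unfolding L2_normsq_circle
    proof (rule integral_mono)
      fix l
      have "cmod (qform (F l) (trig_poly G (\<gamma> n) l) (trig_poly G (\<gamma> n) l)) \<le> entry_sum (F l) * (t n * t n)"
        unfolding t_def by (rule qform_le_entry_sum; rule trig_poly_bound)
      then show "qnorm (F l) (trig_poly G (\<gamma> n) l) \<le> entry_sum (F l) * (t n * t n)"
        using complex_Re_le_cmod order_trans by blast
    qed (use L2_integrable[OF trig_poly_L2[OF F]] weight_entry_sum[OF F] in auto)
    then show ?thesis using weight_entry_sum[OF F] by (simp add: E_def)
  qed
  have split: "trig_poly (J n - G) (\<beta> n) l = trig_poly (J n) (\<beta> n) l - trig_poly G (\<gamma> n) l" for n l
  proof -
    have "trig_poly (J n) (\<beta> n) l = trig_poly (J n - G) (\<beta> n) l + trig_poly (J n \<inter> G) (\<beta> n) l"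
      unfolding trig_poly_unit_char using J(1)[of n]
      by (subst sum.union_disjoint[symmetric]) (auto intro: sum.cong)
    moreover have "trig_poly (J n \<inter> G) (\<beta> n) l = trig_poly G (\<gamma> n) l"
      unfolding trig_poly_unit_char using G
      by (intro sum.mono_neutral_cong_left) (auto simp: \<gamma>_def)
    ultimately show ?thesis by simp
  qed
  have bound: "L2_normsq F (\<lambda>l. h l - trig_poly (J n - G) (\<beta> n) l)
      \<le> 2 * L2_normsq F (\<lambda>l. h l - trig_poly (J n) (\<beta> n) l) + 2 * (E * (t n * t n))" for n
  proof -
    have "(\<lambda>l. h l - trig_poly (J n - G) (\<beta> n) l)
        = (\<lambda>l. (h l - trig_poly (J n) (\<beta> n) l) + trig_poly G (\<gamma> n) l)"
      by (simp add: split algebra_simps)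
    then have "L2_normsq F (\<lambda>l. h l - trig_poly (J n - G) (\<beta> n) l)
        \<le> 2 * L2_normsq F (\<lambda>l. h l - trig_poly (J n) (\<beta> n) l) + 2 * L2_normsq F (trig_poly G (\<gamma> n))"
      using L2_normsq_add_le[OF F L2_diff[OF F hL2 trig_poly_L2[OF F]] trig_poly_L2[OF F], of "J n" "\<beta> n" G "\<gamma> n"]
      by (simp only:)
    with gap[of n] show ?thesis by linarith
  qed
  have lim': "(\<lambda>n. 2 * L2_normsq F (\<lambda>l. h l - trig_poly (J n) (\<beta> n) l) + 2 * (E * (t n * t n))) \<longlonglongrightarrow> 2 * 0 + 2 * (E * (0 * 0))"
    by (intro tendsto_intros lim t0)
  show ?thesis
    unfolding L2_span_def
  proof (intro CollectI conjI hL2 allI impI)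
    fix e :: real assume "0 < e"
    then have "\<forall>\<^sub>F n in sequentially. 2 * L2_normsq F (\<lambda>l. h l - trig_poly (J n) (\<beta> n) l) + 2 * (E * (t n * t n)) < e"
      using order_tendstoD(2)[OF lim', of e] by simp
    then obtain n where "2 * L2_normsq F (\<lambda>l. h l - trig_poly (J n) (\<beta> n) l) + 2 * (E * (t n * t n)) < e"
      by (auto simp: eventually_sequentially)
    with bound[of n] have "L2_normsq F (\<lambda>l. h l - trig_poly (J n - G) (\<beta> n) l) < e" by linarith
    moreover have "finite (J n - G)" "J n - G \<subseteq> S - G" using J by auto
    ultimately show "\<exists>J \<beta>. finite J \<and> J \<subseteq> S - G \<and> L2_normsq F (\<lambda>l. h l - trig_poly J \<beta> l) < e"
      by blast
  qed
qed

section \<open>Stochastic integrals\<close>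

lemma square_integrable_norm_tendsto:
  assumes X: "\<And>n. square_integrable M (X n)" and Y: "square_integrable M Y"
    and lim: "(\<lambda>n. \<integral>x. (cmod (X n x - Y x))\<^sup>2 \<partial>M) \<longlonglongrightarrow> 0"
  shows "(\<lambda>n. \<integral>x. (cmod (X n x))\<^sup>2 \<partial>M) \<longlonglongrightarrow> (\<integral>x. (cmod (Y x))\<^sup>2 \<partial>M)"
proof -
  have "(\<integral>x. (cmod (X n x))\<^sup>2 \<partial>M) = (\<integral>x. (cmod (X n x - Y x))\<^sup>2 \<partial>M)
      + 2 * Re (\<integral>x. X n x * cnj (Y x) \<partial>M) - (\<integral>x. (cmod (Y x))\<^sup>2 \<partial>M)" for n
    using square_integrable_norm_diff[OF X Y, of n 1] by simp
  moreover have "(\<lambda>n. (\<integral>x. (cmod (X n x - Y x))\<^sup>2 \<partial>M)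
      + 2 * Re (\<integral>x. X n x * cnj (Y x) \<partial>M) - (\<integral>x. (cmod (Y x))\<^sup>2 \<partial>M))
    \<longlonglongrightarrow> 0 + 2 * Re (\<integral>x. Y x * cnj (Y x) \<partial>M) - (\<integral>x. (cmod (Y x))\<^sup>2 \<partial>M)"
    by (intro tendsto_intros lim square_integrable_inner_tendsto X Y)
  moreover have "Re (\<integral>x. Y x * cnj (Y x) \<partial>M) = (\<integral>x. (cmod (Y x))\<^sup>2 \<partial>M)"
  proof -
    have "(\<integral>x. Y x * cnj (Y x) \<partial>M) = (\<integral>x. of_real ((cmod (Y x))\<^sup>2) \<partial>M)"
      unfolding complex_norm_square ..
    then show ?thesis by (simp only: integral_complex_of_real Re_complex_of_real)
  qed
  ultimately show ?thesis by simp
qed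

lemma square_integrable_norm_add_le:
  assumes "square_integrable M u" "square_integrable M v"
  shows "(\<integral>x. (cmod (u x + v x))\<^sup>2 \<partial>M) \<le> 2 * (\<integral>x. (cmod (u x))\<^sup>2 \<partial>M) + 2 * (\<integral>x. (cmod (v x))\<^sup>2 \<partial>M)"
proof -
  have "(\<integral>x. (cmod (u x + v x))\<^sup>2 \<partial>M) \<le> (\<integral>x. 2 * (cmod (u x))\<^sup>2 + 2 * (cmod (v x))\<^sup>2 \<partial>M)"
    using assms square_integrable_add[OF assms]
    by (intro integral_mono cmod_add_square_le) (auto simp: square_integrable_def)
  then show ?thesis
    using assms by (simp add: square_integrable_def)
qed

lemma integral_double_sum:
  fixes u :: "'i \<Rightarrow> 'j \<Rightarrow> 'a \<Rightarrow> complex"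
  assumes u: "\<And>i j. i \<in> I \<Longrightarrow> j \<in> J \<Longrightarrow> integrable M (u i j)"
  shows "(\<integral>x. (\<Sum>i\<in>I. \<Sum>j\<in>J. u i j x) \<partial>M) = (\<Sum>i\<in>I. \<Sum>j\<in>J. \<integral>x. u i j x \<partial>M)"
proof -
  have "(\<integral>x. (\<Sum>i\<in>I. \<Sum>j\<in>J. u i j x) \<partial>M) = (\<Sum>i\<in>I. \<integral>x. (\<Sum>j\<in>J. u i j x) \<partial>M)"
    by (intro Bochner_Integration.integral_sum Bochner_Integration.integrable_sum u)
  also have "\<dots> = (\<Sum>i\<in>I. \<Sum>j\<in>J. \<integral>x. u i j x \<partial>M)"
    by (intro sum.cong refl Bochner_Integration.integral_sum u)
  finally show ?thesis .
qed

text \<open>A relation rather than a map: a step function has many representations, and only the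
  isometry shows that its integral is determined up to a null set.\<close>

definition steps :: "(real set \<Rightarrow> 'a \<Rightarrow> complex^'t) \<Rightarrow> ((real \<Rightarrow> complex^'t) \<times> ('a \<Rightarrow> complex)) set" where
  "steps Z = {(k, X). \<exists>(m::nat) A b. (\<forall>i<m. A i \<in> sets borel \<and> A i \<subseteq> {-pi..pi})
     \<and> k = (\<lambda>l. \<Sum>i<m. indicat_real (A i) l *\<^sub>R b i) \<and> X = (\<lambda>\<omega>. \<Sum>i<m. vdot (b i) (Z (A i) \<omega>))}"

lemma stepsI:
  assumes "\<And>i. i < m \<Longrightarrow> A i \<in> sets borel" "\<And>i. i < m \<Longrightarrow> A i \<subseteq> {-pi..pi}"
  shows "((\<lambda>l. \<Sum>i<m. indicat_real (A i) l *\<^sub>R b i), (\<lambda>\<omega>. \<Sum>i<(m::nat). vdot (b i) (Z (A i) \<omega>))) \<in> steps Z"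
  unfolding steps_def using assms by blast

lemma steps_cases:
  assumes "(k, X) \<in> steps Z"
  obtains m :: nat and A b where "\<And>i. i < m \<Longrightarrow> A i \<in> sets borel" "\<And>i. i < m \<Longrightarrow> A i \<subseteq> {-pi..pi}"
    "k = (\<lambda>l. \<Sum>i<m. indicat_real (A i) l *\<^sub>R b i)" "X = (\<lambda>\<omega>. \<Sum>i<m. vdot (b i) (Z (A i) \<omega>))"
  using assms unfolding steps_def by blast

lemma steps_single:
  assumes "A \<in> sets borel" "A \<subseteq> {-pi..pi}"
  shows "((\<lambda>l. indicat_real A l *\<^sub>R b), (\<lambda>\<omega>. vdot b (Z A \<omega>))) \<in> steps Z"
  using stepsI[of 1 "\<lambda>_. A" "\<lambda>_. b" Z] assms by simp

lemma steps_smult: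
  assumes "(k, X) \<in> steps Z"
  shows "((\<lambda>l. c *s k l), (\<lambda>\<omega>. c * X \<omega>)) \<in> steps Z"
proof -
  obtain m :: nat and A b where A: "\<And>i. i < m \<Longrightarrow> A i \<in> sets borel" "\<And>i. i < m \<Longrightarrow> A i \<subseteq> {-pi..pi}"
    and k: "k = (\<lambda>l. \<Sum>i<m. indicat_real (A i) l *\<^sub>R b i)" and X: "X = (\<lambda>\<omega>. \<Sum>i<m. vdot (b i) (Z (A i) \<omega>))"
    using assms by (rule steps_cases) blast
  have "(\<lambda>l. c *s k l) = (\<lambda>l. \<Sum>i<m. indicat_real (A i) l *\<^sub>R (c *s b i))"
    unfolding k by (simp add: vec_eq_iff fun_eq_iff sum_distrib_left)
  moreover have "(\<lambda>\<omega>. c * X \<omega>) = (\<lambda>\<omega>. \<Sum>i<m. vdot (c *s b i) (Z (A i) \<omega>))"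
    unfolding X by (simp add: sum_distrib_left vdot_smult_left)
  ultimately show ?thesis using stepsI[OF A] by simp
qed

lemma sum_lessThan_plus: "(\<Sum>i<m + n. u i) = (\<Sum>i<m. u i) + (\<Sum>i<n::nat. u (m + i))"
  for u :: "nat \<Rightarrow> 'b::comm_monoid_add"
  by (induction n) (simp_all add: add.assoc)

lemma steps_add:
  assumes "(k, X) \<in> steps Z" "(k', X') \<in> steps Z"
  shows "((\<lambda>l. k l + k' l), (\<lambda>\<omega>. X \<omega> + X' \<omega>)) \<in> steps Z"
proof -
  obtain m :: nat and A b where A: "\<And>i. i < m \<Longrightarrow> A i \<in> sets borel" "\<And>i. i < m \<Longrightarrow> A i \<subseteq> {-pi..pi}"
    and k: "k = (\<lambda>l. \<Sum>i<m. indicat_real (A i) l *\<^sub>R b i)" and X: "X = (\<lambda>\<omega>. \<Sum>i<m. vdot (b i) (Z (A i) \<omega>))"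
    using assms(1) by (rule steps_cases) blast
  obtain n :: nat and B d where B: "\<And>i. i < n \<Longrightarrow> B i \<in> sets borel" "\<And>i. i < n \<Longrightarrow> B i \<subseteq> {-pi..pi}"
    and k': "k' = (\<lambda>l. \<Sum>i<n. indicat_real (B i) l *\<^sub>R d i)" and X': "X' = (\<lambda>\<omega>. \<Sum>i<n. vdot (d i) (Z (B i) \<omega>))"
    using assms(2) by (rule steps_cases) blast
  define C where "C i = (if i < m then A i else B (i - m))" for i
  define e where "e i = (if i < m then b i else d (i - m))" for i
  have C: "C i \<in> sets borel" "C i \<subseteq> {-pi..pi}" if "i < m + n" for i
    using A[of i] B[of "i - m"] that unfolding C_def by auto
  have "(\<lambda>l. k l + k' l) = (\<lambda>l. \<Sum>i<m + n. indicat_real (C i) l *\<^sub>R e i)"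
    unfolding sum_lessThan_plus k k' by (simp add: C_def e_def)
  moreover have "(\<lambda>\<omega>. X \<omega> + X' \<omega>) = (\<lambda>\<omega>. \<Sum>i<m + n. vdot (e i) (Z (C i) \<omega>))"
    unfolding sum_lessThan_plus X X' by (simp add: C_def e_def)
  ultimately show ?thesis using stepsI[OF C] by simp
qed

lemma has_stoch_integral_iff:
  "has_stoch_integral M Z F h \<eta> \<longleftrightarrow> h \<in> L2 F \<and> square_integrable M \<eta>
    \<and> (\<forall>e>0. \<exists>k X. (k, X) \<in> steps Z \<and> L2_normsq F (\<lambda>l. h l - k l) < e \<and> (\<integral>\<omega>. (cmod (\<eta> \<omega> - X \<omega>))\<^sup>2 \<partial>M) < e)"
proof -
  have "(\<exists>m A b. (\<forall>i<m. A i \<in> sets borel \<and> A i \<subseteq> {-pi..pi})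
        \<and> L2_normsq F (\<lambda>l. h l - (\<Sum>i<m. indicat_real (A i) l *\<^sub>R b i)) < e
        \<and> (\<integral>\<omega>. (cmod (\<eta> \<omega> - (\<Sum>i<m::nat. vdot (b i) (Z (A i) \<omega>))))\<^sup>2 \<partial>M) < e)
     \<longleftrightarrow> (\<exists>k X. (k, X) \<in> steps Z \<and> L2_normsq F (\<lambda>l. h l - k l) < e \<and> (\<integral>\<omega>. (cmod (\<eta> \<omega> - X \<omega>))\<^sup>2 \<partial>M) < e)" for e
    unfolding steps_def mem_Collect_eq prod.case by blast
  then show ?thesis
    unfolding has_stoch_integral_def square_integrable_def by simp
qed

lemma steps_bounded_measurable:
  fixes Z :: "real set \<Rightarrow> 'a \<Rightarrow> complex^'t"
  assumes "(k, X) \<in> steps Z"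
  shows "k \<in> borel_measurable circle" and "\<exists>K. \<forall>l i. cmod (k l $ i) \<le> K"
proof -
  obtain m :: nat and A b where A: "\<And>i. i < m \<Longrightarrow> A i \<in> sets borel"
    and k: "k = (\<lambda>l. \<Sum>i<m. indicat_real (A i) l *\<^sub>R b i)"
    using assms by (rule steps_cases) blast
  have "(\<lambda>l. indicat_real (A i) l *\<^sub>R b i) \<in> borel_measurable circle" if "i < m" for i
    by (intro borel_measurable_circle borel_measurable_scaleR borel_measurable_indicator borel_measurable_const A[OF that])
  then show "k \<in> borel_measurable circle" unfolding k by (intro borel_measurable_sum) auto
  have "cmod (k l $ i) \<le> (\<Sum>i\<in>UNIV. \<Sum>j<m. cmod (b j $ i))" for l i
  proof -
    have "cmod (k l $ i) \<le> (\<Sum>j<m. cmod (b j $ i))"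
      unfolding k sum_component
      by (rule order_trans[OF norm_sum], rule sum_mono) (simp add: indicator_def)
    also have "\<dots> \<le> (\<Sum>i\<in>UNIV. \<Sum>j<m. cmod (b j $ i))"
      by (rule member_le_sum) (auto intro: sum_nonneg)
    finally show ?thesis .
  qed
  then show "\<exists>K. \<forall>l i. cmod (k l $ i) \<le> K" by blast
qed

text \<open>The second-order structure alone, shared by both spectral measures, their sum and their
  direct sum, so that one theory of the integral covers all four.\<close>

definition orthogonal_measure ::
    "'a measure \<Rightarrow> (real set \<Rightarrow> 'a \<Rightarrow> complex^'t) \<Rightarrow> (real \<Rightarrow> complex^'t^'t) \<Rightarrow> bool" where
  "orthogonal_measure M Z F \<longleftrightarrow>
     (\<forall>A\<in>sets borel. A \<subseteq> {-pi..pi} \<longrightarrow> (\<forall>p. square_integrable M (\<lambda>\<omega>. Z A \<omega> $ p))) \<and>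
     (\<forall>A\<in>sets borel. \<forall>B\<in>sets borel. A \<subseteq> {-pi..pi} \<longrightarrow> B \<subseteq> {-pi..pi} \<longrightarrow>
        (\<forall>p q. (\<integral>\<omega>. Z A \<omega> $ p * cnj (Z B \<omega> $ q) \<partial>M)
                 = (LINT l:A \<inter> B|lborel. F l $ p $ q) / (2 * pi)))"

lemma random_spectral_measure_orthogonal:
  fixes Z :: "real set \<Rightarrow> 'a \<Rightarrow> complex^'t"
  assumes Z: "random_spectral_measure M Z F"
  shows "orthogonal_measure M Z F"
  unfolding orthogonal_measure_def
proof (intro conjI ballI impI allI)
  fix A :: "real set" and p assume A: "A \<in> sets borel" "A \<subseteq> {-pi..pi}"
  have [measurable]: "Z A \<in> borel_measurable M" and i: "integrable M (\<lambda>\<omega>. (norm (Z A \<omega>))\<^sup>2)"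
    using Z A unfolding random_spectral_measure_def by auto
  have "integrable M (\<lambda>\<omega>. (cmod (Z A \<omega> $ p))\<^sup>2)"
    by (rule Bochner_Integration.integrable_bound[OF i])
      (use Finite_Cartesian_Product.norm_nth_le in \<open>auto intro!: power_mono\<close>)
  then show "square_integrable M (\<lambda>\<omega>. Z A \<omega> $ p)" by (simp add: square_integrable_def)
qed (use Z in \<open>simp add: random_spectral_measure_def\<close>)

context
  fixes M :: "'a measure" and Z :: "real set \<Rightarrow> 'a \<Rightarrow> complex^'t" and F :: "real \<Rightarrow> complex^'t^'t"
  assumes Z: "orthogonal_measure M Z F" and F: "weight F"
begin

lemma vdot_spectral_measure_square_integrable:
  assumes "A \<in> sets borel" "A \<subseteq> {-pi..pi}"
  shows "square_integrable M (\<lambda>\<omega>. vdot b (Z A \<omega>))"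
  unfolding vdot_def
  using Z assms by (intro square_integrable_sum square_integrable_cmult) (simp add: orthogonal_measure_def)

lemma steps_L2: "(k, X) \<in> steps Z \<Longrightarrow> k \<in> L2 F"
  using steps_bounded_measurable[of k X Z] L2_bounded[OF F, of k] by auto

lemma steps_square_integrable: "(k, X) \<in> steps Z \<Longrightarrow> square_integrable M X"
  by (erule steps_cases) (auto intro!: square_integrable_sum vdot_spectral_measure_square_integrable)

lemma spectral_measure_covariance:
  assumes A: "A \<in> sets borel" "A \<subseteq> {-pi..pi}" and B: "B \<in> sets borel" "B \<subseteq> {-pi..pi}"
  shows "(\<integral>\<omega>. vdot b (Z A \<omega>) * cnj (vdot d (Z B \<omega>)) \<partial>M)
    = (\<integral>l. qform (F l) (indicat_real A l *\<^sub>R b) (indicat_real B l *\<^sub>R d) \<partial>circle) / (2 * pi)"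
proof -
  have cov: "(\<integral>\<omega>. Z A \<omega> $ p * cnj (Z B \<omega> $ q) \<partial>M) = (\<integral>l. indicat_real (A \<inter> B) l *\<^sub>R F l $ p $ q \<partial>circle) / (2 * pi)" for p q
  proof -
    have "(LINT l:A \<inter> B|lborel. F l $ p $ q) = (\<integral>l. indicat_real (A \<inter> B) l *\<^sub>R F l $ p $ q \<partial>circle)"
      unfolding set_lebesgue_integral_def using A(2)
      by (subst integral_restrict_space) (auto intro!: Bochner_Integration.integral_cong simp: indicator_def)
    then show ?thesis using Z A B unfolding orthogonal_measure_def by simp
  qed
  have iF: "integrable circle (\<lambda>l. indicat_real (A \<inter> B) l *\<^sub>R F l $ p $ q)" for p q
  proof (rule Bochner_Integration.integrable_bound[OF weight_integrable[OF F, of p q]])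
    have [measurable]: "indicat_real (A \<inter> B) \<in> borel_measurable circle"
      by (intro borel_measurable_circle borel_measurable_indicator sets.Int A(1) B(1))
    show "(\<lambda>l. indicat_real (A \<inter> B) l *\<^sub>R F l $ p $ q) \<in> borel_measurable circle"
      using weight_measurable[OF F] by measurable
  qed (auto simp: indicator_def)
  have "(\<integral>\<omega>. vdot b (Z A \<omega>) * cnj (vdot d (Z B \<omega>)) \<partial>M)
      = (\<integral>\<omega>. (\<Sum>q\<in>UNIV. \<Sum>p\<in>UNIV. (b $ p * cnj (d $ q)) * (Z A \<omega> $ p * cnj (Z B \<omega> $ q))) \<partial>M)"
    unfolding vdot_def cnj_sum sum_product
    by (subst sum.swap) (simp add: mult_ac)
  also have "\<dots> = (\<Sum>q\<in>UNIV. \<Sum>p\<in>UNIV. (b $ p * cnj (d $ q)) * (\<integral>\<omega>. Z A \<omega> $ p * cnj (Z B \<omega> $ q) \<partial>M))"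
  proof -
    have "square_integrable M (\<lambda>\<omega>. Z A \<omega> $ p)" "square_integrable M (\<lambda>\<omega>. Z B \<omega> $ p)" for p
      using Z A B unfolding orthogonal_measure_def by auto
    from square_integrable_mult_cnj[OF this] show ?thesis by simp
  qed
  also have "\<dots> = (\<Sum>q\<in>UNIV. \<Sum>p\<in>UNIV. (b $ p * cnj (d $ q)) * (\<integral>l. indicat_real (A \<inter> B) l *\<^sub>R F l $ p $ q \<partial>circle)) / (2 * pi)"
    unfolding cov by (simp add: sum_divide_distrib)
  also have "(\<Sum>q\<in>UNIV. \<Sum>p\<in>UNIV. (b $ p * cnj (d $ q)) * (\<integral>l. indicat_real (A \<inter> B) l *\<^sub>R F l $ p $ q \<partial>circle))
      = (\<integral>l. (\<Sum>q\<in>UNIV. \<Sum>p\<in>UNIV. (b $ p * cnj (d $ q)) * (indicat_real (A \<inter> B) l *\<^sub>R F l $ p $ q)) \<partial>circle)"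
    unfolding integral_mult_right_zero[symmetric]
    by (rule integral_double_sum[symmetric]) (intro integrable_mult_right iF)
  also have "\<dots> = (\<integral>l. qform (F l) (indicat_real A l *\<^sub>R b) (indicat_real B l *\<^sub>R d) \<partial>circle)"
    unfolding qform_expand
    by (intro Bochner_Integration.integral_cong refl sum.cong) (auto simp: indicator_def)
  finally show ?thesis .
qed

lemma steps_covariance:
  assumes "(k, X) \<in> steps Z" "(k', X') \<in> steps Z"
  shows "(\<integral>\<omega>. X \<omega> * cnj (X' \<omega>) \<partial>M) = (\<integral>l. qform (F l) (k l) (k' l) \<partial>circle) / (2 * pi)"
proof -
  obtain m :: nat and A b where A: "\<And>i. i < m \<Longrightarrow> A i \<in> sets borel" "\<And>i. i < m \<Longrightarrow> A i \<subseteq> {-pi..pi}"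
    and k: "k = (\<lambda>l. \<Sum>i<m. indicat_real (A i) l *\<^sub>R b i)" and X: "X = (\<lambda>\<omega>. \<Sum>i<m. vdot (b i) (Z (A i) \<omega>))"
    using assms(1) by (rule steps_cases) blast
  obtain n :: nat and B d where B: "\<And>i. i < n \<Longrightarrow> B i \<in> sets borel" "\<And>i. i < n \<Longrightarrow> B i \<subseteq> {-pi..pi}"
    and k': "k' = (\<lambda>l. \<Sum>i<n. indicat_real (B i) l *\<^sub>R d i)" and X': "X' = (\<lambda>\<omega>. \<Sum>i<n. vdot (d i) (Z (B i) \<omega>))"
    using assms(2) by (rule steps_cases) blast
  have qsum1: "qform G (\<Sum>i\<in>I. u i) v = (\<Sum>i\<in>I. qform G (u i) v)" for G :: "complex^'t^'t" and I :: "nat set" and u v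
    by (induction I rule: infinite_finite_induct) (simp_all add: qform_add_left)
  have qsum2: "qform G v (\<Sum>i\<in>I. u i) = (\<Sum>i\<in>I. qform G v (u i))" for G :: "complex^'t^'t" and I :: "nat set" and u v
    by (induction I rule: infinite_finite_induct) (simp_all add: qform_add_right)
  have "(\<integral>\<omega>. X \<omega> * cnj (X' \<omega>) \<partial>M)
      = (\<integral>\<omega>. (\<Sum>i<m. \<Sum>j<n. vdot (b i) (Z (A i) \<omega>) * cnj (vdot (d j) (Z (B j) \<omega>))) \<partial>M)"
    unfolding X X' cnj_sum sum_product ..
  also have "\<dots> = (\<Sum>i<m. \<Sum>j<n. \<integral>\<omega>. vdot (b i) (Z (A i) \<omega>) * cnj (vdot (d j) (Z (B j) \<omega>)) \<partial>M)"
  proof -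
    have "integrable M (\<lambda>\<omega>. vdot (b i) (Z (A i) \<omega>) * cnj (vdot (d j) (Z (B j) \<omega>)))" if "i < m" "j < n" for i j
      by (intro square_integrable_mult_cnj vdot_spectral_measure_square_integrable A B that)
    then show ?thesis by (intro integral_double_sum) auto
  qed
  also have "\<dots> = (\<Sum>i<m. \<Sum>j<n. \<integral>l. qform (F l) (indicat_real (A i) l *\<^sub>R b i) (indicat_real (B j) l *\<^sub>R d j) \<partial>circle) / (2 * pi)"
    unfolding sum_divide_distrib using A B by (intro sum.cong refl spectral_measure_covariance) auto
  also have "(\<Sum>i<m. \<Sum>j<n. \<integral>l. qform (F l) (indicat_real (A i) l *\<^sub>R b i) (indicat_real (B j) l *\<^sub>R d j) \<partial>circle)
      = (\<integral>l. qform (F l) (k l) (k' l) \<partial>circle)"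
  proof -
    have i: "integrable circle (\<lambda>l. qform (F l) (indicat_real (A i) l *\<^sub>R b i) (indicat_real (B j) l *\<^sub>R d j))"
      if "i < m" "j < n" for i j
      using steps_L2[OF steps_single[OF A[OF that(1)]]] steps_L2[OF steps_single[OF B[OF that(2)]]]
      by (rule L2_inner_integrable[OF F])
    have "(\<integral>l. qform (F l) (k l) (k' l) \<partial>circle)
        = (\<integral>l. (\<Sum>i<m. \<Sum>j<n. qform (F l) (indicat_real (A i) l *\<^sub>R b i) (indicat_real (B j) l *\<^sub>R d j)) \<partial>circle)"
      unfolding k k' unfolding qsum1 unfolding qsum2 ..
    also have "\<dots> = (\<Sum>i<m. \<Sum>j<n. \<integral>l. qform (F l) (indicat_real (A i) l *\<^sub>R b i) (indicat_real (B j) l *\<^sub>R d j) \<partial>circle)"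
      using i by (intro integral_double_sum) auto
    finally show ?thesis ..
  qed
  finally show ?thesis .
qed

lemma steps_isometry:
  assumes "(k, X) \<in> steps Z"
  shows "(\<integral>\<omega>. (cmod (X \<omega>))\<^sup>2 \<partial>M) = L2_normsq F k / (2 * pi)"
proof -
  have "complex_of_real (\<integral>\<omega>. (cmod (X \<omega>))\<^sup>2 \<partial>M) = (\<integral>\<omega>. X \<omega> * cnj (X \<omega>) \<partial>M)"
    unfolding integral_complex_of_real[symmetric] complex_norm_square ..
  also have "\<dots> = (\<integral>l. qform (F l) (k l) (k l) \<partial>circle) / (2 * pi)"
    by (rule steps_covariance[OF assms assms])
  finally have "(\<integral>\<omega>. (cmod (X \<omega>))\<^sup>2 \<partial>M) = Re ((\<integral>l. qform (F l) (k l) (k l) \<partial>circle) / of_real (2 * pi))"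
    by (metis Re_complex_of_real of_real_mult of_real_numeral)
  also have "\<dots> = L2_normsq F k / (2 * pi)"
    using L2_inner_integrable[OF F steps_L2[OF assms] steps_L2[OF assms]]
    by (simp only: Re_divide_of_real) (simp add: L2_normsq_circle)
  finally show ?thesis .
qed

lemma stoch_integral_sequence:
  assumes "has_stoch_integral M Z F h \<eta>"
  obtains k X where "\<And>n::nat. (k n, X n) \<in> steps Z" "(\<lambda>n. L2_normsq F (\<lambda>l. h l - k n l)) \<longlonglongrightarrow> 0"
    "(\<lambda>n. \<integral>\<omega>. (cmod (X n \<omega> - \<eta> \<omega>))\<^sup>2 \<partial>M) \<longlonglongrightarrow> 0"
proof -
  define near where "near n k X \<longleftrightarrow> (k, X) \<in> steps Z \<and> L2_normsq F (\<lambda>l. h l - k l) < 1 / real (Suc n)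
      \<and> (\<integral>\<omega>. (cmod (\<eta> \<omega> - X \<omega>))\<^sup>2 \<partial>M) < 1 / real (Suc n)" for n k X
  have "\<exists>k X. near n k X" for n
  proof -
    have "0 < 1 / real (Suc n)" by simp
    with assms show ?thesis unfolding has_stoch_integral_iff near_def by blast
  qed
  then obtain k X where "\<And>n. near n (k n) (X n)" by metis
  then have kX: "(k n, X n) \<in> steps Z" "L2_normsq F (\<lambda>l. h l - k n l) < 1 / real (Suc n)"
      "(\<integral>\<omega>. (cmod (\<eta> \<omega> - X n \<omega>))\<^sup>2 \<partial>M) < 1 / real (Suc n)" for n
    unfolding near_def by blast+
  have inv0: "(\<lambda>n. 1 / real (Suc n)) \<longlonglongrightarrow> 0" using LIMSEQ_Suc[OF lim_1_over_n] by simp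
  have "(\<lambda>n. L2_normsq F (\<lambda>l. h l - k n l)) \<longlonglongrightarrow> 0"
  proof (rule tendsto_sandwich[OF _ _ tendsto_const inv0])
    show "\<forall>\<^sub>F n in sequentially. L2_normsq F (\<lambda>l. h l - k n l) \<le> 1 / real (Suc n)"
      by (intro always_eventually allI less_imp_le kX)
    show "\<forall>\<^sub>F n in sequentially. 0 \<le> L2_normsq F (\<lambda>l. h l - k n l)"
      by (intro always_eventually allI L2_normsq_nonneg F)
  qed
  moreover have "(\<lambda>n. \<integral>\<omega>. (cmod (X n \<omega> - \<eta> \<omega>))\<^sup>2 \<partial>M) \<longlonglongrightarrow> 0"
  proof (rule tendsto_sandwich[OF _ _ tendsto_const inv0])
    show "\<forall>\<^sub>F n in sequentially. (\<integral>\<omega>. (cmod (X n \<omega> - \<eta> \<omega>))\<^sup>2 \<partial>M) \<le> 1 / real (Suc n)"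
      unfolding norm_minus_commute[of "X _ _"] by (intro always_eventually allI less_imp_le kX)
  qed auto
  ultimately show thesis by (rule that[OF kX(1)])
qed

lemma stoch_integral_isometry:
  assumes "has_stoch_integral M Z F h \<eta>"
  shows "(\<integral>\<omega>. (cmod (\<eta> \<omega>))\<^sup>2 \<partial>M) = L2_normsq F h / (2 * pi)"
proof -
  obtain k X where kX: "\<And>n::nat. (k n, X n) \<in> steps Z"
    and k: "(\<lambda>n. L2_normsq F (\<lambda>l. h l - k n l)) \<longlonglongrightarrow> 0"
    and X: "(\<lambda>n. \<integral>\<omega>. (cmod (X n \<omega> - \<eta> \<omega>))\<^sup>2 \<partial>M) \<longlonglongrightarrow> 0"
    using assms by (rule stoch_integral_sequence) blast
  have h: "h \<in> L2 F" and \<eta>: "square_integrable M \<eta>"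
    using assms unfolding has_stoch_integral_iff by auto
  have "(\<lambda>n. L2_normsq F (k n) / (2 * pi)) \<longlonglongrightarrow> L2_normsq F h / (2 * pi)"
    using L2_normsq_tendsto[OF F steps_L2[OF kX] h k] by (intro tendsto_intros) auto
  moreover have "(\<lambda>n. L2_normsq F (k n) / (2 * pi)) \<longlonglongrightarrow> (\<integral>\<omega>. (cmod (\<eta> \<omega>))\<^sup>2 \<partial>M)"
    using square_integrable_norm_tendsto[OF steps_square_integrable[OF kX] \<eta> X]
    by (simp only: steps_isometry[OF kX])
  ultimately show ?thesis by (rule LIMSEQ_unique[symmetric])
qed

lemma stoch_integral_smult:
  assumes "has_stoch_integral M Z F h \<eta>"
  shows "has_stoch_integral M Z F (\<lambda>l. c *s h l) (\<lambda>\<omega>. c * \<eta> \<omega>)"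
  unfolding has_stoch_integral_iff
proof (intro conjI allI impI)
  have h: "h \<in> L2 F" and \<eta>: "square_integrable M \<eta>"
    and approx: "\<And>e. 0 < e \<Longrightarrow> \<exists>k X. (k, X) \<in> steps Z \<and> L2_normsq F (\<lambda>l. h l - k l) < e \<and> (\<integral>\<omega>. (cmod (\<eta> \<omega> - X \<omega>))\<^sup>2 \<partial>M) < e"
    using assms unfolding has_stoch_integral_iff by auto
  show "(\<lambda>l. c *s h l) \<in> L2 F" by (rule L2_smult[OF F h])
  show "square_integrable M (\<lambda>\<omega>. c * \<eta> \<omega>)" by (rule square_integrable_cmult[OF \<eta>])
  fix e :: real assume e: "0 < e"
  define r where "r = (cmod c)\<^sup>2 + 1"
  have r: "0 < r" unfolding r_def by (simp add: add_nonneg_pos)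
  from approx[of "e / r"] e r obtain k X where kX: "(k, X) \<in> steps Z" and k: "L2_normsq F (\<lambda>l. h l - k l) < e / r"
    and X: "(\<integral>\<omega>. (cmod (\<eta> \<omega> - X \<omega>))\<^sup>2 \<partial>M) < e / r" by auto
  have small: "(cmod c)\<^sup>2 * y < e" if "0 \<le> y" "y < e / r" for y
  proof -
    have "(cmod c)\<^sup>2 * y \<le> r * y" using that unfolding r_def by (intro mult_right_mono) auto
    also have "\<dots> < e" using that r by (simp add: field_simps)
    finally show ?thesis .
  qed
  have "L2_normsq F (\<lambda>l. c *s h l - c *s k l) = (cmod c)\<^sup>2 * L2_normsq F (\<lambda>l. h l - k l)"
    unfolding vector_ssub_ldistrib[symmetric] L2_normsq_circle qnorm_smult by simp
  then have 1: "L2_normsq F (\<lambda>l. c *s h l - c *s k l) < e"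
    using small[OF L2_normsq_nonneg[OF F] k] by simp
  have "(\<integral>\<omega>. (cmod (c * \<eta> \<omega> - c * X \<omega>))\<^sup>2 \<partial>M) = (cmod c)\<^sup>2 * (\<integral>\<omega>. (cmod (\<eta> \<omega> - X \<omega>))\<^sup>2 \<partial>M)"
    by (simp add: norm_mult power_mult_distrib flip: right_diff_distrib)
  then have 2: "(\<integral>\<omega>. (cmod (c * \<eta> \<omega> - c * X \<omega>))\<^sup>2 \<partial>M) < e"
    using small[OF _ X] by simp
  show "\<exists>k X. (k, X) \<in> steps Z \<and> L2_normsq F (\<lambda>l. c *s h l - k l) < e \<and> (\<integral>\<omega>. (cmod (c * \<eta> \<omega> - X \<omega>))\<^sup>2 \<partial>M) < e"
    using steps_smult[OF kX] 1 2 by blast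
qed

lemma stoch_integral_add:
  assumes "has_stoch_integral M Z F h \<eta>" "has_stoch_integral M Z F h' \<eta>'"
  shows "has_stoch_integral M Z F (\<lambda>l. h l + h' l) (\<lambda>\<omega>. \<eta> \<omega> + \<eta>' \<omega>)"
  unfolding has_stoch_integral_iff
proof (intro conjI allI impI)
  have h: "h \<in> L2 F" "h' \<in> L2 F" and \<eta>: "square_integrable M \<eta>" "square_integrable M \<eta>'"
    using assms unfolding has_stoch_integral_iff by auto
  show "(\<lambda>l. h l + h' l) \<in> L2 F" by (rule L2_add[OF F h])
  show "square_integrable M (\<lambda>\<omega>. \<eta> \<omega> + \<eta>' \<omega>)" by (rule square_integrable_add[OF \<eta>])
  fix e :: real assume e: "0 < e"
  then have e4: "0 < e / 4" by simp
  obtain k X where kX: "(k, X) \<in> steps Z" and k: "L2_normsq F (\<lambda>l. h l - k l) < e / 4"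
    and X: "(\<integral>\<omega>. (cmod (\<eta> \<omega> - X \<omega>))\<^sup>2 \<partial>M) < e / 4"
    using assms(1) e4 unfolding has_stoch_integral_iff by blast
  obtain k' X' where kX': "(k', X') \<in> steps Z" and k': "L2_normsq F (\<lambda>l. h' l - k' l) < e / 4"
    and X': "(\<integral>\<omega>. (cmod (\<eta>' \<omega> - X' \<omega>))\<^sup>2 \<partial>M) < e / 4"
    using assms(2) e4 unfolding has_stoch_integral_iff by blast
  have "L2_normsq F (\<lambda>l. (h l - k l) + (h' l - k' l)) < e"
    using L2_normsq_add_le[OF F L2_diff[OF F h(1) steps_L2[OF kX]] L2_diff[OF F h(2) steps_L2[OF kX']]] k k' by linarith
  then have 1: "L2_normsq F (\<lambda>l. h l + h' l - (k l + k' l)) < e" by (simp add: algebra_simps)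
  have "(\<integral>\<omega>. (cmod ((\<eta> \<omega> - X \<omega>) + (\<eta>' \<omega> - X' \<omega>)))\<^sup>2 \<partial>M) < e"
    using square_integrable_norm_add_le[OF square_integrable_diff[OF \<eta>(1) steps_square_integrable[OF kX]]
        square_integrable_diff[OF \<eta>(2) steps_square_integrable[OF kX']]] X X' by linarith
  then have 2: "(\<integral>\<omega>. (cmod (\<eta> \<omega> + \<eta>' \<omega> - (X \<omega> + X' \<omega>)))\<^sup>2 \<partial>M) < e" by (simp add: algebra_simps)
  show "\<exists>k X. (k, X) \<in> steps Z \<and> L2_normsq F (\<lambda>l. h l + h' l - k l) < e \<and> (\<integral>\<omega>. (cmod (\<eta> \<omega> + \<eta>' \<omega> - X \<omega>))\<^sup>2 \<partial>M) < e"
    using steps_add[OF kX kX'] 1 2 by blast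
qed

lemma stoch_integral_diff:
  assumes "has_stoch_integral M Z F h \<eta>" "has_stoch_integral M Z F h' \<eta>'"
  shows "has_stoch_integral M Z F (\<lambda>l. h l - h' l) (\<lambda>\<omega>. \<eta> \<omega> - \<eta>' \<omega>)"
  using stoch_integral_add[OF assms(1) stoch_integral_smult[OF assms(2), of "-1"]]
  by (simp flip: vector_sneg_minus1)

lemma stoch_integral_steps:
  assumes "(k, X) \<in> steps Z"
  shows "has_stoch_integral M Z F k X"
  unfolding has_stoch_integral_iff
proof (intro conjI allI impI)
  show "k \<in> L2 F" by (rule steps_L2[OF assms])
  show "square_integrable M X" by (rule steps_square_integrable[OF assms])
  show "\<exists>k' X'. (k', X') \<in> steps Z \<and> L2_normsq F (\<lambda>l. k l - k' l) < e \<and> (\<integral>\<omega>. (cmod (X \<omega> - X' \<omega>))\<^sup>2 \<partial>M) < e"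
    if "0 < e" for e
    using assms that by (intro exI[of _ k] exI[of _ X]) simp
qed

lemma stoch_integral_zero: "has_stoch_integral M Z F (\<lambda>l. 0) (\<lambda>\<omega>. 0)"
  using stoch_integral_steps[OF stepsI[of 0]] by simp

lemma stoch_integral_sum:
  assumes "\<And>i. i \<in> I \<Longrightarrow> has_stoch_integral M Z F (h i) (\<eta> i)"
  shows "has_stoch_integral M Z F (\<lambda>l. \<Sum>i\<in>I. h i l) (\<lambda>\<omega>. \<Sum>i\<in>I. \<eta> i \<omega>)"
  using assms
  by (induction I rule: infinite_finite_induct) (auto intro: stoch_integral_add stoch_integral_zero)

lemma stoch_integral_limit:
  assumes hn: "\<And>n. has_stoch_integral M Z F (h n) (\<eta> n)" and a: "a \<in> L2 F" and X: "square_integrable M X"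
    and h: "(\<lambda>n. L2_normsq F (\<lambda>l. a l - h n l)) \<longlonglongrightarrow> 0"
    and \<eta>: "(\<lambda>n. \<integral>\<omega>. (cmod (\<eta> n \<omega> - X \<omega>))\<^sup>2 \<partial>M) \<longlonglongrightarrow> 0"
  shows "has_stoch_integral M Z F a X"
  unfolding has_stoch_integral_iff
proof (intro conjI allI impI a X)
  fix e :: real assume e: "0 < e"
  then have e4: "0 < e / 4" by simp
  have "\<forall>\<^sub>F n in sequentially. L2_normsq F (\<lambda>l. a l - h n l) < e / 4 \<and> (\<integral>\<omega>. (cmod (\<eta> n \<omega> - X \<omega>))\<^sup>2 \<partial>M) < e / 4"
    using order_tendstoD(2)[OF h e4] order_tendstoD(2)[OF \<eta> e4] by (rule eventually_conj)
  then obtain n where n: "L2_normsq F (\<lambda>l. a l - h n l) < e / 4" "(\<integral>\<omega>. (cmod (\<eta> n \<omega> - X \<omega>))\<^sup>2 \<partial>M) < e / 4"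
    by (auto simp: eventually_sequentially)
  obtain k Y where kY: "(k, Y) \<in> steps Z" and k: "L2_normsq F (\<lambda>l. h n l - k l) < e / 4"
    and Y: "(\<integral>\<omega>. (cmod (\<eta> n \<omega> - Y \<omega>))\<^sup>2 \<partial>M) < e / 4"
    using hn[of n] e4 unfolding has_stoch_integral_iff by blast
  have hL: "h n \<in> L2 F" and \<eta>L: "square_integrable M (\<eta> n)"
    using hn[of n] unfolding has_stoch_integral_iff by auto
  have 1: "L2_normsq F (\<lambda>l. a l - k l) < e"
    using L2_normsq_triangle[OF F a hL steps_L2[OF kY]] n(1) k by linarith
  have "(\<integral>\<omega>. (cmod ((X \<omega> - \<eta> n \<omega>) + (\<eta> n \<omega> - Y \<omega>)))\<^sup>2 \<partial>M) < e"
    using square_integrable_norm_add_le[OF square_integrable_diff[OF X \<eta>L]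
        square_integrable_diff[OF \<eta>L steps_square_integrable[OF kY]]] n(2) Y
    unfolding norm_minus_commute[of "X _"] by linarith
  then have "(\<integral>\<omega>. (cmod (X \<omega> - Y \<omega>))\<^sup>2 \<partial>M) < e" by simp
  with 1 kY show "\<exists>k Y. (k, Y) \<in> steps Z \<and> L2_normsq F (\<lambda>l. a l - k l) < e \<and> (\<integral>\<omega>. (cmod (X \<omega> - Y \<omega>))\<^sup>2 \<partial>M) < e"
    by blast
qed

text \<open>The isometry carries the Cauchy property from the integrands to the random variables,
  and completeness in mean square supplies the integral of the limit.\<close>

lemma stoch_integral_of_limit:
  assumes hn: "\<And>n::nat. has_stoch_integral M Z F (h n) (\<eta> n)" and a: "a \<in> L2 F"
    and h: "(\<lambda>n. L2_normsq F (\<lambda>l. a l - h n l)) \<longlonglongrightarrow> 0"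
  obtains X where "has_stoch_integral M Z F a X" "square_integrable M X"
    "(\<lambda>n. \<integral>\<omega>. (cmod (\<eta> n \<omega> - X \<omega>))\<^sup>2 \<partial>M) \<longlonglongrightarrow> 0"
proof -
  have hL: "h n \<in> L2 F" and \<eta>L: "square_integrable M (\<eta> n)" for n
    using hn[of n] unfolding has_stoch_integral_iff by auto
  obtain X where X: "square_integrable M X" "(\<lambda>n. \<integral>\<omega>. (cmod (\<eta> n \<omega> - X \<omega>))\<^sup>2 \<partial>M) \<longlonglongrightarrow> 0"
  proof (rule square_integrable_complete[of M \<eta>, OF \<eta>L])
    fix e :: real assume "0 < e"
    then have "0 < e / 4" by simp
    from order_tendstoD(2)[OF h this] obtain N where N: "\<And>n. N \<le> n \<Longrightarrow> L2_normsq F (\<lambda>l. a l - h n l) < e / 4"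
      by (auto simp: eventually_sequentially)
    have "(\<integral>\<omega>. (cmod (\<eta> m \<omega> - \<eta> n \<omega>))\<^sup>2 \<partial>M) < e" if "N \<le> m" "N \<le> n" for m n
    proof -
      have "(\<integral>\<omega>. (cmod (\<eta> m \<omega> - \<eta> n \<omega>))\<^sup>2 \<partial>M) = L2_normsq F (\<lambda>l. h m l - h n l) / (2 * pi)"
        by (rule stoch_integral_isometry[OF stoch_integral_diff[OF hn hn]])
      also have "\<dots> \<le> L2_normsq F (\<lambda>l. h m l - h n l) / 1"
        using L2_normsq_nonneg[OF F] pi_gt3 by (intro divide_left_mono) auto
      also have "\<dots> < e"
        using L2_normsq_triangle[OF F hL[of m] a hL[of n]] N[OF that(1)] N[OF that(2)]
          L2_normsq_minus_commute[OF F, of a "h m"] by simp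
      finally show ?thesis .
    qed
    then show "\<exists>N. \<forall>m\<ge>N. \<forall>n\<ge>N. (\<integral>\<omega>. (cmod (\<eta> m \<omega> - \<eta> n \<omega>))\<^sup>2 \<partial>M) < e" by blast
  qed blast
  show thesis
    by (rule that[OF stoch_integral_limit[OF hn a X(1) h X(2)] X])
qed

end

section \<open>Existence of stochastic integrals\<close>

lemma norm_vec_le_sum: "norm x \<le> (\<Sum>i\<in>UNIV. cmod (x $ i))" for x :: "complex^'t"
  unfolding norm_vec_def by (rule L2_set_le_sum) simp

lemma steps_finite_sum:
  assumes "finite R" "\<And>y. y \<in> R \<Longrightarrow> A y \<in> sets borel" "\<And>y. y \<in> R \<Longrightarrow> A y \<subseteq> {-pi..pi}"
  shows "\<exists>X. ((\<lambda>l. \<Sum>y\<in>R. indicat_real (A y) l *\<^sub>R d y), X) \<in> steps Z"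
  using assms
proof (induction R rule: finite_induct)
  case empty
  show ?case using stepsI[of 0] by fastforce
next
  case (insert y R)
  then obtain X where "((\<lambda>l. \<Sum>y\<in>R. indicat_real (A y) l *\<^sub>R d y), X) \<in> steps Z" by auto
  from steps_add[OF steps_single[of "A y" "d y" Z] this] insert.prems show ?case
    unfolding sum.insert[OF insert.hyps] by blast
qed

text \<open>Simple functions bounded by twice the norm of \<open>b\<close> differ from it by at most
  \<open>3 * K\<close>, so dominated convergence works against an integrable weight that may be
  unbounded.\<close>

lemma steps_approx:
  fixes b :: "real \<Rightarrow> complex^'t"
  assumes F: "weight F" and b: "b \<in> borel_measurable circle" and K: "\<And>l. norm (b l) \<le> K" and e: "0 < e"
  shows "\<exists>k X. (k, X) \<in> steps Z \<and> L2_normsq F (\<lambda>l. b l - k l) < e"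
proof -
  obtain s where s0: "\<forall>n. simple_function circle (s n)"
    "\<forall>l\<in>space circle. (\<lambda>n. s n l) \<longlonglongrightarrow> b l"
    "\<forall>n. \<forall>l\<in>space circle. dist (s n l) 0 \<le> 2 * dist (b l) 0"
    using borel_measurable_implies_sequence_metric[OF b, of 0] by blast
  have s: "simple_function circle (s n)" "l \<in> {-pi..pi} \<Longrightarrow> (\<lambda>n. s n l) \<longlonglongrightarrow> b l"
    "l \<in> {-pi..pi} \<Longrightarrow> norm (s n l) \<le> 2 * norm (b l)" for n l
    using s0 by auto
  define d where "d n l = b l - s n l" for n l
  have sm: "s n \<in> borel_measurable circle" for n using s(1) by (rule borel_measurable_simple_function)
  have dm: "d n \<in> borel_measurable circle" for n unfolding d_def using b sm by measurable
  have qd: "norm (qnorm (F l) (d n l)) \<le> entry_sum (F l) * (norm (d n l) * norm (d n l))" for n l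
  proof -
    have "norm (qnorm (F l) (d n l)) \<le> cmod (qform (F l) (d n l) (d n l))" by (simp add: abs_Re_le_cmod)
    also have "\<dots> \<le> entry_sum (F l) * (norm (d n l) * norm (d n l))"
      by (rule qform_le_entry_sum) (rule Finite_Cartesian_Product.norm_nth_le)+
    finally show ?thesis .
  qed
  have "(\<lambda>n. L2_normsq F (d n)) \<longlonglongrightarrow> (\<integral>l. 0 \<partial>circle)"
    unfolding L2_normsq_circle
  proof (rule integral_dominated_convergence)
    show "integrable circle (\<lambda>l. entry_sum (F l) * (3 * K * (3 * K)))"
      using weight_entry_sum[OF F] by simp
    show "(\<lambda>l. qnorm (F l) (d n l)) \<in> borel_measurable circle" for n
      using qform_measurable[OF F dm dm] by measurable
    show "AE l in circle. norm (qnorm (F l) (d n l)) \<le> entry_sum (F l) * (3 * K * (3 * K))" for n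
    proof (rule AE_I2)
      fix l assume "l \<in> space circle"
      then have "norm (d n l) \<le> norm (b l) + 2 * norm (b l)"
        unfolding d_def using s(3)[of l n] by (intro norm_triangle_le_diff) auto
      also have "\<dots> \<le> 3 * K" using K[of l] by simp
      moreover have "0 \<le> K" using order_trans[OF norm_ge_zero K] .
      ultimately have "entry_sum (F l) * (norm (d n l) * norm (d n l)) \<le> entry_sum (F l) * (3 * K * (3 * K))"
        by (intro mult_left_mono mult_mono entry_sum_nonneg) auto
      with qd show "norm (qnorm (F l) (d n l)) \<le> entry_sum (F l) * (3 * K * (3 * K))"
        using order_trans by blast
    qed
    show "AE l in circle. (\<lambda>n. qnorm (F l) (d n l)) \<longlonglongrightarrow> 0"
    proof (rule AE_I2)
      fix l assume "l \<in> space circle"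
      then have "(\<lambda>n. entry_sum (F l) * (norm (d n l) * norm (d n l)))
          \<longlonglongrightarrow> entry_sum (F l) * (norm (b l - b l) * norm (b l - b l))"
        unfolding d_def using s(2) by (intro tendsto_intros) auto
      then have to0: "(\<lambda>n. entry_sum (F l) * (norm (d n l) * norm (d n l))) \<longlonglongrightarrow> 0" by simp
      have "(\<lambda>n. norm (qnorm (F l) (d n l))) \<longlonglongrightarrow> 0"
      proof (rule tendsto_sandwich[OF _ _ tendsto_const to0])
        show "\<forall>\<^sub>F n in sequentially. norm (qnorm (F l) (d n l)) \<le> entry_sum (F l) * (norm (d n l) * norm (d n l))"
          by (intro always_eventually allI qd)
      qed simp
      then show "(\<lambda>n. qnorm (F l) (d n l)) \<longlonglongrightarrow> 0" by (rule tendsto_norm_zero_cancel)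
    qed
  qed auto
  then have "\<forall>\<^sub>F n in sequentially. L2_normsq F (d n) < e"
    using e by (auto dest: order_tendstoD)
  then obtain n where n: "L2_normsq F (d n) < e" by (auto simp: eventually_sequentially)
  \<comment> \<open>The level sets of the simple function, indexed by its finitely many values, give
    the representation as a sum of indicators.\<close>
  define R where "R = s n ` {-pi..pi}"
  have R: "finite R" using s(1)[of n] by (simp add: R_def simple_function_def)
  define A where "A y = s n -` {y} \<inter> {-pi..pi}" for y
  have A: "A y \<in> sets borel" "A y \<subseteq> {-pi..pi}" for y
  proof -
    have "s n -` {y} \<inter> space circle \<in> sets circle" by (rule simple_functionD(2)[OF s(1)])
    then show "A y \<in> sets borel" by (auto simp: A_def sets_restrict_space_iff)
  qed (simp add: A_def)
  obtain X where X: "((\<lambda>l. \<Sum>y\<in>R. indicat_real (A y) l *\<^sub>R y), X) \<in> steps Z"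
    using steps_finite_sum[of R A, OF R A, where d = "\<lambda>y. y" and Z = Z] by auto
  have eq: "(\<Sum>y\<in>R. indicat_real (A y) l *\<^sub>R y) = s n l" if l: "l \<in> {-pi..pi}" for l
  proof -
    have "(\<Sum>y\<in>R. indicat_real (A y) l *\<^sub>R y) = (\<Sum>y\<in>R. if y = s n l then y else 0)"
      using l by (intro sum.cong) (auto simp: A_def indicator_def)
    then show ?thesis using R l by (simp add: R_def)
  qed
  have "L2_normsq F (\<lambda>l. b l - (\<Sum>y\<in>R. indicat_real (A y) l *\<^sub>R y)) = L2_normsq F (d n)"
    unfolding L2_normsq_circle d_def by (intro Bochner_Integration.integral_cong) (auto simp: eq)
  with n X show ?thesis by auto
qed

lemma steps_approx_span:
  fixes F :: "real \<Rightarrow> complex^'t^'t"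
  assumes F: "weight F" and h: "h \<in> L2_span F S" and e: "0 < e"
  shows "\<exists>k X. (k, X) \<in> steps Z \<and> L2_normsq F (\<lambda>l. h l - k l) < e"
proof -
  have e4: "0 < e / 4" using e by simp
  obtain J \<beta> where J: "L2_normsq F (\<lambda>l. h l - trig_poly J \<beta> l) < e / 4"
    by (rule L2_span_approx[OF h e4])
  have "norm (trig_poly J \<beta> l) \<le> (\<Sum>p\<in>(UNIV :: 't set). \<Sum>i\<in>UNIV. \<Sum>j\<in>J. cmod (\<beta> j $ i))" for l
    by (rule order_trans[OF norm_vec_le_sum], rule sum_mono, rule trig_poly_bound)
  from steps_approx[OF F trig_poly_measurable this e4] obtain k X where kX: "(k, X) \<in> steps Z"
    and k: "L2_normsq F (\<lambda>l. trig_poly J \<beta> l - k l) < e / 4" by blast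
  have "k \<in> L2 F"
    using steps_bounded_measurable[OF kX] L2_bounded[OF F, of k] by auto
  with L2_normsq_triangle[OF F L2_span_L2[OF h] trig_poly_L2[OF F] this, of J \<beta>] J k
  have "L2_normsq F (\<lambda>l. h l - k l) < e" by linarith
  with kX show ?thesis by blast
qed

text \<open>A member of the closed span may be unbounded, but it is a limit of trigonometric
  polynomials, which are bounded and hence limits of step functions.\<close>

lemma stoch_integral_exists:
  assumes Z: "orthogonal_measure M Z F" and F: "weight F" and h: "h \<in> L2_span F S"
  obtains \<eta> where "has_stoch_integral M Z F h \<eta>"
proof -
  have "\<exists>p. p \<in> steps Z \<and> L2_normsq F (\<lambda>l. h l - fst p l) < 1 / real (Suc n)" for n
  proof -
    have "0 < 1 / real (Suc n)" by simp
    from steps_approx_span[OF F h this, of Z] show ?thesis by auto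
  qed
  then obtain p where p: "\<And>n. p n \<in> steps Z" "\<And>n. L2_normsq F (\<lambda>l. h l - fst (p n) l) < 1 / real (Suc n)"
    by metis
  have st: "has_stoch_integral M Z F (fst (p n)) (snd (p n))" for n
    by (rule stoch_integral_steps[OF Z F]) (use p(1) in simp)
  have "(\<lambda>n. L2_normsq F (\<lambda>l. h l - fst (p n) l)) \<longlonglongrightarrow> 0"
  proof (rule tendsto_sandwich[OF _ _ tendsto_const])
    show "(\<lambda>n. 1 / real (Suc n)) \<longlonglongrightarrow> 0" using LIMSEQ_Suc[OF lim_1_over_n] by simp
    show "\<forall>\<^sub>F n in sequentially. L2_normsq F (\<lambda>l. h l - fst (p n) l) \<le> 1 / real (Suc n)"
      by (intro always_eventually allI less_imp_le p)
    show "\<forall>\<^sub>F n in sequentially. 0 \<le> L2_normsq F (\<lambda>l. h l - fst (p n) l)"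
      by (intro always_eventually allI L2_normsq_nonneg F)
  qed
  from stoch_integral_of_limit[OF Z F st L2_span_L2[OF h] this] that show thesis by blast
qed

section \<open>Spectral representations and uncorrelated measures\<close>

lemma stoch_integral_trig:
  assumes X: "spectral_representation M Z f X" and f: "weight f"
  shows "has_stoch_integral M Z f (\<lambda>l. unit_char n l *s b) (\<lambda>\<omega>. vdot b (X n \<omega>))"
proof -
  have Z: "orthogonal_measure M Z f" and
    ax: "\<And>n p. has_stoch_integral M Z f (\<lambda>l. axis p (unit_char n l)) (\<lambda>\<omega>. X n \<omega> $ p)"
    using X random_spectral_measure_orthogonal unfolding spectral_representation_def unit_char_def by auto
  have "has_stoch_integral M Z f (\<lambda>l. \<Sum>p\<in>UNIV. b $ p *s axis p (unit_char n l)) (\<lambda>\<omega>. \<Sum>p\<in>UNIV. b $ p * X n \<omega> $ p)"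
    by (intro stoch_integral_sum[OF Z f] stoch_integral_smult[OF Z f] ax)
  moreover have "(\<Sum>p\<in>UNIV. b $ p *s axis p (unit_char n l)) = unit_char n l *s b" for l
    by (simp add: vec_eq_iff axis_def if_distrib mult.commute cong: if_cong)
  ultimately show ?thesis by (simp add: vdot_def)
qed

lemma stoch_integral_trig_poly:
  assumes X: "spectral_representation M Z f X" and f: "weight f"
  shows "has_stoch_integral M Z f (trig_poly J \<beta>) (\<lambda>\<omega>. \<Sum>j\<in>J. vdot (\<beta> j) (X j \<omega>))"
proof -
  have "orthogonal_measure M Z f"
    using X random_spectral_measure_orthogonal unfolding spectral_representation_def by auto
  then have "has_stoch_integral M Z f (\<lambda>l. \<Sum>j\<in>J. unit_char j l *s \<beta> j) (\<lambda>\<omega>. \<Sum>j\<in>J. vdot (\<beta> j) (X j \<omega>))"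
    by (intro stoch_integral_sum[OF _ f] stoch_integral_trig[OF X f])
  then show ?thesis by (simp only: trig_poly_unit_char[abs_def])
qed

text \<open>A converse of the spectral representation: trigonometric polynomials approximate the
  indicator of \<open>A\<close> in \<open>L2 f\<close>, so by the isometry \<open>Z A\<close> is a
  mean-square limit of linear combinations of the sequence. Second-order facts about the sequence
  thereby pass to its measure.\<close>

lemma spectral_measure_approx:
  fixes Z :: "real set \<Rightarrow> 'a \<Rightarrow> complex^'t"
  assumes X: "spectral_representation M Z f X" and f: "weight f" and A: "A \<in> sets borel" "A \<subseteq> {-pi..pi}"
  obtains J \<beta> where "(\<lambda>n. \<integral>\<omega>. (cmod ((\<Sum>j\<in>J n. vdot (\<beta> n j) (X j \<omega>)) - Z A \<omega> $ p))\<^sup>2 \<partial>M) \<longlonglongrightarrow> 0"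
proof -
  have Z: "orthogonal_measure M Z f"
    using X random_spectral_measure_orthogonal unfolding spectral_representation_def by auto
  define k where "k l = indicat_real A l *\<^sub>R (axis p 1 :: complex^'t)" for l
  have "(k, \<lambda>\<omega>. vdot (axis p 1) (Z A \<omega>)) \<in> steps Z"
    unfolding k_def by (rule steps_single[OF A])
  then have kX: "(k, \<lambda>\<omega>. Z A \<omega> $ p) \<in> steps Z" by (simp add: vdot_commute[of "axis p 1"] vdot_axis)
  obtain K where K: "\<And>l i. cmod (k l $ i) \<le> K" using steps_bounded_measurable(2)[OF kX] by blast
  have "\<exists>J \<beta>. L2_normsq f (\<lambda>l. k l - trig_poly J \<beta> l) < 1 / real (Suc n)" for n
  proof -
    have pos: "0 < 1 / real (Suc n)" by simp
    have "AE l in circle. \<forall>i. cmod (k l $ i) \<le> K" using K by simp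
    then show ?thesis
      by (rule bounded_trig_approx[OF f steps_bounded_measurable(1)[OF kX] _ pos]) blast
  qed
  then obtain J \<beta> where J: "\<And>n. L2_normsq f (\<lambda>l. k l - trig_poly (J n) (\<beta> n) l) < 1 / real (Suc n)"
    by metis
  have le: "(\<integral>\<omega>. (cmod ((\<Sum>j\<in>J n. vdot (\<beta> n j) (X j \<omega>)) - Z A \<omega> $ p))\<^sup>2 \<partial>M) \<le> 1 / real (Suc n)" for n
  proof -
    have "(\<integral>\<omega>. (cmod ((\<Sum>j\<in>J n. vdot (\<beta> n j) (X j \<omega>)) - Z A \<omega> $ p))\<^sup>2 \<partial>M)
        = L2_normsq f (\<lambda>l. trig_poly (J n) (\<beta> n) l - k l) / (2 * pi)"
      by (rule stoch_integral_isometry[OF Z f stoch_integral_diff[OF Z f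
            stoch_integral_trig_poly[OF X f] stoch_integral_steps[OF Z f kX]]])
    also have "\<dots> \<le> L2_normsq f (\<lambda>l. trig_poly (J n) (\<beta> n) l - k l) / 1"
      using L2_normsq_nonneg[OF f] pi_gt3 by (intro divide_left_mono) auto
    also have "\<dots> \<le> 1 / real (Suc n)"
      using J[of n] L2_normsq_minus_commute[OF f, of k] by simp
    finally show ?thesis .
  qed
  have inv0: "(\<lambda>n. 1 / real (Suc n)) \<longlonglongrightarrow> 0" using LIMSEQ_Suc[OF lim_1_over_n] by simp
  have "(\<lambda>n. \<integral>\<omega>. (cmod ((\<Sum>j\<in>J n. vdot (\<beta> n j) (X j \<omega>)) - Z A \<omega> $ p))\<^sup>2 \<partial>M) \<longlonglongrightarrow> 0"
  proof (rule tendsto_sandwich[OF _ _ tendsto_const inv0])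
    show "\<forall>\<^sub>F n in sequentially. (\<integral>\<omega>. (cmod ((\<Sum>j\<in>J n. vdot (\<beta> n j) (X j \<omega>)) - Z A \<omega> $ p))\<^sup>2 \<partial>M) \<le> 1 / real (Suc n)"
      by (intro always_eventually allI le)
  qed simp
  then show thesis by (rule that)
qed

text \<open>Each measure lies in the mean-square closure of its own sequence; the limit is taken in
  one argument of the inner product at a time.\<close>

lemma spectral_measures_uncorrelated:
  fixes X Y :: "int \<Rightarrow> 'a \<Rightarrow> complex^'t"
  assumes X: "spectral_representation M Z f X" and f: "weight f"
    and Y: "spectral_representation M Z' g Y" and g: "weight g"
    and unc: "\<And>n m p q. (\<integral>\<omega>. X n \<omega> $ p * cnj (Y m \<omega> $ q) \<partial>M) = 0"
    and A: "A \<in> sets borel" "A \<subseteq> {-pi..pi}" and B: "B \<in> sets borel" "B \<subseteq> {-pi..pi}"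
  shows "(\<integral>\<omega>. Z A \<omega> $ p * cnj (Z' B \<omega> $ q) \<partial>M) = 0"
proof -
  have ZA: "square_integrable M (\<lambda>\<omega>. Z A \<omega> $ p)" and ZB: "square_integrable M (\<lambda>\<omega>. Z' B \<omega> $ q)"
    using X Y A B random_spectral_measure_orthogonal
    unfolding spectral_representation_def orthogonal_measure_def by blast+
  have Xs: "square_integrable M (\<lambda>\<omega>. X n \<omega> $ p)" and Ys: "square_integrable M (\<lambda>\<omega>. Y n \<omega> $ p)" for n p
    using X Y unfolding spectral_representation_def has_stoch_integral_iff by auto
  have XS: "square_integrable M (\<lambda>\<omega>. \<Sum>j\<in>J. vdot (\<beta> j) (X j \<omega>))"
    and YS: "square_integrable M (\<lambda>\<omega>. \<Sum>j\<in>J. vdot (\<beta> j) (Y j \<omega>))" for J \<beta>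
    unfolding vdot_def by (intro square_integrable_sum square_integrable_cmult Xs Ys)+
  have XY: "(\<integral>\<omega>. (\<Sum>j\<in>J. vdot (\<beta> j) (X j \<omega>)) * cnj (\<Sum>j\<in>I. vdot (\<gamma> j) (Y j \<omega>)) \<partial>M) = 0" for J I \<beta> \<gamma>
  proof -
    have v: "(\<integral>\<omega>. vdot b (X j \<omega>) * cnj (vdot d (Y m \<omega>)) \<partial>M) = 0" for b d j m
    proof -
      have "(\<integral>\<omega>. vdot b (X j \<omega>) * cnj (vdot d (Y m \<omega>)) \<partial>M)
          = (\<integral>\<omega>. (\<Sum>p\<in>UNIV. \<Sum>q\<in>UNIV. (b $ p * cnj (d $ q)) * (X j \<omega> $ p * cnj (Y m \<omega> $ q))) \<partial>M)"
        unfolding vdot_def cnj_sum sum_product by (simp add: mult_ac)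
      also have "\<dots> = (\<Sum>p\<in>UNIV. \<Sum>q\<in>UNIV. \<integral>\<omega>. (b $ p * cnj (d $ q)) * (X j \<omega> $ p * cnj (Y m \<omega> $ q)) \<partial>M)"
        by (intro integral_double_sum integrable_mult_right square_integrable_mult_cnj Xs Ys)
      finally show ?thesis by (simp add: unc)
    qed
    have vs: "square_integrable M (\<lambda>\<omega>. vdot b (X j \<omega>))" "square_integrable M (\<lambda>\<omega>. vdot b (Y j \<omega>))" for b j
      unfolding vdot_def by (intro square_integrable_sum square_integrable_cmult Xs Ys)+
    have "(\<integral>\<omega>. (\<Sum>j\<in>J. vdot (\<beta> j) (X j \<omega>)) * cnj (\<Sum>j\<in>I. vdot (\<gamma> j) (Y j \<omega>)) \<partial>M)
        = (\<integral>\<omega>. (\<Sum>j\<in>J. \<Sum>i\<in>I. vdot (\<beta> j) (X j \<omega>) * cnj (vdot (\<gamma> i) (Y i \<omega>))) \<partial>M)"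
      unfolding cnj_sum sum_product ..
    also have "\<dots> = (\<Sum>j\<in>J. \<Sum>i\<in>I. \<integral>\<omega>. vdot (\<beta> j) (X j \<omega>) * cnj (vdot (\<gamma> i) (Y i \<omega>)) \<partial>M)"
      by (intro integral_double_sum square_integrable_mult_cnj vs)
    finally show ?thesis by (simp add: v)
  qed
  obtain J \<beta> where J: "(\<lambda>n. \<integral>\<omega>. (cmod ((\<Sum>j\<in>J n. vdot (\<beta> n j) (X j \<omega>)) - Z A \<omega> $ p))\<^sup>2 \<partial>M) \<longlonglongrightarrow> 0"
    by (rule spectral_measure_approx[OF X f A])
  obtain I \<gamma> where I: "(\<lambda>n. \<integral>\<omega>. (cmod ((\<Sum>j\<in>I n. vdot (\<gamma> n j) (Y j \<omega>)) - Z' B \<omega> $ q))\<^sup>2 \<partial>M) \<longlonglongrightarrow> 0"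
    by (rule spectral_measure_approx[OF Y g B])
  have 1: "(\<integral>\<omega>. Z A \<omega> $ p * cnj (\<Sum>j\<in>I n. vdot (\<gamma> n j) (Y j \<omega>)) \<partial>M) = 0" for n
    using square_integrable_inner_tendsto[OF XS ZA YS[of "\<gamma> n" "I n"] J] by (simp only: XY LIMSEQ_const_iff)
  have "(\<integral>\<omega>. (\<Sum>j\<in>I n. vdot (\<gamma> n j) (Y j \<omega>)) * cnj (Z A \<omega> $ p) \<partial>M) = 0" for n
  proof -
    have "(\<integral>\<omega>. (\<Sum>j\<in>I n. vdot (\<gamma> n j) (Y j \<omega>)) * cnj (Z A \<omega> $ p) \<partial>M)
        = cnj (\<integral>\<omega>. Z A \<omega> $ p * cnj (\<Sum>j\<in>I n. vdot (\<gamma> n j) (Y j \<omega>)) \<partial>M)"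
      unfolding Bochner_Integration.integral_cnj[symmetric] by (simp add: mult.commute)
    then show ?thesis using 1 by simp
  qed
  then have "(\<integral>\<omega>. Z' B \<omega> $ q * cnj (Z A \<omega> $ p) \<partial>M) = 0"
    using square_integrable_inner_tendsto[OF YS ZB ZA I] by (simp only: LIMSEQ_const_iff)
  moreover have "(\<integral>\<omega>. Z A \<omega> $ p * cnj (Z' B \<omega> $ q) \<partial>M) = cnj (\<integral>\<omega>. Z' B \<omega> $ q * cnj (Z A \<omega> $ p) \<partial>M)"
    unfolding Bochner_Integration.integral_cnj[symmetric] by (simp add: mult.commute)
  ultimately show ?thesis by simp
qed

text \<open>Two uncorrelated measures are handled as one measure with values in a direct sum, whose density
  is block diagonal.\<close>

definition vec_pair :: "complex^'m \<Rightarrow> complex^'n \<Rightarrow> complex^('m + 'n)" where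
  "vec_pair a b = (\<chi> i. case i of Inl p \<Rightarrow> a $ p | Inr q \<Rightarrow> b $ q)"

definition block_diag :: "complex^'m^'m \<Rightarrow> complex^'n^'n \<Rightarrow> complex^('m + 'n)^('m + 'n)" where
  "block_diag F G = (\<chi> i j. case i of Inl p \<Rightarrow> (case j of Inl q \<Rightarrow> F $ p $ q | Inr q \<Rightarrow> 0)
     | Inr p \<Rightarrow> (case j of Inl q \<Rightarrow> 0 | Inr q \<Rightarrow> G $ p $ q))"

lemma vec_pair_nth [simp]: "vec_pair a b $ Inl p = a $ p" "vec_pair a b $ Inr q = b $ q"
  by (simp_all add: vec_pair_def)

lemma block_diag_nth [simp]:
  "block_diag F G $ Inl p $ Inl p' = F $ p $ p'" "block_diag F G $ Inl p $ Inr q = 0"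
  "block_diag F G $ Inr q $ Inl p = 0" "block_diag F G $ Inr q $ Inr q' = G $ q $ q'"
  by (simp_all add: block_diag_def)

lemma sum_UNIV_plus: "(\<Sum>i\<in>UNIV. u i) = (\<Sum>p\<in>UNIV. u (Inl p)) + (\<Sum>q\<in>UNIV. u (Inr q))"
  for u :: "'m::finite + 'n::finite \<Rightarrow> 'b::comm_monoid_add"
proof -
  have "sum u (UNIV <+> UNIV) = (\<Sum>p\<in>UNIV. u (Inl p)) + (\<Sum>q\<in>UNIV. u (Inr q))"
    by (subst sum.Plus) simp_all
  then show ?thesis by simp
qed

lemma all_sum_iff: "(\<forall>i. P i) \<longleftrightarrow> (\<forall>p. P (Inl p)) \<and> (\<forall>q. P (Inr q))"
  by (metis sum.exhaust)

lemma vec_pair_diff: "vec_pair a b - vec_pair c d = vec_pair (a - c) (b - d)"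
  by (simp add: vec_eq_iff all_sum_iff)

lemma vec_pair_surj: "v = vec_pair (\<chi> p. v $ Inl p) (\<chi> q. v $ Inr q)"
  by (simp add: vec_eq_iff all_sum_iff)

lemma vdot_vec_pair: "vdot (vec_pair a b) (vec_pair c d) = vdot a c + vdot b d"
  by (simp add: vdot_def sum_UNIV_plus)

lemma qform_block_diag: "qform (block_diag F G) (vec_pair a b) (vec_pair c d) = qform F a c + qform G b d"
  by (simp add: qform_expand sum_UNIV_plus)

lemma hermitian_psd_block_diag:
  assumes "hermitian_psd F" "hermitian_psd G" shows "hermitian_psd (block_diag F G)"
proof -
  have F: "F $ i $ j = cnj (F $ j $ i)" for i j using assms(1) unfolding hermitian_psd_def by blast
  have G: "G $ i $ j = cnj (G $ j $ i)" for i j using assms(2) unfolding hermitian_psd_def by blast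
  have "block_diag F G $ i $ j = cnj (block_diag F G $ j $ i)" for i j
    by (cases i; cases j) (simp_all, (rule F G)+)
  moreover have "0 \<le> qnorm (block_diag F G) v" for v
    using qnorm_nonneg[OF assms(1)] qnorm_nonneg[OF assms(2)]
    by (subst (1 2) vec_pair_surj[of v]) (simp add: qform_block_diag)
  ultimately show ?thesis unfolding hermitian_psd_def by blast
qed

lemma weight_block_diag:
  assumes F: "weight F" and G: "weight G"
  shows "weight (\<lambda>l. block_diag (F l) (G l))"
  unfolding weight_def all_sum_iff
proof (intro conjI allI)
  show "AE l in circle. hermitian_psd (block_diag (F l) (G l))"
    using weight_hermitian[OF F] weight_hermitian[OF G] by eventually_elim (rule hermitian_psd_block_diag)
qed (simp_all add: weight_integrable F G)

lemma L2_block_diag: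
  assumes a: "a \<in> L2 F" and b: "b \<in> L2 G"
  shows "(\<lambda>l. vec_pair (a l) (b l)) \<in> L2 (\<lambda>l. block_diag (F l) (G l))"
    and "L2_normsq (\<lambda>l. block_diag (F l) (G l)) (\<lambda>l. vec_pair (a l) (b l)) = L2_normsq F a + L2_normsq G b"
proof -
  have "(\<lambda>l. vec_pair (a l) (b l)) \<in> borel_measurable circle"
    unfolding borel_measurable_vec_iff all_sum_iff
    using L2_measurable[OF a] L2_measurable[OF b] by simp measurable
  then show "(\<lambda>l. vec_pair (a l) (b l)) \<in> L2 (\<lambda>l. block_diag (F l) (G l))"
    using a b by (simp add: L2_iff qform_block_diag)
  show "L2_normsq (\<lambda>l. block_diag (F l) (G l)) (\<lambda>l. vec_pair (a l) (b l)) = L2_normsq F a + L2_normsq G b"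
    using L2_integrable[OF a] L2_integrable[OF b] by (simp add: L2_normsq_circle qform_block_diag)
qed

lemma L2_summand:
  fixes f g :: "real \<Rightarrow> complex^'t^'t"
  assumes f: "weight f" and g: "weight g" and h: "h \<in> L2 (\<lambda>l. f l + g l)"
  shows "h \<in> L2 f" and "h \<in> L2 g"
proof -
  have *: "h \<in> L2 f'" if "weight f'" "weight g'" "h \<in> L2 (\<lambda>l. f' l + g' l)" for f' g' :: "real \<Rightarrow> complex^'t^'t"
  proof (rule L2I[OF that(1) L2_measurable[OF that(3)] L2_integrable[OF that(3)]])
    show "AE l in circle. qnorm (f' l) (h l) \<le> qnorm (f' l + g' l) (h l)"
      using weight_hermitian[OF that(2)]
    proof eventually_elim
      case (elim l)
      from qnorm_nonneg[OF this, of "h l"] show ?case by (simp add: qform_add_mat)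
    qed
  qed
  show "h \<in> L2 f" by (rule *[OF f g h])
  show "h \<in> L2 g" by (rule *[OF g f]) (use h in \<open>simp add: add.commute\<close>)
qed

context
  fixes M :: "'a measure" and X Y :: "int \<Rightarrow> 'a \<Rightarrow> complex^'t"
    and Z1 Z2 :: "real set \<Rightarrow> 'a \<Rightarrow> complex^'t" and f g :: "real \<Rightarrow> complex^'t^'t"
  assumes X: "spectral_representation M Z1 f X" and f: "weight f"
    and Y: "spectral_representation M Z2 g Y" and g: "weight g"
    and unc: "\<And>n m p q. (\<integral>\<omega>. X n \<omega> $ p * cnj (Y m \<omega> $ q) \<partial>M) = 0"
begin

lemma Z12: "orthogonal_measure M Z1 f" "orthogonal_measure M Z2 g"
  using X Y random_spectral_measure_orthogonal unfolding spectral_representation_def by auto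

lemma cross_zero:
  assumes A: "A \<in> sets borel" "A \<subseteq> {-pi..pi}" and B: "B \<in> sets borel" "B \<subseteq> {-pi..pi}"
  shows "(\<integral>\<omega>. Z1 A \<omega> $ p * cnj (Z2 B \<omega> $ q) \<partial>M) = 0" "(\<integral>\<omega>. Z2 A \<omega> $ p * cnj (Z1 B \<omega> $ q) \<partial>M) = 0"
proof -
  have *: "(\<integral>\<omega>. Z1 A \<omega> $ p * cnj (Z2 B \<omega> $ q) \<partial>M) = 0" if A: "A \<in> sets borel" "A \<subseteq> {-pi..pi}" and B: "B \<in> sets borel" "B \<subseteq> {-pi..pi}" for A B p q
    by (rule spectral_measures_uncorrelated[OF X f Y g unc A B])
  show "(\<integral>\<omega>. Z1 A \<omega> $ p * cnj (Z2 B \<omega> $ q) \<partial>M) = 0" by (rule *[OF A B])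
  have "(\<integral>\<omega>. Z2 A \<omega> $ p * cnj (Z1 B \<omega> $ q) \<partial>M) = cnj (\<integral>\<omega>. Z1 B \<omega> $ q * cnj (Z2 A \<omega> $ p) \<partial>M)"
    unfolding Bochner_Integration.integral_cnj[symmetric] by (simp add: mult.commute)
  then show "(\<integral>\<omega>. Z2 A \<omega> $ p * cnj (Z1 B \<omega> $ q) \<partial>M) = 0"
    using *[OF B A] by simp
qed

text \<open>The zero blocks of the density express exactly that the two measures are
  uncorrelated.\<close>

lemma orthogonal_measure_pair:
  "orthogonal_measure M (\<lambda>A \<omega>. vec_pair (Z1 A \<omega>) (Z2 A \<omega>)) (\<lambda>l. block_diag (f l) (g l))"
  using Z12 by (simp add: orthogonal_measure_def all_sum_iff cross_zero)

lemma orthogonal_measure_sum: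
  "orthogonal_measure M (\<lambda>A \<omega>. Z1 A \<omega> + Z2 A \<omega>) (\<lambda>l. f l + g l)"
  unfolding orthogonal_measure_def
proof (intro conjI ballI impI allI)
  have sq: "square_integrable M (\<lambda>\<omega>. Z1 A \<omega> $ p)" "square_integrable M (\<lambda>\<omega>. Z2 A \<omega> $ p)"
    if "A \<in> sets borel" "A \<subseteq> {-pi..pi}" for A p
    using Z12 that by (simp_all add: orthogonal_measure_def)
  fix A p assume A: "A \<in> sets borel" "A \<subseteq> {-pi..pi::real}"
  show "square_integrable M (\<lambda>\<omega>. (Z1 A \<omega> + Z2 A \<omega>) $ p)"
    using square_integrable_add[OF sq[OF A, of p]] by simp
  fix B q assume B: "B \<in> sets borel" "B \<subseteq> {-pi..pi::real}"
  have i: "integrable circle (\<lambda>l. indicat_real (A \<inter> B) l *\<^sub>R F l $ p $ q)" if F: "weight F" for F :: "real \<Rightarrow> complex^'t^'t"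
  proof (rule Bochner_Integration.integrable_bound[OF weight_integrable[OF F, of p q]])
    have [measurable]: "indicat_real (A \<inter> B) \<in> borel_measurable circle"
      by (intro borel_measurable_circle borel_measurable_indicator sets.Int A(1) B(1))
    show "(\<lambda>l. indicat_real (A \<inter> B) l *\<^sub>R F l $ p $ q) \<in> borel_measurable circle"
      using weight_measurable[OF F] by measurable
  qed (auto simp: indicator_def)
  have c: "(LINT l:A \<inter> B|lborel. F l $ p $ q) = (\<integral>l. indicat_real (A \<inter> B) l *\<^sub>R F l $ p $ q \<partial>circle)"
    for F :: "real \<Rightarrow> complex^'t^'t"
    unfolding set_lebesgue_integral_def using A(2)
    by (subst integral_restrict_space) (auto intro!: Bochner_Integration.integral_cong simp: indicator_def)
  have "(\<integral>\<omega>. (Z1 A \<omega> + Z2 A \<omega>) $ p * cnj ((Z1 B \<omega> + Z2 B \<omega>) $ q) \<partial>M)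
      = (\<integral>\<omega>. Z1 A \<omega> $ p * cnj (Z1 B \<omega> $ q) + Z1 A \<omega> $ p * cnj (Z2 B \<omega> $ q)
          + (Z2 A \<omega> $ p * cnj (Z1 B \<omega> $ q) + Z2 A \<omega> $ p * cnj (Z2 B \<omega> $ q)) \<partial>M)"
    by (simp add: algebra_simps)
  also have "\<dots> = (\<integral>\<omega>. Z1 A \<omega> $ p * cnj (Z1 B \<omega> $ q) \<partial>M) + (\<integral>\<omega>. Z2 A \<omega> $ p * cnj (Z2 B \<omega> $ q) \<partial>M)"
    using square_integrable_mult_cnj[OF sq(1)[OF A, of p] sq(1)[OF B, of q]]
      square_integrable_mult_cnj[OF sq(1)[OF A, of p] sq(2)[OF B, of q]]
      square_integrable_mult_cnj[OF sq(2)[OF A, of p] sq(1)[OF B, of q]]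
      square_integrable_mult_cnj[OF sq(2)[OF A, of p] sq(2)[OF B, of q]]
    by (simp add: cross_zero[OF A B])
  also have "\<dots> = ((LINT l:A \<inter> B|lborel. f l $ p $ q) + (LINT l:A \<inter> B|lborel. g l $ p $ q)) / (2 * pi)"
    using Z12 A B unfolding orthogonal_measure_def by (simp add: add_divide_distrib)
  also have "(LINT l:A \<inter> B|lborel. f l $ p $ q) + (LINT l:A \<inter> B|lborel. g l $ p $ q) = (LINT l:A \<inter> B|lborel. (f l + g l) $ p $ q)"
    unfolding c using i[OF f] i[OF g] by (simp add: scaleR_add_right)
  finally show "(\<integral>\<omega>. (Z1 A \<omega> + Z2 A \<omega>) $ p * cnj ((Z1 B \<omega> + Z2 B \<omega>) $ q) \<partial>M)
      = (LINT l:A \<inter> B|lborel. (f l + g l) $ p $ q) / (2 * pi)" .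
qed

lemma stoch_integral_pair_left:
  assumes "has_stoch_integral M Z1 f h \<eta>"
  shows "has_stoch_integral M (\<lambda>A \<omega>. vec_pair (Z1 A \<omega>) (Z2 A \<omega>)) (\<lambda>l. block_diag (f l) (g l)) (\<lambda>l. vec_pair (h l) 0) \<eta>"
  unfolding has_stoch_integral_iff
proof (intro conjI allI impI)
  show "(\<lambda>l. vec_pair (h l) 0) \<in> L2 (\<lambda>l. block_diag (f l) (g l))"
    by (rule L2_block_diag(1)[OF _ L2_zero[OF g]]) (use assms in \<open>simp add: has_stoch_integral_iff\<close>)
  show "square_integrable M \<eta>" using assms unfolding has_stoch_integral_iff by blast
  fix e :: real assume "0 < e"
  then obtain k X where kX: "(k, X) \<in> steps Z1" and k: "L2_normsq f (\<lambda>l. h l - k l) < e"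
    and X: "(\<integral>\<omega>. (cmod (\<eta> \<omega> - X \<omega>))\<^sup>2 \<partial>M) < e"
    using assms unfolding has_stoch_integral_iff by blast
  obtain m :: nat and A b where A: "\<And>i. i < m \<Longrightarrow> A i \<in> sets borel" "\<And>i. i < m \<Longrightarrow> A i \<subseteq> {-pi..pi}"
    and keq: "k = (\<lambda>l. \<Sum>i<m. indicat_real (A i) l *\<^sub>R b i)" and Xeq: "X = (\<lambda>\<omega>. \<Sum>i<m. vdot (b i) (Z1 (A i) \<omega>))"
    using kX by (rule steps_cases) blast
  have "(\<lambda>l. vec_pair (k l) (0 :: complex^'t)) = (\<lambda>l. \<Sum>i<m. indicat_real (A i) l *\<^sub>R vec_pair (b i) 0)"
    by (simp add: keq fun_eq_iff vec_eq_iff all_sum_iff)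
  moreover have "X = (\<lambda>\<omega>. \<Sum>i<m. vdot (vec_pair (b i) 0) (vec_pair (Z1 (A i) \<omega>) (Z2 (A i) \<omega>)))"
    by (simp add: Xeq vdot_vec_pair)
  ultimately have "((\<lambda>l. vec_pair (k l) 0), X) \<in> steps (\<lambda>A \<omega>. vec_pair (Z1 A \<omega>) (Z2 A \<omega>))"
    using stepsI[of m A, OF A, where b = "\<lambda>i. vec_pair (b i) 0" and Z = "\<lambda>A \<omega>. vec_pair (Z1 A \<omega>) (Z2 A \<omega>)"] by (simp only:)
  moreover have "L2_normsq (\<lambda>l. block_diag (f l) (g l)) (\<lambda>l. vec_pair (h l) 0 - vec_pair (k l) 0) < e"
    using k by (simp add: L2_normsq_circle vec_pair_diff qform_block_diag)
  ultimately show "\<exists>k X. (k, X) \<in> steps (\<lambda>A \<omega>. vec_pair (Z1 A \<omega>) (Z2 A \<omega>))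
      \<and> L2_normsq (\<lambda>l. block_diag (f l) (g l)) (\<lambda>l. vec_pair (h l) 0 - k l) < e \<and> (\<integral>\<omega>. (cmod (\<eta> \<omega> - X \<omega>))\<^sup>2 \<partial>M) < e"
    using X by (intro exI[of _ "\<lambda>l. vec_pair (k l) 0"] exI[of _ X]) simp
qed

text \<open>A step function integrated against \<open>Z1 + Z2\<close> uses the same coefficients in
  both components, so \<open>h\<close> becomes the diagonal integrand; an integral against
  \<open>Z1\<close> alone has second component 0.\<close>

lemma stoch_integral_pair_sum:
  assumes "has_stoch_integral M (\<lambda>A \<omega>. Z1 A \<omega> + Z2 A \<omega>) (\<lambda>l. f l + g l) h \<eta>"
  shows "has_stoch_integral M (\<lambda>A \<omega>. vec_pair (Z1 A \<omega>) (Z2 A \<omega>)) (\<lambda>l. block_diag (f l) (g l)) (\<lambda>l. vec_pair (h l) (h l)) \<eta>"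
  unfolding has_stoch_integral_iff
proof (intro conjI allI impI)
  have h: "h \<in> L2 (\<lambda>l. f l + g l)" using assms unfolding has_stoch_integral_iff by blast
  show "(\<lambda>l. vec_pair (h l) (h l)) \<in> L2 (\<lambda>l. block_diag (f l) (g l))"
    by (rule L2_block_diag(1)[OF L2_summand[OF f g h]])
  show "square_integrable M \<eta>" using assms unfolding has_stoch_integral_iff by blast
  fix e :: real assume "0 < e"
  then obtain k X where kX: "(k, X) \<in> steps (\<lambda>A \<omega>. Z1 A \<omega> + Z2 A \<omega>)" and k: "L2_normsq (\<lambda>l. f l + g l) (\<lambda>l. h l - k l) < e"
    and X: "(\<integral>\<omega>. (cmod (\<eta> \<omega> - X \<omega>))\<^sup>2 \<partial>M) < e"
    using assms unfolding has_stoch_integral_iff by blast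
  obtain m :: nat and A b where A: "\<And>i. i < m \<Longrightarrow> A i \<in> sets borel" "\<And>i. i < m \<Longrightarrow> A i \<subseteq> {-pi..pi}"
    and keq: "k = (\<lambda>l. \<Sum>i<m. indicat_real (A i) l *\<^sub>R b i)"
    and Xeq: "X = (\<lambda>\<omega>. \<Sum>i<m. vdot (b i) (Z1 (A i) \<omega> + Z2 (A i) \<omega>))"
    using kX by (rule steps_cases) blast
  have "(\<lambda>l. vec_pair (k l) (k l)) = (\<lambda>l. \<Sum>i<m. indicat_real (A i) l *\<^sub>R vec_pair (b i) (b i))"
    by (simp add: keq fun_eq_iff vec_eq_iff all_sum_iff)
  moreover have "X = (\<lambda>\<omega>. \<Sum>i<m. vdot (vec_pair (b i) (b i)) (vec_pair (Z1 (A i) \<omega>) (Z2 (A i) \<omega>)))"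
    by (simp add: Xeq vdot_vec_pair vdot_add_right)
  ultimately have "((\<lambda>l. vec_pair (k l) (k l)), X) \<in> steps (\<lambda>A \<omega>. vec_pair (Z1 A \<omega>) (Z2 A \<omega>))"
    using stepsI[of m A, OF A, where b = "\<lambda>i. vec_pair (b i) (b i)" and Z = "\<lambda>A \<omega>. vec_pair (Z1 A \<omega>) (Z2 A \<omega>)"] by simp
  moreover have "L2_normsq (\<lambda>l. block_diag (f l) (g l)) (\<lambda>l. vec_pair (h l) (h l) - vec_pair (k l) (k l)) < e"
    using k by (simp add: L2_normsq_circle vec_pair_diff qform_block_diag qform_add_mat)
  ultimately show "\<exists>k X. (k, X) \<in> steps (\<lambda>A \<omega>. vec_pair (Z1 A \<omega>) (Z2 A \<omega>))
      \<and> L2_normsq (\<lambda>l. block_diag (f l) (g l)) (\<lambda>l. vec_pair (h l) (h l) - k l) < e \<and> (\<integral>\<omega>. (cmod (\<eta> \<omega> - X \<omega>))\<^sup>2 \<partial>M) < e"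
    using X by (intro exI[of _ "\<lambda>l. vec_pair (k l) (k l)"] exI[of _ X]) simp
qed

text \<open>In the direct sum the error is a single integral, with components \<open>a - h\<close>
  and \<open>- h\<close>; the block diagonal density leaves no cross terms in its norm.\<close>

lemma mean_square_error_spectral:
  assumes a: "has_stoch_integral M Z1 f a \<xi>"
    and h: "has_stoch_integral M (\<lambda>A \<omega>. Z1 A \<omega> + Z2 A \<omega>) (\<lambda>l. f l + g l) h \<eta>"
  shows "mean_square_error M \<xi> \<eta> = (L2_normsq f (\<lambda>l. a l - h l) + L2_normsq g h) / (2 * pi)"
proof -
  have aL: "a \<in> L2 f" and hL: "h \<in> L2 (\<lambda>l. f l + g l)"
    using a h unfolding has_stoch_integral_iff by auto
  note W = weight_block_diag[OF f g]
  have "mean_square_error M \<xi> \<eta>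
      = L2_normsq (\<lambda>l. block_diag (f l) (g l)) (\<lambda>l. vec_pair (a l) 0 - vec_pair (h l) (h l)) / (2 * pi)"
    unfolding mean_square_error_def
    by (rule stoch_integral_isometry[OF orthogonal_measure_pair W
          stoch_integral_diff[OF orthogonal_measure_pair W stoch_integral_pair_left[OF a] stoch_integral_pair_sum[OF h]]])
  also have "L2_normsq (\<lambda>l. block_diag (f l) (g l)) (\<lambda>l. vec_pair (a l) 0 - vec_pair (h l) (h l))
      = L2_normsq f (\<lambda>l. a l - h l) + L2_normsq g (\<lambda>l. 0 - h l)"
    unfolding vec_pair_diff
    by (rule L2_block_diag(2)[OF L2_diff[OF f aL L2_summand(1)[OF f g hL]] L2_diff[OF g L2_zero[OF g] L2_summand(2)[OF f g hL]]])
  also have "L2_normsq g (\<lambda>l. 0 - h l) = L2_normsq g h"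
    using L2_normsq_minus[OF g, of h] by simp
  finally show ?thesis .
qed

end

section \<open>The functional as a stochastic integral\<close>

text \<open>The tail of the absolutely convergent coefficient series bounds the error uniformly in
  \<open>l\<close>. The same rate \<open>t\<close> later gives the convergence of the operator
  series and of the pairing.\<close>

lemma symbol_A_approx:
  fixes av :: "nat \<Rightarrow> complex^'t"
  assumes av: "summable (\<lambda>j. \<Sum>p\<in>UNIV. cmod (av j $ p))"
  obtains t where "t \<longlonglongrightarrow> 0"
    "\<And>n l i. cmod ((symbol_A av l - (\<Sum>j<n. unit_char (int j) l *s av j)) $ i) \<le> t n"
    "symbol_A av \<in> borel_measurable circle"
proof -
  define s where "s j = (\<Sum>p\<in>UNIV. cmod (av j $ p))" for j
  have ss: "summable s" using av by (simp add: s_def[abs_def])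
  have norm_av: "norm (unit_char n l *s av j) \<le> s j" for n l j
    using norm_vec_le_sum[of "unit_char n l *s av j"] by (simp add: norm_mult s_def)
  define h where "h n l = (\<Sum>j<n. unit_char (int j) l *s av j)" for n l
  have hm: "h n \<in> borel_measurable circle" for n
    unfolding h_def by (intro borel_measurable_sum borel_measurable_smult unit_char_measurable_circle borel_measurable_const)
  have sym: "symbol_A av l = (\<Sum>j. unit_char (int j) l *s av j)" for l
    by (simp add: symbol_A_def unit_char_def)
  have ssum: "summable (\<lambda>j. norm (unit_char (int j) l *s av j))" for l
    by (rule summable_comparison_test'[OF ss]) (use norm_av in simp)
  define t where "t n = (\<Sum>j. s (j + n))" for n
  have t0: "t \<longlonglongrightarrow> 0"
    unfolding t_def by (rule suminf_exist_split2[OF ss])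
  have tail: "norm (symbol_A av l - h n l) \<le> t n" for l n
  proof -
    have "symbol_A av l - h n l = (\<Sum>j. unit_char (int (j + n)) l *s av (j + n))"
      unfolding sym h_def by (rule suminf_minus_initial_segment[OF summable_norm_cancel[OF ssum], symmetric])
    also have "norm \<dots> \<le> (\<Sum>j. norm (unit_char (int (j + n)) l *s av (j + n)))"
      by (rule summable_norm) (rule summable_ignore_initial_segment[OF ssum])
    also have "\<dots> \<le> t n"
      unfolding t_def by (intro suminf_le norm_av summable_ignore_initial_segment[OF ss] summable_ignore_initial_segment[OF ssum])
    finally show ?thesis .
  qed
  have tail_nth: "cmod ((symbol_A av l - h n l) $ i) \<le> t n" for l n i
    using Finite_Cartesian_Product.norm_nth_le tail order_trans by blast
  have Am: "symbol_A av \<in> borel_measurable circle"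
  proof -
    have "(\<lambda>n. h n l) \<longlonglongrightarrow> symbol_A av l" for l
    proof (rule LIM_zero_cancel, rule tendsto_norm_zero_cancel, rule tendsto_sandwich[OF _ _ tendsto_const t0])
      show "\<forall>\<^sub>F n in sequentially. norm (h n l - symbol_A av l) \<le> t n"
        using tail by (intro always_eventually allI) (simp add: norm_minus_commute)
    qed simp
    then show ?thesis
      by (rule borel_measurable_LIMSEQ_metric[OF hm])
  qed
  show thesis
    by (rule that[OF t0 _ Am]) (use tail_nth in \<open>simp only: h_def\<close>)
qed

text \<open>\<open>functional_A\<close> is a pointwise sum while the integral is a mean-square
  limit. Summable first absolute moments make the sum converge almost surely, and a subsequence that
  converges almost surely to the mean-square limit identifies the two.\<close>

lemma functional_A_stoch_integral:
  fixes X :: "int \<Rightarrow> 'a \<Rightarrow> complex^'t"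
  assumes M: "prob_space M" and X: "spectral_representation M Z f X" and f: "weight f"
    and av: "summable (\<lambda>j. \<Sum>p\<in>UNIV. cmod (av j $ p))"
  shows "has_stoch_integral M Z f (symbol_A av) (functional_A av X)"
proof -
  interpret prob_space M by fact
  have Z: "orthogonal_measure M Z f"
    using X random_spectral_measure_orthogonal unfolding spectral_representation_def by auto
  define s where "s j = (\<Sum>p\<in>UNIV. cmod (av j $ p))" for j
  have s0: "0 \<le> s j" for j by (simp add: s_def sum_nonneg)
  have ss: "summable s" using av by (simp add: s_def[abs_def])
  have avs: "cmod (av j $ p) \<le> s j" for j p
    unfolding s_def by (rule member_le_sum) auto
  define E where "E = (\<integral>l. entry_sum (f l) \<partial>circle)"
  have E0: "0 \<le> E" unfolding E_def by (simp add: entry_sum_nonneg)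
  have normsq_le: "L2_normsq f b \<le> E * (K * K)"
    if b: "b \<in> L2 f" and K: "\<And>l i. cmod (b l $ i) \<le> K" for b K
  proof -
    have "L2_normsq f b \<le> (\<integral>l. entry_sum (f l) * (K * K) \<partial>circle)"
      unfolding L2_normsq_circle
    proof (rule integral_mono)
      fix l
      have "cmod (qform (f l) (b l) (b l)) \<le> entry_sum (f l) * (K * K)"
        by (rule qform_le_entry_sum) (rule K)+
      then show "qnorm (f l) (b l) \<le> entry_sum (f l) * (K * K)"
        using complex_Re_le_cmod order_trans by blast
    qed (use L2_integrable[OF b] weight_entry_sum[OF f] in auto)
    then show ?thesis using weight_entry_sum[OF f] by (simp add: E_def)
  qed
  define h where "h n l = (\<Sum>j<n. unit_char (int j) l *s av j)" for n l
  define \<eta> where "\<eta> n \<omega> = (\<Sum>j<n. vdot (av j) (X (int j) \<omega>))" for n \<omega>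
  have st: "has_stoch_integral M Z f (h n) (\<eta> n)" for n
    unfolding h_def \<eta>_def by (intro stoch_integral_sum[OF Z f] stoch_integral_trig[OF X f])
  have hL: "h n \<in> L2 f" and \<eta>L: "square_integrable M (\<eta> n)" for n
    using st[of n] unfolding has_stoch_integral_iff by auto
  obtain t where t0: "t \<longlonglongrightarrow> 0" and tail_nth: "\<And>n l i. cmod ((symbol_A av l - h n l) $ i) \<le> t n"
    and Am: "symbol_A av \<in> borel_measurable circle"
    unfolding h_def by (rule symbol_A_approx[OF av]) blast
  have AL: "symbol_A av \<in> L2 f"
    by (rule L2_bounded[OF f Am, of "t 0"]) (use tail_nth[of _ 0] in \<open>simp add: h_def\<close>)
  have hlim: "(\<lambda>n. L2_normsq f (\<lambda>l. symbol_A av l - h n l)) \<longlonglongrightarrow> 0"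
  proof (rule tendsto_sandwich[OF _ _ tendsto_const])
    show "\<forall>\<^sub>F n in sequentially. L2_normsq f (\<lambda>l. symbol_A av l - h n l) \<le> E * (t n * t n)"
      by (intro always_eventually allI normsq_le L2_diff[OF f AL hL] tail_nth)
    show "\<forall>\<^sub>F n in sequentially. 0 \<le> L2_normsq f (\<lambda>l. symbol_A av l - h n l)"
      by (intro always_eventually allI L2_normsq_nonneg f)
    have "(\<lambda>n. E * (t n * t n)) \<longlonglongrightarrow> E * (0 * 0)" by (intro tendsto_intros t0)
    then show "(\<lambda>n. E * (t n * t n)) \<longlonglongrightarrow> 0" by simp
  qed
  obtain L where L: "square_integrable M L" "(\<lambda>n. \<integral>\<omega>. (cmod (\<eta> n \<omega> - L \<omega>))\<^sup>2 \<partial>M) \<longlonglongrightarrow> 0"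
    by (rule stoch_integral_of_limit[OF Z f st AL hlim]) blast
  define y where "y j \<omega> = vdot (av j) (X (int j) \<omega>)" for j \<omega>
  have ys: "has_stoch_integral M Z f (\<lambda>l. unit_char (int j) l *s av j) (y j)" for j
    unfolding y_def by (rule stoch_integral_trig[OF X f])
  have ysq: "square_integrable M (y j)" for j
    using ys unfolding has_stoch_integral_iff by blast
  then have ym [measurable]: "y j \<in> borel_measurable M" and y2: "integrable M (\<lambda>\<omega>. (cmod (y j \<omega>))\<^sup>2)" for j
    by (auto simp: square_integrable_def)
  have yi: "integrable M (\<lambda>\<omega>. cmod (y j \<omega>))" for j
    using square_integrable_integrable[OF finite_measure_axioms ysq] by (rule integrable_norm)
  \<comment> \<open>On a probability space the first absolute moment is at most the root of the
    second, which the isometry expresses through \<open>f\<close>.\<close>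
  have y1: "(\<integral>\<omega>. cmod (y j \<omega>) \<partial>M) \<le> sqrt E * s j" for j
  proof -
    have "(\<integral>\<omega>. cmod (y j \<omega>) \<partial>M)\<^sup>2 \<le> (\<integral>\<omega>. (cmod (y j \<omega>))\<^sup>2 \<partial>M) * (\<integral>\<omega>. 1 \<partial>M)"
      by (rule integral_Cauchy_Schwarz) (use yi y2 in auto)
    also have "\<dots> = L2_normsq f (\<lambda>l. unit_char (int j) l *s av j) / (2 * pi)"
      by (simp add: stoch_integral_isometry[OF Z f ys] prob_space)
    also have "\<dots> \<le> L2_normsq f (\<lambda>l. unit_char (int j) l *s av j) / 1"
      using L2_normsq_nonneg[OF f] pi_gt3 by (intro divide_left_mono) auto
    also have "\<dots> \<le> E * (s j * s j)"
      using ys avs unfolding has_stoch_integral_iff by (auto intro!: normsq_le simp: norm_mult)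
    also have "\<dots> = (sqrt E * s j)\<^sup>2"
      using E0 by (simp add: power2_eq_square algebra_simps)
    finally show ?thesis
      by (rule power2_le_imp_le) (use E0 s0 in auto)
  qed
  have "(\<integral>\<^sup>+\<omega>. (\<Sum>j. ennreal (cmod (y j \<omega>))) \<partial>M) = (\<Sum>j. \<integral>\<^sup>+\<omega>. ennreal (cmod (y j \<omega>)) \<partial>M)"
    by (rule nn_integral_suminf) measurable
  also have "\<dots> = (\<Sum>j. ennreal (\<integral>\<omega>. cmod (y j \<omega>) \<partial>M))"
    by (subst nn_integral_eq_integral[OF yi]) auto
  also have "\<dots> \<le> (\<Sum>j. ennreal (sqrt E * s j))"
    by (intro suminf_le ennreal_leI y1) auto
  also have "\<dots> < \<infinity>"
    using summable_mult[OF ss] E0 s0 by (subst suminf_ennreal2) auto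
  finally have "AE \<omega> in M. (\<Sum>j. ennreal (cmod (y j \<omega>))) \<noteq> \<infinity>"
    by (intro nn_integral_PInf_AE) auto
  then have conv: "AE \<omega> in M. (\<lambda>n. \<eta> n \<omega>) \<longlonglongrightarrow> functional_A av X \<omega>"
  proof eventually_elim
    case (elim \<omega>)
    have "summable (\<lambda>j. cmod (y j \<omega>))"
      by (rule summable_suminf_not_top) (use elim in auto)
    then have "summable (\<lambda>j. y j \<omega>)" by (rule summable_norm_cancel)
    then show ?case
      using summable_LIMSEQ[of "\<lambda>j. y j \<omega>"] by (simp add: functional_A_def \<eta>_def y_def)
  qed
  have Am': "functional_A av X \<in> borel_measurable M"
    unfolding functional_A_def y_def[symmetric] by measurable
  obtain r where r: "strict_mono r" "AE \<omega> in M. (\<lambda>n. \<eta> (r n) \<omega>) \<longlonglongrightarrow> L \<omega>"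
  proof (rule AE_subseq_tendsto_of_integral[of \<eta> M L])
    show "\<eta> n \<in> borel_measurable M" for n using \<eta>L by (simp add: square_integrable_def)
    show "integrable M (\<lambda>\<omega>. (cmod (\<eta> n \<omega> - L \<omega>))\<^sup>2)" for n
      using square_integrable_diff[OF \<eta>L L(1)] by (simp add: square_integrable_def)
  qed (use L(2) in auto)
  have eq: "AE \<omega> in M. functional_A av X \<omega> = L \<omega>"
    using conv r(2)
  proof eventually_elim
    case (elim \<omega>)
    from LIMSEQ_subseq_LIMSEQ[OF elim(1) r(1)] elim(2) show ?case
      using LIMSEQ_unique by (auto simp: o_def)
  qed
  have Lm [measurable]: "L \<in> borel_measurable M" using L(1) by (simp add: square_integrable_def)
  note [measurable] = Am'
  have fsq: "square_integrable M (functional_A av X)"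
  proof -
    have "integrable M (\<lambda>\<omega>. (cmod (functional_A av X \<omega>))\<^sup>2) \<longleftrightarrow> integrable M (\<lambda>\<omega>. (cmod (L \<omega>))\<^sup>2)"
      using eq by (intro integrable_cong_AE) (auto elim!: eventually_mono)
    then show ?thesis using L(1) by (simp add: square_integrable_def)
  qed
  have "(\<integral>\<omega>. (cmod (\<eta> n \<omega> - functional_A av X \<omega>))\<^sup>2 \<partial>M) = (\<integral>\<omega>. (cmod (\<eta> n \<omega> - L \<omega>))\<^sup>2 \<partial>M)" for n
  proof (rule integral_cong_AE)
    have [measurable]: "\<eta> n \<in> borel_measurable M" using \<eta>L by (simp add: square_integrable_def)
    show "(\<lambda>\<omega>. (cmod (\<eta> n \<omega> - functional_A av X \<omega>))\<^sup>2) \<in> borel_measurable M"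
      "(\<lambda>\<omega>. (cmod (\<eta> n \<omega> - L \<omega>))\<^sup>2) \<in> borel_measurable M" by measurable
  qed (use eq in \<open>auto elim!: eventually_mono\<close>)
  with L(2) have "(\<lambda>n. \<integral>\<omega>. (cmod (\<eta> n \<omega> - functional_A av X \<omega>))\<^sup>2 \<partial>M) \<longlonglongrightarrow> 0" by simp
  then show ?thesis
    by (rule stoch_integral_limit[OF Z f st AL fsq hlim])
qed

section \<open>The spectral characteristic\<close>

lemma borel_measurable_det:
  fixes F :: "'a \<Rightarrow> complex^'t^'t"
  assumes "\<And>i j. (\<lambda>x. F x $ i $ j) \<in> borel_measurable M"
  shows "(\<lambda>x. det (F x)) \<in> borel_measurable M"
  unfolding det_def using assms by (intro borel_measurable_sum borel_measurable_times borel_measurable_prod borel_measurable_const)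

text \<open>\<open>matrix_inv\<close> is a choice; for a singular matrix the chosen predicate is
  unsatisfiable, hence the same predicate for all singular matrices. The constant value there
  settles measurability on the set where the determinant vanishes.\<close>

lemma matrix_inv_singular: "\<not> invertible A \<Longrightarrow> matrix_inv A = matrix_inv (0 :: complex^'t^'t)"
  for A :: "complex^'t^'t"
proof -
  assume A: "\<not> invertible A"
  have "\<not> invertible (0 :: complex^'t^'t)"
    by (auto simp: invertible_def matrix_matrix_mult_def mat_def vec_eq_iff)
  then have "(\<lambda>B. A ** B = mat 1 \<and> B ** A = mat 1) = (\<lambda>B. (0 :: complex^'t^'t) ** B = mat 1 \<and> B ** 0 = mat 1)"
    using A unfolding invertible_def by blast
  then show ?thesis unfolding matrix_inv_def by simp
qed

lemma matrix_inv_cancel: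
  fixes A :: "complex^'t^'t"
  assumes "invertible A"
  shows "A ** matrix_inv A = mat 1" and "matrix_inv A ** A = mat 1"
  using someI_ex[OF assms[unfolded invertible_def]] unfolding matrix_inv_def by auto

text \<open>Cramer's rule writes the entries as quotients of determinants, which are polynomials in
  the entries of \<open>A\<close> and so measurable along a measurable family.\<close>

lemma matrix_inv_cramer:
  fixes A :: "complex^'t^'t"
  assumes "det A \<noteq> 0"
  shows "matrix_inv A $ k $ j = det (\<chi> i q. if q = k then axis j 1 $ i else A $ i $ q) / det A"
proof -
  have "A ** matrix_inv A = mat 1"
    using assms matrix_inv_cancel(1) invertible_det_nz by blast
  then have "A *v (matrix_inv A *v axis j 1) = axis j 1"
    by (simp add: matrix_vector_mul_assoc)
  then have "matrix_inv A *v axis j 1 = (\<chi> k. det (\<chi> i q. if q = k then axis j 1 $ i else A $ i $ q) / det A)"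
    using cramer[OF assms] by blast
  then have "(matrix_inv A *v axis j 1) $ k = det (\<chi> i q. if q = k then axis j 1 $ i else A $ i $ q) / det A"
    by simp
  then show ?thesis by (simp add: mat_vec_axis)
qed

lemma borel_measurable_matrix_inv:
  fixes F :: "'a \<Rightarrow> complex^'t^'t"
  assumes F: "\<And>i j. (\<lambda>x. F x $ i $ j) \<in> borel_measurable M"
  shows "(\<lambda>x. matrix_inv (F x) $ k $ j) \<in> borel_measurable M"
proof -
  have eq: "matrix_inv (F x) $ k $ j = (if det (F x) = 0 then matrix_inv 0 $ k $ j
      else det (\<chi> i q. if q = k then axis j 1 $ i else F x $ i $ q) / det (F x))" for x
    using matrix_inv_cramer[of "F x"] matrix_inv_singular[of "F x"] invertible_det_nz[of "F x"] by auto
  have [measurable]: "(\<lambda>x. det (F x)) \<in> borel_measurable M"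
    by (rule borel_measurable_det[OF F])
  have [measurable]: "(\<lambda>x. det (\<chi> i q. if q = k then axis j 1 $ i else F x $ i $ q)) \<in> borel_measurable M"
  proof (rule borel_measurable_det)
    show "(\<lambda>x. (\<chi> i q. if q = k then axis j 1 $ i else F x $ i $ q) $ i $ q) \<in> borel_measurable M" for i q
      using F by (cases "q = k") simp_all
  qed
  show ?thesis unfolding eq by measurable
qed

lemma hermitian_psd_diag:
  assumes F: "hermitian_psd F"
  shows "0 \<le> Re (F $ i $ i)" and "(cmod (F $ i $ j))\<^sup>2 \<le> Re (F $ i $ i) * Re (F $ j $ j)"
  using qnorm_nonneg[OF F, of "axis i 1"] qform_Cauchy_Schwarz[OF F, of "axis i 1" "axis j 1"]
  by (simp_all add: qform_axis)

lemma sqrt_mult_le_add: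
  fixes x y z :: real
  assumes "x\<^sup>2 \<le> y * z" "0 \<le> y" "0 \<le> z"
  shows "x \<le> y + z"
proof (rule power2_le_imp_le)
  have "y * z \<le> (y + z)\<^sup>2" using assms by (simp add: power2_eq_square algebra_simps)
  with assms(1) show "x\<^sup>2 \<le> (y + z)\<^sup>2" by linarith
qed (use assms in simp)

text \<open>The trace controls every entry of a positive semidefinite matrix: an entry is at most
  the geometric mean of two diagonal entries, each at most the trace. So integrability of the trace
  is integrability of the whole inverse.\<close>

lemma inverse_weights_matrix_inv:
  fixes F :: "real \<Rightarrow> complex^'t^'t"
  assumes F: "weight F" and inv: "AE l in circle. invertible (F l)"
    and tr: "integrable circle (\<lambda>l. trace (matrix_inv (F l)))"
  shows "inverse_weights F (\<lambda>l. matrix_inv (F l))"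
proof -
  have eq: "AE l in circle. F l ** matrix_inv (F l) = mat 1 \<and> matrix_inv (F l) ** F l = mat 1"
    using inv by eventually_elim (simp add: matrix_inv_cancel)
  have psd: "AE l in circle. hermitian_psd (matrix_inv (F l))"
    using eq weight_hermitian[OF F] by eventually_elim (rule hermitian_psd_inverse, auto)
  have "integrable circle (\<lambda>l. matrix_inv (F l) $ i $ j)" for i j
  proof (rule Bochner_Integration.integrable_bound)
    show "integrable circle (\<lambda>l. 2 * Re (trace (matrix_inv (F l))))"
      using integrable_Re[OF tr] by simp
    show "(\<lambda>l. matrix_inv (F l) $ i $ j) \<in> borel_measurable circle"
      by (rule borel_measurable_matrix_inv) (rule weight_measurable[OF F])
    show "AE l in circle. norm (matrix_inv (F l) $ i $ j) \<le> norm (2 * Re (trace (matrix_inv (F l))))"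
      using psd
    proof eventually_elim
      case (elim l)
      note d = hermitian_psd_diag[OF elim]
      have le: "Re (matrix_inv (F l) $ q $ q) \<le> Re (trace (matrix_inv (F l)))" for q
        unfolding trace_def Re_sum by (rule member_le_sum) (auto intro: d)
      have "norm (matrix_inv (F l) $ i $ j) \<le> Re (matrix_inv (F l) $ i $ i) + Re (matrix_inv (F l) $ j $ j)"
        by (rule sqrt_mult_le_add) (rule d)+
      also have "\<dots> \<le> 2 * Re (trace (matrix_inv (F l)))"
        using le[of i] le[of j] by simp
      finally show ?case by simp
    qed
  qed
  with F eq psd show ?thesis by (simp add: inverse_weights_def weight_def)
qed

lemma L2_vec_mat_inverse:
  assumes FW: "inverse_weights F W" and c: "c \<in> L2 W"
  shows "(\<lambda>l. c l v* W l) \<in> L2 F" and "L2_normsq F (\<lambda>l. c l v* W l) = L2_normsq W c"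
proof -
  have F: "weight F" and W: "weight W"
    and inv: "AE l in circle. F l ** W l = mat 1 \<and> W l ** F l = mat 1"
    using FW by (auto simp: inverse_weights_def)
  have m: "(\<lambda>l. c l v* W l) \<in> borel_measurable circle"
    by (rule borel_measurable_vec_mat[OF weight_measurable[OF W] L2_measurable[OF c]])
  have eq: "AE l in circle. qnorm (F l) (c l v* W l) = qnorm (W l) (c l)"
    using weight_hermitian[OF F] inv by eventually_elim (simp add: qform_inverse)
  show "(\<lambda>l. c l v* W l) \<in> L2 F"
    by (rule L2I[OF F m L2_integrable[OF c]]) (use eq in eventually_elim, simp)
  show "L2_normsq F (\<lambda>l. c l v* W l) = L2_normsq W c"
    unfolding L2_normsq_circle
  proof (rule integral_cong_AE[OF _ _ eq])
    show "(\<lambda>l. qnorm (F l) (c l v* W l)) \<in> borel_measurable circle"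
      using qform_measurable[OF F m m] by measurable
    show "(\<lambda>l. qnorm (W l) (c l)) \<in> borel_measurable circle"
      using L2_integrable[OF c] by simp
  qed
qed

lemma L2_normsq_add:
  assumes F: "weight F" and b: "b \<in> L2 F" and c: "c \<in> L2 F"
  shows "L2_normsq F (\<lambda>l. b l + c l)
    = L2_normsq F b + 2 * Re (\<integral>l. qform (F l) (b l) (c l) \<partial>circle) + L2_normsq F c"
proof -
  have "qform G x (- y) = - qform G x y" for G :: "complex^'a^'a" and x y
    using qform_smult_right[of G x "-1" y] by (simp flip: vector_sneg_minus1)
  with L2_normsq_diff[OF F b L2_smult[OF F c, of "-1"]] L2_normsq_minus[OF F, of c]
  show ?thesis by (simp flip: vector_sneg_minus1)
qed

lemma L2_normsq_complex:
  assumes F: "weight F" and b: "b \<in> L2 F"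
  shows "complex_of_real (L2_normsq F b) = (\<integral>l. qform (F l) (b l) (b l) \<partial>circle)"
  unfolding L2_normsq_circle integral_complex_of_real[symmetric]
proof (rule integral_cong_AE)
  show "AE l in circle. complex_of_real (qnorm (F l) (b l)) = qform (F l) (b l) (b l)"
    using weight_hermitian[OF F] by eventually_elim (rule qform_eq_qnorm[symmetric])
qed (use L2_inner_integrable[OF F b b] in \<open>auto intro: borel_measurable_integrable\<close>)

lemma L2_normsq_eq_0_imp:
  assumes FW: "inverse_weights F W" and b: "b \<in> L2 F" and "L2_normsq F b = 0"
  shows "AE l in circle. b l = 0"
proof -
  have F: "weight F" and inv: "AE l in circle. F l ** W l = mat 1 \<and> W l ** F l = mat 1"
    using FW by (auto simp: inverse_weights_def)
  have "AE l in circle. 0 \<le> qnorm (F l) (b l)"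
    using weight_hermitian[OF F] by eventually_elim (rule qnorm_nonneg)
  then have "AE l in circle. qnorm (F l) (b l) = 0"
    using assms(3) L2_integrable[OF b] unfolding L2_normsq_circle by (simp add: integral_nonneg_eq_0_iff_AE)
  then show ?thesis
    using weight_hermitian[OF F] inv
  proof eventually_elim
    case (elim l)
    then show ?case by (intro qnorm_eq_0_imp[of "F l" "W l"]) auto
  qed
qed

section \<open>Orthogonality and the quadratic error\<close>

text \<open>Expanding the polynomial turns the integral into a finite pairing of coefficients. This
  serves the orthogonality of \<open>C\<close> to the observed exponentials and identifies the
  partial sums of \<open>pairing\<close>.\<close>

lemma vdot_trig_poly_integral:
  assumes u: "\<And>p. integrable circle (\<lambda>l. u l $ p)"
  shows "(\<integral>l. vdot (u l) (vcnj (trig_poly J x l)) \<partial>circle)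
    = 2 * pi * (\<Sum>k\<in>J. vdot (\<chi> p. fourier_coeff (\<lambda>l. u l $ p) k) (vcnj (x k)))"
proof -
  have "(\<integral>l. vdot (u l) (vcnj (trig_poly J x l)) \<partial>circle)
      = (\<integral>l. (\<Sum>p\<in>UNIV. \<Sum>k\<in>J. cnj (x k $ p) * (unit_char (- k) l * u l $ p)) \<partial>circle)"
    unfolding vdot_def vcnj_nth trig_poly_component
    by (intro Bochner_Integration.integral_cong refl sum.cong) (simp add: sum_distrib_left mult_ac)
  also have "\<dots> = (\<Sum>p\<in>UNIV. \<Sum>k\<in>J. \<integral>l. cnj (x k $ p) * (unit_char (- k) l * u l $ p) \<partial>circle)"
    by (intro integral_double_sum integrable_mult_right integrable_unit_char_mult u)
  also have "\<dots> = (\<Sum>p\<in>UNIV. \<Sum>k\<in>J. 2 * pi * (fourier_coeff (\<lambda>l. u l $ p) k * cnj (x k $ p)))"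
    by (intro sum.cong refl) (simp add: fourier_coeff_def)
  also have "\<dots> = 2 * pi * (\<Sum>k\<in>J. vdot (\<chi> p. fourier_coeff (\<lambda>l. u l $ p) k) (vcnj (x k)))"
    unfolding vdot_def by (subst sum.swap) (simp add: sum_distrib_left)
  finally show ?thesis .
qed

text \<open>For polynomials over \<open>S\<close> the pairing is a finite sum of zeros; the duality
  of \<open>L2 W\<close> and \<open>L2 F\<close> extends this to the closed span.\<close>

lemma vdot_span_eq_0:
  assumes FW: "inverse_weights F W" and h: "h \<in> L2_span F S" and C: "C \<in> L2 W"
    and zero: "\<And>n p. n \<in> S \<Longrightarrow> fourier_coeff (\<lambda>l. C l $ p) n = 0"
  shows "(\<integral>l. vdot (C l) (vcnj (h l)) \<partial>circle) = 0"
proof -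
  have F: "weight F" using FW by (simp add: inverse_weights_def)
  note WF = inverse_weights_sym[OF FW]
  note hL = L2_span_L2[OF h]
  obtain J \<beta> where J: "\<And>n::nat. finite (J n)" "\<And>n. J n \<subseteq> S"
    and lim: "(\<lambda>n. L2_normsq F (\<lambda>l. h l - trig_poly (J n) (\<beta> n) l)) \<longlonglongrightarrow> 0"
    by (rule L2_span_sequence[OF h F]) blast
  have "(\<integral>l. vdot (C l) (vcnj (trig_poly (J n) (\<beta> n) l)) \<partial>circle) = 0" for n
  proof -
    have "(\<chi> p. fourier_coeff (\<lambda>l. C l $ p) k) = 0" if "k \<in> J n" for k
      using zero[of k] J(2)[of n] that by (auto simp: vec_eq_iff)
    then show ?thesis
      unfolding vdot_trig_poly_integral[OF L2_component_integrable[OF WF C]] by simp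
  qed
  then have "(cmod (\<integral>l. vdot (C l) (vcnj (h l)) \<partial>circle))\<^sup>2
      \<le> L2_normsq W C * L2_normsq F (\<lambda>l. h l - trig_poly (J n) (\<beta> n) l)" for n
    using vdot_integrable(2)[OF WF C L2_diff[OF F hL trig_poly_L2[OF F]], of "J n" "\<beta> n"]
      vdot_integrable(1)[OF WF C hL] vdot_integrable(1)[OF WF C trig_poly_L2[OF F], of "J n" "\<beta> n"]
    by (simp add: vcnj_diff vdot_diff_right)
  moreover have "(\<lambda>n. L2_normsq W C * L2_normsq F (\<lambda>l. h l - trig_poly (J n) (\<beta> n) l)) \<longlonglongrightarrow> 0"
    using tendsto_mult_right_zero[OF lim] .
  ultimately have "(cmod (\<integral>l. vdot (C l) (vcnj (h l)) \<partial>circle))\<^sup>2 \<le> 0"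
    by (intro LIMSEQ_le_const) auto
  then show ?thesis by simp
qed

lemma vec_mat_vcnj:
  assumes "hermitian_psd f"
  shows "vdot (x v* f) (vcnj y) = vdot x (vcnj (y v* f))"
proof -
  have "qform f x y = cnj (qform f y x)" by (rule qform_cnj[OF assms])
  then show ?thesis by (simp add: qform_def cnj_vdot vdot_commute[of "vcnj (y v* f)"])
qed

context
  fixes f g W :: "real \<Rightarrow> complex^'t^'t" and A C h :: "real \<Rightarrow> complex^'t"
  assumes f: "weight f" and g: "weight g" and FW: "inverse_weights (\<lambda>l. f l + g l) W"
    and A: "A \<in> L2 f" "A \<in> L2 g" and C: "C \<in> L2 W" and h: "h = (\<lambda>l. (A l v* f l - C l) v* W l)"
begin

lemma weights: "weight (\<lambda>l. f l + g l)" "weight W"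
  and inverse_AE: "AE l in circle. (f l + g l) ** W l = mat 1 \<and> W l ** (f l + g l) = mat 1
    \<and> hermitian_psd (f l) \<and> hermitian_psd (g l) \<and> hermitian_psd (f l + g l) \<and> hermitian_psd (W l)"
proof -
  show F: "weight (\<lambda>l. f l + g l)" and W: "weight W" using FW by (auto simp: inverse_weights_def)
  have "AE l in circle. (f l + g l) ** W l = mat 1 \<and> W l ** (f l + g l) = mat 1"
    using FW by (simp add: inverse_weights_def)
  then show "AE l in circle. (f l + g l) ** W l = mat 1 \<and> W l ** (f l + g l) = mat 1
    \<and> hermitian_psd (f l) \<and> hermitian_psd (g l) \<and> hermitian_psd (f l + g l) \<and> hermitian_psd (W l)"
    using weight_hermitian[OF f] weight_hermitian[OF g] weight_hermitian[OF F] weight_hermitian[OF W]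
    by eventually_elim blast
qed

text \<open>By \<open>f W f \<le> f\<close> the product lies in the same space \<open>L2 W\<close>
  as \<open>C\<close>, which right multiplication by \<open>W\<close> maps isometrically into
  \<open>L2 (f + g)\<close>.\<close>

lemma Af_L2: "(\<lambda>l. A l v* f l) \<in> L2 W"
proof (rule L2I[OF weights(2) _ L2_integrable[OF A(1)]])
  show "(\<lambda>l. A l v* f l) \<in> borel_measurable circle"
    by (rule borel_measurable_vec_mat[OF weight_measurable[OF f] L2_measurable[OF A(1)]])
  show "AE l in circle. qnorm (W l) (A l v* f l) \<le> qnorm (f l) (A l)"
    using inverse_AE
  proof eventually_elim
    case (elim l)
    then show ?case by (intro qnorm_inverse_le[of "f l + g l" "W l" "f l" "g l"]) auto
  qed
qed

lemma h_L2: "h \<in> L2 (\<lambda>l. f l + g l)"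
  unfolding h by (rule L2_vec_mat_inverse(1)[OF FW L2_diff[OF weights(2) Af_L2 C]])

lemma h_times: "AE l in circle. h l v* (f l + g l) = A l v* f l - C l"
  using inverse_AE by eventually_elim (simp add: h vec_mat_assoc)

lemma h_alt: "AE l in circle. h l = A l - (A l v* g l + C l) v* W l"
  using inverse_AE
proof eventually_elim
  case (elim l)
  have "A l = (A l v* (f l + g l)) v* W l" using elim by (simp add: vec_mat_assoc)
  also have "\<dots> = (A l v* f l) v* W l + (A l v* g l) v* W l"
    by (simp add: vec_mat_add_right vec_mat_add_left)
  finally have "(A l v* f l) v* W l = A l - (A l v* g l) v* W l" by (simp add: algebra_simps)
  then show ?case by (simp add: h vec_mat_diff_left vec_mat_add_left algebra_simps)
qed

text \<open>Up to a constant factor, the real part of the left side is the derivative of the error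
  at \<open>h\<close> in direction \<open>u\<close>. Multiplying \<open>h\<close> by
  \<open>f + g\<close> collapses it to the pairing with \<open>C\<close>.\<close>

lemma error_gradient:
  "AE l in circle. \<forall>u. qform (f l) (A l - h l) u - qform (g l) (h l) u = vdot (C l) (vcnj u)"
  using h_times
proof (eventually_elim, intro allI)
  fix l u assume l: "h l v* (f l + g l) = A l v* f l - C l"
  have "qform (f l) (A l - h l) u - qform (g l) (h l) u = vdot (A l v* f l - h l v* (f l + g l)) (vcnj u)"
    by (simp add: qform_def vec_mat_diff_left vec_mat_add_right vdot_diff_left vdot_add_left)
  then show "qform (f l) (A l - h l) u - qform (g l) (h l) u = vdot (C l) (vcnj u)"
    by (simp add: l)
qed

text \<open>The error is quadratic, so once its first-order term vanishes the increment is exactly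
  the squared norm of the perturbation.\<close>

lemma error_perturbation:
  assumes u: "u \<in> L2 (\<lambda>l. f l + g l)" and orth: "(\<integral>l. vdot (C l) (vcnj (u l)) \<partial>circle) = 0"
  shows "L2_normsq f (\<lambda>l. A l - (h l + u l)) + L2_normsq g (\<lambda>l. h l + u l)
    = L2_normsq f (\<lambda>l. A l - h l) + L2_normsq g h + L2_normsq (\<lambda>l. f l + g l) u"
proof -
  have hf: "h \<in> L2 f" "h \<in> L2 g" using L2_summand[OF f g h_L2] by auto
  have uf: "u \<in> L2 f" "u \<in> L2 g" using L2_summand[OF f g u] by auto
  note Ah = L2_diff[OF f A(1) hf(1)]
  have 1: "L2_normsq f (\<lambda>l. A l - (h l + u l))
      = L2_normsq f (\<lambda>l. A l - h l) - 2 * Re (\<integral>l. qform (f l) (A l - h l) (u l) \<partial>circle) + L2_normsq f u"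
    unfolding diff_diff_eq[symmetric] by (rule L2_normsq_diff[OF f Ah uf(1)])
  have 2: "L2_normsq g (\<lambda>l. h l + u l)
      = L2_normsq g h + 2 * Re (\<integral>l. qform (g l) (h l) (u l) \<partial>circle) + L2_normsq g u"
    by (rule L2_normsq_add[OF g hf(2) uf(2)])
  have i: "integrable circle (\<lambda>l. qform (f l) (A l - h l) (u l))" "integrable circle (\<lambda>l. qform (g l) (h l) (u l))"
    by (rule L2_inner_integrable[OF f Ah uf(1)] L2_inner_integrable[OF g hf(2) uf(2)])+
  have "(\<integral>l. qform (f l) (A l - h l) (u l) \<partial>circle) - (\<integral>l. qform (g l) (h l) (u l) \<partial>circle)
      = (\<integral>l. vdot (C l) (vcnj (u l)) \<partial>circle)"
    unfolding Bochner_Integration.integral_diff[OF i, symmetric]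
  proof (rule integral_cong_AE)
    show "AE l in circle. qform (f l) (A l - h l) (u l) - qform (g l) (h l) (u l) = vdot (C l) (vcnj (u l))"
      using error_gradient by eventually_elim blast
  qed (use i in auto, intro borel_measurable_vdot borel_measurable_vcnj L2_measurable[OF C] L2_measurable[OF u])
  with orth have 3: "(\<integral>l. qform (f l) (A l - h l) (u l) \<partial>circle) = (\<integral>l. qform (g l) (h l) (u l) \<partial>circle)" by simp
  have 4: "L2_normsq (\<lambda>l. f l + g l) u = L2_normsq f u + L2_normsq g u"
    using L2_integrable[OF uf(1)] L2_integrable[OF uf(2)] by (simp add: L2_normsq_circle qform_add_mat)
  show ?thesis unfolding 1 2 3 4 by simp
qed

lemma error_value:
  assumes D: "integrable circle (\<lambda>l. vdot (A l v* (f l ** W l ** g l)) (vcnj (A l)))"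
  shows "complex_of_real (L2_normsq f (\<lambda>l. A l - h l) + L2_normsq g h)
    = (\<integral>l. vdot (A l v* (f l ** W l ** g l)) (vcnj (A l)) \<partial>circle) + (\<integral>l. qform (W l) (C l) (C l) \<partial>circle)"
proof -
  have hf: "h \<in> L2 f" "h \<in> L2 g" using L2_summand[OF f g h_L2] by auto
  note Ah = L2_diff[OF f A(1) hf(1)]
  have i1: "integrable circle (\<lambda>l. qform (f l) (A l - h l) (A l - h l))" "integrable circle (\<lambda>l. qform (g l) (h l) (h l))"
    by (rule L2_inner_integrable[OF f Ah Ah] L2_inner_integrable[OF g hf(2) hf(2)])+
  have i2: "integrable circle (\<lambda>l. qform (W l) (C l) (C l))" by (rule L2_inner_integrable[OF weights(2) C C])
  have "complex_of_real (L2_normsq f (\<lambda>l. A l - h l) + L2_normsq g h)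
      = (\<integral>l. qform (f l) (A l - h l) (A l - h l) + qform (g l) (h l) (h l) \<partial>circle)"
    using i1 by (simp add: L2_normsq_complex[OF f Ah] L2_normsq_complex[OF g hf(2)])
  also have "\<dots> = (\<integral>l. vdot (A l v* (f l ** W l ** g l)) (vcnj (A l)) + qform (W l) (C l) (C l) \<partial>circle)"
  proof (rule integral_cong_AE)
    show "AE l in circle. qform (f l) (A l - h l) (A l - h l) + qform (g l) (h l) (h l)
        = vdot (A l v* (f l ** W l ** g l)) (vcnj (A l)) + qform (W l) (C l) (C l)"
      using inverse_AE h_times h_alt error_gradient
    proof eventually_elim
      case (elim l)
      define F where "F = f l + g l"
      have inv: "F ** W l = mat 1" "W l ** F = mat 1" and psd: "hermitian_psd (f l)" "hermitian_psd (g l)" "hermitian_psd F" "hermitian_psd (W l)"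
        using elim(1) by (auto simp: F_def)
      have grad: "qform (f l) (A l - h l) (h l) - qform (g l) (h l) (h l) = vdot (C l) (vcnj (h l))"
        using elim(4) by blast
      \<comment> \<open>Both products equal \<open>f - f W f\<close>: on each side \<open>g\<close>
        is replaced by \<open>F - f\<close> and one inverse cancels.\<close>
      have sym: "g l ** W l ** f l = f l ** W l ** g l"
      proof -
        have diff: "(P - Q) ** R = P ** R - Q ** R" for P Q R :: "complex^'t^'t"
          by (simp add: vec_eq_iff matrix_matrix_mult_def left_diff_distrib sum_subtractf)
        have "g l ** W l ** f l = (F - f l) ** W l ** f l" by (simp add: F_def)
        also have "\<dots> = f l - f l ** W l ** f l"
          by (simp add: diff inv)
        also have "\<dots> = f l ** W l ** g l"
          by (rule parallel_sum_eq[OF psd(3) inv psd(1,2) F_def, symmetric])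
        finally show ?thesis .
      qed
      \<comment> \<open>By the gradient identity the error density is this form minus
        \<open>vdot (C l) (vcnj (h l))\<close>. The second expression for \<open>h\<close> produces
        the parallel sum and a term in \<open>C\<close>; replacing \<open>A f\<close> by
        \<open>h F + C\<close> splits that term into the same pairing and the \<open>W\<close>-norm
        of \<open>C\<close>, so the mixed terms cancel.\<close>
      have "qform (f l) (A l - h l) (A l) = vdot ((A l v* g l + C l) v* W l v* f l) (vcnj (A l))"
        using elim(3) by (simp add: qform_def)
      also have "\<dots> = vdot (A l v* (f l ** W l ** g l)) (vcnj (A l)) + vdot (C l v* W l v* f l) (vcnj (A l))"
        by (simp add: vec_mat_add_left vdot_add_left vec_mat_assoc sym[symmetric] matrix_mul_assoc)
      also have "vdot (C l v* W l v* f l) (vcnj (A l)) = qform (W l) (C l) (A l v* f l)"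
        unfolding vec_mat_vcnj[OF psd(1)] qform_def ..
      also have "A l v* f l = h l v* F + C l" using elim(2) by (simp add: F_def)
      also have "qform (W l) (C l) (h l v* F + C l) = vdot (C l) (vcnj (h l)) + qform (W l) (C l) (C l)"
        unfolding qform_add_right vdot_qform[OF psd(4) inv(2,1)] ..
      finally show ?case using grad by (simp add: qform_diff_right algebra_simps)
    qed
  qed (use i1 i2 D in auto)
  also have "\<dots> = (\<integral>l. vdot (A l v* (f l ** W l ** g l)) (vcnj (A l)) \<partial>circle) + (\<integral>l. qform (W l) (C l) (C l) \<partial>circle)"
    using i2 D by simp
  finally show ?thesis .
qed

end

section \<open>Infinite block Toeplitz matrices\<close>

lemma series_sums_eq: "series_sums \<Gamma> u v \<Longrightarrow> series \<Gamma> u = v"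
  unfolding series_def by (rule the_equality) (auto simp: series_sums_def intro: LIMSEQ_unique)

lemma series_sums_summable: "series_sums \<Gamma> u v \<Longrightarrow> series_summable \<Gamma> u"
  unfolding series_summable_def by blast

lemma toeplitz_nth:
  "toeplitz \<Phi> k j $ p $ q = (\<integral>l. unit_char (j - k) l * \<Phi> l $ q $ p \<partial>circle) / (2 * pi)"
  by (simp add: toeplitz_def set_integral_circle transpose_def unit_char_def mult.commute)

text \<open>The transpose in \<open>toeplitz\<close> makes the matrix acting on columns correspond
  to right multiplication of the symbol by \<open>\<Phi>\<close>. A partial sum is then a Fourier
  coefficient of a product of functions, so convergence of the series is a matter of continuity of
  coefficients.\<close>

lemma toeplitz_partial_sum:
  assumes \<Phi>: "\<And>p q. integrable circle (\<lambda>l. \<Phi> l $ p $ q)"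
  shows "(\<Sum>j\<in>J. toeplitz \<Phi> k j *v x j) = (\<chi> p. fourier_coeff (\<lambda>l. (trig_poly J x l v* \<Phi> l) $ p) k)"
proof -
  have "(\<Sum>j\<in>J. toeplitz \<Phi> k j *v x j) $ p = fourier_coeff (\<lambda>l. (trig_poly J x l v* \<Phi> l) $ p) k" for p
  proof -
    have "(\<integral>l. unit_char (- k) l * (trig_poly J x l v* \<Phi> l) $ p \<partial>circle)
        = (\<integral>l. (\<Sum>q\<in>UNIV. \<Sum>j\<in>J. x j $ q * (unit_char (j - k) l * \<Phi> l $ q $ p)) \<partial>circle)"
    proof (intro Bochner_Integration.integral_cong refl)
      fix l
      have "unit_char (- k) l * (x j $ q * unit_char j l * \<Phi> l $ q $ p) = x j $ q * (unit_char (j - k) l * \<Phi> l $ q $ p)" for j q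
        using unit_char_mult[of "- k" l j] by (simp add: mult_ac)
      then show "unit_char (- k) l * (trig_poly J x l v* \<Phi> l) $ p
          = (\<Sum>q\<in>UNIV. \<Sum>j\<in>J. x j $ q * (unit_char (j - k) l * \<Phi> l $ q $ p))"
        unfolding vec_mat_nth trig_poly_component sum_distrib_right sum_distrib_left by (simp only:)
    qed
    also have "\<dots> = (\<Sum>q\<in>UNIV. \<Sum>j\<in>J. \<integral>l. x j $ q * (unit_char (j - k) l * \<Phi> l $ q $ p) \<partial>circle)"
      by (intro integral_double_sum integrable_mult_right integrable_unit_char_mult \<Phi>)
    also have "\<dots> = (\<Sum>j\<in>J. \<Sum>q\<in>UNIV. x j $ q * (\<integral>l. unit_char (j - k) l * \<Phi> l $ q $ p \<partial>circle))"
      by (subst sum.swap) simp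
    finally show ?thesis
      by (simp add: fourier_coeff_def matrix_vector_mult_def toeplitz_nth sum_divide_distrib mult.commute)
  qed
  then show ?thesis by (simp add: vec_eq_iff)
qed

lemma toeplitz_apply:
  fixes \<Phi> :: "real \<Rightarrow> complex^'t^'t"
  assumes \<Phi>: "\<And>p q. integrable circle (\<lambda>l. \<Phi> l $ p $ q)"
    and lim: "\<And>k p. k \<in> \<Gamma> \<Longrightarrow> (\<lambda>N. fourier_coeff (\<lambda>l. (trig_poly {n\<in>\<Gamma>. n \<le> int N} x l v* \<Phi> l) $ p) k) \<longlonglongrightarrow> y k $ p"
  shows "applicable \<Gamma> (toeplitz \<Phi>) x" and "\<And>k. k \<in> \<Gamma> \<Longrightarrow> op_apply \<Gamma> (toeplitz \<Phi>) x k = y k"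
proof -
  have s: "series_sums \<Gamma> (\<lambda>j. toeplitz \<Phi> k j *v x j) (y k)" if "k \<in> \<Gamma>" for k
    unfolding series_sums_def toeplitz_partial_sum[OF \<Phi>]
    by (rule vec_tendstoI) (simp add: lim[OF that])
  show "applicable \<Gamma> (toeplitz \<Phi>) x"
    unfolding applicable_def using s series_sums_summable by blast
  show "op_apply \<Gamma> (toeplitz \<Phi>) x k = y k" if "k \<in> \<Gamma>" for k
    using series_sums_eq[OF s[OF that]] that by (simp add: op_apply_def)
qed

lemma pairing_limit:
  assumes u: "\<And>p. integrable circle (\<lambda>l. u l $ p)"
    and z: "\<And>k p. k \<in> \<Gamma> \<Longrightarrow> z k $ p = fourier_coeff (\<lambda>l. u l $ p) k"
    and lim: "(\<lambda>N. \<integral>l. vdot (u l) (vcnj (trig_poly {n\<in>\<Gamma>. n \<le> int N} x l)) \<partial>circle) \<longlonglongrightarrow> L"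
  shows "pairing_converges \<Gamma> z x" and "pairing \<Gamma> z x = L / (2 * pi)"
proof -
  have "(\<lambda>N. (\<integral>l. vdot (u l) (vcnj (trig_poly {n\<in>\<Gamma>. n \<le> int N} x l)) \<partial>circle) / (2 * pi)) \<longlonglongrightarrow> L / (2 * pi)"
    by (intro tendsto_intros lim) simp
  moreover have "(\<integral>l. vdot (u l) (vcnj (trig_poly {n\<in>\<Gamma>. n \<le> int N} x l)) \<partial>circle) / (2 * pi)
      = (\<Sum>k\<in>{n\<in>\<Gamma>. n \<le> int N}. vdot (z k) (vcnj (x k)))" for N
  proof -
    have "(\<chi> p. fourier_coeff (\<lambda>l. u l $ p) k) = z k" if "k \<in> \<Gamma>" for k
      using z[OF that] by (simp add: vec_eq_iff)
    then show ?thesis unfolding vdot_trig_poly_integral[OF u] by simp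
  qed
  ultimately have "series_sums \<Gamma> (\<lambda>k. vdot (z k) (vcnj (x k))) (L / (2 * pi))"
    unfolding series_sums_def by simp
  then show "pairing_converges \<Gamma> z x" "pairing \<Gamma> z x = L / (2 * pi)"
    unfolding pairing_converges_def pairing_def using series_sums_summable series_sums_eq by blast+
qed

text \<open>For a merely integrable \<open>\<Phi>\<close> there is no duality of weighted spaces to
  appeal to; uniform convergence of the partial sums of \<open>A\<close> takes its place. The cases
  applied are \<open>f ** W\<close> and \<open>f ** W ** g\<close>.\<close>

lemma fourier_coeff_uniform_tendsto:
  fixes \<Phi> :: "real \<Rightarrow> complex^'t^'t"
  assumes \<Phi>: "\<And>p q. integrable circle (\<lambda>l. \<Phi> l $ p $ q)"
    and a: "a \<in> borel_measurable circle" and b: "\<And>N. b N \<in> borel_measurable circle"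
    and K: "\<And>l i. cmod (a l $ i) \<le> K"
    and t: "t \<longlonglongrightarrow> 0" and le: "\<And>N l i. cmod ((a l - b N l) $ i) \<le> t N"
  shows "integrable circle (\<lambda>l. (a l v* \<Phi> l) $ p)"
    and "(\<lambda>N. fourier_coeff (\<lambda>l. (b N l v* \<Phi> l) $ p) k) \<longlonglongrightarrow> fourier_coeff (\<lambda>l. (a l v* \<Phi> l) $ p) k"
proof -
  have E: "integrable circle (\<lambda>l. entry_sum (\<Phi> l))"
    unfolding entry_sum_def by (intro Bochner_Integration.integrable_sum integrable_norm \<Phi>)
  have bound: "cmod ((x v* \<Phi> l) $ p) \<le> entry_sum (\<Phi> l) * B" if "\<And>i. cmod (x $ i) \<le> B" for x l B
    using qform_le_entry_sum[of x B "axis p 1" 1 "\<Phi> l"] that unfolding qform_axis_right by (simp add: axis_def)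
  have i: "integrable circle (\<lambda>l. (c l v* \<Phi> l) $ p)"
    if c: "c \<in> borel_measurable circle" and B: "\<And>l i. cmod (c l $ i) \<le> B" for c B
  proof (rule Bochner_Integration.integrable_bound)
    show "integrable circle (\<lambda>l. entry_sum (\<Phi> l) * B)" using E by simp
    show "(\<lambda>l. (c l v* \<Phi> l) $ p) \<in> borel_measurable circle"
      by (intro borel_measurable_vec_nth borel_measurable_vec_mat borel_measurable_integrable[OF \<Phi>] c)
    show "AE l in circle. norm ((c l v* \<Phi> l) $ p) \<le> norm (entry_sum (\<Phi> l) * B)"
      using bound[OF B] by (intro AE_I2) (metis abs_ge_self order_trans real_norm_def)
  qed
  show ai: "integrable circle (\<lambda>l. (a l v* \<Phi> l) $ p)" by (rule i[OF a K])
  have di: "integrable circle (\<lambda>l. ((a l - b N l) v* \<Phi> l) $ p)" for N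
    by (rule i[OF borel_measurable_diff[OF a b] le])
  have bi: "integrable circle (\<lambda>l. (b N l v* \<Phi> l) $ p)" for N
    using Bochner_Integration.integrable_diff[OF ai di[of N]] by (simp add: vec_mat_diff_left)
  show "(\<lambda>N. fourier_coeff (\<lambda>l. (b N l v* \<Phi> l) $ p) k) \<longlonglongrightarrow> fourier_coeff (\<lambda>l. (a l v* \<Phi> l) $ p) k"
  proof (rule LIM_zero_cancel, rule tendsto_norm_zero_cancel, rule tendsto_sandwich[OF _ _ tendsto_const])
    show "\<forall>\<^sub>F N in sequentially. norm (fourier_coeff (\<lambda>l. (b N l v* \<Phi> l) $ p) k - fourier_coeff (\<lambda>l. (a l v* \<Phi> l) $ p) k)
        \<le> (\<integral>l. entry_sum (\<Phi> l) \<partial>circle) * t N"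
    proof (intro always_eventually allI)
      fix N
      have "norm (fourier_coeff (\<lambda>l. (b N l v* \<Phi> l) $ p) k - fourier_coeff (\<lambda>l. (a l v* \<Phi> l) $ p) k)
          = cmod (fourier_coeff (\<lambda>l. ((a l - b N l) v* \<Phi> l) $ p) k)"
        using fourier_coeff_diff[OF ai bi] by (simp add: vec_mat_diff_left norm_minus_commute)
      also have "\<dots> = cmod (\<integral>l. unit_char (- k) l * ((a l - b N l) v* \<Phi> l) $ p \<partial>circle) / (2 * pi)"
        by (simp add: fourier_coeff_def norm_divide)
      also have "\<dots> \<le> cmod (\<integral>l. unit_char (- k) l * ((a l - b N l) v* \<Phi> l) $ p \<partial>circle) / 1"
        using pi_gt3 by (intro divide_left_mono) auto
      also have "\<dots> \<le> (\<integral>l. cmod (unit_char (- k) l * ((a l - b N l) v* \<Phi> l) $ p) \<partial>circle)"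
        by simp
      also have "\<dots> \<le> (\<integral>l. entry_sum (\<Phi> l) * t N \<partial>circle)"
        using di E bound[OF le] by (intro integral_mono) (auto simp: norm_mult)
      also have "\<dots> = (\<integral>l. entry_sum (\<Phi> l) \<partial>circle) * t N" using E by simp
      finally show "norm (fourier_coeff (\<lambda>l. (b N l v* \<Phi> l) $ p) k - fourier_coeff (\<lambda>l. (a l v* \<Phi> l) $ p) k)
        \<le> (\<integral>l. entry_sum (\<Phi> l) \<partial>circle) * t N" .
    qed
    show "(\<lambda>N. (\<integral>l. entry_sum (\<Phi> l) \<partial>circle) * t N) \<longlonglongrightarrow> 0"
      by (rule tendsto_mult_right_zero[OF t])
  qed simp
qed

lemma vdot_uniform_tendsto:
  assumes u: "\<And>p. integrable circle (\<lambda>l. u l $ p)"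
    and a: "a \<in> borel_measurable circle" and b: "\<And>N. b N \<in> borel_measurable circle"
    and K: "\<And>l i. cmod (a l $ i) \<le> K"
    and t: "t \<longlonglongrightarrow> 0" and le: "\<And>N l i. cmod ((a l - b N l) $ i) \<le> t N"
  shows "integrable circle (\<lambda>l. vdot (u l) (vcnj (a l)))"
    and "(\<lambda>N. \<integral>l. vdot (u l) (vcnj (b N l)) \<partial>circle) \<longlonglongrightarrow> (\<integral>l. vdot (u l) (vcnj (a l)) \<partial>circle)"
proof -
  define H where "H l = (\<Sum>p\<in>UNIV. cmod (u l $ p))" for l
  have Hi: "integrable circle H" unfolding H_def using u by simp
  have um: "u \<in> borel_measurable circle" using u by (simp add: borel_measurable_vec_iff)
  have bound: "cmod (vdot (u l) (vcnj x)) \<le> H l * B" if "\<And>i. cmod (x $ i) \<le> B" for x l B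
    unfolding vdot_def H_def sum_distrib_right
    by (rule order_trans[OF norm_sum], rule sum_mono) (simp add: norm_mult mult_left_mono that)
  have i: "integrable circle (\<lambda>l. vdot (u l) (vcnj (c l)))"
    if c: "c \<in> borel_measurable circle" and B: "\<And>l i. cmod (c l $ i) \<le> B" for c B
  proof (rule Bochner_Integration.integrable_bound)
    show "integrable circle (\<lambda>l. H l * B)" using Hi by simp
    show "(\<lambda>l. vdot (u l) (vcnj (c l))) \<in> borel_measurable circle"
      by (intro borel_measurable_vdot borel_measurable_vcnj um c)
    show "AE l in circle. norm (vdot (u l) (vcnj (c l))) \<le> norm (H l * B)"
      using bound[OF B] by (intro AE_I2) (metis abs_ge_self order_trans real_norm_def)
  qed
  show ai: "integrable circle (\<lambda>l. vdot (u l) (vcnj (a l)))" by (rule i[OF a K])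
  have di: "integrable circle (\<lambda>l. vdot (u l) (vcnj (a l - b N l)))" for N
    by (rule i[OF borel_measurable_diff[OF a b] le])
  have bi: "integrable circle (\<lambda>l. vdot (u l) (vcnj (b N l)))" for N
    using Bochner_Integration.integrable_diff[OF ai di[of N]] by (simp add: vcnj_diff vdot_diff_right)
  show "(\<lambda>N. \<integral>l. vdot (u l) (vcnj (b N l)) \<partial>circle) \<longlonglongrightarrow> (\<integral>l. vdot (u l) (vcnj (a l)) \<partial>circle)"
  proof (rule LIM_zero_cancel, rule tendsto_norm_zero_cancel, rule tendsto_sandwich[OF _ _ tendsto_const])
    show "\<forall>\<^sub>F N in sequentially. norm ((\<integral>l. vdot (u l) (vcnj (b N l)) \<partial>circle) - (\<integral>l. vdot (u l) (vcnj (a l)) \<partial>circle))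
        \<le> (\<integral>l. H l \<partial>circle) * t N"
    proof (intro always_eventually allI)
      fix N
      have "norm ((\<integral>l. vdot (u l) (vcnj (b N l)) \<partial>circle) - (\<integral>l. vdot (u l) (vcnj (a l)) \<partial>circle))
          = cmod (\<integral>l. vdot (u l) (vcnj (a l - b N l)) \<partial>circle)"
        using ai bi[of N] by (simp add: vcnj_diff vdot_diff_right norm_minus_commute)
      also have "\<dots> \<le> (\<integral>l. cmod (vdot (u l) (vcnj (a l - b N l))) \<partial>circle)" by simp
      also have "\<dots> \<le> (\<integral>l. H l * t N \<partial>circle)"
        using di Hi bound[OF le] by (intro integral_mono) auto
      also have "\<dots> = (\<integral>l. H l \<partial>circle) * t N" using Hi by simp
      finally show "norm ((\<integral>l. vdot (u l) (vcnj (b N l)) \<partial>circle) - (\<integral>l. vdot (u l) (vcnj (a l)) \<partial>circle))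
        \<le> (\<integral>l. H l \<partial>circle) * t N" .
    qed
    show "(\<lambda>N. (\<integral>l. H l \<partial>circle) * t N) \<longlonglongrightarrow> 0"
      by (rule tendsto_mult_right_zero[OF t])
  qed simp
qed

text \<open>Products of integrable matrices need not be integrable; here the order relations bound
  the entries by sums of diagonal entries of \<open>f\<close> and \<open>W\<close>. The second
  product is first rewritten as \<open>f - f W f\<close>.\<close>

lemma ratio_integrable:
  fixes f g W :: "real \<Rightarrow> complex^'t^'t"
  assumes f: "weight f" and g: "weight g" and FW: "inverse_weights (\<lambda>l. f l + g l) W"
  shows "integrable circle (\<lambda>l. (f l ** W l) $ p $ q)"
    and "integrable circle (\<lambda>l. (f l ** W l ** g l) $ p $ q)"
proof -
  have W: "weight W" using FW by (simp add: inverse_weights_def)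
  have mm: "(\<lambda>l. (P l ** Q l) $ p $ q) \<in> borel_measurable circle"
    if "\<And>p q. (\<lambda>l. P l $ p $ q) \<in> borel_measurable circle" "\<And>p q. (\<lambda>l. Q l $ p $ q) \<in> borel_measurable circle"
    for P Q :: "real \<Rightarrow> complex^'t^'t" and p q
    unfolding matrix_matrix_mult_def using that by simp
  note fm = weight_measurable[OF f] and Wm = weight_measurable[OF W] and gm = weight_measurable[OF g]
  have AE: "AE l in circle. (f l + g l) ** W l = mat 1 \<and> W l ** (f l + g l) = mat 1
      \<and> hermitian_psd (f l) \<and> hermitian_psd (g l) \<and> hermitian_psd (f l + g l) \<and> hermitian_psd (W l)"
    using FW weight_hermitian[OF f] weight_hermitian[OF g] weight_hermitian[OF W]
      weight_hermitian[OF weight_add[OF f g]] unfolding inverse_weights_def by auto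
  show "integrable circle (\<lambda>l. (f l ** W l) $ p $ q)"
  proof (rule Bochner_Integration.integrable_bound[OF _ mm[OF fm Wm]])
    show "integrable circle (\<lambda>l. Re (f l $ p $ p) + Re (W l $ q $ q))"
      using weight_integrable[OF f] weight_integrable[OF W] by simp
    show "AE l in circle. norm ((f l ** W l) $ p $ q) \<le> norm (Re (f l $ p $ p) + Re (W l $ q $ q))"
      using AE
    proof eventually_elim
      case (elim l)
      have "norm ((f l ** W l) $ p $ q) \<le> Re (f l $ p $ p) + Re (W l $ q $ q)"
        using elim by (intro sqrt_mult_le_add ratio_component_le[of "f l + g l" "W l" "f l" "g l"] hermitian_psd_diag) auto
      then show ?case by simp
    qed
  qed
  have i: "integrable circle (\<lambda>l. (f l ** W l ** f l) $ p $ q)"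
  proof (rule Bochner_Integration.integrable_bound[OF _ mm[OF mm[OF fm Wm] fm]])
    show "integrable circle (\<lambda>l. Re (f l $ p $ p) + Re (f l $ q $ q))"
      using weight_integrable[OF f] by simp
    show "AE l in circle. norm ((f l ** W l ** f l) $ p $ q) \<le> norm (Re (f l $ p $ p) + Re (f l $ q $ q))"
      using AE
    proof eventually_elim
      case (elim l)
      have "norm ((f l ** W l ** f l) $ p $ q) \<le> Re (f l $ p $ p) + Re (f l $ q $ q)"
        using elim by (intro sqrt_mult_le_add sandwich_component_le[of "f l + g l" "W l" "f l" "g l"] hermitian_psd_diag) auto
      then show ?case by simp
    qed
  qed
  have eq: "AE l in circle. (f l ** W l ** g l) $ p $ q = f l $ p $ q - (f l ** W l ** f l) $ p $ q"
    using AE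
  proof eventually_elim
    case (elim l)
    then have "f l ** W l ** g l = f l - f l ** W l ** f l"
      by (intro parallel_sum_eq[of "f l + g l"]) auto
    then show ?case by simp
  qed
  show "integrable circle (\<lambda>l. (f l ** W l ** g l) $ p $ q)"
    by (rule integrable_cong_AE_imp[OF Bochner_Integration.integrable_diff[OF weight_integrable[OF f] i] mm[OF mm[OF fm Wm] gm]])
      (use eq in \<open>auto elim!: eventually_mono\<close>)
qed

section \<open>Spectral densities and coefficients of the functional\<close>

lemma weight_spectral_density:
  fixes f :: "real \<Rightarrow> complex^'t^'t"
  assumes "spectral_density_matrix f"
  shows "weight f"
  unfolding weight_def
proof (intro conjI allI)
  have i: "integrable circle f" and h: "\<forall>l\<in>{-pi..pi}. hermitian_psd (f l)"
    using assms unfolding spectral_density_matrix_def set_integrable_circle by auto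
  show "integrable circle (\<lambda>l. f l $ p $ q)" for p q
    by (intro integrable_bounded_linear[OF bounded_linear_vec_nth] i)
  show "AE l in circle. hermitian_psd (f l)" using h by (intro AE_I2) simp
qed

lemma finite_missing: "finite (missing s N K)"
  unfolding missing_def by simp

lemma summable_coeff_vec:
  fixes idx :: "'t::finite \<Rightarrow> nat"
  assumes idx: "bij_betw idx UNIV {1..T}" and a: "summable (\<lambda>j. cmod (a (Suc j)))"
    and form: "\<And>j \<nu>. \<nu> \<in> {1..T} \<Longrightarrow>
        a (\<nu> + j * T) = ahat j * exp (2 * of_real pi * \<i> * of_nat j * of_nat \<nu> / of_nat T)"
  shows "summable (\<lambda>j. \<Sum>p\<in>UNIV. cmod ((coeff_vec T idx ahat j :: complex^'t) $ p))"
proof (rule summable_sum)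
  fix p :: 't
  have p: "idx p \<in> {1..T}" using idx by (auto simp: bij_betw_def)
  \<comment> \<open>\<open>idx p\<close> is at least 1, so the subtraction on naturals is exact, and
    the shift matches a series that starts at \<open>a 1\<close>. Each coordinate is then an
    injectively indexed part of that series.\<close>
  have "(coeff_vec T idx ahat j :: complex^'t) $ p = a (Suc (idx p - 1 + j * T))" for j
    using form[OF p, of j] p by (simp add: coeff_vec_def)
  moreover have "inj (\<lambda>j. idx p - 1 + j * T)"
  proof (rule injI)
    fix x y assume "idx p - 1 + x * T = idx p - 1 + y * T"
    then have "x * T = y * T" by simp
    with p show "x = y" by simp
  qed
  then have "summable ((\<lambda>j. cmod (a (Suc j))) \<circ> (\<lambda>j. idx p - 1 + j * T))"
    by (intro summable_reindex[OF a]) auto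
  ultimately show "summable (\<lambda>j. cmod ((coeff_vec T idx ahat j :: complex^'t) $ p))"
    by (simp add: o_def)
qed

text \<open>\<open>series\<close> is a definite description, so the conclusion also asserts
  convergence of the series in the error formula. Uniqueness almost everywhere says that the formula
  gives every optimal characteristic. \<open>Ra_in_domain\<close> places \<open>R a\<close> in
  \<open>Y\<close>, where \<open>Binv\<close> acts as a right inverse of the operator; matrix
  identities alone do not give this.\<close>

theorem theorem1:
  fixes M :: "'a measure"
    and \<zeta> \<theta> :: "int \<Rightarrow> 'a \<Rightarrow> complex"
    and T s :: nat
    and idx :: "'t::finite \<Rightarrow> nat"
    and f g W :: "real \<Rightarrow> complex^'t^'t"
    and Z\<zeta> Z\<theta> Z :: "real set \<Rightarrow> 'a \<Rightarrow> complex^'t"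
    and N K :: "nat \<Rightarrow> nat"
    and a ahat :: "nat \<Rightarrow> complex"
    and \<Gamma> :: "int set"
    and X Y :: "(int \<Rightarrow> complex^'t) set"
    and B R D Binv :: "int \<Rightarrow> int \<Rightarrow> complex^'t^'t"
    and av :: "nat \<Rightarrow> complex^'t"
    and abold c :: "int \<Rightarrow> complex^'t"
    and A C h :: "real \<Rightarrow> complex^'t"
    and A\<zeta> :: "'a \<Rightarrow> complex"
  assumes M: "prob_space M"
    and idx: "bij_betw idx UNIV {1..T}"
    and \<zeta>: "periodically_correlated M T \<zeta>"
    and \<theta>: "periodically_correlated M T \<theta>"
    and uncorrelated: "mutually_uncorrelated M \<zeta> \<theta>"
    and f: "has_spectral_density M (blocked T idx \<zeta>) f"
    and g: "has_spectral_density M (blocked T idx \<theta>) g"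
    and Z\<zeta>: "spectral_representation M Z\<zeta> f (blocked T idx \<zeta>)"
    and Z\<theta>: "spectral_representation M Z\<theta> g (blocked T idx \<theta>)"
    and Z: "Z = (\<lambda>E \<omega>. Z\<zeta> E \<omega> + Z\<theta> E \<omega>)"
    and W: "W = (\<lambda>l. matrix_inv (f l + g l))"
    and nonsingular: "AE l in lborel. l \<in> {-pi..pi} \<longrightarrow> invertible (f l + g l)"
    and minimality: "set_integrable lborel {-pi..pi} (\<lambda>l. trace (W l))"
    and s: "1 \<le> s" and N0: "N 0 = 0" and K0: "K 0 = 0"
    and \<Gamma>: "\<Gamma> = Gamma_set s N K"
    and a_summable: "summable (\<lambda>j. cmod (a (Suc j)))"
    and a_form: "\<And>j \<nu>. \<nu> \<in> {1..T} \<Longrightarrow>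
        a (\<nu> + j * T) = ahat j * exp (2 * of_real pi * \<i> * of_nat j * of_nat \<nu> / of_nat T)"
    and av: "av = coeff_vec T idx ahat"
    and abold: "abold = extended_coeff T idx ahat"
    and B: "B = toeplitz W"
    and R: "R = toeplitz (\<lambda>l. f l ** W l)"
    and D: "D = toeplitz (\<lambda>l. f l ** W l ** g l)"
    and B_invertible: "invertible_operator \<Gamma> X Y B Binv"
    and Ra_in_domain: "op_apply \<Gamma> R abold \<in> Y"
    and c: "c = op_apply \<Gamma> Binv (op_apply \<Gamma> R abold)"
    and A\<zeta>: "A\<zeta> = functional_A av (blocked T idx \<zeta>)"
    and A: "A = symbol_A av"
    and C: "fourier_sums_in_L2 W \<Gamma> c C"
    and h: "h = (\<lambda>l. (A l v* f l - C l) v* W l)"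
  shows "(AE l in lborel. l \<in> {-pi..pi} \<longrightarrow> h l = A l - (A l v* g l + C l) v* W l)
    \<and> (\<exists>\<eta>. optimal_estimate M A\<zeta> Z (\<lambda>l. f l + g l) (observed s N K) h \<eta>
          \<and> complex_of_real (mean_square_error M A\<zeta> \<eta>)
              = pairing \<Gamma> (op_apply \<Gamma> D abold) abold + pairing \<Gamma> (op_apply \<Gamma> B c) c)
    \<and> (\<forall>h' \<eta>'. optimal_estimate M A\<zeta> Z (\<lambda>l. f l + g l) (observed s N K) h' \<eta>'
          \<longrightarrow> (AE l in lborel. l \<in> {-pi..pi} \<longrightarrow> h' l = h l))
    \<and> applicable \<Gamma> R abold \<and> applicable \<Gamma> D abold \<and> applicable \<Gamma> B c
    \<and> pairing_converges \<Gamma> (op_apply \<Gamma> D abold) abold \<and> pairing_converges \<Gamma> (op_apply \<Gamma> B c) c"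
proof -
  have wf: "weight f" and wg: "weight g"
    using f g weight_spectral_density unfolding has_spectral_density_def by blast+
  have FW: "inverse_weights (\<lambda>l. f l + g l) W"
    unfolding W
  proof (rule inverse_weights_matrix_inv[OF weight_add[OF wf wg]])
    show "AE l in circle. invertible (f l + g l)" using nonsingular unfolding AE_circle_iff .
    show "integrable circle (\<lambda>l. trace (matrix_inv (f l + g l)))"
      using minimality unfolding set_integrable_circle W .
  qed
  have wF: "weight (\<lambda>l. f l + g l)" and wW: "weight W" using FW by (auto simp: inverse_weights_def)
  have av_summable: "summable (\<lambda>j. \<Sum>p\<in>UNIV. cmod (av j $ p))"
    unfolding av by (rule summable_coeff_vec[OF idx a_summable a_form])
  obtain t where t: "t \<longlonglongrightarrow> 0"
    and tail: "\<And>n l i. cmod ((A l - (\<Sum>j<n. unit_char (int j) l *s av j)) $ i) \<le> t n"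
    and Am: "A \<in> borel_measurable circle"
    unfolding A by (rule symbol_A_approx[OF av_summable]) blast
  have AK: "cmod (A l $ i) \<le> t 0" for l i using tail[of l 0 i] by simp
  have A2: "A \<in> L2 f" "A \<in> L2 g"
    by (rule L2_bounded[OF _ Am, of _ "t 0"]; simp add: wf wg AK)+
  have CL: "C \<in> L2 W" and Clim: "(\<lambda>N. L2_normsq W (\<lambda>l. C l - trig_poly {n\<in>\<Gamma>. n \<le> int N} c l)) \<longlonglongrightarrow> 0"
    using C unfolding fourier_sums_in_L2_def by auto

  have fin: "finite {n\<in>\<Gamma>. n \<le> int m}" for m
    by (rule finite_subset[of _ "missing s N K \<union> {0..int m}"]) (auto simp: \<Gamma> Gamma_set_def finite_missing)
  \<comment> \<open>\<open>abold\<close> vanishes on the missing times, so the partial sum over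
    \<open>\<Gamma>\<close> up to \<open>m\<close> consists of the first \<open>Suc m\<close> terms
    of \<open>A\<close>; hence the shifted index in the tail bound.\<close>
  define AN where "AN m = trig_poly {n\<in>\<Gamma>. n \<le> int m} abold" for m
  have AN: "AN m l = (\<Sum>j<Suc m. unit_char (int j) l *s av j)" for m l
  proof -
    have "AN m l = (\<Sum>n\<in>int ` {..<Suc m}. unit_char n l *s abold n)"
      unfolding AN_def trig_poly_unit_char
    proof (rule sum.mono_neutral_right[OF fin])
      show "int ` {..<Suc m} \<subseteq> {n\<in>\<Gamma>. n \<le> int m}" by (auto simp: \<Gamma> Gamma_set_def)
      show "\<forall>n\<in>{n\<in>\<Gamma>. n \<le> int m} - int ` {..<Suc m}. unit_char n l *s abold n = 0"
      proof
        fix n assume n: "n \<in> {n\<in>\<Gamma>. n \<le> int m} - int ` {..<Suc m}"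
        have "\<not> 0 \<le> n"
        proof
          assume "0 \<le> n"
          then have "n = int (nat n)" by simp
          moreover have "nat n \<in> {..<Suc m}" using n \<open>0 \<le> n\<close> by auto
          ultimately show False using n by blast
        qed
        then show "unit_char n l *s abold n = 0" by (simp add: abold extended_coeff_def)
      qed
    qed
    also have "\<dots> = (\<Sum>j<Suc m. unit_char (int j) l *s av j)"
      by (subst sum.reindex) (auto simp: inj_on_def abold extended_coeff_def av)
    finally show ?thesis .
  qed
  have ANm: "AN m \<in> borel_measurable circle" for m
    unfolding AN_def by (rule trig_poly_measurable)
  have t': "(\<lambda>m. t (Suc m)) \<longlonglongrightarrow> 0" by (rule LIMSEQ_Suc[OF t])
  have tail': "cmod ((A l - AN m l) $ i) \<le> t (Suc m)" for m l i
    using tail[of l "Suc m" i] by (simp only: AN)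

  note fWi = ratio_integrable(1)[OF wf wg FW] and Di = ratio_integrable(2)[OF wf wg FW]
  note R_lim = fourier_coeff_uniform_tendsto[of "\<lambda>l. f l ** W l", OF fWi Am ANm AK t' tail']
  note D_lim = fourier_coeff_uniform_tendsto[of "\<lambda>l. f l ** W l ** g l", OF Di Am ANm AK t' tail']
  define rA where "rA k = (\<chi> p. fourier_coeff (\<lambda>l. (A l v* (f l ** W l)) $ p) k)" for k
  define dA where "dA k = (\<chi> p. fourier_coeff (\<lambda>l. (A l v* (f l ** W l ** g l)) $ p) k)" for k
  have R_lim': "(\<lambda>m. fourier_coeff (\<lambda>l. (trig_poly {n\<in>\<Gamma>. n \<le> int m} abold l v* (f l ** W l)) $ p) k) \<longlonglongrightarrow> rA k $ p" for k p
    using R_lim(2)[of p k] by (simp add: AN_def rA_def)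
  have R_app: "applicable \<Gamma> R abold"
    unfolding R by (rule toeplitz_apply(1)[OF fWi R_lim'])
  have R_eq: "op_apply \<Gamma> R abold k = rA k" if "k \<in> \<Gamma>" for k
    unfolding R by (rule toeplitz_apply(2)[OF fWi R_lim' that])
  have D_lim': "(\<lambda>m. fourier_coeff (\<lambda>l. (trig_poly {n\<in>\<Gamma>. n \<le> int m} abold l v* (f l ** W l ** g l)) $ p) k) \<longlonglongrightarrow> dA k $ p" for k p
    using D_lim(2)[of p k] by (simp add: AN_def dA_def)
  have D_app: "applicable \<Gamma> D abold"
    unfolding D by (rule toeplitz_apply(1)[OF Di D_lim'])
  have D_eq: "op_apply \<Gamma> D abold k = dA k" if "k \<in> \<Gamma>" for k
    unfolding D by (rule toeplitz_apply(2)[OF Di D_lim' that])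

  define CN where "CN m = trig_poly {n\<in>\<Gamma>. n \<le> int m} c" for m
  have CNL: "CN m \<in> L2 W" for m unfolding CN_def by (rule trig_poly_L2[OF wW])
  have CNlim: "(\<lambda>m. L2_normsq W (\<lambda>l. C l - CN m l)) \<longlonglongrightarrow> 0" using Clim by (simp add: CN_def)
  note CW = L2_vec_mat_inverse(1)[OF FW CL] and CNW = L2_vec_mat_inverse(1)[OF FW CNL]
  \<comment> \<open>The isometry given by \<open>W\<close> moves the convergence of the series for
    \<open>C\<close> from \<open>L2 W\<close> to \<open>L2 (f + g)\<close>, where Fourier
    coefficients are continuous. So the series for \<open>B c\<close> converges although nothing is
    assumed about summability of \<open>c\<close>.\<close>
  have CWlim: "(\<lambda>m. L2_normsq (\<lambda>l. f l + g l) (\<lambda>l. C l v* W l - CN m l v* W l)) \<longlonglongrightarrow> 0"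
    using CNlim L2_vec_mat_inverse(2)[OF FW L2_diff[OF wW CL CNL]] by (simp add: vec_mat_diff_left)
  define bC where "bC k = (\<chi> p. fourier_coeff (\<lambda>l. (C l v* W l) $ p) k)" for k
  have B_lim: "(\<lambda>m. fourier_coeff (\<lambda>l. (trig_poly {n\<in>\<Gamma>. n \<le> int m} c l v* W l) $ p) k) \<longlonglongrightarrow> bC k $ p" for k p
    using fourier_coeff_tendsto[OF FW CNW CW CWlim, of p k] by (simp add: CN_def bC_def)
  have B_app: "applicable \<Gamma> B c"
    unfolding B by (rule toeplitz_apply(1)[OF weight_integrable[OF wW] B_lim])
  have B_eq: "op_apply \<Gamma> B c k = bC k" if "k \<in> \<Gamma>" for k
    unfolding B by (rule toeplitz_apply(2)[OF weight_integrable[OF wW] B_lim that])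

  \<comment> \<open>The right-inverse property of \<open>Binv\<close> on \<open>Y\<close>. Read
    through Fourier coefficients, the two sides are those of \<open>C v* W\<close> and of
    \<open>A v* f v* W\<close>, whose difference is \<open>h\<close>.\<close>
  have "op_apply \<Gamma> B c = op_apply \<Gamma> R abold"
    using B_invertible Ra_in_domain unfolding c invertible_operator_def by blast
  then have rb: "rA k = bC k" if "k \<in> \<Gamma>" for k
    using R_eq[OF that] B_eq[OF that] by simp
  have hL: "h \<in> L2 (\<lambda>l. f l + g l)" by (rule h_L2[OF wf wg FW A2 CL h])
  have h_zero: "fourier_coeff (\<lambda>l. h l $ p) k = 0" if "k \<in> \<Gamma>" for k p
  proof -
    have "h l $ p = (A l v* (f l ** W l)) $ p - (C l v* W l) $ p" for l
      by (simp add: h vec_mat_diff_left vec_mat_assoc)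
    then have "fourier_coeff (\<lambda>l. h l $ p) k = rA k $ p - bC k $ p"
      using fourier_coeff_diff[OF R_lim(1) L2_component_integrable[OF FW CW]] by (simp add: rA_def bC_def)
    then show ?thesis using rb[OF that] by simp
  qed
  have h_span: "h \<in> L2_span (\<lambda>l. f l + g l) (observed s N K)"
    unfolding observed_def
  proof (rule L2_span_delete[OF FW L2_span_negative[OF FW hL] finite_missing])
    show "fourier_coeff (\<lambda>l. h l $ i) n = 0" if "0 \<le> n" for n i
      by (rule h_zero) (use that in \<open>simp add: \<Gamma> Gamma_set_def\<close>)
    show "fourier_coeff (\<lambda>l. h l $ i) n = 0" if "n \<in> missing s N K" for n i
      by (rule h_zero) (use that in \<open>simp add: \<Gamma> Gamma_set_def\<close>)
  qed
  \<comment> \<open>The partial sums of \<open>C\<close> have no frequencies outside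
    \<open>\<Gamma>\<close>, and coefficients are continuous on \<open>L2 W\<close> by the symmetric
    use of the dual weights.\<close>
  have C_zero: "fourier_coeff (\<lambda>l. C l $ p) n = 0" if "n \<in> observed s N K" for n p
  proof -
    have "n \<notin> \<Gamma>" using that by (auto simp: \<Gamma> Gamma_set_def observed_def)
    then have "fourier_coeff (\<lambda>l. CN m l $ p) n = 0" for m
      unfolding CN_def fourier_coeff_trig_poly[OF fin] by simp
    then show ?thesis
      using fourier_coeff_tendsto[OF inverse_weights_sym[OF FW] CNL CL CNlim, of p n] by (simp add: LIMSEQ_const_iff)
  qed
  have orth: "(\<integral>l. vdot (C l) (vcnj (h' l)) \<partial>circle) = 0" if "h' \<in> L2_span (\<lambda>l. f l + g l) (observed s N K)" for h'
    by (rule vdot_span_eq_0[OF FW that CL C_zero])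

  have unc: "(\<integral>\<omega>. blocked T idx \<zeta> n \<omega> $ p * cnj (blocked T idx \<theta> m \<omega> $ q) \<partial>M) = 0" for n m p q
    using uncorrelated by (simp add: mutually_uncorrelated_def blocked_def)
  have A_int: "has_stoch_integral M Z\<zeta> f A A\<zeta>"
    unfolding A A\<zeta> by (rule functional_A_stoch_integral[OF M Z\<zeta> wf av_summable])
  have mse: "mean_square_error M A\<zeta> \<eta> = (L2_normsq f (\<lambda>l. A l - h' l) + L2_normsq g h') / (2 * pi)"
    if "has_stoch_integral M Z (\<lambda>l. f l + g l) h' \<eta>" for h' \<eta>
    by (rule mean_square_error_spectral[OF Z\<zeta> wf Z\<theta> wg unc A_int that[unfolded Z]])
  obtain \<eta> where \<eta>: "has_stoch_integral M Z (\<lambda>l. f l + g l) h \<eta>"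
    unfolding Z by (rule stoch_integral_exists[OF orthogonal_measure_sum[OF Z\<zeta> wf Z\<theta> wg unc] wF h_span])
  \<comment> \<open>The excess error of a competitor is exactly a squared distance from
    \<open>h\<close>. Its nonnegativity gives optimality, its vanishing gives uniqueness.\<close>
  have gain: "mean_square_error M A\<zeta> \<eta>' = mean_square_error M A\<zeta> \<eta> + L2_normsq (\<lambda>l. f l + g l) (\<lambda>l. h' l - h l) / (2 * pi)"
    if h': "h' \<in> L2_span (\<lambda>l. f l + g l) (observed s N K)" and \<eta>': "has_stoch_integral M Z (\<lambda>l. f l + g l) h' \<eta>'" for h' \<eta>'
  proof -
    note h'L = L2_span_L2[OF h']
    have "(\<integral>l. vdot (C l) (vcnj (h' l - h l)) \<partial>circle) = 0"
      using vdot_integrable(1)[OF inverse_weights_sym[OF FW] CL h'L] vdot_integrable(1)[OF inverse_weights_sym[OF FW] CL hL]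
      by (simp add: vcnj_diff vdot_diff_right orth[OF h'] orth[OF h_span])
    from error_perturbation[OF wf wg FW A2 CL h L2_diff[OF wF h'L hL] this]
    show ?thesis unfolding mse[OF \<eta>] mse[OF \<eta>'] by (simp add: add_divide_distrib)
  qed
  have opt: "optimal_estimate M A\<zeta> Z (\<lambda>l. f l + g l) (observed s N K) h \<eta>"
    unfolding optimal_estimate_def
  proof (intro conjI h_span \<eta> allI impI)
    fix h' \<eta>' assume "h' \<in> L2_span (\<lambda>l. f l + g l) (observed s N K) \<and> has_stoch_integral M Z (\<lambda>l. f l + g l) h' \<eta>'"
    then show "mean_square_error M A\<zeta> \<eta> \<le> mean_square_error M A\<zeta> \<eta>'"
      using gain[of h' \<eta>'] L2_normsq_nonneg[OF wF, of "\<lambda>l. h' l - h l"] by simp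
  qed
  have unique: "AE l in lborel. l \<in> {-pi..pi} \<longrightarrow> h' l = h l"
    if o: "optimal_estimate M A\<zeta> Z (\<lambda>l. f l + g l) (observed s N K) h' \<eta>'" for h' \<eta>'
  proof -
    have h': "h' \<in> L2_span (\<lambda>l. f l + g l) (observed s N K)" and \<eta>': "has_stoch_integral M Z (\<lambda>l. f l + g l) h' \<eta>'"
      and le: "mean_square_error M A\<zeta> \<eta>' \<le> mean_square_error M A\<zeta> \<eta>"
      using o h_span \<eta> unfolding optimal_estimate_def by blast+
    have "L2_normsq (\<lambda>l. f l + g l) (\<lambda>l. h' l - h l) / (2 * pi) \<le> 0" using gain[OF h' \<eta>'] le by linarith
    then have "L2_normsq (\<lambda>l. f l + g l) (\<lambda>l. h' l - h l) = 0"
      using L2_normsq_nonneg[OF wF, of "\<lambda>l. h' l - h l"] pi_gt_zero by (auto simp: divide_le_0_iff)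
    from L2_normsq_eq_0_imp[OF FW L2_diff[OF wF L2_span_L2[OF h'] hL] this]
    show ?thesis unfolding AE_circle_iff[symmetric] by eventually_elim simp
  qed

  \<comment> \<open>The function paired with \<open>A\<close> is only integrable here, so the
    uniform approximation of \<open>A\<close> is used once more for the pairing with
    \<open>D\<close>.\<close>
  note D_vdot = vdot_uniform_tendsto[of "\<lambda>l. A l v* (f l ** W l ** g l)", OF D_lim(1) Am ANm AK t' tail']
  have D_coeff: "op_apply \<Gamma> D abold k $ p = fourier_coeff (\<lambda>l. (A l v* (f l ** W l ** g l)) $ p) k" if "k \<in> \<Gamma>" for k p
    using D_eq[OF that] by (simp add: dA_def)
  note D_pairing = pairing_limit[OF D_lim(1) D_coeff D_vdot(2)[unfolded AN_def]]
  have D_pair: "pairing_converges \<Gamma> (op_apply \<Gamma> D abold) abold"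
    by (rule D_pairing(1))
  have D_pair_eq: "pairing \<Gamma> (op_apply \<Gamma> D abold) abold = (\<integral>l. vdot (A l v* (f l ** W l ** g l)) (vcnj (A l)) \<partial>circle) / (2 * pi)"
    by (rule D_pairing(2))
  have B_pair: "pairing_converges \<Gamma> (op_apply \<Gamma> B c) c"
      "pairing \<Gamma> (op_apply \<Gamma> B c) c = (\<integral>l. qform (W l) (C l) (C l) \<partial>circle) / (2 * pi)"
  proof -
    have lim: "(\<lambda>m. \<integral>l. vdot (C l v* W l) (vcnj (trig_poly {n\<in>\<Gamma>. n \<le> int m} c l)) \<partial>circle) \<longlonglongrightarrow> (\<integral>l. qform (W l) (C l) (C l) \<partial>circle)"
    proof -
      \<comment> \<open>Continuity of the inner product is available in its first argument, whereas
        the partial sums of \<open>c\<close> stand in the conjugated one; Hermitian symmetry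
        exchanges the two.\<close>
      have cnj_inner: "(\<integral>l. qform (W l) (C l) (u l) \<partial>circle) = cnj (\<integral>l. qform (W l) (u l) (C l) \<partial>circle)" if u: "u \<in> L2 W" for u
        unfolding Bochner_Integration.integral_cnj[symmetric]
      proof (rule integral_cong_AE)
        show "AE l in circle. qform (W l) (C l) (u l) = cnj (qform (W l) (u l) (C l))"
          using weight_hermitian[OF wW] by eventually_elim (rule qform_cnj)
      qed (use borel_measurable_integrable[OF L2_inner_integrable[OF wW CL u]]
          borel_measurable_integrable[OF L2_inner_integrable[OF wW u CL]] in measurable)
      have "(\<lambda>m. cnj (\<integral>l. qform (W l) (CN m l) (C l) \<partial>circle)) \<longlonglongrightarrow> cnj (\<integral>l. qform (W l) (C l) (C l) \<partial>circle)"
        by (intro tendsto_intros L2_inner_tendsto[OF wW CNL CL CL CNlim])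
      then show ?thesis
        unfolding cnj_inner[OF CNL, symmetric] cnj_inner[OF CL, symmetric] by (simp add: qform_def CN_def)
    qed
    have B_coeff: "op_apply \<Gamma> B c k $ p = fourier_coeff (\<lambda>l. (C l v* W l) $ p) k" if "k \<in> \<Gamma>" for k p
      using B_eq[OF that] by (simp add: bC_def)
    note B_pairing = pairing_limit[OF L2_component_integrable[OF FW CW] B_coeff lim]
    show "pairing_converges \<Gamma> (op_apply \<Gamma> B c) c"
      by (rule B_pairing(1))
    show "pairing \<Gamma> (op_apply \<Gamma> B c) c = (\<integral>l. qform (W l) (C l) (C l) \<partial>circle) / (2 * pi)"
      by (rule B_pairing(2))
  qed
  have mse_value: "complex_of_real (mean_square_error M A\<zeta> \<eta>)
      = pairing \<Gamma> (op_apply \<Gamma> D abold) abold + pairing \<Gamma> (op_apply \<Gamma> B c) c"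
    unfolding mse[OF \<eta>] D_pair_eq B_pair(2) of_real_divide
      error_value[OF wf wg FW A2 CL h D_vdot(1)]
    by (simp add: add_divide_distrib)
  have "AE l in lborel. l \<in> {-pi..pi} \<longrightarrow> h l = A l - (A l v* g l + C l) v* W l"
    using h_alt[OF wf wg FW A2 CL h] unfolding AE_circle_iff .
  with opt mse_value unique R_app D_app B_app D_pair B_pair(1) show ?thesis by blast
qed

end
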